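(* Let $k$ be a positive integer and let $G$ be a $50k$-connected graph. At least one of the following holds: (i) $G$ is parity-$k$-linked restricted to independent sets; (ii) there is a set $X$ of at most $2k-2$ vertices such that $G - X$ is bipartite.
   Context: All graphs are finite and simple. $G$ is parity-$k$-linked restricted to independent sets if for every independent set $\{s_1,\dots,s_k,t_1,\dots,t_k\}$ of $2k$ distinct vertices of $G$ and every choice of parities $p_1,\dots,p_k \in\{\text{odd},\text{even}\}$ there are pairwise vertex-disjoint paths $P_1,\dots,P_k$ such that $P_i$ joins $s_i$ and $t_i$ and has length of parity $p_i$. *)

theory Defs
  imports Main
begin

definition graph :: "'a set \<Rightarrow> ('a \<Rightarrow> 'a \<Rightarrow> bool) \<Rightarrow> bool" where
  "graph V E \<longleftrightarrow> finite V \<and> (\<forall>u v. E u v \<longrightarrow> E v u) \<and> (\<forall>u. \<not> E u u)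
     \<and> (\<forall>u v. E u v \<longrightarrow> u \<in> V \<and> v \<in> V)"

definition is_path :: "'a set \<Rightarrow> ('a \<Rightarrow> 'a \<Rightarrow> bool) \<Rightarrow> 'a list \<Rightarrow> bool" where
  "is_path V E P \<longleftrightarrow> P \<noteq> [] \<and> distinct P \<and> set P \<subseteq> V
     \<and> (\<forall>i. Suc i < length P \<longrightarrow> E (P ! i) (P ! Suc i))"

definition path_length :: "'a list \<Rightarrow> nat" where
  "path_length P = length P - 1"

definition connected_graph :: "'a set \<Rightarrow> ('a \<Rightarrow> 'a \<Rightarrow> bool) \<Rightarrow> bool" where
  "connected_graph V E \<longleftrightarrow>
     (\<forall>u\<in>V. \<forall>v\<in>V. \<exists>P. is_path V E P \<and> hd P = u \<and> last P = v)"

text \<open>k-connected: more than k vertices, and deleting fewer than k vertices leaves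
a connected graph (paths in V - X only use vertices of V - X, i.e. the induced
subgraph G - X).\<close>

definition k_connected :: "nat \<Rightarrow> 'a set \<Rightarrow> ('a \<Rightarrow> 'a \<Rightarrow> bool) \<Rightarrow> bool" where
  "k_connected k V E \<longleftrightarrow> card V > k \<and>
     (\<forall>X. X \<subseteq> V \<and> card X < k \<longrightarrow> connected_graph (V - X) E)"

definition independent_set :: "('a \<Rightarrow> 'a \<Rightarrow> bool) \<Rightarrow> 'a set \<Rightarrow> bool" where
  "independent_set E S \<longleftrightarrow> (\<forall>u\<in>S. \<forall>v\<in>S. \<not> E u v)"

definition parity_linked_indep :: "nat \<Rightarrow> 'a set \<Rightarrow> ('a \<Rightarrow> 'a \<Rightarrow> bool) \<Rightarrow> bool" where
  "parity_linked_indep k V E \<longleftrightarrow>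
     (\<forall>(s :: nat \<Rightarrow> 'a) (t :: nat \<Rightarrow> 'a) (p :: nat \<Rightarrow> bool).
        (\<forall>i<k. s i \<in> V \<and> t i \<in> V)
        \<and> (\<forall>i<k. \<forall>j<k. i \<noteq> j \<longrightarrow> s i \<noteq> s j \<and> t i \<noteq> t j)
        \<and> (\<forall>i<k. \<forall>j<k. s i \<noteq> t j)
        \<and> independent_set E (s ` {..<k} \<union> t ` {..<k})
        \<longrightarrow> (\<exists>P :: nat \<Rightarrow> 'a list.
              (\<forall>i<k. is_path V E (P i) \<and> hd (P i) = s i \<and> last (P i) = t i
                      \<and> (odd (path_length (P i)) \<longleftrightarrow> p i))
              \<and> (\<forall>i<k. \<forall>j<k. i \<noteq> j \<longrightarrow> set (P i) \<inter> set (P j) = {})))"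

definition bipartite :: "'a set \<Rightarrow> ('a \<Rightarrow> 'a \<Rightarrow> bool) \<Rightarrow> bool" where
  "bipartite V E \<longleftrightarrow> (\<exists>c :: 'a \<Rightarrow> bool. \<forall>u\<in>V. \<forall>v\<in>V. E u v \<longrightarrow> c u \<noteq> c v)"

end

theory Submission
  imports Defs
begin

text \<open>As all degrees are at least \<open>50k\<close>, a maximum cut, with sides given by a colouring \<open>c\<close>, contains
  a dense bipartite subgraph on a set \<open>H\<close>, in which any \<open>4k\<close> vertices are linked by the theorem of
  Thomas and Wollan on massed graphs. A path is broken if an odd number of its edges have both ends of
  the same colour. Let \<open>T\<close> be the set of terminals. Expressing broken paths as matchings in a double
  cover of the graph, the Tutte--Berge formula shows that \<open>G - T\<close> either contains \<open>3k\<close> disjoint broken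
  paths with ends in \<open>H\<close>, or has a set \<open>Z\<close> of at most \<open>6k - 2\<close> vertices that meets all of them.

  In the first case, \<open>2k\<close> disjoint paths from \<open>T\<close> to \<open>H\<close> avoid \<open>k\<close> of the broken paths, and linkages
  in \<open>H\<close> join everything up, going through a broken path whenever the parity has to be changed.

  In the second case \<open>G - T - Z\<close> is bipartite, because \<open>G\<close> is highly connected, and each vertex of
  \<open>T\<close> and \<open>Z\<close> is coloured against the majority of its neighbours. The parity of a path can be
  changed by a vertex with many neighbours of both colours, or by an edge with ends of the same colour.
  The Tutte--Berge formula for the graph of these edges, with \<open>s\<^sub>i\<close> and \<open>t\<^sub>i\<close> identified, yields
  either enough disjoint such corrections, or a set of at most \<open>2k - 2\<close> vertices that meets all of them,
  whose deletion makes \<open>G\<close> bipartite.\<close>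

text \<open>Links inside \<open>H\<close> follow crossing edges only, so they are never broken: the
  parity of a composed path is decided outside \<open>H\<close>. A pair whose parity must change
  needs two links, one into a broken path and one out of it, and this is why \<open>4k\<close>
  vertices, that is \<open>2k\<close> pairs, have to be linkable. The maximum cut halves the degree
  \<open>50k\<close>. The density \<open>25k/2\<close> that remains is barely more than the
  \<open>99 * 2k / 16 = 12.375k\<close> edges per vertex that the linkage theorem asks for with
  \<open>2k\<close> pairs. The paths from the \<open>2k\<close> terminals spoil at most
  \<open>2k\<close> broken paths, hence a packing of \<open>3k\<close> is wanted, and
  \<open>6k - 2 = 2 * 3k - 2\<close> is the bound dual to it. That set \<open>Z\<close> only serves
  to find a colouring. The bound \<open>2k - 2\<close> comes from the second use of the Tutte--Berge
  formula, with matchings of corrections in place of matchings in the double cover. Independence of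
  the terminals matters there: a class of the barrier that contains terminals can leave all of them
  uncovered, so the identification of \<open>s i\<close> with \<open>t i\<close> does not double the
  cost of a class.\<close>

definition sym_irrefl :: "('a \<Rightarrow> 'a \<Rightarrow> bool) \<Rightarrow> bool" where
  "sym_irrefl E \<longleftrightarrow> (\<forall>u v. E u v \<longrightarrow> E v u) \<and> (\<forall>u. \<not> E u u)"

lemma sym_irreflD:
  assumes "sym_irrefl E"
  shows "E u v \<Longrightarrow> E v u" "\<not> E u u" "E u v \<longleftrightarrow> E v u" "E u v \<Longrightarrow> u \<noteq> v"
  using assms unfolding sym_irrefl_def by metis+

section \<open>Walks, paths and reachability\<close>

lemma is_path_iff:
  "is_path V E P \<longleftrightarrow> P \<noteq> [] \<and> distinct P \<and> set P \<subseteq> V \<and> successively E P"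
  unfolding is_path_def by (auto simp: successively_conv_nth)

lemma successively_rev_sym:
  assumes "sym_irrefl E"
  shows "successively E (rev P) \<longleftrightarrow> successively E P"
proof -
  have "(\<lambda>x y. E y x) = E"
    using assms by (auto simp: sym_irrefl_def fun_eq_iff)
  then show ?thesis
    unfolding successively_rev by metis
qed

lemma successively_appendI:
  assumes "successively E p" "successively E q" "p \<noteq> [] \<Longrightarrow> q \<noteq> [] \<Longrightarrow> E (last p) (hd q)"
  shows "successively E (p @ q)"
  using assms by (auto simp: successively_append_iff)

lemma walk_to_path:
  assumes "w \<noteq> []" "successively E w"
  shows "\<exists>p. p \<noteq> [] \<and> distinct p \<and> successively E p \<and> hd p = hd w \<and> last p = last w
     \<and> set p \<subseteq> set w \<and> length p \<le> length w"
  using assms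
proof (induction "length w" arbitrary: w rule: less_induct)
  case less
  show ?case
  proof (cases "distinct w")
    case True
    then show ?thesis using less.prems by blast
  next
    case False
    then obtain xs ys zs y where w: "w = xs @ [y] @ ys @ [y] @ zs"
      using not_distinct_decomp by blast
    let ?w = "xs @ [y] @ zs"
    have len: "length ?w < length w" using w by simp
    have suc: "successively E ?w"
      using less.prems(2) unfolding w
      by (auto simp: successively_append_iff successively_Cons split: if_splits)
    have "?w \<noteq> []" by simp
    from less.hyps[OF len this suc] obtain p where p: "p \<noteq> []" "distinct p" "successively E p"
       "hd p = hd ?w" "last p = last ?w" "set p \<subseteq> set ?w" "length p \<le> length ?w" by blast
    have "hd ?w = hd w" "last ?w = last w" "set ?w \<subseteq> set w"
      unfolding w by (auto simp: hd_append)
    then show ?thesis using p len by (intro exI[of _ p]) auto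
  qed
qed

text \<open>Transitive closure instead of lists: reachability composes without any disjointness
  condition. The start is required to lie in \<open>S\<close> because the closure is reflexive
  everywhere.\<close>

definition reach :: "('a \<Rightarrow> 'a \<Rightarrow> bool) \<Rightarrow> 'a set \<Rightarrow> 'a \<Rightarrow> 'a \<Rightarrow> bool" where
  "reach E S u v \<longleftrightarrow> u \<in> S \<and> (\<lambda>a b. E a b \<and> a \<in> S \<and> b \<in> S)\<^sup>*\<^sup>* u v"

lemma reach_refl: "u \<in> S \<Longrightarrow> reach E S u u"
  unfolding reach_def by simp

lemma reach_edge: "u \<in> S \<Longrightarrow> v \<in> S \<Longrightarrow> E u v \<Longrightarrow> reach E S u v"
  unfolding reach_def by auto

lemma reach_trans: "reach E S u v \<Longrightarrow> reach E S v w \<Longrightarrow> reach E S u w"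
  unfolding reach_def by auto

lemma reach_mem:
  assumes "reach E S u v"
  shows "u \<in> S" "v \<in> S"
proof -
  show u: "u \<in> S" using assms unfolding reach_def by simp
  have "(\<lambda>a b. E a b \<and> a \<in> S \<and> b \<in> S)\<^sup>*\<^sup>* u v" using assms unfolding reach_def by simp
  then show "v \<in> S" using u by (induction rule: rtranclp_induct) auto
qed

lemma reach_mono:
  assumes "reach E S u v" "S \<subseteq> S'" "\<And>a b. E a b \<Longrightarrow> a \<in> S \<Longrightarrow> b \<in> S \<Longrightarrow> E' a b"
  shows "reach E' S' u v"
proof -
  have "(\<lambda>a b. E a b \<and> a \<in> S \<and> b \<in> S)\<^sup>*\<^sup>* u v" using assms(1) unfolding reach_def by simp
  then have "(\<lambda>a b. E' a b \<and> a \<in> S' \<and> b \<in> S')\<^sup>*\<^sup>* u v"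
    by (rule rtranclp_mono[THEN predicate2D, rotated]) (use assms(2,3) in auto)
  then show ?thesis using assms(1,2) unfolding reach_def by auto
qed

lemma reach_sym:
  assumes "sym_irrefl E" "reach E S u v"
  shows "reach E S v u"
proof -
  have "(\<lambda>a b. E a b \<and> a \<in> S \<and> b \<in> S)\<^sup>*\<^sup>* u v" using assms unfolding reach_def by simp
  then have "(\<lambda>a b. E a b \<and> a \<in> S \<and> b \<in> S)\<^sup>*\<^sup>* v u"
  proof (induction rule: rtranclp_induct)
    case (step y z)
    then show ?case using sym_irreflD(1)[OF assms(1)]
      by (metis (mono_tags, lifting) converse_rtranclp_into_rtranclp)
  qed simp
  then show ?thesis using reach_mem[OF assms(2)] unfolding reach_def by simp
qed

lemma reach_walk:
  assumes "w \<noteq> []" "successively E w" "set w \<subseteq> S"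
  shows "reach E S (hd w) (last w)"
  using assms
proof (induction w rule: induct_list012)
  case (2 x)
  then show ?case by (simp add: reach_refl)
next
  case (3 x y zs)
  have "reach E S x y" using 3 by (intro reach_edge) auto
  moreover have "reach E S y (last (y # zs))" using 3 by auto
  ultimately show ?case using reach_trans by fastforce
qed simp

lemma reach_path:
  assumes "reach E S u v"
  shows "\<exists>p. is_path S E p \<and> hd p = u \<and> last p = v"
proof -
  have u: "u \<in> S" using assms reach_mem by fast
  have "(\<lambda>a b. E a b \<and> a \<in> S \<and> b \<in> S)\<^sup>*\<^sup>* u v" using assms unfolding reach_def by simp
  then have "\<exists>w. w \<noteq> [] \<and> successively E w \<and> set w \<subseteq> S \<and> hd w = u \<and> last w = v"
  proof (induction rule: rtranclp_induct)
    case base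
    then show ?case using u by (intro exI[of _ "[u]"]) auto
  next
    case (step y z)
    then obtain w where "w \<noteq> []" "successively E w" "set w \<subseteq> S" "hd w = u" "last w = y" by blast
    then show ?case using step by (intro exI[of _ "w @ [z]"]) (auto simp: successively_append_iff)
  qed
  then obtain w where w: "w \<noteq> []" "successively E w" "set w \<subseteq> S" "hd w = u" "last w = v" by blast
  from walk_to_path[OF w(1,2)] w show ?thesis unfolding is_path_iff by (meson order_trans)
qed

lemma reach_iff_path:
  "reach E S u v \<longleftrightarrow> (\<exists>p. is_path S E p \<and> hd p = u \<and> last p = v)"
  using reach_path reach_walk unfolding is_path_iff by metis

text \<open>Cut at the last visit to \<open>A\<close>, and then at the first visit to
  \<open>B\<close> after it.\<close>

lemma trim_path:
  assumes "p \<noteq> []" "distinct p" "successively E p" "hd p \<in> A" "last p \<in> B"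
  shows "\<exists>q. q \<noteq> [] \<and> distinct q \<and> successively E q \<and> set q \<subseteq> set p
     \<and> set q \<inter> A = {hd q} \<and> set q \<inter> B = {last q}"
proof -
  have "\<exists>x\<in>set p. x \<in> A" using assms by (meson hd_in_set)
  then obtain ys x zs where p: "p = ys @ x # zs" "x \<in> A" "\<forall>z\<in>set zs. z \<notin> A"
    using split_list_last_prop[of p "\<lambda>x. x \<in> A"] by blast
  let ?r = "x # zs"
  have "last ?r \<in> B" using assms(5) p(1) by simp
  then have "\<exists>x\<in>set ?r. x \<in> B" by (meson last_in_set list.discI)
  then obtain us b vs where r: "?r = us @ b # vs" "b \<in> B" "\<forall>z\<in>set us. z \<notin> B"
    using split_list_first_prop[of ?r "\<lambda>x. x \<in> B"] by blast
  let ?q = "us @ [b]"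
  have hdq: "hd ?q = x" using r(1) by (cases us) auto
  have 1: "set ?q \<subseteq> set p" using p(1) r(1) by (metis append_Cons append_Nil append_assoc le_supI2 set_append subset_refl sup_ge1)
  have dr: "distinct ?r" "successively E ?r" using assms p by (auto simp: successively_append_iff)
  have 2: "distinct ?q" using dr r(1) by auto
  have 3: "successively E ?q" using dr(2) unfolding r(1) by (auto simp: successively_append_iff successively_Cons)
  have sq: "set ?q \<subseteq> set ?r" using r(1) by auto
  have "set ?r \<inter> A = {x}" using p by auto
  moreover have "x \<in> set ?q" using hdq by (metis hd_in_set snoc_eq_iff_butlast)
  ultimately have 4: "set ?q \<inter> A = {hd ?q}" using p hdq
    using sq hdq by blast
  have 5: "set ?q \<inter> B = {last ?q}" using r by auto
  show ?thesis using 1 2 3 4 5 by (intro exI[of _ ?q]) auto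
qed

section \<open>Menger's theorem\<close>

definition lpath :: "('a \<times> 'a) set \<Rightarrow> 'a list \<Rightarrow> bool" where
  "lpath R p \<longleftrightarrow> p \<noteq> [] \<and> distinct p \<and> successively (\<lambda>x y. (x, y) \<in> R) p"

definition separates :: "('a \<times> 'a) set \<Rightarrow> 'a set \<Rightarrow> 'a set \<Rightarrow> 'a set \<Rightarrow> bool" where
  "separates R A B Z \<longleftrightarrow> (\<forall>p. lpath R p \<and> hd p \<in> A \<and> last p \<in> B \<longrightarrow> set p \<inter> Z \<noteq> {})"

definition disjoint_paths :: "('a \<times> 'a) set \<Rightarrow> 'a set \<Rightarrow> 'a set \<Rightarrow> nat \<Rightarrow> (nat \<Rightarrow> 'a list) \<Rightarrow> bool" where
  "disjoint_paths R A B k P \<longleftrightarrow>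
     (\<forall>i<k. lpath R (P i) \<and> set (P i) \<inter> A = {hd (P i)} \<and> set (P i) \<inter> B = {last (P i)})
     \<and> (\<forall>i<k. \<forall>j<k. i \<noteq> j \<longrightarrow> set (P i) \<inter> set (P j) = {})"

lemma disjoint_paths_trim:
  assumes "\<And>i. i < k \<Longrightarrow> lpath R (P i) \<and> hd (P i) \<in> A \<and> last (P i) \<in> B"
    and "\<And>i j. i < k \<Longrightarrow> j < k \<Longrightarrow> i \<noteq> j \<Longrightarrow> set (P i) \<inter> set (P j) = {}"
  shows "\<exists>Q. disjoint_paths R A B k Q"
proof -
  have "\<forall>i. \<exists>q. i < k \<longrightarrow> lpath R q \<and> set q \<subseteq> set (P i) \<and> set q \<inter> A = {hd q} \<and> set q \<inter> B = {last q}"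
    using trim_path[of _ "\<lambda>x y. (x, y) \<in> R" A B] assms(1) unfolding lpath_def by meson
  then obtain Q where Q: "\<And>i. i < k \<Longrightarrow> lpath R (Q i) \<and> set (Q i) \<subseteq> set (P i) \<and> set (Q i) \<inter> A = {hd (Q i)} \<and> set (Q i) \<inter> B = {last (Q i)}"
    by metis
  have "set (Q i) \<inter> set (Q j) = {}" if "i < k" "j < k" "i \<noteq> j" for i j
    using Q[of i] Q[of j] assms(2)[of i j] that by blast
  then show ?thesis using Q unfolding disjoint_paths_def by blast
qed

lemma lpath_walk:
  assumes "w \<noteq> []" "successively (\<lambda>x y. (x, y) \<in> R) w"
  shows "\<exists>p. lpath R p \<and> hd p = hd w \<and> last p = last w \<and> set p \<subseteq> set w"
  using walk_to_path[OF assms] unfolding lpath_def by metis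

text \<open>The vertices of a path are distinct, so it uses the new arc at most once.\<close>

lemma lpath_insert_arc:
  assumes "lpath (insert (x, y) R) p" "\<not> lpath R p"
  shows "\<exists>p1 p2. p = p1 @ p2 \<and> lpath R p1 \<and> lpath R p2 \<and> last p1 = x \<and> hd p2 = y"
proof -
  let ?E = "\<lambda>a b. (a, b) \<in> R"
  have "\<not> successively ?E p" using assms unfolding lpath_def by auto
  then obtain i where i: "Suc i < length p" "(p ! i, p ! Suc i) \<notin> R"
    unfolding successively_conv_nth by blast
  have d: "distinct p" "p \<noteq> []" using assms unfolding lpath_def by auto
  have arc: "(p ! j, p ! Suc j) \<in> insert (x, y) R" if "Suc j < length p" for j
    using assms(1) that unfolding lpath_def successively_conv_nth by blast
  have xy: "p ! i = x" "p ! Suc i = y" using arc[OF i(1)] i(2) by auto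
  have oth: "(p ! j, p ! Suc j) \<in> R" if "Suc j < length p" "j \<noteq> i" for j
    using arc[OF that(1)] that d xy i by (auto simp: nth_eq_iff_index_eq)
  let ?p1 = "take (Suc i) p" and ?p2 = "drop (Suc i) p"
  have "lpath R ?p1" unfolding lpath_def successively_conv_nth using i d oth by auto
  moreover have "lpath R ?p2" unfolding lpath_def successively_conv_nth using i d oth by auto
  moreover have "last ?p1 = x" using i xy by (simp add: take_Suc_conv_app_nth)
  moreover have "hd ?p2 = y" using i xy by (simp add: hd_drop_conv_nth)
  ultimately show ?thesis by (metis append_take_drop_id)
qed

text \<open>Remove an arc \<open>(x, y)\<close>. If the rest has a separator \<open>Z\<close> of
  fewer than \<open>k\<close> vertices, then \<open>insert x Z\<close> and \<open>insert y Z\<close>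
  separate in the whole digraph and thus have exactly \<open>k\<close> elements. By induction there
  are \<open>k\<close> disjoint paths from \<open>A\<close> to the first set and from the second set
  to \<open>B\<close>, which are glued at \<open>Z\<close> and along the arc.\<close>

theorem menger_directed:
  fixes R :: "('a \<times> 'a) set"
  assumes "finite R" "finite A" "finite B"
    and "\<And>Z. finite Z \<Longrightarrow> separates R A B Z \<Longrightarrow> k \<le> card Z"
  shows "\<exists>P. disjoint_paths R A B k P"
  using assms
proof (induction R arbitrary: A B rule: finite_induct)
  case empty
  have "separates {} A B (A \<inter> B)"
    unfolding separates_def lpath_def
  proof (intro allI impI)
    fix p assume p: "(p \<noteq> [] \<and> distinct p \<and> successively (\<lambda>x y. (x, y) \<in> {}) p) \<and> hd p \<in> A \<and> last p \<in> B"
    then obtain a where "p = [a]"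
      by (metis successively.simps(3) empty_iff neq_Nil_conv)
    then show "set p \<inter> (A \<inter> B) \<noteq> {}" using p by auto
  qed
  then have "k \<le> card (A \<inter> B)" using empty by simp
  then obtain f where f: "inj_on f {..<k}" "f ` {..<k} \<subseteq> A \<inter> B"
    using empty(1) by (metis card_le_inj card_lessThan finite_Int finite_lessThan)
  have "disjoint_paths {} A B k (\<lambda>i. [f i])"
    using f unfolding disjoint_paths_def lpath_def inj_on_def by auto
  then show ?case by blast
next
  case (insert e R)
  obtain x y where e: "e = (x, y)" by force
  show ?case
  proof (cases "\<forall>Z. finite Z \<longrightarrow> separates R A B Z \<longrightarrow> k \<le> card Z")
    case True
    then obtain P where "disjoint_paths R A B k P" using insert by metis
    then have "disjoint_paths (insert e R) A B k P"
      unfolding disjoint_paths_def lpath_def by (auto intro: successively_mono)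
    then show ?thesis by blast
  next
    case False
    then obtain Z where Z: "finite Z" "separates R A B Z" "card Z < k" by auto
    have sxy: "separates (insert e R) A B (insert w Z)" if w: "w = x \<or> w = y" for w
      unfolding separates_def
    proof (intro allI impI)
      fix p assume p: "lpath (insert e R) p \<and> hd p \<in> A \<and> last p \<in> B"
      show "set p \<inter> insert w Z \<noteq> {}"
      proof (cases "lpath R p")
        case True then show ?thesis using Z(2) p unfolding separates_def by blast
      next
        case False
        then obtain p1 p2 where q: "p = p1 @ p2" "lpath R p1" "lpath R p2" "last p1 = x" "hd p2 = y"
          using lpath_insert_arc[of x y R p] p e by blast
        then have "x \<in> set p" "y \<in> set p" unfolding lpath_def by auto
        then show ?thesis using w by blast
      qed
    qed
    have cx: "card (insert x Z) = k" "x \<notin> Z" and cy: "card (insert y Z) = k" "y \<notin> Z"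
      using insert.prems(3)[OF _ sxy[of x]] insert.prems(3)[OF _ sxy[of y]] Z(1,3) by (auto simp: card_insert_if split: if_splits)
    have "\<exists>P. disjoint_paths R A (insert x Z) k P"
    proof (rule insert.IH)
      fix W assume W: "finite W" "separates R A (insert x Z) W"
      \<comment> \<open>Every path reaches \<open>insert x Z\<close> while it is still in
        \<open>R\<close>: either at a vertex of \<open>Z\<close> or at the tail \<open>x\<close> of
        the new arc.\<close>
      have "separates (insert e R) A B W"
        unfolding separates_def
      proof (intro allI impI)
        fix p assume p: "lpath (insert e R) p \<and> hd p \<in> A \<and> last p \<in> B"
        show "set p \<inter> W \<noteq> {}"
        proof (cases "lpath R p")
          case True
          then have "set p \<inter> Z \<noteq> {}" using Z(2) p unfolding separates_def by blast
          then obtain z us vs where z: "p = us @ z # vs" "z \<in> Z" by (metis Int_emptyI in_set_conv_decomp)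
          have "lpath R (us @ [z])" using True unfolding z lpath_def
            by (auto simp: successively_append_iff successively_Cons)
          moreover have "hd (us @ [z]) \<in> A" using p z by (cases us) auto
          ultimately show ?thesis using W(2) z unfolding separates_def by fastforce
        next
          case False
          then obtain p1 p2 where "p = p1 @ p2" "lpath R p1" "last p1 = x"
            using lpath_insert_arc[of x y R p] p e by blast
          moreover have "hd p1 \<in> A" using calculation p by (auto simp: lpath_def)
          ultimately show ?thesis using W(2) unfolding separates_def by fastforce
        qed
      qed
      then show "k \<le> card W" using insert.prems W by blast
    qed (use insert Z in auto)
    then obtain P1 where P1: "disjoint_paths R A (insert x Z) k P1" by blast
    have "\<exists>P. disjoint_paths R (insert y Z) B k P"
    proof (rule insert.IH)
      fix W assume W: "finite W" "separates R (insert y Z) B W"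
      have "separates (insert e R) A B W"
        unfolding separates_def
      proof (intro allI impI)
        fix p assume p: "lpath (insert e R) p \<and> hd p \<in> A \<and> last p \<in> B"
        show "set p \<inter> W \<noteq> {}"
        proof (cases "lpath R p")
          case True
          then have "set p \<inter> Z \<noteq> {}" using Z(2) p unfolding separates_def by blast
          then obtain z us vs where z: "p = us @ z # vs" "z \<in> Z" by (metis Int_emptyI in_set_conv_decomp)
          have "lpath R (z # vs)" using True unfolding z lpath_def
            by (auto simp: successively_append_iff)
          moreover have "last (z # vs) \<in> B" using p z by auto
          ultimately show ?thesis using W(2) z unfolding separates_def by fastforce
        next
          case False
          then obtain p1 p2 where "p = p1 @ p2" "lpath R p2" "hd p2 = y"
            using lpath_insert_arc[of x y R p] p e by blast
          moreover have "last p2 \<in> B" using calculation p by (auto simp: lpath_def)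
          ultimately show ?thesis using W(2) unfolding separates_def by fastforce
        qed
      qed
      then show "k \<le> card W" using insert.prems W by blast
    qed (use insert Z in auto)
    then obtain P2 where P2: "disjoint_paths R (insert y Z) B k P2" by blast
    have P1p: "lpath R (P1 i)" "hd (P1 i) \<in> A" "set (P1 i) \<inter> insert x Z = {last (P1 i)}" if "i < k" for i
      using P1 that unfolding disjoint_paths_def by blast+
    have P2p: "lpath R (P2 i)" "last (P2 i) \<in> B" "set (P2 i) \<inter> insert y Z = {hd (P2 i)}" if "i < k" for i
      using P2 that unfolding disjoint_paths_def by blast+
    have P1d: "set (P1 i) \<inter> set (P1 j) = {}" if "i < k" "j < k" "i \<noteq> j" for i j
      using P1 that unfolding disjoint_paths_def by blast
    have P2d: "set (P2 i) \<inter> set (P2 j) = {}" if "i < k" "j < k" "i \<noteq> j" for i j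
      using P2 that unfolding disjoint_paths_def by blast
    have inj1: "inj_on (\<lambda>i. last (P1 i)) {..<k}"
      using P1d P1p(1) unfolding inj_on_def lpath_def by (metis IntI empty_iff last_in_set lessThan_iff)
    have im1: "(\<lambda>i. last (P1 i)) ` {..<k} = insert x Z"
    proof (rule card_subset_eq)
      show "finite (insert x Z)" using Z by simp
      show "(\<lambda>i. last (P1 i)) ` {..<k} \<subseteq> insert x Z" using P1p(3) by blast
      show "card ((\<lambda>i. last (P1 i)) ` {..<k}) = card (insert x Z)"
        using card_image[OF inj1] cx by simp
    qed
    \<comment> \<open>A common vertex off \<open>Z\<close> would splice the two paths into an
      \<open>A\<close>-\<open>B\<close> path of \<open>R\<close> that avoids
      \<open>Z\<close>.\<close>
    have cross: "set (P1 i) \<inter> set (P2 j) \<subseteq> Z" if ij: "i < k" "j < k" for i j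
    proof
      fix z assume z: "z \<in> set (P1 i) \<inter> set (P2 j)"
      show "z \<in> Z"
      proof (rule ccontr)
        assume nz: "z \<notin> Z"
        obtain a b where ab: "P1 i = a @ z # b" using z by (meson IntD1 in_set_conv_decomp)
        obtain c d where cd: "P2 j = c @ z # d" using z by (meson IntD2 in_set_conv_decomp)
        let ?w = "a @ z # d"
        have "successively (\<lambda>x y. (x, y) \<in> R) ?w"
          using P1p(1)[OF ij(1)] P2p(1)[OF ij(2)] unfolding ab cd lpath_def
          by (auto simp: successively_append_iff successively_Cons)
        then obtain p where p: "lpath R p" "hd p = hd ?w" "last p = last ?w" "set p \<subseteq> set ?w"
          using lpath_walk[of ?w R] by blast
        have "hd ?w \<in> A" using P1p(2)[OF ij(1)] ab by (cases a) auto
        moreover have "last ?w \<in> B" using P2p(2)[OF ij(2)] cd by auto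
        ultimately have "set ?w \<inter> Z \<noteq> {}" using Z(2) p unfolding separates_def by fastforce
        then consider s where "s \<in> set a" "s \<in> Z" | s where "s \<in> set d" "s \<in> Z" using nz by auto
        then show False
        proof cases
          case 1
          have "s \<in> set (P1 i) \<inter> insert x Z" using 1 ab by simp
          then have "s = last (P1 i)" unfolding P1p(3)[OF ij(1)] by simp
          moreover have "last (P1 i) \<in> set (z # b)" using ab by (metis last_appendR last_in_set list.discI)
          moreover have "distinct (P1 i)" using P1p(1)[OF ij(1)] unfolding lpath_def by blast
          ultimately show False using 1 ab by auto
        next
          case 2
          have "s \<in> set (P2 j) \<inter> insert y Z" using 2 cd by simp
          then have "s = hd (P2 j)" unfolding P2p(3)[OF ij(2)] by simp
          moreover have "hd (P2 j) \<in> set (c @ [z])" using cd by (cases c) auto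
          moreover have "distinct (P2 j)" using P2p(1)[OF ij(2)] unfolding lpath_def by blast
          ultimately show False using 2 cd by auto
        qed
      qed
    qed
    \<comment> \<open>The path that starts at \<open>y\<close> continues the one that ends at
      \<open>x\<close>; all others are matched by their common vertex in \<open>Z\<close>.\<close>
    have "\<exists>i<k. last (P1 i) = (if hd (P2 j) = y then x else hd (P2 j))" if "j < k" for j
    proof -
      have "hd (P2 j) \<in> insert y Z" using P2p(3)[OF that] by blast
      then have "(if hd (P2 j) = y then x else hd (P2 j)) \<in> (\<lambda>i. last (P1 i)) ` {..<k}"
        unfolding im1 by auto
      then show ?thesis by auto
    qed
    then obtain \<sigma> where \<sigma>: "\<And>j. j < k \<Longrightarrow> \<sigma> j < k \<and> last (P1 (\<sigma> j)) = (if hd (P2 j) = y then x else hd (P2 j))"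
      by metis
    have hdinj: "hd (P2 i) \<noteq> hd (P2 j)" if "i < k" "j < k" "i \<noteq> j" for i j
      using P2d[OF that] P2p(1)[OF that(1)] P2p(1)[OF that(2)] unfolding lpath_def
      by (metis IntI empty_iff hd_in_set)
    have \<sigma>inj: "\<sigma> i \<noteq> \<sigma> j" if "i < k" "j < k" "i \<noteq> j" for i j
    proof
      assume eq: "\<sigma> i = \<sigma> j"
      have "hd (P2 i) \<in> insert y Z" "hd (P2 j) \<in> insert y Z" using P2p(3) that by blast+
      then show False using \<sigma>[OF that(1)] \<sigma>[OF that(2)] eq hdinj[OF that] cx(2) by (auto split: if_splits)
    qed
    \<comment> \<open>At \<open>y\<close> the new arc connects two disjoint paths; elsewhere the two
      paths share a vertex, which \<open>tl\<close> removes.\<close>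
    define Q where "Q j = (if hd (P2 j) = y then P1 (\<sigma> j) @ P2 j else P1 (\<sigma> j) @ tl (P2 j))" for j
    have setQ: "set (Q j) \<subseteq> set (P1 (\<sigma> j)) \<union> set (P2 j)" for j
      unfolding Q_def by (auto dest: list.set_sel(2)) (metis list.set_sel(2) tl_Nil)
    have Qpath: "lpath (insert e R) (Q j) \<and> hd (Q j) \<in> A \<and> last (Q j) \<in> B" if j: "j < k" for j
    proof -
      have s: "\<sigma> j < k" using \<sigma> j by blast
      note p1 = P1p[OF s] and p2 = P2p[OF j]
      have suc1: "successively (\<lambda>x y. (x, y) \<in> insert e R) (P1 (\<sigma> j))"
        "successively (\<lambda>x y. (x, y) \<in> insert e R) (P2 j)"
        using p1(1) p2(1) unfolding lpath_def by (auto intro: successively_mono)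
      have ne: "P1 (\<sigma> j) \<noteq> []" "P2 j \<noteq> []" using p1(1) p2(1) unfolding lpath_def by auto
      show ?thesis
      proof (cases "hd (P2 j) = y")
        case True
        have "set (P2 j) \<inter> Z \<subseteq> set (P2 j) \<inter> insert y Z" by auto
        then have "set (P2 j) \<inter> Z \<subseteq> {y}" unfolding p2(3) True .
        then have "set (P2 j) \<inter> Z = {}" using cy(2) by blast
        then have "set (P1 (\<sigma> j)) \<inter> set (P2 j) = {}" using cross[OF s j] by blast
        moreover have "last (P1 (\<sigma> j)) = x" using \<sigma>[OF j] True by simp
        ultimately show ?thesis
          using p1 p2 suc1 ne True unfolding lpath_def Q_def by (auto simp: successively_append_iff e)
      next
        case False
        have l: "last (P1 (\<sigma> j)) = hd (P2 j)" using \<sigma>[OF j] False by simp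
        obtain h t where ht: "P2 j = h # t" using ne by (cases "P2 j") auto
        have "h \<notin> set t" using p2(1) ht unfolding lpath_def by simp
        moreover have "set t \<inter> Z \<subseteq> {h}" using p2(3) ht by auto
        ultimately have "set t \<inter> Z = {}" by blast
        then have dis: "set (P1 (\<sigma> j)) \<inter> set t = {}" using cross[OF s j] ht by auto
        have "t \<noteq> [] \<Longrightarrow> (h, hd t) \<in> insert e R"
          using suc1(2) ht by (auto simp: successively_Cons)
        then show ?thesis
          using p1 p2 suc1 ne False l ht dis unfolding lpath_def Q_def
          by (auto simp: successively_append_iff successively_Cons last_append)
      qed
    qed
    have Qdis: "set (Q i) \<inter> set (Q j) = {}" if ij: "i < k" "j < k" "i \<noteq> j" for i j
    proof -
      have s: "\<sigma> i < k" "\<sigma> j < k" using \<sigma> ij by blast+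
      have key: "set (P1 (\<sigma> i)) \<inter> set (P2 j) = {}" if ij: "i < k" "j < k" "i \<noteq> j" and s: "\<sigma> i < k" for i j
      proof (rule ccontr)
        assume "set (P1 (\<sigma> i)) \<inter> set (P2 j) \<noteq> {}"
        then obtain z where z: "z \<in> set (P1 (\<sigma> i))" "z \<in> set (P2 j)" by blast
        then have zZ: "z \<in> Z" using cross[OF s ij(2)] by blast
        have a: "z = last (P1 (\<sigma> i))" using P1p(3)[OF s] z zZ by blast
        have b: "z = hd (P2 j)" using P2p(3)[OF ij(2)] z zZ by blast
        have c: "last (P1 (\<sigma> i)) = hd (P2 i)" using \<sigma>[OF ij(1)] a zZ cx(2) by (auto split: if_splits)
        show False using hdinj[OF ij] a b c by simp
      qed
      have "set (P1 (\<sigma> i)) \<inter> set (P1 (\<sigma> j)) = {}" using P1d[OF s] \<sigma>inj[OF ij] by blast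
      moreover have "set (P2 i) \<inter> set (P2 j) = {}" using P2d[OF ij] .
      moreover have "set (P1 (\<sigma> i)) \<inter> set (P2 j) = {}" using key[OF ij s(1)] .
      moreover have "set (P1 (\<sigma> j)) \<inter> set (P2 i) = {}" using key[OF ij(2,1) ij(3)[symmetric] s(2)] .
      ultimately show ?thesis using setQ[of i] setQ[of j] by blast
    qed
    show ?thesis using disjoint_paths_trim[of k "insert e R" Q A B] Qpath Qdis by blast
  qed
qed

theorem menger:
  fixes V :: "'a set"
  assumes V: "finite V" and A: "A \<subseteq> V" and B: "B \<subseteq> V"
    and sep: "\<And>Z. Z \<subseteq> V \<Longrightarrow> (\<forall>p. is_path V E p \<and> hd p \<in> A \<and> last p \<in> B \<longrightarrow> set p \<inter> Z \<noteq> {}) \<Longrightarrow> k \<le> card Z"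
  shows "\<exists>P :: nat \<Rightarrow> 'a list.
     (\<forall>i<k. is_path V E (P i) \<and> set (P i) \<inter> A = {hd (P i)} \<and> set (P i) \<inter> B = {last (P i)})
     \<and> (\<forall>i<k. \<forall>j<k. i \<noteq> j \<longrightarrow> set (P i) \<inter> set (P j) = {})"
proof -
  define R where "R = {(x, y). x \<in> V \<and> y \<in> V \<and> E x y}"
  have finR: "finite R" by (rule finite_subset[of _ "V \<times> V"]) (use V R_def in auto)
  have sub: "set p \<subseteq> V" if "lpath R p" "hd p \<in> V" for p
  proof -
    have "successively (\<lambda>x y. (x, y) \<in> R) p \<Longrightarrow> p \<noteq> [] \<Longrightarrow> hd p \<in> V \<Longrightarrow> set p \<subseteq> V" for p
      by (induction p rule: induct_list012) (auto simp: R_def)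
    then show ?thesis using that unfolding lpath_def by blast
  qed
  have eq: "is_path V E p \<longleftrightarrow> lpath R p \<and> hd p \<in> V" for p
  proof
    assume "is_path V E p"
    then show "lpath R p \<and> hd p \<in> V" unfolding is_path_iff lpath_def R_def
      by (auto intro: successively_if_sorted_wrt simp: successively_conv_nth dest: nth_mem)
  next
    assume l: "lpath R p \<and> hd p \<in> V"
    then have "successively E p" unfolding lpath_def R_def by (auto intro: successively_mono)
    then show "is_path V E p" using l sub unfolding is_path_iff lpath_def by blast
  qed
  have "\<exists>P. disjoint_paths R A B k P"
  proof (rule menger_directed)
    show "finite R" by (rule finR)
    show "finite A" "finite B" using assms finite_subset by blast+
    fix Z assume Z: "finite Z" "separates R A B Z"
    have "\<forall>p. is_path V E p \<and> hd p \<in> A \<and> last p \<in> B \<longrightarrow> set p \<inter> (Z \<inter> V) \<noteq> {}"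
    proof (intro allI impI)
      fix p assume p: "is_path V E p \<and> hd p \<in> A \<and> last p \<in> B"
      then have "set p \<inter> Z \<noteq> {}" using Z(2) eq unfolding separates_def by blast
      moreover have "set p \<subseteq> V" using p unfolding is_path_iff by blast
      ultimately show "set p \<inter> (Z \<inter> V) \<noteq> {}" by blast
    qed
    then have "k \<le> card (Z \<inter> V)" by (intro sep) auto
    also have "\<dots> \<le> card Z" using Z(1) by (intro card_mono) auto
    finally show "k \<le> card Z" .
  qed
  then show ?thesis unfolding disjoint_paths_def eq using A by blast
qed

section \<open>Linkages in dense graphs\<close>

text \<open>\<open>l\<close> bounds the number of inner vertices of a linking path: it is
  \<open>2\<close> in the dense case and \<open>7\<close> in the large one.\<close>

locale linkage_problem =
  fixes V :: "'a set" and E :: "'a \<Rightarrow> 'a \<Rightarrow> bool" and m :: nat and x y :: "nat \<Rightarrow> 'a" and l :: nat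
  assumes finV: "finite V" and E: "sym_irrefl E"
    and xV: "i < m \<Longrightarrow> x i \<in> V" and yV: "i < m \<Longrightarrow> y i \<in> V"
    and xy: "i < m \<Longrightarrow> j < m \<Longrightarrow> x i \<noteq> y j"
    and xx: "i < m \<Longrightarrow> j < m \<Longrightarrow> i \<noteq> j \<Longrightarrow> x i \<noteq> x j"
    and yy: "i < m \<Longrightarrow> j < m \<Longrightarrow> i \<noteq> j \<Longrightarrow> y i \<noteq> y j"
begin

definition X :: "'a set" where "X = x ` {..<m} \<union> y ` {..<m}"

text \<open>A pair that is not (yet) linked is represented by the two-element list of its ends.\<close>

definition ok :: "nat \<Rightarrow> 'a list \<Rightarrow> bool" where
  "ok i w \<longleftrightarrow> w \<noteq> [] \<and> distinct w \<and> set w \<subseteq> V \<and> hd w = x i \<and> last w = y i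
     \<and> set w \<inter> X = {x i, y i} \<and> length w \<le> l + 2 \<and> (successively E w \<or> w = [x i, y i])"

definition valid :: "(nat \<Rightarrow> 'a list) \<Rightarrow> bool" where
  "valid g \<longleftrightarrow> (\<forall>i<m. ok i (g i)) \<and> (\<forall>i<m. \<forall>j<m. i \<noteq> j \<longrightarrow> set (g i) \<inter> set (g j) = {})"

definition unl :: "(nat \<Rightarrow> 'a list) \<Rightarrow> nat" where
  "unl g = card {i. i < m \<and> \<not> successively E (g i)}"

definition tot :: "(nat \<Rightarrow> 'a list) \<Rightarrow> nat" where
  "tot g = (\<Sum>i<m. length (g i))"

definition free :: "(nat \<Rightarrow> 'a list) \<Rightarrow> 'a set" where
  "free g = V - (\<Union>i<m. set (g i))"

definition closed_end :: "(nat \<Rightarrow> 'a list) \<Rightarrow> 'a \<Rightarrow> nat" where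
  "closed_end g a = (if \<exists>r\<in>free g. E a r then 0 else 1)"

definition closed :: "(nat \<Rightarrow> 'a list) \<Rightarrow> nat \<Rightarrow> nat" where
  "closed g i = closed_end g (x i) + closed_end g (y i)"

lemma valid_upd2:
  assumes "valid g" "i < m" "j < m" "i \<noteq> j" "ok i w" "ok j w'" "set w \<inter> set w' = {}"
    "set w \<subseteq> set (g i) \<union> set (g j) \<union> free g" "set w' \<subseteq> set (g i) \<union> set (g j) \<union> free g"
  shows "valid (g(i := w, j := w'))"
proof -
  let ?g = "g(i := w, j := w')"
  have dis: "set (g h) \<inter> (set (g i) \<union> set (g j) \<union> free g) = {}" if "h < m" "h \<noteq> i" "h \<noteq> j" for h
    using assms(1-3) that unfolding valid_def free_def by blast
  have sub: "set (?g h) \<subseteq> set (g i) \<union> set (g j) \<union> free g" if "h = i \<or> h = j" for h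
    using assms(4,8,9) that by auto
  have "set (?g h) \<inter> set (?g h') = {}" if "h < m" "h' < m" "h \<noteq> h'" for h h'
  proof (cases "h = i \<or> h = j"; cases "h' = i \<or> h' = j")
    assume "h = i \<or> h = j" "h' = i \<or> h' = j"
    then show ?thesis using assms(4,7) that(3) by auto
  next
    assume a: "h = i \<or> h = j" "\<not> (h' = i \<or> h' = j)"
    then have "?g h' = g h'" by auto
    then show ?thesis using sub[OF a(1)] dis[of h'] a(2) that(2) by auto
  next
    assume a: "\<not> (h = i \<or> h = j)" "h' = i \<or> h' = j"
    then have "?g h = g h" by auto
    then show ?thesis using sub[OF a(2)] dis[of h] a(1) that(1) by auto
  next
    assume "\<not> (h = i \<or> h = j)" "\<not> (h' = i \<or> h' = j)"
    then have "?g h = g h" "?g h' = g h'" by auto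
    then show ?thesis using assms(1) that unfolding valid_def by auto
  qed
  then show ?thesis using assms unfolding valid_def by auto
qed

lemma valid_upd1:
  assumes "valid g" "i < m" "ok i w" "set w \<subseteq> set (g i) \<union> free g"
  shows "valid (g(i := w))"
proof -
  let ?g = "g(i := w)"
  have dis: "set (g h) \<inter> (set (g i) \<union> free g) = {}" if "h < m" "h \<noteq> i" for h
    using assms(1,2) that unfolding valid_def free_def by blast
  have "set (?g h) \<inter> set (?g h') = {}" if "h < m" "h' < m" "h \<noteq> h'" for h h'
  proof -
    have "set (g h) \<inter> set (g h') = {}" using assms(1) that unfolding valid_def by blast
    then show ?thesis
      using dis[of h] dis[of h'] that assms by (cases "h = i"; cases "h' = i") (simp_all, blast+)
  qed
  then show ?thesis using assms unfolding valid_def by auto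
qed

lemma tot_upd: "i < m \<Longrightarrow> tot (g(i := w)) + length (g i) = tot g + length w"
  unfolding tot_def by (subst (1 2) sum.remove[of _ i]) auto

lemma valid_init: "valid (\<lambda>i. [x i, y i])"
proof -
  have "ok i [x i, y i]" if "i < m" for i
    using that xy[OF that that] xV[OF that] yV[OF that] unfolding ok_def X_def by auto
  moreover have "set [x i, y i] \<inter> set [x j, y j] = {}" if "i < m" "j < m" "i \<noteq> j" for i j
    using xy[OF that(1,2)] xy[OF that(2,1)] xx[OF that] yy[OF that] by auto
  ultimately show ?thesis unfolding valid_def by blast
qed

lemma ok_two: "i < m \<Longrightarrow> ok i [x i, y i]"
  using valid_init unfolding valid_def by blast

lemma unl_mono:
  assumes "\<And>i. i < m \<Longrightarrow> successively E (g i) \<Longrightarrow> successively E (g' i)"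
  shows "unl g' \<le> unl g"
  unfolding unl_def by (rule card_mono) (use assms in auto)

lemma unl_less:
  assumes "\<And>i. i < m \<Longrightarrow> successively E (g i) \<Longrightarrow> successively E (g' i)"
    and "i < m" "\<not> successively E (g i)" "successively E (g' i)"
  shows "unl g' < unl g"
  unfolding unl_def by (rule psubset_card_mono) (use assms in auto)

text \<open>The lexicographic minimum is taken over families together with one of their unlinked
  indices, because the last component of the measure depends on that index.\<close>

lemma optimum_exists:
  assumes "\<And>g. valid g \<Longrightarrow> unl g \<noteq> 0"
  shows "\<exists>g i0. valid g \<and> i0 < m \<and> \<not> successively E (g i0) \<and>
     (\<forall>g' i'. valid g' \<longrightarrow> i' < m \<longrightarrow> \<not> successively E (g' i') \<longrightarrow>
        unl g < unl g' \<or> (unl g = unl g' \<and> (tot g < tot g' \<or> (tot g = tot g' \<and> closed g i0 \<le> closed g' i'))))"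
proof -
  define S where "S = {(g, i). valid g \<and> i < m \<and> \<not> successively E (g i)}"
  define f where "f = (\<lambda>(g, i). (unl g, tot g, closed g i))"
  define r where "r = inv_image (less_than <*lex*> less_than <*lex*> less_than) f"
  have wf: "wf r" unfolding r_def by auto
  have "\<exists>i. i < m \<and> \<not> successively E [x i, y i]"
  proof (rule ccontr)
    assume "\<not> ?thesis"
    then have "unl (\<lambda>i. [x i, y i]) = 0" unfolding unl_def by auto
    then show False using assms valid_init by blast
  qed
  then have "\<exists>s. s \<in> S" unfolding S_def using valid_init by fastforce
  then obtain s where s: "s \<in> S" "\<And>t. (t, s) \<in> r \<Longrightarrow> t \<notin> S" using wfE_min[OF wf] by metis
  obtain g i0 where gi: "s = (g, i0)" by force
  show ?thesis
  proof (rule exI[of _ g], rule exI[of _ i0], intro conjI allI impI)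
    show "valid g" "i0 < m" "\<not> successively E (g i0)" using s(1) gi unfolding S_def by auto
    fix g' i' assume a: "valid g'" "i' < m" "\<not> successively E (g' i')"
    have "((g', i'), (g, i0)) \<notin> r" using s(2) a gi unfolding S_def by blast
    then show "unl g < unl g' \<or> (unl g = unl g' \<and> (tot g < tot g' \<or> (tot g = tot g' \<and> closed g i0 \<le> closed g' i')))"
      unfolding r_def f_def by auto
  qed
qed

end

text \<open>An optimal family: as many linked pairs as possible, then as few vertices as possible, and
  then as many ends of the unlinked pair \<open>{u, v}\<close> as possible with a free neighbour.\<close>

locale optimal_linkage = linkage_problem +
  fixes g :: "nat \<Rightarrow> 'a list" and i0 :: nat and u v :: 'a
  assumes valid: "valid g" and i0: "i0 < m" and ni0: "\<not> successively E (g i0)"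
    and unlinkable: "valid g' \<Longrightarrow> unl g' \<noteq> 0"
    and opt: "valid g' \<Longrightarrow> i' < m \<Longrightarrow> \<not> successively E (g' i') \<Longrightarrow>
        unl g < unl g' \<or> (unl g = unl g' \<and> (tot g < tot g' \<or> (tot g = tot g' \<and> closed g i0 \<le> closed g' i')))"
    and uv: "u = x i0 \<and> v = y i0 \<or> u = y i0 \<and> v = x i0"
begin

abbreviation R :: "'a set" where "R \<equiv> free g"

lemmas Esym = sym_irreflD(1)[OF E] and Eirr = sym_irreflD(2)[OF E]

lemma okg: "i < m \<Longrightarrow> ok i (g i)" using valid unfolding valid_def by blast

lemma g_disj: "i < m \<Longrightarrow> j < m \<Longrightarrow> i \<noteq> j \<Longrightarrow> set (g i) \<inter> set (g j) = {}"
  using valid unfolding valid_def by blast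

lemma g_basic:
  assumes "i < m"
  shows "g i \<noteq> []" "distinct (g i)" "set (g i) \<subseteq> V" "hd (g i) = x i" "last (g i) = y i"
    "set (g i) \<inter> X = {x i, y i}" "length (g i) \<le> l + 2" "2 \<le> length (g i)"
proof -
  show *: "g i \<noteq> []" "distinct (g i)" "set (g i) \<subseteq> V" "hd (g i) = x i" "last (g i) = y i"
    "set (g i) \<inter> X = {x i, y i}" "length (g i) \<le> l + 2"
    using okg[OF assms] unfolding ok_def by auto
  show "2 \<le> length (g i)"
  proof (rule ccontr)
    assume "\<not> 2 \<le> length (g i)"
    then have "length (g i) = 1" using *(1) length_greater_0_conv[of "g i"] by linarith
    then obtain a where "g i = [a]" by (auto simp: length_Suc_conv)
    then show False using *(4,5) xy[OF assms assms] by simp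
  qed
qed

lemma g_unlinked: "i < m \<Longrightarrow> \<not> successively E (g i) \<Longrightarrow> g i = [x i, y i]"
  using okg unfolding ok_def by blast

lemma gi0: "g i0 = [x i0, y i0]" using g_unlinked i0 ni0 by blast

lemma uv_facts: "u \<noteq> v" "\<not> E u v" "\<not> E v u" "set (g i0) = {u, v}" "u \<in> V" "v \<in> V" "u \<in> X" "v \<in> X"
  using uv xy[OF i0 i0] gi0 ni0 Esym xV[OF i0] yV[OF i0] i0 unfolding X_def by auto

lemma R_facts: "R \<subseteq> V" "finite R" "R \<inter> X = {}" "u \<notin> R" "v \<notin> R" "i < m \<Longrightarrow> R \<inter> set (g i) = {}"
proof -
  show 1: "R \<subseteq> V" "finite R" unfolding free_def using finV by auto
  show 2: "i < m \<Longrightarrow> R \<inter> set (g i) = {}" for i unfolding free_def by auto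
  have "X \<subseteq> (\<Union>i<m. set (g i))" using g_basic(6) unfolding X_def by fast
  then show 3: "R \<inter> X = {}" unfolding free_def by auto
  show "u \<notin> R" "v \<notin> R" using 3 uv_facts by auto
qed

lemma unl_opt: "valid g' \<Longrightarrow> unl g \<le> unl g'"
proof -
  assume v: "valid g'"
  then have "unl g' \<noteq> 0" using unlinkable by blast
  then obtain i where "i < m" "\<not> successively E (g' i)" unfolding unl_def
    by (metis (mono_tags, lifting) card.empty empty_Collect_eq)
  then show ?thesis using opt[OF v] by force
qed

lemma tot_opt: "valid g' \<Longrightarrow> unl g' \<le> unl g \<Longrightarrow> tot g \<le> tot g'"
proof -
  assume v: "valid g'" "unl g' \<le> unl g"
  then have "unl g' \<noteq> 0" using unlinkable by blast
  then obtain i where "i < m" "\<not> successively E (g' i)" unfolding unl_def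
    by (metis (mono_tags, lifting) card.empty empty_Collect_eq)
  then show ?thesis using opt[OF v(1)] v(2) by force
qed

text \<open>\<open>u\<close> and \<open>v\<close> are the ends of the unlinked pair in either order,
  so that every argument serves both ends; paths from \<open>u\<close> to \<open>v\<close> may have
  to be reversed to count as linking \<open>x i0\<close> and \<open>y i0\<close>.\<close>

definition orient :: "'a list \<Rightarrow> 'a list" where
  "orient w = (if u = x i0 then w else rev w)"

lemma ok_orient:
  assumes "w \<noteq> []" "distinct w" "set w \<subseteq> V" "hd w = u" "last w = v" "set w \<inter> X = {u, v}" "length w \<le> l + 2"
    "successively E w"
  shows "ok i0 (orient w)" "successively E (orient w)" "set (orient w) = set w" "length (orient w) = length w"
proof -
  show s: "successively E (orient w)" "set (orient w) = set w" "length (orient w) = length w"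
    using assms(8) successively_rev_sym[OF E] unfolding orient_def by auto
  show "ok i0 (orient w)"
    using assms s uv uv_facts(1) unfolding ok_def orient_def by (auto simp: hd_rev last_rev)
qed

text \<open>Such a path would link one more pair.\<close>

lemma no_link:
  assumes "w \<noteq> []" "distinct w" "hd w = u" "last w = v" "set w \<subseteq> insert u (insert v R)" "length w \<le> l + 2"
    "successively E w"
  shows False
proof -
  have mem: "u \<in> set w" "v \<in> set w" using assms by auto
  have "set w \<inter> X = {u, v}" using assms(5) mem R_facts uv_facts by auto
  moreover have "set w \<subseteq> V" using assms(5) R_facts uv_facts by auto
  ultimately have o: "ok i0 (orient w)" "successively E (orient w)" "set (orient w) = set w"
    using ok_orient[of w] assms by auto
  have "valid (g(i0 := orient w))"
    using valid_upd1[OF valid i0 o(1)] o(3) assms(5) uv_facts by auto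
  moreover have "unl (g(i0 := orient w)) < unl g"
    by (rule unl_less[where i = i0]) (use o i0 ni0 in auto)
  ultimately show False using unl_opt by force
qed

text \<open>A linked pair may hand over inner vertices to the link of \<open>u\<close> and
  \<open>v\<close> provided that it can be rerouted through free vertices; this again would link one
  more pair.\<close>

lemma no_link2:
  assumes i: "i < m" "i \<noteq> i0" and w': "ok i w'" "successively E w'" "set w' \<subseteq> set (g i) \<union> R"
    and w: "w \<noteq> []" "distinct w" "hd w = u" "last w = v" "set w \<subseteq> insert u (insert v R) \<union> (set (g i) - X)"
     "length w \<le> l + 2" "successively E w" "set w \<inter> set w' = {}"
  shows False
proof -
  have mem: "u \<in> set w" "v \<in> set w" using w by auto
  have "set w \<inter> X = {u, v}" using w(5) mem R_facts uv_facts by auto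
  moreover have "set w \<subseteq> V" using w(5) R_facts uv_facts g_basic(3)[OF i(1)] by auto
  ultimately have o: "ok i0 (orient w)" "successively E (orient w)" "set (orient w) = set w"
    using ok_orient[of w] w by auto
  have "valid (g(i0 := orient w, i := w'))"
    by (rule valid_upd2[OF valid i0 i(1) i(2)[symmetric] o(1) w'(1)]) (use o(3) w w' uv_facts in auto)
  moreover have "unl (g(i0 := orient w, i := w')) < unl g"
    by (rule unl_less[where i = i0]) (use o w' i i0 ni0 in auto)
  ultimately show False using unl_opt by force
qed

text \<open>Linking \<open>u\<close> and \<open>v\<close> at the expense of pair \<open>i\<close>
  keeps the number of unlinked pairs. As \<open>g i\<close> falls back to its two ends, the total
  number of vertices drops as soon as the new path is shorter than the old one.\<close>

lemma no_swap:
  assumes i: "i < m" "i \<noteq> i0"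
    and w: "w \<noteq> []" "distinct w" "hd w = u" "last w = v" "set w \<subseteq> insert u (insert v R) \<union> (set (g i) - X)"
     "successively E w" "length w < length (g i)"
  shows False
proof -
  have mem: "u \<in> set w" "v \<in> set w" using w by auto
  have "set w \<inter> X = {u, v}" using w(5) mem R_facts uv_facts by auto
  moreover have "set w \<subseteq> V" using w(5) R_facts uv_facts g_basic(3)[OF i(1)] by auto
  moreover have "length w \<le> l + 2" using w(7) g_basic(7)[OF i(1)] by simp
  ultimately have o: "ok i0 (orient w)" "successively E (orient w)" "set (orient w) = set w" "length (orient w) = length w"
    using ok_orient[of w] w by auto
  let ?h = "g(i0 := orient w, i := [x i, y i])"
  have xyi: "x i \<in> set (g i)" "y i \<in> set (g i)" using g_basic(6)[OF i(1)] by auto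
  have val: "valid ?h"
  proof (rule valid_upd2[OF valid i0 i(1) i(2)[symmetric] o(1) ok_two[OF i(1)]])
    have "x i \<in> X" "y i \<in> X" using i unfolding X_def by auto
    moreover have "x i \<notin> {u, v}" "y i \<notin> {u, v}"
      using uv xx[OF i(1) i0 i(2)] yy[OF i(1) i0 i(2)] xy[OF i(1) i0] xy[OF i0 i(1)] by auto
    ultimately show "set (orient w) \<inter> set [x i, y i] = {}" using o(3) w(5) R_facts(3) by auto
    show "set (orient w) \<subseteq> set (g i0) \<union> set (g i) \<union> R" using o(3) w(5) uv_facts by auto
    show "set [x i, y i] \<subseteq> set (g i0) \<union> set (g i) \<union> R" using xyi by auto
  qed
  have "unl ?h \<le> unl g"
  proof -
    have "{j. j < m \<and> \<not> successively E (?h j)} \<subseteq> insert i ({j. j < m \<and> \<not> successively E (g j)} - {i0})"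
      using o(2) i by auto
    then have "unl ?h \<le> card (insert i ({j. j < m \<and> \<not> successively E (g j)} - {i0}))"
      unfolding unl_def by (intro card_mono) auto
    also have "\<dots> \<le> Suc (card ({j. j < m \<and> \<not> successively E (g j)} - {i0}))"
      by (rule card_insert_le_m1) auto
    also have "\<dots> = unl g" unfolding unl_def
      by (subst card_Suc_Diff1) (use i0 ni0 in auto)
    finally show ?thesis .
  qed
  moreover have "tot ?h < tot g"
  proof -
    have 1: "tot (g(i0 := orient w)) + length (g i0) = tot g + length w" using tot_upd[OF i0] o(4) by metis
    have 2: "tot ?h + length ((g(i0 := orient w)) i) = tot (g(i0 := orient w)) + length [x i, y i]"
      using tot_upd[OF i(1)] by metis
    show ?thesis using 1 2 w(7) i(2) gi0 by simp
  qed
  ultimately show False using tot_opt[OF val] by simp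
qed

text \<open>The surgery behind all exchange arguments: the part of \<open>g i\<close> strictly
  between positions \<open>a\<close> and \<open>b\<close> gives way to free vertices
  \<open>ws\<close>, and \<open>a + length ws < b\<close> ensures that the path does not
  grow.\<close>

lemma ok_reroute:
  assumes i: "i < m" "successively E (g i)" and ab: "a < b" "b < length (g i)"
    and ws: "distinct ws" "set ws \<subseteq> R" "successively E ([g i ! a] @ ws @ [g i ! b])"
     "a + length ws < b"
  defines "w \<equiv> take (Suc a) (g i) @ ws @ drop b (g i)"
  shows "ok i w" "successively E w" "set w \<subseteq> set (g i) \<union> R" "length w = Suc a + length ws + (length (g i) - b)"
    "set w = set (take (Suc a) (g i)) \<union> set ws \<union> set (drop b (g i))"
proof -
  note gb = g_basic[OF i(1)]
  let ?A = "take (Suc a) (g i)" and ?B = "drop b (g i)"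
  have ne: "?A \<noteq> []" "?B \<noteq> []" using ab by auto
  have hA: "hd ?A = x i" using gb by (cases "g i") auto
  have lA: "last ?A = g i ! a" using ab by (simp add: take_Suc_conv_app_nth)
  have hB: "hd ?B = g i ! b" using ab by (simp add: hd_drop_conv_nth)
  have lB: "last ?B = y i" using ab gb by simp
  have sA: "successively E ?A" and sB: "successively E ?B"
    using i(2) by (metis append_take_drop_id successively_append_iff)+
  show setw: "set w = set ?A \<union> set ws \<union> set ?B" unfolding w_def by auto
  show sub: "set w \<subseteq> set (g i) \<union> R" unfolding setw using ws(2) set_take_subset set_drop_subset by fast
  show lw: "length w = Suc a + length ws + (length (g i) - b)" unfolding w_def using ab by auto
  show suc: "successively E w"
    using ws(3) sA sB lA hB ne unfolding w_def
    by (cases ws) (auto simp: successively_append_iff successively_Cons hd_append split: if_splits)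
  have dAB: "set ?A \<inter> set ?B = {}" using gb(2) ab by (simp add: set_take_disj_set_drop_if_distinct)
  have "set ws \<inter> set (g i) = {}" using ws(2) R_facts(6)[OF i(1)] by auto
  then have dist: "distinct w" unfolding w_def using gb(2) ws(1) dAB
    by (auto dest: in_set_takeD in_set_dropD)
  have mem: "x i \<in> set w" "y i \<in> set w" unfolding setw using hA lB ne hd_in_set last_in_set by (metis UnI1, metis UnI2)
  have "x i \<in> X" "y i \<in> X" using i unfolding X_def by auto
  then have "set w \<inter> X = {x i, y i}" using sub mem gb(6) R_facts(3) by blast
  moreover have "hd w = x i" "last w = y i" unfolding w_def using ne hA lB by auto
  moreover have "length w \<le> l + 2" using lw gb(7) ws(4) ab by simp
  moreover have "set w \<subseteq> V" using sub gb(3) R_facts(1) by auto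
  ultimately show "ok i w" unfolding ok_def using suc dist ne unfolding w_def by auto
qed

text \<open>Neighbours further apart would give a shortcut through \<open>r\<close>, which saves
  vertices.\<close>

lemma window:
  assumes i: "i < m" "successively E (g i)" and r: "r \<in> R" and ab: "a < b" "b < length (g i)"
    and e: "E r (g i ! a)" "E r (g i ! b)"
  shows "b \<le> a + 2"
proof (rule ccontr)
  assume n: "\<not> ?thesis"
  define w where "w = take (Suc a) (g i) @ [r] @ drop b (g i)"
  have w: "ok i w" "successively E w" "set w \<subseteq> set (g i) \<union> R" "length w = Suc a + 1 + (length (g i) - b)"
    using ok_reroute[OF i ab, of "[r]"] r e(2) Esym[OF e(1)] n unfolding w_def by simp_all
  have "valid (g(i := w))" by (rule valid_upd1[OF valid i(1) w(1,3)])
  moreover have "unl (g(i := w)) \<le> unl g" by (rule unl_mono) (use w in auto)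
  moreover have "tot (g(i := w)) + length (g i) = tot g + length w" by (rule tot_upd[OF i(1)])
  ultimately show False using tot_opt[of "g(i := w)"] w(4) n ab by simp
qed

text \<open>Exchanging \<open>r\<close> for the vertex between its two neighbours keeps all lengths
  and makes that vertex free. If \<open>u\<close> saw it, then \<open>u\<close> would gain a free
  neighbour while \<open>v\<close>, by \<open>op\<close>, does not lose its last one, so the third
  criterion would improve.\<close>

lemma middle_missed:
  assumes i: "i < m" "successively E (g i)" and r: "r \<in> R" and j: "j + 2 < length (g i)"
    and e: "E r (g i ! j)" "E r (g i ! (j + 2))"
    and cl: "\<forall>a\<in>R. \<not> E u a" and op: "(\<exists>b\<in>R. b \<noteq> r \<and> E v b) \<or> (\<forall>b\<in>R. \<not> E v b)"
  shows "\<not> E u (g i ! (j + 1))"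
proof
  assume z: "E u (g i ! (j + 1))"
  let ?z = "g i ! (j + 1)"
  define w where "w = take (Suc j) (g i) @ [r] @ drop (j + 2) (g i)"
  have w: "ok i w" "successively E w" "set w \<subseteq> set (g i) \<union> R" "length w = length (g i)"
     "set w = set (take (Suc j) (g i)) \<union> {r} \<union> set (drop (j + 2) (g i))"
    using ok_reroute[OF i _ j, of j "[r]"] r e(2) Esym[OF e(1)] j unfolding w_def by simp_all
  let ?h = "g(i := w)"
  have ii0: "i \<noteq> i0" using i ni0 by blast
  have val: "valid ?h" by (rule valid_upd1[OF valid i(1) w(1,3)])
  have un: "unl ?h \<le> unl g" by (rule unl_mono) (use w in auto)
  have tt: "tot ?h = tot g" using tot_upd[OF i(1), of g w] w(4) by simp
  have d: "distinct (g i)" using g_basic i by blast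
  have "?z \<notin> set w"
  proof -
    have "?z \<notin> set (take (Suc j) (g i))"
    proof
      assume "?z \<in> set (take (Suc j) (g i))"
      then obtain h where "h < Suc j" "g i ! h = ?z" using j by (auto simp: in_set_conv_nth)
      then show False using d j by (simp add: nth_eq_iff_index_eq)
    qed
    moreover have "?z \<notin> set (drop (j + 2) (g i))"
    proof
      assume "?z \<in> set (drop (j + 2) (g i))"
      then obtain h where "h < length (g i) - (j + 2)" "g i ! (j + 2 + h) = ?z" using j by (auto simp: in_set_conv_nth)
      then show False using d j by (simp add: nth_eq_iff_index_eq)
    qed
    moreover have "?z \<noteq> r" using r R_facts(6)[OF i(1)] j by (metis Int_iff Suc_eq_plus1 add_2_eq_Suc' empty_iff nth_mem less_SucI Suc_lessD)
    ultimately show ?thesis unfolding w(5) by blast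
  qed
  moreover have "?z \<in> set (g i)" using j by simp
  ultimately have zf: "?z \<in> free ?h" using g_disj i(1) g_basic(3)[OF i(1)] unfolding free_def
    by (auto split: if_splits)
  have "set w \<subseteq> insert r (set (g i))" unfolding w(5) by (auto dest: in_set_takeD in_set_dropD)
  then have "(R - {r}) \<inter> set w = {}" using R_facts(6)[OF i(1)] by auto
  then have Rf: "R - {r} \<subseteq> free ?h" unfolding free_def by (auto split: if_splits)
  have cu: "closed_end ?h u = 0" "closed_end g u = 1" using z zf cl unfolding closed_end_def by auto
  have cv: "closed_end ?h v \<le> closed_end g v" using op Rf unfolding closed_end_def by (auto split: if_splits)
  have "closed ?h i0 < closed g i0" using uv cu cv unfolding closed_def by auto
  moreover have "\<not> successively E (?h i0)" using ii0 ni0 by auto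
  ultimately show False using opt[OF val i0, of] un tt by auto
qed

end

definition mlinked :: "nat \<Rightarrow> 'a set \<Rightarrow> ('a \<Rightarrow> 'a \<Rightarrow> bool) \<Rightarrow> bool" where
  "mlinked m L E \<longleftrightarrow>
     (\<forall>x y :: nat \<Rightarrow> 'a. (\<forall>i<m. x i \<in> L \<and> y i \<in> L) \<and> (\<forall>i<m. \<forall>j<m. x i \<noteq> y j)
        \<and> (\<forall>i<m. \<forall>j<m. i \<noteq> j \<longrightarrow> x i \<noteq> x j \<and> y i \<noteq> y j) \<longrightarrow>
      (\<exists>P :: nat \<Rightarrow> 'a list. (\<forall>i<m. is_path L E (P i) \<and> hd (P i) = x i \<and> last (P i) = y i)
         \<and> (\<forall>i<m. \<forall>j<m. i \<noteq> j \<longrightarrow> set (P i) \<inter> set (P j) = {})))"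

abbreviation nb :: "('a \<Rightarrow> 'a \<Rightarrow> bool) \<Rightarrow> 'a set \<Rightarrow> 'a \<Rightarrow> 'a set" where
  "nb E A r \<equiv> {z \<in> A. E r z}"

lemma (in linkage_problem) unl0_paths:
  assumes "valid g" "unl g = 0"
  shows "\<exists>P :: nat \<Rightarrow> 'a list. (\<forall>i<m. is_path V E (P i) \<and> hd (P i) = x i \<and> last (P i) = y i)
         \<and> (\<forall>i<m. \<forall>j<m. i \<noteq> j \<longrightarrow> set (P i) \<inter> set (P j) = {})"
proof (rule exI[of _ g])
  have "\<forall>i<m. successively E (g i)" using assms(2) unfolding unl_def by auto
  then show "(\<forall>i<m. is_path V E (g i) \<and> hd (g i) = x i \<and> last (g i) = y i)
         \<and> (\<forall>i<m. \<forall>j<m. i \<noteq> j \<longrightarrow> set (g i) \<inter> set (g j) = {})"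
    using assms(1) unfolding valid_def ok_def is_path_iff by auto
qed

lemma card_positions:
  assumes "distinct w"
  shows "card {z \<in> set w. P z} = card {j. j < length w \<and> P (w ! j)}"
proof -
  have "{z \<in> set w. P z} = (!) w ` {j. j < length w \<and> P (w ! j)}"
    by (auto simp: in_set_conv_nth)
  moreover have "inj_on ((!) w) {j. j < length w \<and> P (w ! j)}"
    using assms by (auto simp: inj_on_def nth_eq_iff_index_eq)
  ultimately show ?thesis by (simp add: card_image)
qed

lemma window_card:
  assumes "finite (J :: nat set)" "\<And>a b. a \<in> J \<Longrightarrow> b \<in> J \<Longrightarrow> a < b \<Longrightarrow> b \<le> a + 2"
  shows "card J \<le> 3" "card J = 3 \<Longrightarrow> \<exists>a. J = {a, a + 1, a + 2}"
proof -
  have *: "J \<noteq> {} \<Longrightarrow> J \<subseteq> {Min J, Min J + 1, Min J + 2}"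
  proof
    fix b assume b: "J \<noteq> {}" "b \<in> J"
    then have "Min J \<in> J" "Min J \<le> b" using assms(1) by auto
    then have "b \<le> Min J + 2" using assms(2)[of "Min J" b] b by (cases "Min J = b") auto
    then show "b \<in> {Min J, Min J + 1, Min J + 2}" using \<open>Min J \<le> b\<close> by auto
  qed
  have c: "card {a, a + 1, a + 2 :: nat} = 3" for a by auto
  show "card J \<le> 3"
  proof (cases "J = {}")
    case False
    then show ?thesis using card_mono[OF _ *[OF False]] c by (metis finite.emptyI finite_insert)
  qed simp
  assume 3: "card J = 3"
  then have ne: "J \<noteq> {}" by auto
  have "J = {Min J, Min J + 1, Min J + 2}"
    by (rule card_subset_eq[OF _ *[OF ne]]) (use 3 c in auto)
  then show "\<exists>a. J = {a, a + 1, a + 2}" by blast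
qed

section \<open>Counting neighbours on the paths of an optimal family\<close>

context optimal_linkage
begin

lemma split_card:
  "card {z \<in> V. P z} = (\<Sum>i<m. card {z \<in> set (g i). P z}) + card {z \<in> R. P z}"
proof -
  have "{z \<in> V. P z} = (\<Union>i<m. {z \<in> set (g i). P z}) \<union> {z \<in> R. P z}"
    using g_basic(3) unfolding free_def by auto
  moreover have "(\<Union>i<m. {z \<in> set (g i). P z}) \<inter> {z \<in> R. P z} = {}" unfolding free_def by auto
  moreover have "card (\<Union>i<m. {z \<in> set (g i). P z}) = (\<Sum>i<m. card {z \<in> set (g i). P z})"
    using g_disj by (intro card_UN_disjoint) (auto simp: disjoint_iff)
  ultimately show ?thesis using R_facts(2) by (simp add: card_Un_disjoint)
qed

lemma card_V: "card V = tot g + card R"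
proof -
  have "length (g i) = card (set (g i))" if "i < m" for i
    using g_basic(2)[OF that] by (simp add: distinct_card)
  then show ?thesis using split_card[of "\<lambda>_. True"] unfolding tot_def by simp
qed

text \<open>The bounds add up to \<open>tot g + K * m\<close>, except that the unlinked pair
  \<open>i0\<close>, a list of length \<open>2\<close>, has its own bound \<open>k0\<close>; this is
  the \<open>2 + K\<close> on the left.\<close>

lemma path_bound_sum:
  assumes "\<And>i. i < m \<Longrightarrow> i \<noteq> i0 \<Longrightarrow> f i \<le> length (g i) + K" "f i0 \<le> k0"
  shows "(\<Sum>i<m. f i) + 2 + K \<le> k0 + tot g + K * m"
proof -
  have "(\<Sum>i<m. f i) = f i0 + (\<Sum>i\<in>{..<m} - {i0}. f i)" by (rule sum.remove) (use i0 in auto)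
  also have "(\<Sum>i\<in>{..<m} - {i0}. f i) \<le> (\<Sum>i\<in>{..<m} - {i0}. length (g i) + K)"
    by (rule sum_mono) (use assms in auto)
  also have "\<dots> = (\<Sum>i\<in>{..<m} - {i0}. length (g i)) + K * (m - 1)"
    using i0 by (simp add: sum.distrib mult.commute)
  finally have 1: "(\<Sum>i<m. f i) \<le> f i0 + ((\<Sum>i\<in>{..<m} - {i0}. length (g i)) + K * (m - 1))" by simp
  have 2: "tot g = length (g i0) + (\<Sum>i\<in>{..<m} - {i0}. length (g i))" unfolding tot_def
    by (rule sum.remove) (use i0 in auto)
  have "K * (m - 1) + K = K * m" using i0 by (cases m) auto
  then show ?thesis using 1 2 gi0 assms(2) by simp
qed

lemma card_le_length: "i < m \<Longrightarrow> card {z \<in> set (g i). P z} \<le> length (g i)"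
  using card_mono[of "set (g i)" "{z \<in> set (g i). P z}"] card_length[of "g i"] by auto

lemma linked_if_long: "i < m \<Longrightarrow> length (g i) \<noteq> 2 \<Longrightarrow> successively E (g i)"
  using g_unlinked by force

lemma seen_le3:
  assumes "r \<in> R" "i < m"
  shows "card (nb E (set (g i)) r) \<le> 3"
proof (cases "length (g i) = 2")
  case True
  then show ?thesis using card_le_length[OF assms(2), of "E r"] by simp
next
  case False
  have "card {j. j < length (g i) \<and> E r (g i ! j)} \<le> 3"
    by (rule window_card(1)) (use window[OF assms(2) linked_if_long[OF assms(2) False] assms(1)] in auto)
  then show ?thesis using card_positions[of "g i" "E r"] g_basic(2)[OF assms(2)] by simp
qed

lemma seen_eq3:
  assumes "r \<in> R" "i < m" "card (nb E (set (g i)) r) = 3"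
  shows "successively E (g i) \<and> (\<exists>a. {j. j < length (g i) \<and> E r (g i ! j)} = {a, a + 1, a + 2})"
proof -
  have l: "length (g i) \<noteq> 2" using card_le_length[OF assms(2), of "E r"] assms(3) by auto
  have "\<exists>a. {j. j < length (g i) \<and> E r (g i ! j)} = {a, a + 1, a + 2}"
    by (rule window_card(2))
      (use window[OF assms(2) linked_if_long[OF assms(2) l] assms(1)] card_positions[of "g i" "E r"] g_basic(2)[OF assms(2)] assms(3) in auto)
  then show ?thesis using linked_if_long[OF assms(2) l] by blast
qed

lemma seen_eq3_middle:
  assumes "r \<in> R" "i < m" "card (nb E (set (g i)) r) = 3"
    and cl: "\<forall>a\<in>R. \<not> E u a" and op: "(\<exists>b\<in>R. b \<noteq> r \<and> E v b) \<or> (\<forall>b\<in>R. \<not> E v b)"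
  shows "\<exists>a. a + 2 < length (g i) \<and> {j. j < length (g i) \<and> E r (g i ! j)} = {a, a + 1, a + 2} \<and> \<not> E u (g i ! (a + 1))"
proof -
  obtain a where a: "{j. j < length (g i) \<and> E r (g i ! j)} = {a, a + 1, a + 2}" and l: "successively E (g i)"
    using seen_eq3[OF assms(1-3)] by blast
  then have "a + 2 < length (g i)" "E r (g i ! a)" "E r (g i ! (a + 2))" by auto
  then show ?thesis using a middle_missed[OF assms(2) l assms(1) _ _ _ cl op] by blast
qed

lemma seen_eq3_u:
  assumes "r \<in> R" "i < m" "card (nb E (set (g i)) r) = 3"
    and cl: "\<forall>a\<in>R. \<not> E u a" and op: "(\<exists>b\<in>R. b \<noteq> r \<and> E v b) \<or> (\<forall>b\<in>R. \<not> E v b)"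
  shows "card (nb E (set (g i)) u) < length (g i)"
proof -
  obtain a where a: "a + 2 < length (g i)" "\<not> E u (g i ! (a + 1))"
    using seen_eq3_middle[OF assms] by blast
  have "nb E (set (g i)) u \<subset> set (g i)" using a by fastforce
  then have "card (nb E (set (g i)) u) < card (set (g i))" by (intro psubset_card_mono) auto
  then show ?thesis using card_length[of "g i"] by linarith
qed

lemma interior: "i < m \<Longrightarrow> set (g i) - X = set (g i) - {x i, y i}"
  using g_basic(6) by blast

text \<open>The path through \<open>z\<close> has three vertices, so on a path of at least four it
  would be a profitable swap.\<close>

lemma no_common:
  assumes i: "i < m" "i \<noteq> i0" and l: "length (g i) \<ge> 4" and z: "z \<in> set (g i) - X"
  shows "\<not> (E u z \<and> E v z)"
proof
  assume e: "E u z \<and> E v z"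
  then have "successively E [u, z, v]" using Esym by auto
  moreover have "distinct [u, z, v]" using z uv_facts by auto
  ultimately show False using no_swap[OF i, of "[u, z, v]"] z l by auto
qed

text \<open>By \<open>no_common\<close>, only the two ends of the path can be neighbours of both
  \<open>u\<close> and \<open>v\<close>.\<close>

lemma ends_bound:
  assumes i: "i < m" "i \<noteq> i0" and l: "length (g i) \<ge> 4"
  shows "card (nb E (set (g i)) u) + card (nb E (set (g i)) v) \<le> length (g i) + 2"
proof -
  let ?U = "nb E (set (g i)) u" and ?W = "nb E (set (g i)) v"
  have "?U \<inter> ?W \<subseteq> {x i, y i}" using no_common[OF i l] interior[OF i(1)] by blast
  then have "card (?U \<inter> ?W) \<le> card {x i, y i}" by (intro card_mono) auto
  also have "\<dots> \<le> 2" by (simp add: card_insert_if)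
  finally have 1: "card (?U \<inter> ?W) \<le> 2" .
  have "card (?U \<union> ?W) \<le> card (set (g i))" by (intro card_mono) auto
  then have 2: "card (?U \<union> ?W) \<le> length (g i)" using card_length[of "g i"] by linarith
  have "card ?U + card ?W = card (?U \<union> ?W) + card (?U \<inter> ?W)" by (rule card_Un_Int) auto
  then show ?thesis using 1 2 by linarith
qed

lemma i0_ends: "card (nb E (set (g i0)) u) = 0" "card (nb E (set (g i0)) v) = 0"
proof -
  have "nb E (set (g i0)) u = {}" "nb E (set (g i0)) v = {}" using uv_facts Eirr by auto
  then show "card (nb E (set (g i0)) u) = 0" "card (nb E (set (g i0)) v) = 0" by (metis card.empty)+
qed

lemma not_both:
  assumes "l \<ge> 1" "r \<in> R"
  shows "\<not> (E u r \<and> E v r)"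
proof
  assume "E u r \<and> E v r"
  then show False using no_link[of "[u, r, v]"] assms R_facts uv_facts Esym by auto
qed

lemma i0_free:
  assumes "l \<ge> 1" "r \<in> R"
  shows "card (nb E (set (g i0)) r) \<le> 1"
proof -
  have "nb E (set (g i0)) r \<subseteq> {u} \<or> nb E (set (g i0)) r \<subseteq> {v}"
    using not_both[OF assms] uv_facts Esym by auto
  then show ?thesis by (metis card_mono card.empty card_insert_disjoint empty_iff finite.emptyI finite_insert One_nat_def)
qed

text \<open>Count the neighbours of \<open>u\<close>, those of \<open>v\<close>, and the common
  neighbours of \<open>a\<close> and \<open>b\<close>. In the free part the three sets are disjoint,
  and on each path they total at most its length plus \<open>5\<close>, which gives at most
  \<open>card V + 5 * m - 7\<close> altogether. The degree condition, applied to \<open>u, v\<close>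
  and to \<open>a, b\<close>, gives at least \<open>card V + 5 * m - 4\<close>.\<close>

lemma dense_both_open:
  assumes l: "l = 2" and a: "a \<in> R" "E u a" and b: "b \<in> R" "E v b"
    and deg: "\<And>p q. p \<in> V \<Longrightarrow> q \<in> V \<Longrightarrow> p \<noteq> q \<Longrightarrow> \<not> E p q \<Longrightarrow>
       2 * card V + 5 * m \<le> 2 * (card (nb E V p) + card (nb E V q)) + 6"
  shows False
proof -
  have arith: "ab \<le> r \<Longrightarrow> s' + 2 + 5 \<le> 0 + t + 5 * m' \<Longrightarrow> d1 + d2 + c = s' + ab
      \<Longrightarrow> 2 * n + 5 * m' \<le> 2 * (d1 + d2) + 6 \<Longrightarrow> 5 * m' \<le> 2 * c + 2 \<Longrightarrow> n = t + r \<Longrightarrow> False"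
    for ab r s' t m' d1 d2 c n :: nat unfolding distrib_left by linarith
  \<comment> \<open>The path \<open>u, p, q, v\<close> has exactly \<open>l + 2 = 4\<close>
    vertices.\<close>
  have nAB: "\<not> E p q" if "p \<in> R" "E u p" "q \<in> R" "E v q" for p q
  proof
    assume "E p q"
    then have "successively E [u, p, q, v]" "distinct [u, p, q, v]"
      using that Esym[OF that(4)] uv_facts R_facts(4,5) not_both[of p] l Eirr by auto
    then show False using no_link[of "[u, p, q, v]"] that l by auto
  qed
  have ab: "a \<noteq> b" "\<not> E a b" using nAB[OF a b] not_both[of a] a b l by auto
  have nab: "\<not> E a v" "\<not> E b u" using not_both[of a] not_both[of b] a b l Esym[of a v] Esym[of b u] by auto
  let ?A = "nb E R u" and ?B = "nb E R v" and ?C = "{z \<in> R. E a z \<and> E b z}"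
  let ?f = "\<lambda>i. card (nb E (set (g i)) u) + card (nb E (set (g i)) v) + card {z \<in> set (g i). E a z \<and> E b z}"
  have "card ?A + card ?B + card ?C \<le> card R"
  proof -
    have 1: "?A \<inter> ?B = {}" using not_both l by auto
    have "z \<notin> ?C" if "z \<in> ?A" for z using nAB[of z b] Esym[of b z] that b by auto
    moreover have "z \<notin> ?C" if "z \<in> ?B" for z using nAB[of a z] that a by auto
    ultimately have 2: "(?A \<union> ?B) \<inter> ?C = {}" by blast
    have "card ((?A \<union> ?B) \<union> ?C) \<le> card R" using R_facts(2) by (intro card_mono) auto
    then show ?thesis using 1 2 R_facts(2) by (simp add: card_Un_disjoint)
  qed
  moreover have "(\<Sum>i<m. ?f i) + 2 + 5 \<le> 0 + tot g + 5 * m"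
  proof (rule path_bound_sum)
    have "{z \<in> set (g i0). E a z \<and> E b z} = {}" using uv_facts(4) nab by auto
    then have "card {z \<in> set (g i0). E a z \<and> E b z} = 0" by (metis card.empty)
    then show "?f i0 \<le> 0" using i0_ends by linarith
    fix i assume i: "i < m" "i \<noteq> i0"
    have cm: "card {z \<in> set (g i). E a z \<and> E b z} \<le> card (nb E (set (g i)) a)"
      by (intro card_mono) auto
    have len: "length (g i) \<le> 4" "2 \<le> length (g i)" using g_basic[OF i(1)] l by auto
    consider "length (g i) = 2" | "length (g i) = 3" | "length (g i) = 4" using len by linarith
    then show "?f i \<le> length (g i) + 5"
    proof cases
      case 1
      then show ?thesis using card_le_length[OF i(1), of "E u"] card_le_length[OF i(1), of "E v"]
          card_le_length[OF i(1), of "\<lambda>z. E a z \<and> E b z"] by linarith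
    next
      case 3
      then show ?thesis using ends_bound[OF i] seen_le3[OF a(1) i(1)] cm by linarith
    next
      case 2
      obtain p where p: "g i = [x i, p, y i]"
        using 2 g_basic(4,5)[OF i(1)] by (auto simp: length_Suc_conv numeral_3_eq_3)
      \<comment> \<open>On a path of three vertices only \<open>3 + 3 + 3\<close> exceeds the bound.
        In that case \<open>a\<close> can replace the middle vertex \<open>p\<close>, and
        \<open>u, p, b, v\<close> links the unlinked pair.\<close>
      show ?thesis
      proof (cases "card {z \<in> set (g i). E a z \<and> E b z} = 3")
        case True
        have "{z \<in> set (g i). E a z \<and> E b z} = set (g i)"
          using True 2 g_basic(2)[OF i(1)] by (intro card_subset_eq) (auto simp: distinct_card)
        then have see: "E a (x i)" "E a p" "E a (y i)" "E b (x i)" "E b p" "E b (y i)" unfolding p by auto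
        have "\<not> E u p"
        proof
          assume up: "E u p"
          have w: "take (Suc 0) (g i) @ [a] @ drop 2 (g i) = [x i, a, y i]" using p by simp
          have lk: "successively E (g i)" using linked_if_long[OF i(1)] 2 by simp
          have o: "ok i [x i, a, y i]" "successively E [x i, a, y i]" "set [x i, a, y i] \<subseteq> set (g i) \<union> R"
            using ok_reroute[OF i(1) lk, of 0 2 "[a]"] w a(1) see Esym p by auto
          have pX: "p \<in> set (g i) - X" using interior[OF i(1)] g_basic(2)[OF i(1)] unfolding p by auto
          have pR: "p \<noteq> b" "p \<noteq> a" using R_facts(6)[OF i(1)] a b p by auto
          have ends: "u \<notin> set (g i)" "v \<notin> set (g i)" using g_disj[OF i(1) i0 i(2)] uv_facts(4) by auto
          have "distinct [u, p, b, v]" using pX pR uv_facts R_facts b by auto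
          moreover have "successively E [u, p, b, v]" using up see b Esym by auto
          moreover have "set [u, p, b, v] \<inter> set [x i, a, y i] = {}"
            using pX ab pR ends R_facts b a interior[OF i(1)] R_facts(6)[OF i(1)] unfolding p by auto
          ultimately show False using no_link2[OF i o, of "[u, p, b, v]"] pX b l by auto
        qed
        then have "nb E (set (g i)) u \<subseteq> {x i, y i}" unfolding p by auto
        then have "card (nb E (set (g i)) u) \<le> card {x i, y i}" by (intro card_mono) auto
        then have "card (nb E (set (g i)) u) \<le> 2" by (simp add: card_insert_if split: if_splits)
        then show ?thesis using True 2 card_le_length[OF i(1), of "E v"] by linarith
      next
        case False
        then show ?thesis using 2 card_le_length[OF i(1), of "E u"] card_le_length[OF i(1), of "E v"]
            card_le_length[OF i(1), of "\<lambda>z. E a z \<and> E b z"] by linarith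
      qed
    qed
  qed
  moreover have "card (nb E V u) + card (nb E V v) + card {z \<in> V. E a z \<and> E b z}
      = (\<Sum>i<m. ?f i) + (card ?A + card ?B + card ?C)"
    unfolding split_card[of "E u"] split_card[of "E v"] split_card[of "\<lambda>z. E a z \<and> E b z"]
    by (simp add: sum.distrib)
  moreover have "2 * card V + 5 * m \<le> 2 * (card (nb E V u) + card (nb E V v)) + 6"
    using deg[of u v] uv_facts by blast
  moreover have "5 * m \<le> 2 * card {z \<in> V. E a z \<and> E b z} + 2"
  proof -
    have aV: "a \<in> V" "b \<in> V" using a b R_facts by auto
    have "nb E V a \<union> nb E V b \<subseteq> V - {a, b}" using ab Eirr Esym[of b a] by auto
    then have "card (nb E V a \<union> nb E V b) \<le> card (V - {a, b})" using finV by (intro card_mono) auto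
    moreover have "card (V - {a, b}) = card V - 2" using aV ab finV by (simp add: card_Diff_subset)
    moreover have "2 \<le> card V" using card_mono[OF finV, of "{a, b}"] aV ab by simp
    ultimately have 1: "card (nb E V a \<union> nb E V b) + 2 \<le> card V" by linarith
    have eq: "nb E V a \<inter> nb E V b = {z \<in> V. E a z \<and> E b z}" by blast
    have 2: "card (nb E V a) + card (nb E V b) = card (nb E V a \<union> nb E V b) + card {z \<in> V. E a z \<and> E b z}"
      unfolding eq[symmetric] by (rule card_Un_Int) (use finV in auto)
    have 3: "2 * card V + 5 * m \<le> 2 * (card (nb E V a) + card (nb E V b)) + 6"
      using deg[OF aV ab] by blast
    have arith: "u' + 2 \<le> v' \<Longrightarrow> a' + b' = u' + c' \<Longrightarrow> 2 * v' + 5 * m' \<le> 2 * (a' + b') + 6 \<Longrightarrow> 5 * m' \<le> 2 * c' + 2"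
      for u' v' a' b' c' m' :: nat unfolding distrib_left by linarith
    show ?thesis by (rule arith[OF 1 2 3])
  qed
  ultimately show False using card_V by (rule arith)
qed

text \<open>All neighbours of \<open>u\<close> lie on the paths. This forces \<open>v\<close> to
  have two free neighbours \<open>r\<close> and \<open>b\<close>, so the exchange argument applies
  to \<open>r\<close>: together \<open>u\<close> and \<open>r\<close> see at most the length plus
  \<open>2\<close> on each path, too few for the degree sum of the non-adjacent vertices
  \<open>u\<close> and \<open>r\<close>.\<close>

lemma dense_closed:
  assumes l: "l = 2" and cl: "\<forall>a\<in>R. \<not> E u a" and m: "m \<ge> 1"
    and min: "\<And>p. p \<in> V \<Longrightarrow> 3 * m \<le> card (nb E V p) + 2"
    and deg: "\<And>p q. p \<in> V \<Longrightarrow> q \<in> V \<Longrightarrow> p \<noteq> q \<Longrightarrow> \<not> E p q \<Longrightarrow>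
       2 * card V + 5 * m \<le> 2 * (card (nb E V p) + card (nb E V q)) + 6"
  shows False
proof -
  have arith: "sf + sc + 2 + 2 \<le> 1 + t + 2 * m \<Longrightarrow> du = sf \<Longrightarrow> dr = sc + nr
      \<Longrightarrow> nr + 1 \<le> r \<Longrightarrow> 2 * n + 5 * m \<le> 2 * (du + dr) + 6 \<Longrightarrow> n = t + r \<Longrightarrow> False"
    for sf sc t du dr nr r n :: nat unfolding distrib_left by linarith
  let ?e = "\<lambda>i. card (nb E (set (g i)) u)" and ?e' = "\<lambda>i. card (nb E (set (g i)) v)"
  have "nb E R u = {}" using cl by blast
  then have A0: "card (nb E R u) = 0" by (rule subst[where s = "{}", OF sym]) simp
  have len: "length (g i) = 2 \<or> length (g i) = 3 \<or> length (g i) = 4" if "i < m" for i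
    using g_basic(7,8)[OF that] l by auto
  \<comment> \<open>On a path of at most four vertices the two ends see at most \<open>6\<close>
    altogether, \<open>6 * m - 6\<close> in total, while their degrees add up to at least
    \<open>6 * m - 4\<close>.\<close>
  have "(\<Sum>i<m. ?e i + ?e' i) \<le> 6 * (m - 1)"
  proof -
    have "(\<Sum>i<m. ?e i + ?e' i) = ?e i0 + ?e' i0 + (\<Sum>i\<in>{..<m} - {i0}. ?e i + ?e' i)"
      by (rule sum.remove) (use i0 in auto)
    also have "(\<Sum>i\<in>{..<m} - {i0}. ?e i + ?e' i) \<le> (\<Sum>i\<in>{..<m} - {i0}. 6)"
    proof (rule sum_mono)
      fix i assume "i \<in> {..<m} - {i0}"
      then have i: "i < m" "i \<noteq> i0" by auto
      show "?e i + ?e' i \<le> 6"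
        using len[OF i(1)] ends_bound[OF i] card_le_length[OF i(1), of "E u"] card_le_length[OF i(1), of "E v"] by auto
    qed
    also have "\<dots> = 6 * (m - 1)" using i0 by simp
    finally show ?thesis using i0_ends by simp
  qed
  moreover have "card (nb E V u) + card (nb E V v) = (\<Sum>i<m. ?e i + ?e' i) + card (nb E R v)"
    unfolding split_card[of "E u"] split_card[of "E v"] using A0 by (simp add: sum.distrib)
  ultimately have "2 \<le> card (nb E R v)" using min[of u] min[of v] uv_facts m by linarith
  then have "\<not> card (nb E R v) \<le> Suc 0" by simp
  moreover have "finite (nb E R v)" using R_facts(2) by simp
  ultimately obtain r b where rb: "r \<in> R" "E v r" "b \<in> R" "E v b" "b \<noteq> r"
    using card_le_Suc0_iff_eq[of "nb E R v"] by auto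
  have op: "(\<exists>b\<in>R. b \<noteq> r \<and> E v b) \<or> (\<forall>b\<in>R. \<not> E v b)" using rb by blast
  let ?c = "\<lambda>i. card (nb E (set (g i)) r)"
  have "(\<Sum>i<m. ?e i) + (\<Sum>i<m. ?c i) + 2 + 2 \<le> 1 + tot g + 2 * m"
    unfolding sum.distrib[symmetric]
  proof (rule path_bound_sum)
    show "?e i0 + ?c i0 \<le> 1" using i0_ends i0_free[OF _ rb(1)] l by linarith
    fix i assume i: "i < m" "i \<noteq> i0"
    show "?e i + ?c i \<le> length (g i) + 2"
    proof (cases "?c i = 3")
      case True
      then show ?thesis using seen_eq3_u[OF rb(1) i(1) True cl op] by linarith
    next
      case False
      then have "?c i \<le> 2" using seen_le3[OF rb(1) i(1)] by linarith
      then show ?thesis using card_le_length[OF i(1), of "E u"] by linarith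
    qed
  qed
  moreover have "card (nb E V u) = (\<Sum>i<m. ?e i)" unfolding split_card[of "E u"] using A0 by simp
  moreover have "card (nb E V r) = (\<Sum>i<m. ?c i) + card (nb E R r)" unfolding split_card[of "E r"] ..
  moreover have "card (nb E R r) + 1 \<le> card R"
  proof -
    have "nb E R r \<subset> R" using rb(1) Eirr by auto
    from psubset_card_mono[OF R_facts(2) this] show ?thesis by linarith
  qed
  moreover have "2 * card V + 5 * m \<le> 2 * (card (nb E V u) + card (nb E V r)) + 6"
  proof (rule deg)
    show "u \<in> V" "r \<in> V" "u \<noteq> r" "\<not> E u r" using uv_facts rb R_facts cl by auto
  qed
  ultimately show False using card_V by (rule arith)
qed

end

text \<open>An Ore-type condition. In an optimal family with \<open>l = 2\<close>, an end of the
  unlinked pair without a free neighbour takes the role of \<open>u\<close> in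
  \<open>dense_closed\<close>; if there is none, \<open>dense_both_open\<close> applies.\<close>

theorem dense_mlinked:
  assumes "finite L" "sym_irrefl E"
    and min: "\<And>p. p \<in> L \<Longrightarrow> 3 * m \<le> card (nb E L p) + 2"
    and deg: "\<And>p q. p \<in> L \<Longrightarrow> q \<in> L \<Longrightarrow> p \<noteq> q \<Longrightarrow> \<not> E p q \<Longrightarrow>
       2 * card L + 5 * m \<le> 2 * (card (nb E L p) + card (nb E L q)) + 6"
  shows "mlinked m L E"
  unfolding mlinked_def
proof (intro allI impI)
  fix x y :: "nat \<Rightarrow> 'a"
  assume xy: "(\<forall>i<m. x i \<in> L \<and> y i \<in> L) \<and> (\<forall>i<m. \<forall>j<m. x i \<noteq> y j)
        \<and> (\<forall>i<m. \<forall>j<m. i \<noteq> j \<longrightarrow> x i \<noteq> x j \<and> y i \<noteq> y j)"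
  interpret linkage_problem L E m x y 2 by unfold_locales (use assms xy in auto)
  show "\<exists>P :: nat \<Rightarrow> 'a list. (\<forall>i<m. is_path L E (P i) \<and> hd (P i) = x i \<and> last (P i) = y i)
         \<and> (\<forall>i<m. \<forall>j<m. i \<noteq> j \<longrightarrow> set (P i) \<inter> set (P j) = {})"
  proof (rule ccontr)
    assume "\<not> ?thesis"
    then have nl: "\<And>g. valid g \<Longrightarrow> unl g \<noteq> 0" using unl0_paths by blast
    obtain g i0 where g: "valid g" "i0 < m" "\<not> successively E (g i0)"
      "\<And>g' i'. valid g' \<Longrightarrow> i' < m \<Longrightarrow> \<not> successively E (g' i') \<Longrightarrow>
        unl g < unl g' \<or> (unl g = unl g' \<and> (tot g < tot g' \<or> (tot g = tot g' \<and> closed g i0 \<le> closed g' i')))"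
      using optimum_exists[OF nl] by blast
    interpret A: optimal_linkage L E m x y 2 g i0 "x i0" "y i0" by unfold_locales (use g nl in blast)+
    interpret B: optimal_linkage L E m x y 2 g i0 "y i0" "x i0" by unfold_locales (use g nl in blast)+
    have m: "m \<ge> 1" using g(2) by simp
    show False
    proof (cases "\<exists>a\<in>free g. E (x i0) a")
      case False
      then show False using A.dense_closed[OF refl _ m min deg] by blast
    next
      case True
      then obtain a where a: "a \<in> free g" "E (x i0) a" by blast
      show False
      proof (cases "\<exists>b\<in>free g. E (y i0) b")
        case False
        then show False using B.dense_closed[OF refl _ m min deg] by blast
      next
        case True
        then obtain b where "b \<in> free g" "E (y i0) b" by blast
        then show False using A.dense_both_open[OF refl a _ _ deg] by blast
      qed
    qed
  qed
qed

section \<open>Graphs whose minimum degree is about half the number of vertices\<close>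

locale large_linkage = optimal_linkage +
  fixes d :: nat
  assumes l7: "l = 7" and mindeg: "p \<in> V \<Longrightarrow> d \<le> card (nb E V p)"
    and cardV: "card V \<le> 2 * d + 2" and d6: "6 * m \<le> d + 4"
begin

lemma m1: "1 \<le> m" using i0 by linarith

lemma deg_split: "card (nb E V p) = (\<Sum>i<m. card (nb E (set (g i)) p)) + card (nb E R p)"
  by (rule split_card)

lemma ends_many: "(\<Sum>i<m. card (nb E (set (g i)) u) + card (nb E (set (g i)) v)) + 11 \<le> 11 * m"
proof -
  let ?f = "\<lambda>i. card (nb E (set (g i)) u) + card (nb E (set (g i)) v)"
  have "(\<Sum>i<m. ?f i) = ?f i0 + (\<Sum>i\<in>{..<m} - {i0}. ?f i)"
    by (rule sum.remove) (use i0 in auto)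
  also have "(\<Sum>i\<in>{..<m} - {i0}. ?f i) \<le> (\<Sum>i\<in>{..<m} - {i0}. 11)"
  proof (rule sum_mono)
    fix i assume "i \<in> {..<m} - {i0}"
    then have i: "i < m" "i \<noteq> i0" by auto
    have p: "length (g i) \<le> 9" using g_basic(7)[OF i(1)] l7 by simp
    show "?f i \<le> 11"
    proof (cases "length (g i) \<ge> 4")
      case True then show ?thesis using ends_bound[OF i] p by linarith
    next
      case False
      then show ?thesis using card_le_length[OF i(1), of "E u"] card_le_length[OF i(1), of "E v"] by linarith
    qed
  qed
  also have "\<dots> = 11 * (m - 1)" using i0 by simp
  finally have "(\<Sum>i<m. ?f i) \<le> 11 * (m - 1)" using i0_ends by simp
  then show ?thesis using m1 by linarith
qed

lemma ends_free: "2 \<le> card (nb E R u) + card (nb E R v)"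
proof -
  have "2 * d \<le> card (nb E V u) + card (nb E V v)"
    using mindeg[OF uv_facts(5)] mindeg[OF uv_facts(6)] by linarith
  also have "\<dots> = (\<Sum>i<m. card (nb E (set (g i)) u) + card (nb E (set (g i)) v))
      + (card (nb E R u) + card (nb E R v))"
    unfolding deg_split[of u] deg_split[of v] by (simp add: sum.distrib)
  finally show ?thesis using ends_many d6 by linarith
qed

lemma sees_le:
  assumes "r \<in> R"
  shows "(\<Sum>i<m. card (nb E (set (g i)) r)) + 2 \<le> 3 * m"
proof -
  let ?f = "\<lambda>i. card (nb E (set (g i)) r)"
  have "(\<Sum>i<m. ?f i) = ?f i0 + (\<Sum>i\<in>{..<m} - {i0}. ?f i)"
    by (rule sum.remove) (use i0 in auto)
  also have "(\<Sum>i\<in>{..<m} - {i0}. ?f i) \<le> (\<Sum>i\<in>{..<m} - {i0}. 3)"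
    by (rule sum_mono) (use seen_le3[OF assms] in auto)
  also have "\<dots> = 3 * (m - 1)" using i0 by simp
  finally have "(\<Sum>i<m. ?f i) \<le> 1 + 3 * (m - 1)" using i0_free[OF _ assms] l7 by fastforce
  then show ?thesis using m1 by linarith
qed

text \<open>The second bound is the minimum degree that \<open>dense_mlinked\<close> asks for: of at
  least \<open>6 * m - 4\<close> neighbours, at most \<open>3 * m - 2\<close> are on the
  paths.\<close>

lemma free_deg:
  assumes "r \<in> R"
  shows "d \<le> card (nb E R r) + (\<Sum>i<m. card (nb E (set (g i)) r))" "3 * m \<le> card (nb E R r) + 2"
proof -
  show 1: "d \<le> card (nb E R r) + (\<Sum>i<m. card (nb E (set (g i)) r))"
    using mindeg[of r] assms R_facts(1) deg_split[of r] by auto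
  show "3 * m \<le> card (nb E R r) + 2" using 1 sees_le[OF assms] d6 by linarith
qed

text \<open>The critical case is a path of three vertices that \<open>r\<close> sees completely;
  there the exchange argument shows that \<open>u\<close> misses one of them.\<close>

lemma closed_total:
  assumes r: "r \<in> R" and i: "i < m" "i \<noteq> i0" and cl: "\<forall>a\<in>R. \<not> E u a" and op: "\<exists>b\<in>R. b \<noteq> r \<and> E v b"
  shows "card (nb E (set (g i)) r) + card (nb E (set (g i)) u) + card (nb E (set (g i)) v) \<le> length (g i) + 5"
proof (cases "length (g i) \<ge> 4")
  case True
  then show ?thesis using ends_bound[OF i True] seen_le3[OF r i(1)] by linarith
next
  case False
  note b = card_le_length[OF i(1), of "E u"] card_le_length[OF i(1), of "E v"] card_le_length[OF i(1), of "E r"]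
  show ?thesis
  proof (cases "length (g i) = 3 \<and> card (nb E (set (g i)) r) = 3")
    case True
    have "card (nb E (set (g i)) u) < length (g i)" using seen_eq3_u[OF r i(1) _ cl] True op by blast
    then show ?thesis using b True by linarith
  next
    case F: False
    have "length (g i) = 2 \<or> length (g i) = 3" using False g_basic(8)[OF i(1)] by linarith
    then show ?thesis
    proof
      assume "length (g i) = 2" then show ?thesis using b by linarith
    next
      assume "length (g i) = 3" then show ?thesis using b F by linarith
    qed
  qed
qed

text \<open>Otherwise the closed neighbourhood of \<open>r\<close> and the neighbourhood of
  \<open>v\<close> are disjoint in the free part, and adding the degrees of \<open>r\<close>,
  \<open>u\<close>, \<open>v\<close> yields \<open>3 * d \<le> card V + 5 * m - 7\<close>.\<close>

lemma near_open_end: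
  assumes r: "r \<in> R" and cl: "\<forall>a\<in>R. \<not> E u a" and op: "\<exists>b\<in>R. b \<noteq> r \<and> E v b"
  shows "E v r \<or> (\<exists>b\<in>R. E r b \<and> E v b)"
proof (rule ccontr)
  assume n: "\<not> ?thesis"
  have sum: "(\<Sum>i<m. card (nb E (set (g i)) r) + card (nb E (set (g i)) u) + card (nb E (set (g i)) v)) + 2 + 5
     \<le> 1 + tot g + 5 * m"
  proof (rule path_bound_sum)
    show "card (nb E (set (g i0)) r) + card (nb E (set (g i0)) u) + card (nb E (set (g i0)) v) \<le> 1"
      using i0_ends i0_free[OF _ r] l7 by linarith
  qed (use closed_total[OF r _ _ cl op] in blast)
  have "card (insert r (nb E R r) \<union> nb E R v) \<le> card R"
    by (rule card_mono) (use R_facts(2) r in auto)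
  moreover have "card (insert r (nb E R r) \<union> nb E R v) = card (insert r (nb E R r)) + card (nb E R v)"
    by (rule card_Un_disjoint) (use n R_facts(2) in auto)
  moreover have "card (insert r (nb E R r)) = Suc (card (nb E R r))"
    using R_facts(2) Eirr by simp
  ultimately have 1: "card (nb E R r) + 1 + card (nb E R v) \<le> card R" by linarith
  have "nb E R u = {}" using cl by blast
  then have A0: "card (nb E R u) = 0" by (rule subst[where s = "{}", OF sym]) simp
  have "3 * d \<le> card (nb E V r) + card (nb E V u) + card (nb E V v)"
    using mindeg[OF uv_facts(5)] mindeg[OF uv_facts(6)] mindeg[of r] r R_facts(1) by fastforce
  also have "\<dots> = (\<Sum>i<m. card (nb E (set (g i)) r) + card (nb E (set (g i)) u) + card (nb E (set (g i)) v))
     + (card (nb E R r) + card (nb E R v))"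
    unfolding deg_split[of u] deg_split[of v] deg_split[of r] using A0 by (simp add: sum.distrib)
  finally show False using sum 1 card_V cardV d6 by linarith
qed

text \<open>From \<open>u\<close> along \<open>g i\<close> between positions \<open>j\<close> and
  \<open>k\<close>, then to \<open>r\<close>, and through at most one more free vertex to
  \<open>v\<close>: this path has at most \<open>|j - k| + 5\<close> vertices and must not be a
  profitable swap. The two truncated differences add up to \<open>|j - k|\<close>.\<close>

lemma positions_apart:
  assumes r: "r \<in> R" and i: "i < m" "i \<noteq> i0" and cl: "\<forall>a\<in>R. \<not> E u a" and op: "\<exists>b\<in>R. b \<noteq> r \<and> E v b"
    and k: "0 < k" "Suc k < length (g i)" "E r (g i ! k)"
    and j: "0 < j" "Suc j < length (g i)" "E u (g i ! j)"
  shows "length (g i) \<le> j - k + (k - j) + 5"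
proof (rule ccontr)
  assume n: "\<not> ?thesis"
  let ?p = "length (g i)"
  have suc: "successively E (g i)" by (rule linked_if_long[OF i(1)]) (use k in auto)
  have dist: "distinct (g i)" by (rule g_basic(2)[OF i(1)])
  obtain q where q: "q \<noteq> []" "distinct q" "set q \<subseteq> set (g i) - X" "hd q = g i ! j" "last q = g i ! k"
    "length q = j - k + (k - j) + 1" "successively E q"
  proof -
    define mid where "mid a b = drop a (take (Suc b) (g i))" for a b
    have mid: "mid a b \<noteq> [] \<and> distinct (mid a b) \<and> set (mid a b) \<subseteq> set (g i) - X \<and> hd (mid a b) = g i ! a
       \<and> last (mid a b) = g i ! b \<and> length (mid a b) = b - a + 1 \<and> successively E (mid a b)"
      if ab: "0 < a" "a \<le> b" "Suc b < ?p" for a b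
    proof -
      have len: "length (mid a b) = b - a + 1" unfolding mid_def using ab by simp
      have nth: "mid a b ! t = g i ! (a + t)" if "t < b - a + 1" for t
        unfolding mid_def using that ab by simp
      have ne: "mid a b \<noteq> []" using len by auto
      have "set (mid a b) \<subseteq> set (g i) - {x i, y i}"
      proof
        fix z assume "z \<in> set (mid a b)"
        then obtain t where t: "t < b - a + 1" "z = g i ! (a + t)" using len nth by (metis in_set_conv_nth)
        have at: "a + t < ?p" "0 < a + t" "a + t \<noteq> ?p - 1" "0 < ?p" "?p - 1 < ?p" using t(1) ab by auto
        have "x i = g i ! 0" "y i = g i ! (?p - 1)"
          using g_basic(1,4,5)[OF i(1)] by (auto simp: hd_conv_nth last_conv_nth)
        moreover have "g i ! (a + t) \<noteq> g i ! 0" "g i ! (a + t) \<noteq> g i ! (?p - 1)"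
          using nth_eq_iff_index_eq[OF dist, of "a + t" 0] nth_eq_iff_index_eq[OF dist, of "a + t" "?p - 1"] at by auto
        ultimately show "z \<in> set (g i) - {x i, y i}" using t ab by auto
      qed
      then have s: "set (mid a b) \<subseteq> set (g i) - X" using interior[OF i(1)] by simp
      have "successively E (mid a b)"
        unfolding successively_conv_nth using len nth suc ab by (auto simp: successively_conv_nth)
      moreover have "distinct (mid a b)" unfolding mid_def using dist by simp
      moreover have "hd (mid a b) = g i ! a" using ne nth[of 0] ab by (simp add: hd_conv_nth)
      moreover have "last (mid a b) = g i ! b" using ne nth[of "b - a"] len ab by (simp add: last_conv_nth)
      ultimately show ?thesis using len ne s by blast
    qed
    show ?thesis
    proof (cases "j \<le> k")
      case True
      then show ?thesis using that[of "mid j k"] mid[OF j(1) True k(2)] by simp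
    next
      case False
      then have "k \<le> j" by simp
      then show ?thesis using that[of "rev (mid k j)"] mid[OF k(1) _ j(2)] successively_rev_sym[OF E]
        by (simp add: hd_rev last_rev)
    qed
  qed
  from near_open_end[OF r cl op] obtain tl where tl: "successively E (tl @ [v])" "hd (tl @ [v]) = r" "distinct tl" "set tl \<subseteq> R"
    "length tl \<le> 2" "tl \<noteq> []"
  proof
    assume "E v r"
    then show ?thesis using that[of "[r]"] Esym[of v r] r by auto
  next
    assume "\<exists>b\<in>R. E r b \<and> E v b"
    then obtain b where "b \<in> R" "E r b" "E v b" by blast
    then show ?thesis using that[of "[r, b]"] Esym[of v b] Eirr[of r] r by auto
  qed
  have qR: "set q \<inter> R = {}" "u \<notin> set q" "v \<notin> set q" using q(3) R_facts(6)[OF i(1)] uv_facts(7,8) by auto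
  let ?w = "[u] @ q @ tl @ [v]"
  have "successively E (q @ tl @ [v])"
    by (rule successively_appendI) (use q tl k Esym[of r "g i ! k"] in auto)
  then have s: "successively E ?w"
    using q j by (auto simp: successively_append_iff successively_Cons hd_append last_rev hd_rev)
  have "distinct ?w" using q tl qR uv_facts R_facts by auto
  moreover have "length ?w < ?p" using n q(6) tl(5) by simp
  moreover have "set ?w \<subseteq> insert u (insert v R) \<union> (set (g i) - X)" using q(3) tl(4) by auto
  ultimately show False using no_swap[OF i, of ?w] s by auto
qed

text \<open>A single linear inequality for all lengths up to nine, as needed for summation over the
  paths. The case bounds meet it with equality at length \<open>5\<close> (with \<open>2\<close> and
  \<open>3\<close>) and at length \<open>9\<close> (with \<open>7\<close> and
  \<open>1\<close>).\<close>

lemma inner_bound: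
  assumes r: "r \<in> R" and i: "i < m" "i \<noteq> i0" and cl: "\<forall>a\<in>R. \<not> E u a" and op: "\<exists>b\<in>R. b \<noteq> r \<and> E v b"
  defines "J \<equiv> {j. 0 < j \<and> Suc j < length (g i) \<and> E u (g i ! j)}"
  shows "8 * card J + 10 * card (nb E (set (g i)) r) \<le> 5 * length (g i) + 21"
proof -
  let ?p = "length (g i)" and ?c = "card (nb E (set (g i)) r)"
  let ?K = "{j. j < length (g i) \<and> E r (g i ! j)}"
  have p: "2 \<le> ?p" "?p \<le> 9" using g_basic(7,8)[OF i(1)] l7 by auto
  have c3: "?c \<le> 3" by (rule seen_le3[OF r i(1)])
  have cK: "card ?K = ?c" using card_positions[OF g_basic(2)[OF i(1)], of "E r"] by simp
  have J0: "J \<subseteq> {1..<?p - 1}" unfolding J_def by auto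
  have J1: "card J \<le> ?p - 2" using card_mono[OF _ J0] by simp
  have c2: "?c \<le> ?p" by (rule card_le_length[OF i(1)])
  have J2: "card J \<le> ?p - 3" if c: "?c = 3"
  proof -
    obtain a where a: "a + 2 < ?p" "\<not> E u (g i ! (a + 1))"
      using seen_eq3_middle[OF r i(1) c cl] op by blast
    have "J \<subseteq> {1..<?p - 1} - {a + 1}" using J0 a unfolding J_def by auto
    then have "card J \<le> card ({1..<?p - 1} - {a + 1})" by (intro card_mono) auto
    also have "\<dots> = ?p - 3" using a by simp
    finally show ?thesis .
  qed
  \<comment> \<open>By \<open>positions_apart\<close>, \<open>u\<close> sees only positions at
    distance at least \<open>?p - 5\<close> from \<open>k\<close>; these form two short intervals at
    the ends of the path.\<close>
  have J3: "card J \<le> 3" if k: "0 < k" "Suc k < ?p" "E r (g i ! k)" and p6: "6 \<le> ?p" for k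
  proof -
    have "J \<subseteq> {1..k + 5 - ?p} \<union> {k + ?p - 5..<?p - 1}"
    proof
      fix j assume j: "j \<in> J"
      then have "?p \<le> j - k + (k - j) + 5" unfolding J_def using positions_apart[OF r i cl op k] by blast
      then show "j \<in> {1..k + 5 - ?p} \<union> {k + ?p - 5..<?p - 1}" using j p6 unfolding J_def by auto
    qed
    then have "card J \<le> card ({1..k + 5 - ?p} \<union> {k + ?p - 5..<?p - 1})" by (intro card_mono) auto
    also have "\<dots> \<le> (k + 5 - ?p) + (?p - 1 - (k + ?p - 5))"
      using card_Un_le[of "{1..k + 5 - ?p}" "{k + ?p - 5..<?p - 1}"] by simp
    also have "\<dots> \<le> 3" using k(1,2) p6 by linarith
    finally show ?thesis .
  qed
  \<comment> \<open>One of two neighbours of \<open>r\<close> is an inner vertex here, since the two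
    ends of the path do not fit into one window.\<close>
  have J4: "card J \<le> 3" if c: "2 \<le> ?c" and p6: "6 \<le> ?p"
  proof -
    have "\<not> ?K \<subseteq> {0, ?p - 1}"
    proof
      assume sub: "?K \<subseteq> {0, ?p - 1}"
      have "card ?K \<le> card {0, ?p - 1}" by (rule card_mono[OF _ sub]) simp
      also have "\<dots> = 2" using p6 by simp
      finally have "card ?K = 2" using c cK by linarith
      then have "?K = {0, ?p - 1}" by (intro card_subset_eq[OF _ sub]) (use p6 in auto)
      then have "E r (g i ! 0)" "E r (g i ! (?p - 1))" by auto
      moreover have "successively E (g i)" by (rule linked_if_long[OF i(1)]) (use p6 in auto)
      ultimately have "?p - 1 \<le> 0 + 2" using window[OF i(1) _ r, of 0 "?p - 1"] p6 by auto
      then show False using p6 by simp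
    qed
    then obtain k where "k < ?p" "E r (g i ! k)" "k \<noteq> 0" "k \<noteq> ?p - 1" by blast
    then show ?thesis using J3[of k] p6 by simp
  qed
  have J5: "card J \<le> 2" if c: "?c = 3" and p6: "?p = 6"
  proof -
    obtain a where a: "a + 2 < ?p" "?K = {a, a + 1, a + 2}"
      using seen_eq3_middle[OF r i(1) c cl] op by blast
    have e: "E r (g i ! a)" "E r (g i ! (a + 1))" "E r (g i ! (a + 2))" using a(2) by auto
    have nJ: "k \<notin> J" if k: "0 < k" "Suc k < ?p" "E r (g i ! k)" for k
      using positions_apart[OF r i cl op k, of k] p6 unfolding J_def by auto
    obtain k k' where k: "k \<noteq> k'" "k \<notin> J" "k' \<notin> J" "k \<in> {1..<5}" "k' \<in> {1..<5}"
    proof (cases "a = 0")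
      case True
      then show ?thesis using that[of "a + 1" "a + 2"] nJ[of "a + 1"] nJ[of "a + 2"] e p6 by auto
    next
      case False
      then show ?thesis using that[of "a" "a + 1"] nJ[of "a + 1"] nJ[of "a"] e p6 a(1) by auto
    qed
    have "J \<subseteq> {1..<5} - {k, k'}" using J0 k p6 by auto
    then have "card J \<le> card ({1..<5} - {k, k'})" by (intro card_mono) auto
    also have "\<dots> = 2" using k by (subst card_Diff_subset) auto
    finally show ?thesis .
  qed
  consider "?p \<le> 5" | "?p = 6" | "7 \<le> ?p" by linarith
  then show ?thesis
  proof cases
    case 1
    consider "?c = 3" | "?c \<le> 2" using c3 by linarith
    then show ?thesis
    proof cases
      case c: 1
      then show ?thesis using J2 1 p c2 by linarith
    next
      case 2
      then show ?thesis using J1 1 p c2 by linarith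
    qed
  next
    case 2
    consider "?c = 3" | "?c = 2" | "?c \<le> 1" using c3 by linarith
    then show ?thesis using J5 J4 J1 2 by cases linarith+
  next
    case 3
    consider "2 \<le> ?c" | "?c \<le> 1" by linarith
    then show ?thesis
    proof cases
      case 1 then show ?thesis using J4 3 c3 by linarith
    next
      case 2 then show ?thesis using J1 3 p by linarith
    qed
  qed
qed

text \<open>Sum of \<open>inner_bound\<close> over the paths. The two ends of a path may also be
  neighbours of \<open>u\<close>, which turns \<open>21\<close> into \<open>21 + 8 * 2 = 37\<close>;
  and as \<open>u\<close> is closed, it has at least \<open>d\<close> neighbours on the
  paths.\<close>

lemma closed_margin:
  assumes r: "r \<in> R" and cl: "\<forall>a\<in>R. \<not> E u a" and op: "\<exists>b\<in>R. b \<noteq> r \<and> E v b"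
  shows "8 * d + 10 * (\<Sum>i<m. card (nb E (set (g i)) r)) + 37 \<le> 5 * tot g + 37 * m"
proof -
  let ?e = "\<lambda>i. card (nb E (set (g i)) u)" and ?c = "\<lambda>i. card (nb E (set (g i)) r)"
  have "nb E R u = {}" using cl by blast
  then have A0: "card (nb E R u) = 0" by (rule subst[where s = "{}", OF sym]) simp
  have le: "8 * ?e i + 10 * ?c i \<le> 5 * length (g i) + 37" if i: "i < m" "i \<noteq> i0" for i
  proof -
    let ?J = "{j. 0 < j \<and> Suc j < length (g i) \<and> E u (g i ! j)}"
    have "{j. j < length (g i) \<and> E u (g i ! j)} \<subseteq> ?J \<union> {0, length (g i) - 1}" by auto
    moreover have fin: "finite ?J" by (rule finite_subset[of _ "{..<length (g i)}"]) auto
    ultimately have "card {j. j < length (g i) \<and> E u (g i ! j)} \<le> card (?J \<union> {0, length (g i) - 1})"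
      by (intro card_mono) auto
    also have "\<dots> \<le> card ?J + card {0, length (g i) - 1}" by (rule card_Un_le)
    also have "card {0, length (g i) - 1} \<le> 2" by (simp add: card_insert_if)
    finally have "?e i \<le> card ?J + 2" using card_positions[OF g_basic(2)[OF i(1)], of "E u"] by simp
    then show ?thesis using inner_bound[OF r i cl op] by linarith
  qed
  have "(\<Sum>i<m. 8 * ?e i + 10 * ?c i) = 8 * ?e i0 + 10 * ?c i0 + (\<Sum>i\<in>{..<m} - {i0}. 8 * ?e i + 10 * ?c i)"
    by (rule sum.remove) (use i0 in auto)
  also have "(\<Sum>i\<in>{..<m} - {i0}. 8 * ?e i + 10 * ?c i) \<le> (\<Sum>i\<in>{..<m} - {i0}. 5 * length (g i) + 37)"
    by (rule sum_mono) (use le in auto)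
  also have "\<dots> = 5 * (\<Sum>i\<in>{..<m} - {i0}. length (g i)) + 37 * (m - 1)"
    using i0 by (simp add: sum.distrib sum_distrib_left)
  finally have 1: "(\<Sum>i<m. 8 * ?e i + 10 * ?c i) \<le> 8 * ?e i0 + 10 * ?c i0
      + (5 * (\<Sum>i\<in>{..<m} - {i0}. length (g i)) + 37 * (m - 1))" by simp
  have 2: "tot g = length (g i0) + (\<Sum>i\<in>{..<m} - {i0}. length (g i))" unfolding tot_def
    by (rule sum.remove) (use i0 in auto)
  have 3: "?e i0 = 0" "?c i0 \<le> 1" using i0_ends i0_free[OF _ r] l7 by auto
  have 4: "(\<Sum>i<m. 8 * ?e i + 10 * ?c i) = 8 * (\<Sum>i<m. ?e i) + 10 * (\<Sum>i<m. ?c i)"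
    by (simp add: sum.distrib sum_distrib_left)
  have 5: "d \<le> (\<Sum>i<m. ?e i)" using mindeg[OF uv_facts(5)] deg_split[of u] A0 by simp
  have 6: "length (g i0) = 2" using gi0 by simp
  have 7: "37 * (m - 1) + 37 = 37 * m" using m1 by simp
  show ?thesis using 1 2 3 4 5 6 7 by linarith
qed

text \<open>With degrees taken in the free part, \<open>free_deg\<close> and
  \<open>closed_margin\<close> for \<open>p\<close> and \<open>q\<close> give
  \<open>10 * (deg p + deg q) \<ge> 36 * d + 74 - 10 * tot g - 74 * m\<close>. Since
  \<open>card R \<le> 2 * d + 2 - tot g\<close>, the degree condition of
  \<open>dense_mlinked\<close> then follows exactly from \<open>99 * m \<le> 16 * d + 84\<close>,
  which is the origin of this hypothesis.\<close>

lemma closed_case: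
  assumes cl: "\<forall>a\<in>R. \<not> E u a" and d16: "99 * m \<le> 16 * d + 84"
  shows "2 * m \<le> card R \<and> mlinked m R E"
proof -
  have "nb E R u = {}" using cl by blast
  then have A0: "card (nb E R u) = 0" by (rule subst[where s = "{}", OF sym]) simp
  then have "\<not> card (nb E R v) \<le> Suc 0" using ends_free by simp
  moreover have "finite (nb E R v)" using R_facts(2) by simp
  ultimately obtain b1 b2 where b: "b1 \<in> R" "E v b1" "b2 \<in> R" "E v b2" "b1 \<noteq> b2"
    using card_le_Suc0_iff_eq[of "nb E R v"] by auto
  have op: "\<exists>b\<in>R. b \<noteq> r \<and> E v b" for r using b by metis
  have "insert b1 (nb E R b1) \<subseteq> R" using b(1) by blast
  then have "card (insert b1 (nb E R b1)) \<le> card R" by (rule card_mono[OF R_facts(2)])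
  then have "card (nb E R b1) < card R" using R_facts(2) Eirr by simp
  then have 1: "2 * m \<le> card R" using free_deg(2)[OF b(1)] m1 by linarith
  have "mlinked m R E"
  proof (rule dense_mlinked[OF R_facts(2) E])
    show "3 * m \<le> card (nb E R p) + 2" if "p \<in> R" for p using free_deg(2)[OF that] by linarith
    fix p q assume pq: "p \<in> R" "q \<in> R" "p \<noteq> q" "\<not> E p q"
    note fp = free_deg(1)[OF pq(1)] and fq = free_deg(1)[OF pq(2)]
    note mp = closed_margin[OF pq(1) cl op] and mq = closed_margin[OF pq(2) cl op]
    show "2 * card R + 5 * m \<le> 2 * (card (nb E R p) + card (nb E R q)) + 6"
      using fp fq mp mq card_V cardV d16 unfolding distrib_left by linarith
  qed
  then show ?thesis using 1 by blast
qed

lemma no_short_link: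
  assumes "w \<noteq> []" "distinct w" "E u (hd w)" "E v (last w)" "set w \<subseteq> R" "length w \<le> 7" "successively E w"
  shows False
proof -
  have "successively E ([u] @ w @ [v])"
    using assms Esym[OF assms(4)] by (auto simp: successively_append_iff successively_Cons hd_append last_rev hd_rev)
  then show False using no_link[of "[u] @ w @ [v]"] assms uv_facts(1) R_facts(4,5) l7 by auto
qed

text \<open>The ball of radius two around \<open>a\<close> in the free part; the equations
  \<open>z = r\<close> and \<open>z = a\<close> admit the distances zero and one.\<close>

definition near :: "'a \<Rightarrow> 'a set" where
  "near a = {r \<in> R. \<exists>z\<in>R. (z = r \<or> E r z) \<and> (z = a \<or> E a z)}"

lemma near_walk:
  assumes "r \<in> near a" "a \<in> R"
  shows "\<exists>w. w \<noteq> [] \<and> successively E w \<and> set w \<subseteq> near a \<and> hd w = a \<and> last w = r \<and> length w \<le> 3"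
proof -
  obtain z where z: "z \<in> R" "z = r \<or> E r z" "z = a \<or> E a z" and r: "r \<in> R" using assms unfolding near_def by blast
  have in_near: "r \<in> near a" "a \<in> near a" "z \<in> near a" using assms z unfolding near_def by auto
  show ?thesis
  proof (cases "z = a")
    case za: True
    show ?thesis
    proof (cases "z = r")
      case True then show ?thesis using za in_near by (intro exI[of _ "[a]"]) auto
    next
      case False then show ?thesis using za in_near z Esym[of r z] by (intro exI[of _ "[a, r]"]) auto
    qed
  next
    case za: False
    show ?thesis
    proof (cases "z = r")
      case True then show ?thesis using za in_near z by (intro exI[of _ "[a, r]"]) auto
    next
      case False then show ?thesis using za in_near z Esym[of r z] by (intro exI[of _ "[a, z, r]"]) auto
    qed
  qed
qed

text \<open>If \<open>p\<close> and \<open>q\<close> were equal or adjacent, a walk of at most six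
  free vertices would lead from \<open>a\<close> to \<open>b\<close>, within the seven that
  \<open>l\<close> allows.\<close>

lemma near_apart:
  assumes a: "a \<in> R" "E u a" and b: "b \<in> R" "E v b" and p: "p \<in> near a" and q: "q \<in> near b"
  shows "p \<noteq> q" "\<not> E p q"
proof -
  obtain w where w: "w \<noteq> []" "successively E w" "set w \<subseteq> near a" "hd w = a" "last w = p" "length w \<le> 3"
    using near_walk[OF p a(1)] by blast
  obtain w' where w': "w' \<noteq> []" "successively E w'" "set w' \<subseteq> near b" "hd w' = b" "last w' = q" "length w' \<le> 3"
    using near_walk[OF q b(1)] by blast
  have R: "near c \<subseteq> R" for c unfolding near_def by blast
  have no: False if x: "x \<noteq> []" "successively E x" "hd x = a" "last x = b" "set x \<subseteq> R" "length x \<le> 7" for x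
  proof -
    from walk_to_path[OF x(1,2)] obtain y where y: "y \<noteq> []" "distinct y" "successively E y" "hd y = hd x" "last y = last x"
      "set y \<subseteq> set x" "length y \<le> length x" by blast
    have "E u (hd y)" "E v (last y)" "set y \<subseteq> R" "length y \<le> 7" using x y a b by auto
    then show False using no_short_link[OF y(1,2)] y(3) by blast
  qed
  have wR: "set w \<subseteq> R" "set w' \<subseteq> R" using w(3) w'(3) R by blast+
  have rw: "successively E (rev w')" using w'(2) successively_rev_sym[OF E] by blast
  have hlw: "hd (rev w') = q" "last (rev w') = b" using w' by (auto simp: hd_rev last_rev)
  show "p \<noteq> q"
  proof
    assume e: "p = q"
    obtain ys where ys: "rev w' = q # ys" using hlw(1) w'(1) by (cases "rev w'") auto
    show False
    proof (cases "ys = []")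
      case True
      then have "last w = b" using hlw(2) ys w(5) e by simp
      then show False using no[OF w(1,2,4)] wR(1) w(6) by simp
    next
      case False
      have "successively E ys" "E q (hd ys)" using rw False unfolding ys by (auto simp: successively_Cons)
      then have "successively E (w @ ys)" using w e by (auto simp: successively_append_iff successively_Cons hd_append last_rev hd_rev)
      moreover have "set (rev w') \<subseteq> R" "length (rev w') \<le> 3" using w' wR by auto
      then have "set ys \<subseteq> R" "length ys \<le> 2" unfolding ys by auto
      moreover have "last ys = b" using hlw(2) ys False by simp
      ultimately show False using no[of "w @ ys"] w wR(1) False by simp
    qed
  qed
  show "\<not> E p q"
  proof
    assume "E p q"
    then have "successively E (w @ rev w')" using w hlw rw by (auto simp: successively_append_iff successively_Cons hd_append last_rev hd_rev)
    then show False using no[of "w @ rev w'"] w w' wR hlw by simp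
  qed
qed

text \<open>Otherwise the closed neighbourhoods of \<open>r\<close>, \<open>a\<close> and
  \<open>b\<close> are disjoint in the free part. On each path the three vertices see at most its
  length plus \<open>6\<close>, so that \<open>3 * d \<le> card V + 6 * m - 8\<close>, against the
  bounds on \<open>card V\<close> and \<open>m\<close>.\<close>

lemma near_cover:
  assumes a: "a \<in> R" "E u a" and b: "b \<in> R" "E v b" and r: "r \<in> R"
  shows "r \<in> near a \<or> r \<in> near b"
proof (rule ccontr)
  assume n: "\<not> ?thesis"
  let ?N = "\<lambda>z. insert z (nb E R z)"
  have cN: "card (?N z) = Suc (card (nb E R z))" for z using R_facts(2) Eirr by simp
  have "b \<notin> near a"
  proof
    assume "b \<in> near a"
    moreover have "b \<in> near b" using b unfolding near_def by blast
    ultimately show False using near_apart(1)[OF a b] by blast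
  qed
  then have d: "?N r \<inter> ?N a = {}" "(?N r \<union> ?N a) \<inter> ?N b = {}"
    using n r b a Esym unfolding near_def by blast+
  have "card (?N r \<union> ?N a \<union> ?N b) \<le> card R" by (rule card_mono) (use R_facts(2) r a b in auto)
  moreover have "card (?N r \<union> ?N a \<union> ?N b) = card (?N r) + card (?N a) + card (?N b)"
    using card_Un_disjoint[OF _ _ d(1)] card_Un_disjoint[OF _ _ d(2)] R_facts(2) by simp
  ultimately have 1: "card (nb E R r) + card (nb E R a) + card (nb E R b) + 3 \<le> card R" unfolding cN by linarith
  have 2: "(\<Sum>i<m. card (nb E (set (g i)) r) + card (nb E (set (g i)) a) + card (nb E (set (g i)) b)) + 2 + 6
     \<le> 3 + tot g + 6 * m"
  proof (rule path_bound_sum)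
    show "card (nb E (set (g i0)) r) + card (nb E (set (g i0)) a) + card (nb E (set (g i0)) b) \<le> 3"
      using i0_free[OF _ r] i0_free[OF _ a(1)] i0_free[OF _ b(1)] l7 by linarith
    fix i assume i: "i < m"
    show "card (nb E (set (g i)) r) + card (nb E (set (g i)) a) + card (nb E (set (g i)) b) \<le> length (g i) + 6"
      using seen_le3[OF r i] seen_le3[OF a(1) i] seen_le3[OF b(1) i] card_le_length[OF i, of "E r"]
        card_le_length[OF i, of "E a"] card_le_length[OF i, of "E b"] by linarith
  qed
  have "3 * d \<le> card (nb E V r) + card (nb E V a) + card (nb E V b)"
    using mindeg[of r] mindeg[of a] mindeg[of b] r a b R_facts(1) by fastforce
  also have "\<dots> = (\<Sum>i<m. card (nb E (set (g i)) r) + card (nb E (set (g i)) a) + card (nb E (set (g i)) b))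
     + (card (nb E R r) + card (nb E R a) + card (nb E R b))"
    unfolding deg_split[of r] deg_split[of a] deg_split[of b] by (simp add: sum.distrib)
  finally show False using 1 2 card_V cardV d6 by linarith
qed

text \<open>One of \<open>u1, u2\<close> replaces the middle one \<open>?z\<close> of its three
  neighbours on \<open>g i\<close>. The other is joined to \<open>u\<close> inside
  \<open>near a\<close>, and \<open>w\<close> to \<open>v\<close> inside \<open>near b\<close>, so
  that \<open>?z\<close> completes a link of at most \<open>1 + 3 + 1 + 3 + 1 = 9\<close> vertices.
  This explains the value \<open>l = 7\<close>.\<close>

lemma three_not_full:
  assumes a: "a \<in> R" "E u a" and b: "b \<in> R" "E v b"
    and u12: "u1 \<in> near a" "u2 \<in> near a" "u1 \<noteq> u2" and w: "w \<in> near b"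
    and i: "i < m" "i \<noteq> i0" and p: "length (g i) \<le> 4"
    and c: "card (nb E (set (g i)) u1) = 3" "card (nb E (set (g i)) u2) = 3" "card (nb E (set (g i)) w) = 3"
  shows False
proof -
  have R: "near c \<subseteq> R" for c unfolding near_def by blast
  have aa: "a \<in> near a" using a unfolding near_def by blast
  \<comment> \<open>\<open>ups\<close> is the one of the two that is nearest to \<open>a\<close>, so
    a shortest path to it misses \<open>rho\<close>.\<close>
  obtain rho ups al where al: "rho \<in> {u1, u2}" "ups \<in> {u1, u2}" "al \<noteq> []" "distinct al" "hd al = a" "last al = ups"
    "set al \<subseteq> near a" "successively E al" "length al \<le> 3" "rho \<notin> set al"
  proof -
    have step: thesis if t: "x \<in> {u1, u2}" "y \<in> {u1, u2}" "x \<noteq> y" "E a x" "y \<noteq> a" for x y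
      using \<open>\<And>rho ups al. rho \<in> {u1, u2} \<Longrightarrow> ups \<in> {u1, u2} \<Longrightarrow> al \<noteq> [] \<Longrightarrow> distinct al \<Longrightarrow> hd al = a \<Longrightarrow> last al = ups
        \<Longrightarrow> set al \<subseteq> near a \<Longrightarrow> successively E al \<Longrightarrow> length al \<le> 3 \<Longrightarrow> rho \<notin> set al \<Longrightarrow> thesis\<close>[of y x "[a, x]"] t u12 aa Eirr by auto
    consider "u1 = a" | "u2 = a" | "E a u1" "u2 \<noteq> a" | "E a u2" "u1 \<noteq> a" | "u1 \<noteq> a" "u2 \<noteq> a" "\<not> E a u1" "\<not> E a u2" by blast
    then show thesis
    proof cases
      case 1 then show thesis using that[of u2 a "[a]"] u12 aa by auto
    next
      case 2 then show thesis using that[of u1 a "[a]"] u12 aa by auto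
    next
      case 3 then show thesis using step[of u1 u2] u12 by blast
    next
      case 4 then show thesis using step[of u2 u1] u12 by blast
    next
      case 5
      obtain z where z: "z \<in> R" "z = u1 \<or> E u1 z" "z = a \<or> E a z" using u12(1) unfolding near_def by blast
      then have z': "E u1 z" "E a z" "z \<in> near a" using 5 Esym[of u1 a] unfolding near_def by auto
      then have "z \<noteq> u2" using 5 by blast
      then show thesis using that[of u2 u1 "[a, z, u1]"] u12 aa 5 z' Esym[of u1 z] Eirr[of u1] Eirr[of a] by auto
    qed
  qed
  have rR: "rho \<in> R" "ups \<in> R" "w \<in> R" "rho \<in> near a" using al u12 w R[of a] R[of b] by auto
  have c': "card (nb E (set (g i)) rho) = 3" "card (nb E (set (g i)) ups) = 3" using al c by auto
  obtain be0 where be0: "be0 \<noteq> []" "successively E be0" "set be0 \<subseteq> near b" "hd be0 = b" "last be0 = w" "length be0 \<le> 3"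
    using near_walk[OF w b(1)] by blast
  from walk_to_path[OF be0(1,2)] obtain be where be: "be \<noteq> []" "distinct be" "successively E be" "hd be = b" "last be = w"
    "set be \<subseteq> near b" "length be \<le> 3"
    using be0 by (metis order_trans)
  obtain s where s: "{j. j < length (g i) \<and> E rho (g i ! j)} = {s, s + 1, s + 2}" and suc: "successively E (g i)"
    using seen_eq3[OF rR(1) i(1) c'(1)] by blast
  have s2: "s + 2 < length (g i)" "E rho (g i ! s)" "E rho (g i ! (s + 2))" using s by auto
  \<comment> \<open>On a path of at most four vertices every window of three contains the middle of
    every other one.\<close>
  have mid: "E r (g i ! (s + 1))" if r: "r \<in> R" "card (nb E (set (g i)) r) = 3" for r
  proof -
    obtain t where t: "{j. j < length (g i) \<and> E r (g i ! j)} = {t, t + 1, t + 2}"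
      using seen_eq3[OF r(1) i(1) r(2)] by blast
    then have "t + 2 < length (g i)" by auto
    then have "s + 1 \<in> {t, t + 1, t + 2}" using s2(1) p by auto
    then show ?thesis unfolding t[symmetric] by blast
  qed
  let ?z = "g i ! (s + 1)"
  have zups: "E ups ?z" and zw: "E w ?z" using mid rR c' c(3) by blast+
  define w' where "w' = take (Suc s) (g i) @ [rho] @ drop (s + 2) (g i)"
  have sr: "successively E ([g i ! s] @ [rho] @ [g i ! (s + 2)])" using s2 Esym[of rho "g i ! s"] by simp
  have w': "ok i w'" "successively E w'" "set w' \<subseteq> set (g i) \<union> R"
    "set w' = set (take (Suc s) (g i)) \<union> set [rho] \<union> set (drop (s + 2) (g i))"
    unfolding w'_def
    by (rule ok_reroute(1,2,3,5)[OF i(1) suc _ s2(1) _ _ sr]; use rR in simp)+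
  have dist: "distinct (g i)" by (rule g_basic(2)[OF i(1)])
  have "?z \<notin> set (take (Suc s) (g i))" "?z \<notin> set (drop (s + 2) (g i))"
    using dist s2(1) by (auto simp: in_set_conv_nth nth_eq_iff_index_eq)
  moreover have zin: "?z \<in> set (g i)" using s2 by simp
  moreover have zR: "?z \<notin> R" using zin R_facts(6)[OF i(1)] by blast
  ultimately have zw': "?z \<notin> set w'" using w'(4) rR by auto
  have "x i \<in> set w'" "y i \<in> set w'" using w'(1) hd_in_set[of w'] last_in_set[of w'] unfolding ok_def by simp_all
  then have "?z \<noteq> x i" "?z \<noteq> y i" using zw' by metis+
  then have zX: "?z \<in> set (g i) - X" unfolding interior[OF i(1)] using zin by blast
  have disj: "near a \<inter> near b = {}" using near_apart(1)[OF a b] by blast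
  let ?w = "[u] @ al @ [?z] @ rev be @ [v]"
  have "successively E (rev be @ [v])"
    using be successively_rev_sym[OF E, of be] b Esym[OF b(2)] by (auto simp: successively_append_iff successively_Cons hd_append last_rev hd_rev)
  then have "successively E ([?z] @ rev be @ [v])"
    using be Esym[OF zw] by (auto simp: successively_append_iff successively_Cons hd_append last_rev hd_rev)
  then have "successively E (al @ [?z] @ rev be @ [v])"
    using al zups by (auto simp: successively_append_iff successively_Cons hd_append last_rev hd_rev)
  then have sw: "successively E ?w" using al a by (auto simp: successively_append_iff successively_Cons hd_append last_rev hd_rev)
  have ab: "set al \<subseteq> R" "set be \<subseteq> R" using al be R by blast+
  have "u \<notin> set al" "v \<notin> set al" "u \<notin> set be" "v \<notin> set be" "?z \<notin> set al" "?z \<notin> set be" "?z \<noteq> u" "?z \<noteq> v"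
    using ab R_facts(4,5) zR zX uv_facts(7,8) by auto
  moreover have "set al \<inter> set be = {}" using al(7) be(6) disj by blast
  ultimately have dw: "distinct ?w" using al(4) be(2) uv_facts(1) by auto
  have "set w' \<inter> R \<subseteq> {rho}" using w'(4) R_facts(6)[OF i(1)] set_take_subset[of "Suc s" "g i"] set_drop_subset[of "s + 2" "g i"] by auto
  moreover have "rho \<notin> set be" using rR(4) be(6) disj by blast
  moreover have "u \<notin> set w'" "v \<notin> set w'" using w'(3) R_facts(4,5) uv_facts(4) g_disj[OF i(1) i0 i(2)] by auto
  ultimately have "set ?w \<inter> set w' = {}" using al(10) ab zw' by auto
  moreover have "length ?w \<le> l + 2" using al(9) be(7) l7 by simp
  moreover have "set ?w \<subseteq> insert u (insert v R) \<union> (set (g i) - X)" using ab zX by auto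
  ultimately show False using no_link2[OF i w'(1,2,3), of ?w] dw sw by auto
qed

end

lemma (in large_linkage) swapped: "large_linkage V E m x y l g i0 v u d"
  by unfold_locales (use valid i0 ni0 unlinkable opt uv l7 mindeg cardV d6 in blast)+

context large_linkage
begin

text \<open>On a path of three or four vertices at most two of the four see three vertices, which
  gives at most \<open>10\<close>; for the other lengths the trivial bounds \<open>8\<close> and
  \<open>12\<close> suffice.\<close>

lemma four_bound:
  assumes a: "a \<in> R" "E u a" and b: "b \<in> R" "E v b"
    and u12: "u1 \<in> near a" "u2 \<in> near a" "u1 \<noteq> u2" and w12: "w1 \<in> near b" "w2 \<in> near b" "w1 \<noteq> w2"
    and i: "i < m" "i \<noteq> i0"
  shows "card (nb E (set (g i)) u1) + card (nb E (set (g i)) u2) + card (nb E (set (g i)) w1) + card (nb E (set (g i)) w2)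
     \<le> length (g i) + 7"
proof -
  interpret S: large_linkage V E m x y l g i0 v u d by (rule swapped)
  have R: "near c \<subseteq> R" for c unfolding near_def by blast
  note R4 = R[THEN subsetD, OF u12(1)] R[THEN subsetD, OF u12(2)] R[THEN subsetD, OF w12(1)] R[THEN subsetD, OF w12(2)]
  note c3 = seen_le3[OF R4(1) i(1)] seen_le3[OF R4(2) i(1)] seen_le3[OF R4(3) i(1)] seen_le3[OF R4(4) i(1)]
  note cl = card_le_length[OF i(1), of "E u1"] card_le_length[OF i(1), of "E u2"] card_le_length[OF i(1), of "E w1"]
    card_le_length[OF i(1), of "E w2"]
  have w: "w1 \<in> S.near b" "w2 \<in> S.near b" "u1 \<in> S.near a" "u2 \<in> S.near a" using u12 w12 by blast+
  have p2: "2 \<le> length (g i)" by (rule g_basic(8)[OF i(1)])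
  show ?thesis
  proof (cases "length (g i) = 3 \<or> length (g i) = 4")
    case True
    then have p: "length (g i) \<le> 4" by auto
    have 1: "\<not> (card (nb E (set (g i)) u1) = 3 \<and> card (nb E (set (g i)) u2) = 3 \<and> card (nb E (set (g i)) w1) = 3)"
      using three_not_full[OF a b u12 w12(1) i p] by blast
    have 2: "\<not> (card (nb E (set (g i)) u1) = 3 \<and> card (nb E (set (g i)) u2) = 3 \<and> card (nb E (set (g i)) w2) = 3)"
      using three_not_full[OF a b u12 w12(2) i p] by blast
    have 3: "\<not> (card (nb E (set (g i)) w1) = 3 \<and> card (nb E (set (g i)) w2) = 3 \<and> card (nb E (set (g i)) u1) = 3)"
      using S.three_not_full[OF b a w(1,2) w12(3) w(3) i p] by blast
    have 4: "\<not> (card (nb E (set (g i)) w1) = 3 \<and> card (nb E (set (g i)) w2) = 3 \<and> card (nb E (set (g i)) u2) = 3)"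
      using S.three_not_full[OF b a w(1,2) w12(3) w(4) i p] by blast
    show ?thesis using 1 2 3 4 c3 True by linarith
  next
    case False
    then show ?thesis using c3 cl p2 by linarith
  qed
qed

text \<open>By \<open>near_cover\<close> and \<open>near_apart\<close>, no edge of the free part
  leaves \<open>near a\<close>.\<close>

lemma near_deg:
  assumes a: "a \<in> R" "E u a" and b: "b \<in> R" "E v b" and r: "r \<in> near a"
  shows "nb E (near a) r = nb E R r"
proof -
  have "z \<in> near a" if "z \<in> R" "E r z" for z
    using near_cover[OF a b that(1)] near_apart(2)[OF a b r] that by blast
  then show ?thesis unfolding near_def by blast
qed

lemma near_mlinked:
  assumes a: "a \<in> R" "E u a" and b: "b \<in> R" "E v b"
    and deg: "\<And>p q. p \<in> near a \<Longrightarrow> q \<in> near a \<Longrightarrow> p \<noteq> q \<Longrightarrow>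
       2 * card (near a) + 5 * m \<le> 2 * (card (nb E R p) + card (nb E R q)) + 6"
  shows "\<exists>L\<subseteq>V. 2 * m \<le> card L \<and> mlinked m L E"
proof (intro exI conjI)
  have sub: "near a \<subseteq> R" unfolding near_def by blast
  then show "near a \<subseteq> V" using R_facts(1) by blast
  have fin: "finite (near a)" using sub R_facts(2) finite_subset by blast
  have aa: "a \<in> near a" using a unfolding near_def by blast
  have min: "3 * m \<le> card (nb E (near a) p) + 2" if "p \<in> near a" for p
    using free_deg(2)[of p] sub that near_deg[OF a b that] by auto
  show "mlinked m (near a) E"
    by (rule dense_mlinked[OF fin E]) (use min deg near_deg[OF a b] in fastforce)+
  have "insert a (nb E (near a) a) \<subseteq> near a" using aa by blast
  then have "card (insert a (nb E (near a) a)) \<le> card (near a)" by (rule card_mono[OF fin])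
  then have "card (nb E (near a) a) < card (near a)" using fin Eirr by simp
  then show "2 * m \<le> card (near a)" using min[OF aa] m1 by linarith
qed

text \<open>If both balls violate the degree condition, a violating pair in each gives four vertices
  whose degrees in the free part total less than \<open>card R + 5 * m - 6\<close>, and by
  \<open>four_bound\<close> they see at most \<open>tot g + 7 * m - 5\<close> on the paths. Hence
  \<open>4 * d < card V + 12 * m - 11\<close>, which is impossible for
  \<open>card V \<le> 2 * d + 2\<close> and \<open>6 * m \<le> d + 4\<close>.\<close>

lemma open_case:
  assumes a: "a \<in> R" "E u a" and b: "b \<in> R" "E v b"
  shows "\<exists>L\<subseteq>V. 2 * m \<le> card L \<and> mlinked m L E"
proof (rule ccontr)
  assume n: "\<not> ?thesis"
  interpret S: large_linkage V E m x y l g i0 v u d by (rule swapped)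
  have "\<not> (\<forall>p q. p \<in> near a \<longrightarrow> q \<in> near a \<longrightarrow> p \<noteq> q \<longrightarrow>
      2 * card (near a) + 5 * m \<le> 2 * (card (nb E R p) + card (nb E R q)) + 6)"
  proof
    assume q: "\<forall>p q. p \<in> near a \<longrightarrow> q \<in> near a \<longrightarrow> p \<noteq> q \<longrightarrow>
      2 * card (near a) + 5 * m \<le> 2 * (card (nb E R p) + card (nb E R q)) + 6"
    have "\<exists>L\<subseteq>V. 2 * m \<le> card L \<and> mlinked m L E"
      by (rule near_mlinked[OF a b]) (use q in blast)
    then show False using n by contradiction
  qed
  then obtain u1 u2 where u: "u1 \<in> near a" "u2 \<in> near a" "u1 \<noteq> u2"
     "2 * (card (nb E R u1) + card (nb E R u2)) + 6 < 2 * card (near a) + 5 * m"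
    unfolding not_all not_imp not_le by blast
  have "\<not> (\<forall>p q. p \<in> near b \<longrightarrow> q \<in> near b \<longrightarrow> p \<noteq> q \<longrightarrow>
      2 * card (near b) + 5 * m \<le> 2 * (card (nb E R p) + card (nb E R q)) + 6)"
  proof
    assume q: "\<forall>p q. p \<in> near b \<longrightarrow> q \<in> near b \<longrightarrow> p \<noteq> q \<longrightarrow>
      2 * card (near b) + 5 * m \<le> 2 * (card (nb E R p) + card (nb E R q)) + 6"
    have "\<exists>L\<subseteq>V. 2 * m \<le> card L \<and> mlinked m L E"
      by (rule S.near_mlinked[OF b a]) (use q in blast)
    then show False using n by contradiction
  qed
  then obtain w1 w2 where w: "w1 \<in> near b" "w2 \<in> near b" "w1 \<noteq> w2"
     "2 * (card (nb E R w1) + card (nb E R w2)) + 6 < 2 * card (near b) + 5 * m"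
    unfolding not_all not_imp not_le by blast
  have sub: "near c \<subseteq> R" for c unfolding near_def by blast
  have fin: "finite (near c)" for c using sub R_facts(2) finite_subset by blast
  have "card (near a) + card (near b) = card (near a \<union> near b)"
  proof (rule card_Un_disjoint[OF fin[of a] fin[of b], symmetric])
    show "near a \<inter> near b = {}" using near_apart(1)[OF a b] by blast
  qed
  also have "\<dots> \<le> card R" using sub by (intro card_mono R_facts(2)) blast
  finally have 1: "card (near a) + card (near b) \<le> card R" .
  have R4: "u1 \<in> R" "u2 \<in> R" "w1 \<in> R" "w2 \<in> R" using u w sub by blast+
  let ?s = "\<lambda>i. card (nb E (set (g i)) u1) + card (nb E (set (g i)) u2) + card (nb E (set (g i)) w1) + card (nb E (set (g i)) w2)"
  have 2: "(\<Sum>i<m. ?s i) + 2 + 7 \<le> 4 + tot g + 7 * m"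
  proof (rule path_bound_sum)
    show "?s i0 \<le> 4"
      using i0_free[OF _ R4(1)] i0_free[OF _ R4(2)] i0_free[OF _ R4(3)] i0_free[OF _ R4(4)] l7 by linarith
  qed (use four_bound[OF a b u(1-3) w(1-3)] in blast)
  have 3: "(\<Sum>i<m. ?s i) = (\<Sum>i<m. card (nb E (set (g i)) u1)) + (\<Sum>i<m. card (nb E (set (g i)) u2))
     + (\<Sum>i<m. card (nb E (set (g i)) w1)) + (\<Sum>i<m. card (nb E (set (g i)) w2))"
    by (simp add: sum.distrib)
  note f = free_deg(1)[OF R4(1)] free_deg(1)[OF R4(2)] free_deg(1)[OF R4(3)] free_deg(1)[OF R4(4)]
  show False using 1 2 3 f u(4) w(4) card_V cardV d6 m1 unfolding distrib_left by linarith
qed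

end

text \<open>If \<open>H\<close> itself is not linked, the free part of an optimal family for a
  failing choice of ends contains \<open>L\<close>. The hypotheses are made for the neighbourhood of
  a vertex of degree at most \<open>2 * lam\<close> all of whose edges lie in at least
  \<open>lam - 1\<close> triangles, with \<open>d = lam - 1\<close>.\<close>

theorem dense_contains_mlinked:
  assumes H: "finite H" "sym_irrefl E" "H \<noteq> {}" and md: "\<And>p. p \<in> H \<Longrightarrow> d \<le> card (nb E H p)"
    and cH: "card H \<le> 2 * d + 2" and d6: "6 * m \<le> d + 4" and m1: "1 \<le> m" and d16: "99 * m \<le> 16 * d + 84"
  shows "\<exists>L\<subseteq>H. 2 * m \<le> card L \<and> mlinked m L E"
proof (cases "mlinked m H E")
  case True
  obtain p where p: "p \<in> H" using H(3) by blast
  have "insert p (nb E H p) \<subseteq> H" using p by blast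
  then have "card (insert p (nb E H p)) \<le> card H" by (rule card_mono[OF H(1)])
  then have "card (nb E H p) < card H" using H(1) sym_irreflD(2)[OF H(2)] by simp
  then have "2 * m \<le> card H" using md[OF p] d6 m1 by linarith
  then show ?thesis using True by blast
next
  case False
  then obtain x y :: "nat \<Rightarrow> 'a" where xy: "(\<forall>i<m. x i \<in> H \<and> y i \<in> H) \<and> (\<forall>i<m. \<forall>j<m. x i \<noteq> y j)
        \<and> (\<forall>i<m. \<forall>j<m. i \<noteq> j \<longrightarrow> x i \<noteq> x j \<and> y i \<noteq> y j)"
    and nP: "\<not> (\<exists>P :: nat \<Rightarrow> 'a list. (\<forall>i<m. is_path H E (P i) \<and> hd (P i) = x i \<and> last (P i) = y i)
         \<and> (\<forall>i<m. \<forall>j<m. i \<noteq> j \<longrightarrow> set (P i) \<inter> set (P j) = {}))"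
    unfolding mlinked_def by blast
  interpret linkage_problem H E m x y 7 by unfold_locales (use H xy in auto)
  have nl: "\<And>g. valid g \<Longrightarrow> unl g \<noteq> 0" using unl0_paths nP by blast
  obtain g i0 where g: "valid g" "i0 < m" "\<not> successively E (g i0)"
    "\<And>g' i'. valid g' \<Longrightarrow> i' < m \<Longrightarrow> \<not> successively E (g' i') \<Longrightarrow>
      unl g < unl g' \<or> (unl g = unl g' \<and> (tot g < tot g' \<or> (tot g = tot g' \<and> closed g i0 \<le> closed g' i')))"
    using optimum_exists[OF nl] by blast
  interpret A: large_linkage H E m x y 7 g i0 "x i0" "y i0" d
    by unfold_locales (use g nl md cH d6 in \<open>blast | simp\<close>)+
  interpret B: large_linkage H E m x y 7 g i0 "y i0" "x i0" d by (rule A.swapped)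
  have sub: "free g \<subseteq> H" by (rule A.R_facts(1))
  show ?thesis
  proof (cases "(\<exists>a\<in>free g. E (x i0) a) \<and> (\<exists>b\<in>free g. E (y i0) b)")
    case True
    then show ?thesis using A.open_case by blast
  next
    case False
    then show ?thesis using A.closed_case[OF _ d16] B.closed_case[OF _ d16] sub by blast
  qed
qed

section \<open>Linked sets in massed graphs\<close>

definition pairing :: "'a set \<Rightarrow> ('a \<times> 'a) set \<Rightarrow> bool" where
  "pairing X Pr \<longleftrightarrow> Pr \<subseteq> X \<times> X \<and> (\<forall>p\<in>Pr. fst p \<noteq> snd p)
     \<and> (\<forall>p\<in>Pr. \<forall>q\<in>Pr. p \<noteq> q \<longrightarrow> {fst p, snd p} \<inter> {fst q, snd q} = {})"

text \<open>Sets in which the ends are connected take the place of paths: virtual edges can be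
  replaced and contractions undone without making the result a simple path again.\<close>

definition linkable :: "'a set \<Rightarrow> ('a \<Rightarrow> 'a \<Rightarrow> bool) \<Rightarrow> 'a set \<Rightarrow> ('a \<times> 'a) set \<Rightarrow> bool" where
  "linkable V E X Pr \<longleftrightarrow> (\<exists>S :: 'a \<times> 'a \<Rightarrow> 'a set.
     (\<forall>p\<in>Pr. S p \<subseteq> V \<and> S p \<inter> X = {fst p, snd p} \<and> reach E (S p) (fst p) (snd p))
     \<and> (\<forall>p\<in>Pr. \<forall>q\<in>Pr. p \<noteq> q \<longrightarrow> S p \<inter> S q = {}))"

definition linked :: "'a set \<Rightarrow> ('a \<Rightarrow> 'a \<Rightarrow> bool) \<Rightarrow> 'a set \<Rightarrow> bool" where
  "linked V E X \<longleftrightarrow> (\<forall>Pr. pairing X Pr \<longrightarrow> linkable V E X Pr)"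

text \<open>A separation, of order \<open>card (A \<inter> B)\<close>.\<close>

definition split :: "'a set \<Rightarrow> ('a \<Rightarrow> 'a \<Rightarrow> bool) \<Rightarrow> 'a set \<Rightarrow> 'a set \<Rightarrow> bool" where
  "split V E A B \<longleftrightarrow> A \<union> B = V \<and> (\<forall>a\<in>A - B. \<forall>b\<in>B - A. \<not> E a b)"

lemma linkableI:
  assumes "\<And>p. p \<in> Pr \<Longrightarrow> S p \<subseteq> V \<and> S p \<inter> X = {fst p, snd p} \<and> reach E (S p) (fst p) (snd p)"
    and "\<And>p q. p \<in> Pr \<Longrightarrow> q \<in> Pr \<Longrightarrow> p \<noteq> q \<Longrightarrow> S p \<inter> S q = {}"
  shows "linkable V E X Pr"
  unfolding linkable_def by (rule exI[of _ S]) (use assms in simp)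

lemma linkableE:
  assumes "linkable V E X Pr"
  obtains S where "\<And>p. p \<in> Pr \<Longrightarrow> S p \<subseteq> V" "\<And>p. p \<in> Pr \<Longrightarrow> S p \<inter> X = {fst p, snd p}"
    "\<And>p. p \<in> Pr \<Longrightarrow> reach E (S p) (fst p) (snd p)"
    "\<And>p q. p \<in> Pr \<Longrightarrow> q \<in> Pr \<Longrightarrow> p \<noteq> q \<Longrightarrow> S p \<inter> S q = {}"
  using assms[unfolded linkable_def]
proof (elim exE conjE)
  fix S :: "'a \<times> 'a \<Rightarrow> 'a set"
  assume a: "\<forall>p\<in>Pr. S p \<subseteq> V \<and> S p \<inter> X = {fst p, snd p} \<and> reach E (S p) (fst p) (snd p)"
    and b: "\<forall>p\<in>Pr. \<forall>q\<in>Pr. p \<noteq> q \<longrightarrow> S p \<inter> S q = {}"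
  show thesis by (rule that[of S]) (use a b in simp_all)
qed

lemma linkedD: "linked V E X \<Longrightarrow> pairing X Pr \<Longrightarrow> linkable V E X Pr"
  unfolding linked_def by simp

lemma pairingD:
  assumes "pairing X Pr"
  shows "p \<in> Pr \<Longrightarrow> fst p \<in> X" "p \<in> Pr \<Longrightarrow> snd p \<in> X" "p \<in> Pr \<Longrightarrow> fst p \<noteq> snd p"
    "p \<in> Pr \<Longrightarrow> q \<in> Pr \<Longrightarrow> p \<noteq> q \<Longrightarrow> fst p \<noteq> fst q \<and> fst p \<noteq> snd q \<and> snd p \<noteq> fst q \<and> snd p \<noteq> snd q"
  using assms unfolding pairing_def by fastforce+

lemma pairingI:
  assumes "\<And>p. p \<in> Pr \<Longrightarrow> fst p \<in> X \<and> snd p \<in> X \<and> fst p \<noteq> snd p"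
    and "\<And>p q. p \<in> Pr \<Longrightarrow> q \<in> Pr \<Longrightarrow> p \<noteq> q \<Longrightarrow> fst p \<noteq> fst q \<and> fst p \<noteq> snd q \<and> snd p \<noteq> fst q \<and> snd p \<noteq> snd q"
  shows "pairing X Pr"
  unfolding pairing_def
proof (intro conjI ballI impI)
  show "Pr \<subseteq> X \<times> X" using assms(1) by force
  show "fst p \<noteq> snd p" if "p \<in> Pr" for p using assms(1)[OF that] by simp
  show "{fst p, snd p} \<inter> {fst q, snd q} = {}" if "p \<in> Pr" "q \<in> Pr" "p \<noteq> q" for p q
    using assms(2)[OF that] by simp
qed

lemma reach_lift:
  assumes "reach E S a b" "S \<subseteq> S'" "\<And>a b. a \<in> S \<Longrightarrow> b \<in> S \<Longrightarrow> E a b \<Longrightarrow> reach E' S' a b"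
  shows "reach E' S' a b"
proof -
  have "(\<lambda>a b. E a b \<and> a \<in> S \<and> b \<in> S)\<^sup>*\<^sup>* a b" using assms(1) unfolding reach_def by simp
  then show ?thesis
  proof (induction rule: rtranclp_induct)
    case base
    then show ?case using reach_mem(1)[OF assms(1)] assms(2) by (intro reach_refl) blast
  next
    case (step y z)
    then show ?case using assms(3)[of y z] reach_trans[of E' S' a y z] by blast
  qed
qed

lemma linked_subset:
  assumes "linked V E X" "Y \<subseteq> X"
  shows "linked V E Y"
  unfolding linked_def
proof (intro allI impI)
  fix Pr assume p: "pairing Y Pr"
  then have "pairing X Pr" using assms(2) pairingD[OF p] by (intro pairingI) auto
  note pQ = this
  obtain S where S: "\<And>p. p \<in> Pr \<Longrightarrow> S p \<subseteq> V" "\<And>p. p \<in> Pr \<Longrightarrow> S p \<inter> X = {fst p, snd p}"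
    "\<And>p. p \<in> Pr \<Longrightarrow> reach E (S p) (fst p) (snd p)" "\<And>p q. p \<in> Pr \<Longrightarrow> q \<in> Pr \<Longrightarrow> p \<noteq> q \<Longrightarrow> S p \<inter> S q = {}" by (rule linkableE[OF linkedD[OF assms(1) pQ]]) (rule that)
  have "S p \<inter> Y = {fst p, snd p}" if "p \<in> Pr" for p
    using S(2)[OF that] pairingD(1,2)[OF p that] assms(2) by blast
  then show "linkable V E Y Pr" using S by (intro linkableI[of Pr S]) auto
qed

text \<open>Everything between the first and the last vertex of the clique can be skipped by one
  virtual edge.\<close>

lemma reach_through_clique:
  assumes "reach (\<lambda>a b. E a b \<or> a \<in> K \<and> b \<in> K \<and> a \<noteq> b) S x y"
  shows "reach E S x y \<or> (\<exists>f l. f \<in> S \<inter> K \<and> l \<in> S \<inter> K \<and> f \<noteq> l \<and> reach E S x f \<and> reach E S l y)"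
proof -
  let ?E = "\<lambda>a b. E a b \<or> a \<in> K \<and> b \<in> K \<and> a \<noteq> b"
  have "(\<lambda>a b. ?E a b \<and> a \<in> S \<and> b \<in> S)\<^sup>*\<^sup>* x y" using assms unfolding reach_def by simp
  then show ?thesis
  proof (induction rule: rtranclp_induct)
    case base
    then show ?case using reach_mem(1)[OF assms] reach_refl by fast
  next
    case (step y z)
    then have yz: "y \<in> S" "z \<in> S" by auto
    have ext: "reach E S p z" if "reach E S p y" "E y z" for p
      using reach_trans[OF that(1) reach_edge[of y S z E]] yz that(2) by blast
    show ?case
    proof (cases "E y z")
      case True
      then show ?thesis using step.IH ext by blast
    next
      case False
      then have k: "y \<in> K" "z \<in> K" "y \<noteq> z" using step by auto
      have rz: "reach E S z z" using yz by (simp add: reach_refl)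
      from step.IH show ?thesis
      proof
        assume "reach E S x y"
        then show ?thesis using k yz rz by blast
      next
        assume "\<exists>f l. f \<in> S \<inter> K \<and> l \<in> S \<inter> K \<and> f \<noteq> l \<and> reach E S x f \<and> reach E S l y"
        then obtain f l where "f \<in> S \<inter> K" "reach E S x f" by blast
        then show ?thesis using k yz rz by (cases "f = z") auto
      qed
    qed
  qed
qed

text \<open>Each pair needs at most one virtual edge, from \<open>F p\<close> to \<open>L p\<close>.
  These edges form a pairing of \<open>A \<inter> B\<close>, which is linked in \<open>B\<close>;
  its linkage sets meet \<open>A\<close> only in \<open>F p\<close> and \<open>L p\<close>, so the
  enlarged sets stay disjoint.\<close>

lemma linkable_replace_clique:
  assumes sp: "split V E A B" and X: "X \<subseteq> A" and B: "linked B E (A \<inter> B)"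
    and l: "linkable A (\<lambda>a b. E a b \<or> a \<in> A \<inter> B \<and> b \<in> A \<inter> B \<and> a \<noteq> b) X Pr"
  shows "linkable V E X Pr"
proof -
  let ?K = "A \<inter> B"
  let ?E = "\<lambda>a b. E a b \<or> a \<in> ?K \<and> b \<in> ?K \<and> a \<noteq> b"
  obtain S where S0: "\<And>p. p \<in> Pr \<Longrightarrow> S p \<subseteq> A" "\<And>p. p \<in> Pr \<Longrightarrow> S p \<inter> X = {fst p, snd p}"
    "\<And>p. p \<in> Pr \<Longrightarrow> reach ?E (S p) (fst p) (snd p)" "\<And>p q. p \<in> Pr \<Longrightarrow> q \<in> Pr \<Longrightarrow> p \<noteq> q \<Longrightarrow> S p \<inter> S q = {}" by (rule linkableE[OF l]) (rule that)
  define bad where "bad p \<longleftrightarrow> \<not> reach E (S p) (fst p) (snd p)" for p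
  have "\<forall>p. \<exists>f l. p \<in> Pr \<and> bad p \<longrightarrow> f \<in> S p \<inter> ?K \<and> l \<in> S p \<inter> ?K \<and> f \<noteq> l \<and> reach E (S p) (fst p) f \<and> reach E (S p) l (snd p)"
    using reach_through_clique[OF S0(3)] unfolding bad_def by metis
  then obtain F L where FL: "\<And>p. p \<in> Pr \<Longrightarrow> bad p \<Longrightarrow> F p \<in> S p \<inter> ?K \<and> L p \<in> S p \<inter> ?K \<and> F p \<noteq> L p
      \<and> reach E (S p) (fst p) (F p) \<and> reach E (S p) (L p) (snd p)" by metis
  let ?Q = "(\<lambda>p. (F p, L p)) ` {p \<in> Pr. bad p}"
  have FLd: "F p \<noteq> F q" "F p \<noteq> L q" "L p \<noteq> F q" "L p \<noteq> L q" if "p \<in> Pr" "q \<in> Pr" "p \<noteq> q" "bad p" "bad q" for p q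
  proof -
    have "F p \<in> S p" "L p \<in> S p" "F q \<in> S q" "L q \<in> S q" using FL[OF that(1,4)] FL[OF that(2,5)] by simp_all
    then show "F p \<noteq> F q" "F p \<noteq> L q" "L p \<noteq> F q" "L p \<noteq> L q" using S0(4)[OF that(1-3)] by (metis disjoint_iff)+
  qed
  have "pairing ?K ?Q"
  proof (rule pairingI)
    fix q assume "q \<in> ?Q"
    then obtain p where p: "p \<in> Pr" "bad p" "q = (F p, L p)" by blast
    show "fst q \<in> ?K \<and> snd q \<in> ?K \<and> fst q \<noteq> snd q" using FL[OF p(1,2)] unfolding p(3) by simp
  next
    fix q q' assume q: "q \<in> ?Q" "q' \<in> ?Q" "q \<noteq> q'"
    then obtain p p' where p: "p \<in> Pr" "bad p" "q = (F p, L p)" "p' \<in> Pr" "bad p'" "q' = (F p', L p')" by blast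
    then have "p \<noteq> p'" using q by blast
    then show "fst q \<noteq> fst q' \<and> fst q \<noteq> snd q' \<and> snd q \<noteq> fst q' \<and> snd q \<noteq> snd q'"
      using FLd[OF p(1,4) _ p(2,5)] unfolding p(3,6) by simp
  qed
  note pQ = this
  obtain T where T: "\<And>p. p \<in> ?Q \<Longrightarrow> T p \<subseteq> B" "\<And>p. p \<in> ?Q \<Longrightarrow> T p \<inter> ?K = {fst p, snd p}"
    "\<And>p. p \<in> ?Q \<Longrightarrow> reach E (T p) (fst p) (snd p)" "\<And>p q. p \<in> ?Q \<Longrightarrow> q \<in> ?Q \<Longrightarrow> p \<noteq> q \<Longrightarrow> T p \<inter> T q = {}" by (rule linkableE[OF linkedD[OF B pQ]]) (rule that)
  have T1: "T (F p, L p) \<subseteq> B" "T (F p, L p) \<inter> ?K = {F p, L p}" "reach E (T (F p, L p)) (F p) (L p)"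
    if "p \<in> Pr" "bad p" for p
  proof -
    have q: "(F p, L p) \<in> ?Q" using that by blast
    show "T (F p, L p) \<subseteq> B" "T (F p, L p) \<inter> ?K = {F p, L p}" "reach E (T (F p, L p)) (F p) (L p)"
      using T(1-3)[OF q] by simp_all
  qed
  define S' where "S' p = (if bad p then S p \<union> T (F p, L p) else S p)" for p
  have TA: "T (F p, L p) \<inter> A \<subseteq> S p" if "p \<in> Pr" "bad p" for p
  proof
    fix t assume t: "t \<in> T (F p, L p) \<inter> A"
    then have "t \<in> T (F p, L p) \<inter> ?K" using T1(1)[OF that] by auto
    then have "t = F p \<or> t = L p" unfolding T1(2)[OF that] by simp
    then show "t \<in> S p" using FL[OF that] by auto
  qed
  have "S' p \<subseteq> V \<and> S' p \<inter> X = {fst p, snd p} \<and> reach E (S' p) (fst p) (snd p)" if p: "p \<in> Pr" for p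
  proof (cases "bad p")
    case False
    then show ?thesis using S0(1-3)[OF p] sp unfolding S'_def bad_def split_def by auto
  next
    case True
    have "S' p \<inter> X = S p \<inter> X" using TA[OF p True] X True unfolding S'_def by auto
    moreover have "S' p \<subseteq> V" using S0(1)[OF p] T1[OF p True] True sp unfolding S'_def split_def by auto
    moreover have "reach E (S' p) (fst p) (snd p)"
    proof -
      have "reach E (S' p) (fst p) (F p)" "reach E (S' p) (L p) (snd p)"
        using FL[OF p True] True unfolding S'_def by (auto intro: reach_mono)
      moreover have "reach E (S' p) (F p) (L p)"
        by (rule reach_mono[OF T1(3)[OF p True]]) (use True in \<open>auto simp: S'_def\<close>)
      ultimately show ?thesis by (meson reach_trans)
    qed
    ultimately show ?thesis using S0(2)[OF p] by simp
  qed
  moreover have "S' p \<inter> S' q = {}" if p: "p \<in> Pr" "q \<in> Pr" "p \<noteq> q" for p q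
  proof -
    have 0: "S p \<inter> S q = {}" by (rule S0(4)[OF p])
    have 1: "T (F p, L p) \<inter> S q = {}" if "bad p"
      using TA[OF p(1) that] S0(1)[OF p(2)] 0 by (simp add: disjoint_iff subset_iff) metis
    have 2: "T (F q, L q) \<inter> S p = {}" if "bad q"
      using TA[OF p(2) that] S0(1)[OF p(1)] 0 by (simp add: disjoint_iff subset_iff) metis
    have 3: "T (F p, L p) \<inter> T (F q, L q) = {}" if b: "bad p" "bad q"
    proof -
      have "(F p, L p) \<noteq> (F q, L q)" using FLd(1)[OF p b] by simp
      then show ?thesis using p b by (intro T(4)) blast+
    qed
    show ?thesis unfolding S'_def using 0 1 2 3 by auto
  qed
  ultimately show ?thesis by (rule linkableI)
qed

text \<open>As the order is minimal, Menger's theorem inside \<open>B \<inter> C\<close> gives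
  disjoint paths from all of \<open>A \<inter> B\<close> to \<open>C \<inter> D\<close>; linkages in
  \<open>D\<close> between their other ends are prolonged along them.\<close>

lemma linked_along_minimal_split:
  assumes fin: "finite V" and E: "sym_irrefl E" and CD: "split V E C D" and AB: "split V E A B"
    and XA: "X \<subseteq> A" and AC: "A \<subseteq> C" and DB: "D \<subseteq> B"
    and min: "\<And>A' B'. split V E A' B' \<Longrightarrow> X \<subseteq> A' \<Longrightarrow> A' \<subseteq> C \<Longrightarrow> D \<subseteq> B' \<Longrightarrow> card (A \<inter> B) \<le> card (A' \<inter> B')"
    and D: "\<And>Y. Y \<subseteq> C \<inter> D \<Longrightarrow> card Y \<le> card (A \<inter> B) \<Longrightarrow> linked D E Y"
  shows "linked B E (A \<inter> B)"
proof -
  let ?U = "B \<inter> C" and ?s = "card (A \<inter> B)"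
  have VAB: "A \<union> B = V" "C \<union> D = V" using AB CD unfolding split_def by auto
  have "\<exists>P :: nat \<Rightarrow> 'a list.
     (\<forall>i<?s. is_path ?U E (P i) \<and> set (P i) \<inter> (A \<inter> B) = {hd (P i)} \<and> set (P i) \<inter> (C \<inter> D) = {last (P i)})
     \<and> (\<forall>i<?s. \<forall>j<?s. i \<noteq> j \<longrightarrow> set (P i) \<inter> set (P j) = {})"
  proof (rule menger)
    show "finite ?U" using fin VAB finite_subset by blast
    show "A \<inter> B \<subseteq> ?U" "C \<inter> D \<subseteq> ?U" using AC DB by auto
    fix Z assume Z: "Z \<subseteq> ?U" "\<forall>p. is_path ?U E p \<and> hd p \<in> A \<inter> B \<and> last p \<in> C \<inter> D \<longrightarrow> set p \<inter> Z \<noteq> {}"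
    \<comment> \<open>A set \<open>Z\<close> that meets all paths is the separator of another split:
      what can be reached from \<open>A \<inter> B\<close> without \<open>Z\<close> moves to the
      near side.\<close>
    define R where "R = {w. \<exists>a\<in>A \<inter> B - Z. reach E (?U - Z) a w}"
    have RU: "R \<subseteq> ?U - Z" unfolding R_def using reach_mem(2) by fast
    have start: "A \<inter> B - Z \<subseteq> R" unfolding R_def using AC by (auto intro!: reach_refl bexI)
    have RD: "R \<inter> D = {}"
    proof (rule ccontr)
      assume "R \<inter> D \<noteq> {}"
      then obtain w a where w: "w \<in> D" "a \<in> A \<inter> B - Z" "reach E (?U - Z) a w" unfolding R_def by blast
      from reach_path[OF w(3)] obtain p where p: "is_path (?U - Z) E p" "hd p = a" "last p = w" by blast
      have "w \<in> C" using reach_mem(2)[OF w(3)] by blast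
      moreover have "is_path ?U E p" using p(1) unfolding is_path_iff by blast
      ultimately have "set p \<inter> Z \<noteq> {}" using Z(2) p w by blast
      then show False using p(1) unfolding is_path_iff by blast
    qed
    let ?A = "A \<union> R \<union> Z" and ?B = "B - R"
    have int: "?A \<inter> ?B = Z" using start RU Z(1) by blast
    have "split V E ?A ?B" unfolding split_def
    proof (intro conjI ballI)
      show "?A \<union> ?B = V" using VAB RU Z(1) by blast
      fix p q assume p: "p \<in> ?A - ?B" and q: "q \<in> ?B - ?A"
      show "\<not> E p q"
      proof
        assume e: "E p q"
        have qB: "q \<in> B" "q \<notin> A" "q \<notin> R" "q \<notin> Z" using q by auto
        show False
        proof (cases "p \<in> R")
          case False
          then have "p \<in> A - B" using p Z(1) by blast
          then show False using AB qB e unfolding split_def by blast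
        next
          case True
          show False
          proof (cases "q \<in> C")
            case True
            obtain a where a: "a \<in> A \<inter> B - Z" "reach E (?U - Z) a p" using \<open>p \<in> R\<close> unfolding R_def by blast
            have "reach E (?U - Z) p q" using \<open>p \<in> R\<close> RU qB True e by (intro reach_edge) auto
            then have "q \<in> R" using a reach_trans unfolding R_def by fast
            then show False using qB by blast
          next
            case False
            then have "q \<in> D - C" using qB VAB by blast
            moreover have "p \<in> C - D" using \<open>p \<in> R\<close> RU RD by blast
            ultimately show False using CD e unfolding split_def by blast
          qed
        qed
      qed
    qed
    moreover have "X \<subseteq> ?A" "?A \<subseteq> C" "D \<subseteq> ?B" using XA AC DB RU RD Z(1) by blast+
    ultimately have "?s \<le> card (?A \<inter> ?B)" by (rule min)
    then show "?s \<le> card Z" using int by simp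
  qed
  then obtain P :: "nat \<Rightarrow> 'a list" where P0:
      "\<forall>i<?s. is_path ?U E (P i) \<and> set (P i) \<inter> (A \<inter> B) = {hd (P i)} \<and> set (P i) \<inter> (C \<inter> D) = {last (P i)}"
      "\<forall>i<?s. \<forall>j<?s. i \<noteq> j \<longrightarrow> set (P i) \<inter> set (P j) = {}" by (elim exE conjE)
  have P: "\<And>i. i < ?s \<Longrightarrow> is_path ?U E (P i)"
      "\<And>i. i < ?s \<Longrightarrow> set (P i) \<inter> (A \<inter> B) = {hd (P i)}" "\<And>i. i < ?s \<Longrightarrow> set (P i) \<inter> (C \<inter> D) = {last (P i)}"
      "\<And>i j. i < ?s \<Longrightarrow> j < ?s \<Longrightarrow> i \<noteq> j \<Longrightarrow> set (P i) \<inter> set (P j) = {}"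
    using P0 by blast+
  have finAB: "finite (A \<inter> B)" using fin VAB finite_subset by blast
  have inj: "inj_on (\<lambda>i. hd (P i)) {..<?s}"
  proof (rule inj_onI, rule ccontr)
    fix i j assume ij: "i \<in> {..<?s}" "j \<in> {..<?s}" "hd (P i) = hd (P j)" "i \<noteq> j"
    then have "set (P i) \<inter> set (P j) = {}" using P(4) by blast
    moreover have "hd (P i) \<in> set (P i)" "hd (P j) \<in> set (P j)" using P(2) ij by blast+
    ultimately show False using ij(3) by auto
  qed
  have img: "(\<lambda>i. hd (P i)) ` {..<?s} = A \<inter> B"
    by (rule card_subset_eq[OF finAB]) (use P(2) inj in \<open>auto simp: card_image\<close>)
  define ix where "ix a = (SOME i. i < ?s \<and> hd (P i) = a)" for a
  have ix: "ix a < ?s \<and> hd (P (ix a)) = a" if "a \<in> A \<inter> B" for a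
  proof -
    have "a \<in> (\<lambda>i. hd (P i)) ` {..<?s}" using that img by simp
    then have "\<exists>i. i < ?s \<and> hd (P i) = a" by (elim imageE) auto
    then show ?thesis unfolding ix_def by (rule someI_ex)
  qed
  define Q where "Q a = set (P (ix a))" for a
  define f where "f a = last (P (ix a))" for a
  have Q: "Q a \<subseteq> ?U" "Q a \<inter> (A \<inter> B) = {a}" "Q a \<inter> (C \<inter> D) = {f a}" "reach E (Q a) a (f a)" if "a \<in> A \<inter> B" for a
  proof -
    have i: "ix a < ?s" "hd (P (ix a)) = a" using ix[OF that] by auto
    show "Q a \<subseteq> ?U" using P(1)[OF i(1)] unfolding Q_def is_path_iff by blast
    show "Q a \<inter> (A \<inter> B) = {a}" using P(2)[OF i(1)] i(2) unfolding Q_def by simp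
    show "Q a \<inter> (C \<inter> D) = {f a}" using P(3)[OF i(1)] unfolding Q_def f_def by simp
    show "reach E (Q a) a (f a)" using reach_walk[of "P (ix a)" E "Q a"] P(1)[OF i(1)] i(2)
      unfolding Q_def f_def is_path_iff by auto
  qed
  have Qd: "Q a \<inter> Q b = {}" if "a \<in> A \<inter> B" "b \<in> A \<inter> B" "a \<noteq> b" for a b
    using P(4)[of "ix a" "ix b"] ix[OF that(1)] ix[OF that(2)] that(3) unfolding Q_def by metis
  have fi: "f a \<noteq> f b" if "a \<in> A \<inter> B" "b \<in> A \<inter> B" "a \<noteq> b" for a b
    using Qd[OF that] Q(3)[OF that(1)] Q(3)[OF that(2)] by blast
  let ?Y = "f ` (A \<inter> B)"
  have lY: "linked D E ?Y"
  proof (rule D)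
    show "?Y \<subseteq> C \<inter> D" using Q(3) by blast
    show "card ?Y \<le> ?s" using card_image_le[OF finAB] by blast
  qed
  show ?thesis unfolding linked_def
  proof (intro allI impI)
    fix Pr assume pr: "pairing (A \<inter> B) Pr"
    note pm = pairingD(1-3)[OF pr]
    have pd: "fst p \<noteq> fst q" "fst p \<noteq> snd q" "snd p \<noteq> fst q" "snd p \<noteq> snd q" if "p \<in> Pr" "q \<in> Pr" "p \<noteq> q" for p q
      using pairingD(4)[OF pr that] by blast+
    let ?h = "\<lambda>p. (f (fst p), f (snd p))"
    have hd': "f (fst p) \<noteq> f (fst q) \<and> f (fst p) \<noteq> f (snd q) \<and> f (snd p) \<noteq> f (fst q) \<and> f (snd p) \<noteq> f (snd q)"
      if "p \<in> Pr" "q \<in> Pr" "p \<noteq> q" for p q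
      using fi pm(1,2)[OF that(1)] pm(1,2)[OF that(2)] pd[OF that] by simp
    have "pairing ?Y (?h ` Pr)"
    proof (rule pairingI)
      show "fst q \<in> ?Y \<and> snd q \<in> ?Y \<and> fst q \<noteq> snd q" if "q \<in> ?h ` Pr" for q
        using that fi pm by auto
      fix q q' assume q: "q \<in> ?h ` Pr" "q' \<in> ?h ` Pr" "q \<noteq> q'"
      then obtain p p' where p: "p \<in> Pr" "q = ?h p" "p' \<in> Pr" "q' = ?h p'" by blast
      then have "p \<noteq> p'" using q by blast
      from hd'[OF p(1,3) this] show "fst q \<noteq> fst q' \<and> fst q \<noteq> snd q' \<and> snd q \<noteq> fst q' \<and> snd q \<noteq> snd q'"
        unfolding p(2,4) by simp
    qed
    note pQ = this
    obtain T where T: "\<And>q. q \<in> ?h ` Pr \<Longrightarrow> T q \<subseteq> D" "\<And>q. q \<in> ?h ` Pr \<Longrightarrow> T q \<inter> ?Y = {fst q, snd q}"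
      "\<And>q. q \<in> ?h ` Pr \<Longrightarrow> reach E (T q) (fst q) (snd q)" "\<And>q q'. q \<in> ?h ` Pr \<Longrightarrow> q' \<in> ?h ` Pr \<Longrightarrow> q \<noteq> q' \<Longrightarrow> T q \<inter> T q' = {}" by (rule linkableE[OF linkedD[OF lY pQ]]) (rule that)
    have T1: "T (?h p) \<subseteq> D" "T (?h p) \<inter> ?Y = {f (fst p), f (snd p)}" "reach E (T (?h p)) (f (fst p)) (f (snd p))"
      if "p \<in> Pr" for p using T(1-3)[OF imageI[OF that]] by simp_all
    have QT: "Q a \<inter> T (?h p) = {}" if "a \<in> A \<inter> B" "p \<in> Pr" "a \<noteq> fst p" "a \<noteq> snd p" for a p
    proof -
      have "Q a \<inter> T (?h p) \<subseteq> {f a}" using Q(1,3)[OF that(1)] T1(1)[OF that(2)] by blast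
      moreover have "f a \<notin> T (?h p)"
        using T1(2)[OF that(2)] that fi[OF that(1) pm(1)[OF that(2)]] fi[OF that(1) pm(2)[OF that(2)]] by blast
      ultimately show ?thesis by blast
    qed
    have TAB: "T (?h p) \<inter> (A \<inter> B) \<subseteq> {fst p, snd p}" if "p \<in> Pr" for p
    proof
      fix t assume t: "t \<in> T (?h p) \<inter> (A \<inter> B)"
      then have "t \<in> Q t" using Q(2)[of t] by blast
      then have "Q t \<inter> T (?h p) \<noteq> {}" using t by blast
      then show "t \<in> {fst p, snd p}" using QT[of t p] t that by blast
    qed
    define S where "S p = Q (fst p) \<union> T (?h p) \<union> Q (snd p)" for p
    have "S p \<subseteq> B \<and> S p \<inter> (A \<inter> B) = {fst p, snd p} \<and> reach E (S p) (fst p) (snd p)" if p: "p \<in> Pr" for p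
    proof (intro conjI)
      note q1 = Q[OF pm(1)[OF p]] and q2 = Q[OF pm(2)[OF p]]
      show "S p \<subseteq> B" unfolding S_def using q1(1) q2(1) T1(1)[OF p] DB by blast
      show "S p \<inter> (A \<inter> B) = {fst p, snd p}" unfolding S_def using q1(2) q2(2) TAB[OF p] by blast
      have "reach E (S p) (fst p) (f (fst p))" by (rule reach_mono[OF q1(4)]) (auto simp: S_def)
      moreover have "reach E (S p) (f (fst p)) (f (snd p))" by (rule reach_mono[OF T1(3)[OF p]]) (auto simp: S_def)
      moreover have "reach E (S p) (f (snd p)) (snd p)" by (rule reach_mono[OF reach_sym[OF E q2(4)]]) (auto simp: S_def)
      ultimately show "reach E (S p) (fst p) (snd p)" by (meson reach_trans)
    qed
    moreover have "S p \<inter> S q = {}" if p: "p \<in> Pr" "q \<in> Pr" "p \<noteq> q" for p q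
    proof -
      note d = pd[OF p] and pq = pm(1,2)[OF p(1)] pm(1,2)[OF p(2)]
      have "T (?h p) \<inter> T (?h q) = {}"
      proof -
        have "?h p \<noteq> ?h q" using fi[OF pq(1,3) d(1)] by simp
        then show ?thesis using p by (intro T(4)) blast+
      qed
      moreover have "Q (fst p) \<inter> Q (fst q) = {}" "Q (fst p) \<inter> Q (snd q) = {}" "Q (snd p) \<inter> Q (fst q) = {}" "Q (snd p) \<inter> Q (snd q) = {}"
        using Qd pq d by blast+
      moreover have "Q (fst p) \<inter> T (?h q) = {}" "Q (snd p) \<inter> T (?h q) = {}" using QT[OF _ p(2)] pq d by blast+
      moreover have "Q (fst q) \<inter> T (?h p) = {}" "Q (snd q) \<inter> T (?h p) = {}" using QT[OF _ p(1)] pq d by metis+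
      ultimately show ?thesis unfolding S_def by blast
    qed
    ultimately show "linkable B E (A \<inter> B) Pr" by (rule linkableI)
  qed
qed

text \<open>Take a split of least order between \<open>X\<close> and \<open>D\<close>. If its order
  is \<open>card X\<close>, then \<open>(X, V)\<close> is also one of least order and yields the
  first alternative; otherwise the split itself yields the second.\<close>

lemma linked_or_linked_split:
  assumes fin: "finite V" and E: "sym_irrefl E" and CD: "split V E C D" and X: "X \<subseteq> C" and XD: "card X \<le> card D"
    and D: "\<And>Y. Y \<subseteq> C \<inter> D \<Longrightarrow> card Y \<le> card X \<Longrightarrow> linked D E Y"
  shows "linked V E X \<or> (\<exists>A B. split V E A B \<and> X \<subseteq> A \<and> card (A \<inter> B) < card X \<and> B - A \<noteq> {} \<and> linked B E (A \<inter> B))"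
proof -
  let ?c = "\<lambda>(A, B). split V E A B \<and> X \<subseteq> A \<and> A \<subseteq> C \<and> D \<subseteq> B"
  have VCD: "C \<union> D = V" using CD unfolding split_def by auto
  have init: "?c (X, V)" using VCD X unfolding split_def by auto
  obtain AB where AB: "?c AB" "\<And>y. ?c y \<Longrightarrow> card (fst AB \<inter> snd AB) \<le> card (fst y \<inter> snd y)"
    using ex_has_least_nat[of ?c "(X, V)" "\<lambda>(A, B). card (A \<inter> B)"] init by (auto simp: case_prod_beta)
  obtain A B where ab: "AB = (A, B)" by fastforce
  have c: "split V E A B" "X \<subseteq> A" "A \<subseteq> C" "D \<subseteq> B" using AB(1) ab by auto
  have min: "card (A \<inter> B) \<le> card (A' \<inter> B')" if "split V E A' B'" "X \<subseteq> A'" "A' \<subseteq> C" "D \<subseteq> B'" for A' B'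
    using AB(2)[of "(A', B')"] that ab by simp
  have XV: "X \<inter> V = X" using VCD X by blast
  have le: "card (A \<inter> B) \<le> card X" using min[of X V] init XV by auto
  show ?thesis
  proof (cases "card (A \<inter> B) = card X")
    case True
    have "linked V E (X \<inter> V)"
      by (rule linked_along_minimal_split[OF fin E CD, of X V X]) (use init min D XV True in auto)
    then show ?thesis using XV by simp
  next
    case False
    have finB: "finite B" using fin c(1) unfolding split_def by auto
    have "linked B E (A \<inter> B)"
      by (rule linked_along_minimal_split[OF fin E CD c(1-4)]) (use min D le in auto)
    moreover have "B - A \<noteq> {}"
    proof
      assume "B - A = {}"
      then have "A \<inter> B = B" by blast
      then have "card D \<le> card (A \<inter> B)" using card_mono[OF finB c(4)] by simp
      then show False using False le XD by simp
    qed
    ultimately show ?thesis using c False le by (metis le_neq_implies_less)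
  qed
qed

text \<open>\<open>mlinked\<close> does not by itself keep the paths away from the other vertices of
  \<open>Y\<close>. Therefore \<open>Pr\<close> is completed to \<open>m\<close> pairs that cover
  \<open>Y\<close>: every vertex of \<open>Y\<close> is then an end of some path, and disjointness
  keeps the other paths off it.\<close>

lemma mlinked_imp_linked:
  assumes ml: "mlinked m L E" and fin: "finite L" and mL: "2 * m \<le> card L" and YL: "Y \<subseteq> L" and Ym: "card Y \<le> 2 * m"
  shows "linked L E Y"
  unfolding linked_def
proof (intro allI impI)
  fix Pr assume pr: "pairing Y Pr"
  have finY: "finite Y" using fin YL finite_subset by blast
  have "Pr \<subseteq> Y \<times> Y" using pr unfolding pairing_def by simp
  then have finP: "finite Pr" using finY finite_subset by blast
  define r where "r = card Pr"
  obtain e where e: "bij_betw e {..<r} Pr" using ex_bij_betw_nat_finite[OF finP] unfolding r_def atLeast0LessThan by blast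
  have eP: "e i \<in> Pr" if "i < r" for i using e that unfolding bij_betw_def by blast
  have ei: "e i \<noteq> e j" if "i < r" "j < r" "i \<noteq> j" for i j using e that unfolding bij_betw_def inj_on_def by blast
  define W where "W = fst ` Pr \<union> snd ` Pr"
  have WY: "W \<subseteq> Y" using pairingD(1,2)[OF pr] unfolding W_def by blast
  have "inj_on fst Pr" by (rule inj_onI, rule ccontr) (use pairingD(4)[OF pr] in simp)
  moreover have "inj_on snd Pr" by (rule inj_onI, rule ccontr) (use pairingD(4)[OF pr] in simp)
  moreover have "fst ` Pr \<inter> snd ` Pr = {}"
  proof (rule ccontr)
    assume "fst ` Pr \<inter> snd ` Pr \<noteq> {}"
    then obtain p q where pq: "p \<in> Pr" "q \<in> Pr" "fst p = snd q" by auto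
    then show False using pairingD(3)[OF pr pq(1)] pairingD(4)[OF pr pq(1,2)] by (cases "p = q") auto
  qed
  ultimately have cW: "card W = 2 * r" using finP unfolding r_def W_def by (simp add: card_Un_disjoint card_image)
  have finW: "finite W" using finP unfolding W_def by simp
  have "card (L - Y) = card L - card Y" using finY YL by (simp add: card_Diff_subset)
  then have "2 * m - card Y \<le> card (L - Y)" using mL by simp
  then obtain Z where Z: "Z \<subseteq> L - Y" "card Z = 2 * m - card Y" "finite Z" by (rule obtain_subset_with_card_n)
  define YY where "YY = Y \<union> Z"
  have "Y \<inter> Z = {}" using Z(1) by blast
  then have cY: "card YY = 2 * m" unfolding YY_def using card_Un_disjoint[OF finY Z(3)] Z(2) Ym by simp
  have fY: "finite YY" unfolding YY_def using finY Z(3) by simp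
  have WY': "W \<subseteq> YY" using WY unfolding YY_def by blast
  have rm: "2 * r \<le> 2 * m" using card_mono[OF fY WY'] cW cY by simp
  have "card (YY - W) = 2 * m - 2 * r" using card_Diff_subset[OF finW WY'] cW cY by simp
  then obtain h where h: "bij_betw h {..<2 * m - 2 * r} (YY - W)"
    using ex_bij_betw_nat_finite[of "YY - W"] fY unfolding atLeast0LessThan by auto
  have hY: "h i \<in> YY - W" if "i < 2 * m - 2 * r" for i using h that unfolding bij_betw_def by blast
  have hi: "h i \<noteq> h j" if "i < 2 * m - 2 * r" "j < 2 * m - 2 * r" "i \<noteq> j" for i j
    using h that unfolding bij_betw_def inj_on_def by blast
  \<comment> \<open>First the pairs of \<open>Pr\<close>; the remaining vertices, even in number,
    are paired off consecutively.\<close>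
  define x where "x i = (if i < r then fst (e i) else h (2 * (i - r)))" for i
  define y where "y i = (if i < r then snd (e i) else h (2 * (i - r) + 1))" for i
  have W: "fst (e i) \<in> W" "snd (e i) \<in> W" if "i < r" for i using eP[OF that] unfolding W_def by blast+
  have hb: "2 * (i - r) < 2 * m - 2 * r \<and> 2 * (i - r) + 1 < 2 * m - 2 * r \<and> h (2 * (i - r)) \<in> YY - W \<and> h (2 * (i - r) + 1) \<in> YY - W"
    if "\<not> i < r" "i < m" for i
  proof -
    have "2 * (i - r) < 2 * m - 2 * r" "2 * (i - r) + 1 < 2 * m - 2 * r" using that by linarith+
    then show ?thesis using hY by blast
  qed
  have xL: "x i \<in> YY \<and> y i \<in> YY" if "i < m" for i
    using W[of i, THEN subsetD[OF WY']] hb[of i] hb[of i] that unfolding x_def y_def by auto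
  have xy: "x i \<noteq> y j" if ij: "i < m" "j < m" for i j
  proof (cases "i < r"; cases "j < r")
    assume a: "i < r" "j < r"
    then show ?thesis using pairingD(3)[OF pr eP[OF a(1)]] pairingD(4)[OF pr eP[OF a(1)] eP[OF a(2)]] unfolding x_def y_def
      by (cases "e i = e j") auto
  next
    assume a: "i < r" "\<not> j < r"
    then show ?thesis using W(1)[OF a(1)] hb[of j] ij unfolding x_def y_def by auto
  next
    assume a: "\<not> i < r" "j < r"
    then show ?thesis using W(2)[OF a(2)] hb[of i] ij unfolding x_def y_def by auto
  next
    assume a: "\<not> i < r" "\<not> j < r"
    have "2 * (i - r) \<noteq> 2 * (j - r) + 1" by presburger
    then show ?thesis using hi[of "2 * (i - r)" "2 * (j - r) + 1"] hb[of i] hb[of j] a ij unfolding x_def y_def by auto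
  qed
  have xx: "x i \<noteq> x j \<and> y i \<noteq> y j" if ij: "i < m" "j < m" "i \<noteq> j" for i j
  proof (cases "i < r"; cases "j < r")
    assume a: "i < r" "j < r"
    then show ?thesis using pairingD(4)[OF pr eP[OF a(1)] eP[OF a(2)] ei[OF a ij(3)]] unfolding x_def y_def by auto
  next
    assume a: "i < r" "\<not> j < r"
    then show ?thesis using W[OF a(1)] hb[of j] hb[of j] ij unfolding x_def y_def by auto
  next
    assume a: "\<not> i < r" "j < r"
    then show ?thesis using W[OF a(2)] hb[of i] hb[of i] ij unfolding x_def y_def by auto
  next
    assume a: "\<not> i < r" "\<not> j < r"
    then show ?thesis using hi[of "2 * (i - r)" "2 * (j - r)"] hi[of "2 * (i - r) + 1" "2 * (j - r) + 1"] hb[of i] hb[of j] a ij unfolding x_def y_def by auto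
  qed
  have YL': "YY \<subseteq> L" using YL Z(1) unfolding YY_def by blast
  have "(\<forall>i<m. x i \<in> L \<and> y i \<in> L) \<and> (\<forall>i<m. \<forall>j<m. x i \<noteq> y j) \<and> (\<forall>i<m. \<forall>j<m. i \<noteq> j \<longrightarrow> x i \<noteq> x j \<and> y i \<noteq> y j)"
    using xL xy xx YL' by blast
  from ml[unfolded mlinked_def, rule_format, OF this] obtain P :: "nat \<Rightarrow> 'a list" where P:
     "\<forall>i<m. is_path L E (P i) \<and> hd (P i) = x i \<and> last (P i) = y i"
     "\<forall>i<m. \<forall>j<m. i \<noteq> j \<longrightarrow> set (P i) \<inter> set (P j) = {}" by (elim exE conjE)
  have Pm: "x i \<in> set (P i)" "y i \<in> set (P i)" if "i < m" for i
  proof -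
    have "P i \<noteq> []" using P(1) that unfolding is_path_iff by blast
    then show "x i \<in> set (P i)" "y i \<in> set (P i)" using P(1) that hd_in_set[of "P i"] last_in_set[of "P i"] by auto
  qed
  have cover: "\<exists>j<m. t = x j \<or> t = y j" if t: "t \<in> YY" for t
  proof (cases "t \<in> W")
    case True
    then obtain p where p: "p \<in> Pr" "t = fst p \<or> t = snd p" unfolding W_def by blast
    obtain j where j: "j < r" "p = e j" using p(1) e unfolding bij_betw_def by blast
    then show ?thesis using p(2) rm unfolding x_def y_def by (intro exI[of _ j]) auto
  next
    case False
    then have "t \<in> h ` {..<2 * m - 2 * r}" using t h unfolding bij_betw_def by simp
    then obtain a where a: "a < 2 * m - 2 * r" "t = h a" by blast
    have "t = x (r + a div 2) \<or> t = y (r + a div 2)"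
    proof (cases "even a")
      case True then show ?thesis using a unfolding x_def by simp
    next
      case False then have "2 * (a div 2) + 1 = a" by presburger
      then show ?thesis using a unfolding y_def by simp
    qed
    moreover have "r + a div 2 < m" using a(1) by linarith
    ultimately show ?thesis by blast
  qed
  define ix where "ix p = the_inv_into {..<r} e p" for p
  have ix: "ix p < r" "e (ix p) = p" if "p \<in> Pr" for p
    using that e the_inv_into_into[of e "{..<r}" p "{..<r}"] f_the_inv_into_f[of e "{..<r}" p] unfolding ix_def bij_betw_def by auto
  have ixm: "ix p < m" if "p \<in> Pr" for p using ix(1)[OF that] rm by simp
  show "linkable L E Y Pr"
  proof (rule linkableI[of Pr "\<lambda>p. set (P (ix p))"])
    fix p assume p: "p \<in> Pr"
    let ?i = "ix p"
    have xi: "x ?i = fst p" "y ?i = snd p" using ix[OF p] unfolding x_def y_def by auto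
    have Pi: "is_path L E (P ?i)" "hd (P ?i) = x ?i" "last (P ?i) = y ?i" using P(1) ixm[OF p] by blast+
    have "set (P ?i) \<subseteq> L" using Pi(1) unfolding is_path_iff by blast
    moreover have "set (P ?i) \<inter> Y = {fst p, snd p}"
    proof (intro equalityI subsetI)
      fix t assume t: "t \<in> set (P ?i) \<inter> Y"
      then obtain j where j: "j < m" "t = x j \<or> t = y j" using cover[of t] unfolding YY_def by blast
      then have "t \<in> set (P j)" using Pm[OF j(1)] by blast
      then have "?i = j" using P(2) ixm[OF p] j(1) t by (metis disjoint_iff IntD1)
      then show "t \<in> {fst p, snd p}" using j xi by auto
    next
      fix t assume "t \<in> {fst p, snd p}"
      then show "t \<in> set (P ?i) \<inter> Y" using Pm[OF ixm[OF p]] xi pairingD(1,2)[OF pr p] by auto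
    qed
    moreover have "reach E (set (P ?i)) (fst p) (snd p)"
      using reach_walk[of "P ?i" E "set (P ?i)"] Pi xi unfolding is_path_iff by auto
    ultimately show "set (P ?i) \<subseteq> L \<and> set (P ?i) \<inter> Y = {fst p, snd p} \<and> reach E (set (P ?i)) (fst p) (snd p)" by blast
  next
    fix p q assume pq: "p \<in> Pr" "q \<in> Pr" "p \<noteq> q"
    then have "ix p \<noteq> ix q" using ix(2) by metis
    then show "set (P (ix p)) \<inter> set (P (ix q)) = {}" using P(2) ixm[OF pq(1)] ixm[OF pq(2)] by blast
  qed
qed

section \<open>Massed graphs\<close>

definition arcs :: "'a set \<Rightarrow> ('a \<Rightarrow> 'a \<Rightarrow> bool) \<Rightarrow> 'a set \<Rightarrow> ('a \<times> 'a) set" where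
  "arcs V E S = {(p, q). p \<in> V \<and> q \<in> V \<and> E p q \<and> (p \<in> S \<or> q \<in> S)}"

text \<open>Twice the number of edges with at least one end in \<open>S\<close>.\<close>

definition rho :: "'a set \<Rightarrow> ('a \<Rightarrow> 'a \<Rightarrow> bool) \<Rightarrow> 'a set \<Rightarrow> nat" where
  "rho V E S = card (arcs V E S)"

text \<open>On average more than \<open>lam\<close> edges per vertex off \<open>X\<close>, while no
  separation of order below \<open>card X\<close> cuts off a part of that density from
  \<open>X\<close>. The factor \<open>2\<close> is there because \<open>rho\<close> counts every
  edge twice.\<close>

definition massed :: "nat \<Rightarrow> nat \<Rightarrow> 'a set \<Rightarrow> ('a \<Rightarrow> 'a \<Rightarrow> bool) \<Rightarrow> 'a set \<Rightarrow> bool" where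
  "massed lam m V E X \<longleftrightarrow> finite V \<and> sym_irrefl E \<and> X \<subseteq> V \<and> card X \<le> 2 * m
     \<and> 2 * lam * card (V - X) < rho V E (V - X)
     \<and> (\<forall>A B. split V E A B \<longrightarrow> X \<subseteq> A \<longrightarrow> card (A \<inter> B) < card X \<longrightarrow> rho V E (B - A) \<le> 2 * lam * card (B - A))"

lemma finite_arcs: "finite V \<Longrightarrow> finite (arcs V E S)"
  by (rule finite_subset[of _ "V \<times> V"]) (auto simp: arcs_def)

lemma rho_le:
  assumes "finite V'"
    and "\<And>p q. p \<in> V \<Longrightarrow> q \<in> V \<Longrightarrow> E p q \<Longrightarrow> p \<in> S \<or> q \<in> S \<Longrightarrow> p \<in> V' \<and> q \<in> V' \<and> E' p q \<and> (p \<in> S' \<or> q \<in> S')"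
  shows "rho V E S \<le> rho V' E' S'"
  unfolding rho_def by (rule card_mono[OF finite_arcs[OF assms(1)]]) (use assms(2) in \<open>auto simp: arcs_def\<close>)

text \<open>A split of \<open>B\<close> that violates the density condition becomes one of
  \<open>V\<close> when \<open>A\<close> is added to its near side, and its far side is smaller than
  \<open>B\<close>.\<close>

lemma massed_split:
  assumes fin: "finite V" and E: "sym_irrefl E" and sp: "split V E A B" and XA: "X \<subseteq> A" and c: "card (A \<inter> B) \<le> 2 * m"
    and M1: "2 * lam * card (B - A) < rho V E (B - A)"
    and M2: "\<And>A' B'. split V E A' B' \<Longrightarrow> X \<subseteq> A' \<Longrightarrow> card (A' \<inter> B') < card (A \<inter> B) \<Longrightarrow> card B' < card B \<Longrightarrow>
        rho V E (B' - A') \<le> 2 * lam * card (B' - A')"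
  shows "massed lam m B E (A \<inter> B)"
proof -
  have BV: "A \<union> B = V" and ne: "\<And>a b. a \<in> A - B \<Longrightarrow> b \<in> B - A \<Longrightarrow> \<not> E a b" using sp unfolding split_def by blast+
  have finB: "finite B" using fin BV by auto
  note Es = sym_irreflD(1)[OF E]
  have eq: "B - A \<inter> B = B - A" by blast
  have "rho V E (B - A) \<le> rho B E (B - A)"
  proof (rule rho_le[OF finB])
    fix p q assume a: "p \<in> V" "q \<in> V" "E p q" "p \<in> B - A \<or> q \<in> B - A"
    then show "p \<in> B \<and> q \<in> B \<and> E p q \<and> (p \<in> B - A \<or> q \<in> B - A)"
      using BV ne[of p q] ne[of q p] Es[of p q] by blast
  qed
  then have 1: "2 * lam * card (B - A \<inter> B) < rho B E (B - A \<inter> B)" using M1 unfolding eq by linarith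
  have "rho B E (B' - A') \<le> 2 * lam * card (B' - A')"
    if s: "split B E A' B'" and i: "A \<inter> B \<subseteq> A'" and cc: "card (A' \<inter> B') < card (A \<inter> B)" for A' B'
  proof -
    have U: "A' \<union> B' = B" and ne': "\<And>a b. a \<in> A' - B' \<Longrightarrow> b \<in> B' - A' \<Longrightarrow> \<not> E a b" using s unfolding split_def by blast+
    have eqs: "(A \<union> A') \<inter> B' = A' \<inter> B'" "B' - (A \<union> A') = B' - A'" using i U by blast+
    have "split V E (A \<union> A') B'" unfolding split_def
    proof (intro conjI ballI)
      show "A \<union> A' \<union> B' = V" using U BV by blast
      fix p q assume p: "p \<in> A \<union> A' - B'" and q: "q \<in> B' - (A \<union> A')"
      show "\<not> E p q"
      proof (cases "p \<in> A'")
        case True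
        then show ?thesis using ne'[of p q] p q by blast
      next
        case False
        then have "p \<in> A - B" using p i by blast
        moreover have "q \<in> B - A" using q U by blast
        ultimately show ?thesis by (rule ne)
      qed
    qed
    moreover have "card B' < card B"
    proof (rule psubset_card_mono[OF finB], rule psubsetI)
      show "B' \<subseteq> B" using U by blast
      show "B' \<noteq> B"
      proof
        assume "B' = B"
        then have "A' \<inter> B' = A'" using U by blast
        moreover have "finite A'" using finB U by auto
        ultimately show False using card_mono[OF _ i] cc by simp
      qed
    qed
    ultimately have "rho V E (B' - A') \<le> 2 * lam * card (B' - A')" using M2[of "A \<union> A'" B'] XA cc unfolding eqs by blast
    moreover have "rho B E (B' - A') \<le> rho V E (B' - A')" by (rule rho_le[OF fin]) (use BV in blast)
    ultimately show ?thesis by linarith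
  qed
  then show ?thesis unfolding massed_def using finB E c 1 by blast
qed

text \<open>With the far side \<open>B\<close> as small as possible, \<open>B\<close> is massed with
  respect to its separator, so that the induction hypothesis applies to it.\<close>

lemma minimal_violation:
  assumes fin: "finite V" and E: "sym_irrefl E" and c: "card X \<le> 2 * m"
    and v: "split V E A0 B0" "X \<subseteq> A0" "card (A0 \<inter> B0) < card X" "2 * lam * card (B0 - A0) < rho V E (B0 - A0)"
  obtains A B where "split V E A B" "X \<subseteq> A" "card (A \<inter> B) < card X" "2 * lam * card (B - A) < rho V E (B - A)"
    "massed lam m B E (A \<inter> B)"
proof -
  define viol where "viol AB \<longleftrightarrow> split V E (fst AB) (snd AB) \<and> X \<subseteq> fst AB \<and> card (fst AB \<inter> snd AB) < card X
    \<and> 2 * lam * card (snd AB - fst AB) < rho V E (snd AB - fst AB)" for AB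
  have "viol (A0, B0)" unfolding viol_def using v by simp
  then obtain AB where AB: "viol AB" "\<And>y. viol y \<Longrightarrow> card (snd AB) \<le> card (snd y)"
    using ex_has_least_nat[of viol "(A0, B0)" "\<lambda>y. card (snd y)"] by blast
  obtain A B where ab: "AB = (A, B)" by fastforce
  have s: "split V E A B" "X \<subseteq> A" "card (A \<inter> B) < card X" "2 * lam * card (B - A) < rho V E (B - A)"
    using AB(1) unfolding viol_def ab by auto
  have "massed lam m B E (A \<inter> B)"
  proof (rule massed_split[OF fin E s(1,2) _ s(4)])
    show "card (A \<inter> B) \<le> 2 * m" using s(3) c by simp
    fix A' B' assume a: "split V E A' B'" "X \<subseteq> A'" "card (A' \<inter> B') < card (A \<inter> B)" "card B' < card B"
    then have "\<not> viol (A', B')" using AB(2)[of "(A', B')"] ab by auto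
    then show "rho V E (B' - A') \<le> 2 * lam * card (B' - A')" using a s(3) unfolding viol_def by auto
  qed
  then show thesis using that s by blast
qed

lemma linkable_mono:
  assumes "linkable V E X Pr" "V \<subseteq> V'" "\<And>a b. E a b \<Longrightarrow> E' a b"
  shows "linkable V' E' X Pr"
proof -
  obtain S where S: "\<And>p. p \<in> Pr \<Longrightarrow> S p \<subseteq> V" "\<And>p. p \<in> Pr \<Longrightarrow> S p \<inter> X = {fst p, snd p}"
    "\<And>p. p \<in> Pr \<Longrightarrow> reach E (S p) (fst p) (snd p)" "\<And>p q. p \<in> Pr \<Longrightarrow> q \<in> Pr \<Longrightarrow> p \<noteq> q \<Longrightarrow> S p \<inter> S q = {}"
    by (rule linkableE[OF assms(1)]) (rule that)
  show ?thesis
  proof (rule linkableI[of Pr S])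
    fix p assume p: "p \<in> Pr"
    have "reach E' (S p) (fst p) (snd p)" by (rule reach_mono[OF S(3)[OF p]]) (use assms(3) in auto)
    then show "S p \<subseteq> V' \<and> S p \<inter> X = {fst p, snd p} \<and> reach E' (S p) (fst p) (snd p)"
      using S(1,2)[OF p] assms(2) by auto
  qed (use S(4) in blast)
qed

text \<open>The one linkage set that contains \<open>u\<close>, if any, also receives
  \<open>v\<close>.\<close>

lemma linkable_uncontract:
  assumes l: "linkable W (\<lambda>a b. a \<noteq> b \<and> (E a b \<or> a = u \<and> E v b \<or> b = u \<and> E v a)) Y Pr"
    and v: "v \<notin> Y" "v \<notin> W" and uv: "E u v" and E: "sym_irrefl E"
  shows "linkable (insert v W) E Y Pr"
proof -
  let ?E = "\<lambda>a b. a \<noteq> b \<and> (E a b \<or> a = u \<and> E v b \<or> b = u \<and> E v a)"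
  obtain S where S: "\<And>p. p \<in> Pr \<Longrightarrow> S p \<subseteq> W" "\<And>p. p \<in> Pr \<Longrightarrow> S p \<inter> Y = {fst p, snd p}"
    "\<And>p. p \<in> Pr \<Longrightarrow> reach ?E (S p) (fst p) (snd p)" "\<And>p q. p \<in> Pr \<Longrightarrow> q \<in> Pr \<Longrightarrow> p \<noteq> q \<Longrightarrow> S p \<inter> S q = {}"
    by (rule linkableE[OF l]) (rule that)
  define T where "T p = (if u \<in> S p then insert v (S p) else S p)" for p
  note Es = sym_irreflD(1)[OF E]
  show ?thesis
  proof (rule linkableI[of Pr T])
    fix p assume p: "p \<in> Pr"
    have "reach E (T p) (fst p) (snd p)"
    proof (rule reach_lift[OF S(3)[OF p]])
      show "S p \<subseteq> T p" unfolding T_def by auto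
      fix a b assume ab: "a \<in> S p" "b \<in> S p" "?E a b"
      then have abT: "a \<in> T p" "b \<in> T p" unfolding T_def by auto
      show "reach E (T p) a b"
      proof (cases "E a b")
        case True
        then show ?thesis using abT by (intro reach_edge)
      next
        case False
        then consider "a = u" "E v b" | "b = u" "E v a" using ab(3) by blast
        then show ?thesis
        proof cases
          case 1
          then have "v \<in> T p" using ab unfolding T_def by auto
          then show ?thesis using 1 abT uv reach_trans[OF reach_edge[of a "T p" v E] reach_edge[of v "T p" b E]] by blast
        next
          case 2
          then have "v \<in> T p" using ab unfolding T_def by auto
          then show ?thesis using 2 abT uv Es reach_trans[OF reach_edge[of a "T p" v E] reach_edge[of v "T p" b E]] by blast
        qed
      qed
    qed
    moreover have "T p \<subseteq> insert v W" using S(1)[OF p] unfolding T_def by auto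
    moreover have "T p \<inter> Y = {fst p, snd p}" using S(2)[OF p] v(1) unfolding T_def by simp
    ultimately show "T p \<subseteq> insert v W \<and> T p \<inter> Y = {fst p, snd p} \<and> reach E (T p) (fst p) (snd p)" by blast
  next
    fix p q assume pq: "p \<in> Pr" "q \<in> Pr" "p \<noteq> q"
    have "v \<notin> S p" "v \<notin> S q" using S(1)[OF pq(1)] S(1)[OF pq(2)] v(2) by blast+
    then show "T p \<inter> T q = {}" using S(4)[OF pq] unfolding T_def by auto
  qed
qed

section \<open>A minimal counterexample to the linkage theorem for massed graphs\<close>

locale massed_counterexample =
  fixes V :: "'a set" and E :: "'a \<Rightarrow> 'a \<Rightarrow> bool" and X :: "'a set" and lam m :: nat and Pr :: "('a \<times> 'a) set"
  assumes mass: "massed lam m V E X" and pr: "pairing X Pr" and nl: "\<not> linkable V E X Pr"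
    and full: "\<And>a b. a \<in> X \<Longrightarrow> b \<in> X \<Longrightarrow> a \<noteq> b \<Longrightarrow> \<not> E a b \<Longrightarrow> (a, b) \<in> Pr \<or> (b, a) \<in> Pr"
    and smaller: "\<And>(V' :: 'a set) E' X'. massed lam m V' E' X' \<Longrightarrow> card V' < card V \<Longrightarrow> linked V' E' X'"
    and sparser: "\<And>E'. massed lam m V E' X \<Longrightarrow> rho V E' (V - X) < rho V E (V - X) \<Longrightarrow> linked V E' X"
    and m1: "1 \<le> m" and lam6: "6 * m \<le> lam + 3" and lam99: "99 * m \<le> 16 * lam + 68"
begin

lemma fin: "finite V" and E: "sym_irrefl E" and XV: "X \<subseteq> V" and cX: "card X \<le> 2 * m"
  and M1: "2 * lam * card (V - X) < rho V E (V - X)"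
  and M2: "split V E A B \<Longrightarrow> X \<subseteq> A \<Longrightarrow> card (A \<inter> B) < card X \<Longrightarrow> rho V E (B - A) \<le> 2 * lam * card (B - A)"
  using mass unfolding massed_def by auto

lemma Es: "E a b \<Longrightarrow> E b a" and Ei: "\<not> E a a"
  using E unfolding sym_irrefl_def by blast+

lemma not_linked: "\<not> linked V E X"
  using nl pr unfolding linked_def by blast

text \<open>Take such a split with \<open>A\<close> smallest and replace \<open>B\<close> by a
  clique on \<open>K = A \<inter> B\<close>. The density survives, so the smaller graph must violate
  the separation condition, and the clique \<open>K\<close> lies on one side of a minimal violation.
  On the near side, the violation lifts to the original graph. On the far side \<open>B'\<close>,
  the set \<open>B' \<union> B\<close> is linked, and \<open>A'\<close> contradicts the choice of
  \<open>A\<close>.\<close>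

lemma no_linked_split:
  assumes "split V E A B" "X \<subseteq> A" "card (A \<inter> B) < card X" "B - A \<noteq> {}" "linked B E (A \<inter> B)"
  shows False
proof -
  define rigid where "rigid AB \<longleftrightarrow> split V E (fst AB) (snd AB) \<and> X \<subseteq> fst AB \<and> card (fst AB \<inter> snd AB) < card X
     \<and> snd AB - fst AB \<noteq> {} \<and> linked (snd AB) E (fst AB \<inter> snd AB)" for AB
  have "rigid (A, B)" unfolding rigid_def using assms by simp
  then obtain AB where AB: "rigid AB" "\<And>y. rigid y \<Longrightarrow> card (fst AB) \<le> card (fst y)"
    using ex_has_least_nat[of rigid "(A, B)" "\<lambda>y. card (fst y)"] by blast
  obtain A B where ab: "AB = (A, B)" by fastforce
  have r: "split V E A B" "X \<subseteq> A" "card (A \<inter> B) < card X" "B - A \<noteq> {}" "linked B E (A \<inter> B)"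
    using AB(1) unfolding rigid_def ab by auto
  have min: "card A \<le> card A'" if "split V E A' B'" "X \<subseteq> A'" "card (A' \<inter> B') < card X" "B' - A' \<noteq> {}" "linked B' E (A' \<inter> B')" for A' B'
    using AB(2)[of "(A', B')"] that ab unfolding rigid_def by simp
  have U: "A \<union> B = V" and ne: "\<And>a b. a \<in> A - B \<Longrightarrow> b \<in> B - A \<Longrightarrow> \<not> E a b" using r(1) unfolding split_def by blast+
  define K where "K = A \<inter> B"
  define E' where "E' = (\<lambda>a b. E a b \<or> a \<in> K \<and> b \<in> K \<and> a \<noteq> b)"
  have E's: "sym_irrefl E'" unfolding sym_irrefl_def E'_def using Es Ei by blast
  have finA: "finite A" using fin U by auto
  have AV: "card A < card V" by (rule psubset_card_mono[OF fin]) (use U r(4) in blast)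
  have nlA: "\<not> linked A E' X"
    using linkable_replace_clique[OF r(1,2,5), of Pr] nl pr unfolding linked_def E'_def K_def by blast
  have "2 * lam * card (A - X) < rho A E' (A - X)"
  proof -
    have "arcs V E (V - X) \<subseteq> arcs A E' (A - X) \<union> arcs V E (B - A)"
      unfolding arcs_def E'_def using U r(2) ne Es by auto
    then have "rho V E (V - X) \<le> card (arcs A E' (A - X) \<union> arcs V E (B - A))" unfolding rho_def
      by (rule card_mono[rotated]) (use finite_arcs fin finA in blast)
    also have "\<dots> \<le> rho A E' (A - X) + rho V E (B - A)" unfolding rho_def by (rule card_Un_le)
    also have "\<dots> \<le> rho A E' (A - X) + 2 * lam * card (B - A)" using M2[OF r(1-3)] by simp
    finally have 1: "2 * lam * card (V - X) < rho A E' (A - X) + 2 * lam * card (B - A)" using M1 by linarith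
    have "V - X = (A - X) \<union> (B - A)" using U r(2) by blast
    moreover have "card ((A - X) \<union> (B - A)) = card (A - X) + card (B - A)"
      by (rule card_Un_disjoint) (use finA fin U in auto)
    ultimately show ?thesis using 1 by (simp add: distrib_left)
  qed
  moreover have "\<not> massed lam m A E' X" using smaller[OF _ AV] nlA by blast
  ultimately obtain A0 B0 where v0: "split A E' A0 B0" "X \<subseteq> A0" "card (A0 \<inter> B0) < card X" "2 * lam * card (B0 - A0) < rho A E' (B0 - A0)"
    unfolding massed_def using finA E's r(2) cX not_le by blast
  obtain A' B' where v: "split A E' A' B'" "X \<subseteq> A'" "card (A' \<inter> B') < card X" "2 * lam * card (B' - A') < rho A E' (B' - A')"
      "massed lam m B' E' (A' \<inter> B')"
    by (rule minimal_violation[OF finA E's cX v0]) (rule that)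
  have U': "A' \<union> B' = A" and ne': "\<And>a b. a \<in> A' - B' \<Longrightarrow> b \<in> B' - A' \<Longrightarrow> \<not> E' a b" using v(1) unfolding split_def by blast+
  have ne'': "\<not> E a b" if "a \<in> A' - B'" "b \<in> B' - A'" for a b using ne'[OF that] unfolding E'_def by blast
  have KA: "K \<subseteq> A" unfolding K_def by blast
  \<comment> \<open>No split for \<open>E'\<close> separates two vertices of the clique
    \<open>K\<close>.\<close>
  have side: "K \<subseteq> A' \<or> K \<subseteq> B'"
  proof (rule ccontr)
    assume "\<not> ?thesis"
    then obtain x y where xy: "x \<in> K" "x \<notin> A'" "y \<in> K" "y \<notin> B'" by blast
    then have "x \<in> B' - A'" "y \<in> A' - B'" using U' KA by blast+
    then have "\<not> E' y x" "x \<noteq> y" using ne' by blast+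
    then show False using xy unfolding E'_def by blast
  qed
  show False
  proof (cases "K \<subseteq> A'")
    case True
    have eqs: "(A' \<union> B) \<inter> B' = A' \<inter> B'" "B' - (A' \<union> B) = B' - A'" using True U' unfolding K_def by blast+
    have "split V E (A' \<union> B) B'" unfolding split_def
    proof (intro conjI ballI)
      show "A' \<union> B \<union> B' = V" using U U' by blast
      fix p q assume p: "p \<in> A' \<union> B - B'" and q: "q \<in> B' - (A' \<union> B)"
      show "\<not> E p q"
      proof (cases "p \<in> A'")
        case pA: True
        then show ?thesis using ne''[of p q] p q by blast
      next
        case False
        then have "p \<in> B - A" using p U' by blast
        moreover have "q \<in> A - B" using q U' by blast
        ultimately show ?thesis using ne[of q p] Es[of p q] by blast
      qed
    qed
    then have "rho V E (B' - A') \<le> 2 * lam * card (B' - A')" using M2[of "A' \<union> B" B'] v(2,3) unfolding eqs by blast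
    moreover have "rho A E' (B' - A') \<le> rho V E (B' - A')"
    proof (rule rho_le[OF fin])
      fix p q assume "p \<in> A" "q \<in> A" "E' p q" "p \<in> B' - A' \<or> q \<in> B' - A'"
      then show "p \<in> V \<and> q \<in> V \<and> E p q \<and> (p \<in> B' - A' \<or> q \<in> B' - A')" using U True unfolding E'_def by blast
    qed
    ultimately show False using v(4) by linarith
  next
    case False
    then have KB: "K \<subseteq> B'" using side by blast
    have BA: "B' \<inter> B = A \<inter> B" using KB U' unfolding K_def by blast
    have eqs: "A' \<inter> (B' \<union> B) = A' \<inter> B'" using KB U' unfolding K_def by blast
    have "card B' \<le> card A" using U' finA by (intro card_mono) auto
    then have lB': "linked B' E' (A' \<inter> B')" using smaller[OF v(5)] AV by simp
    have sB: "split (B' \<union> B) E B' B" unfolding split_def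
    proof (intro conjI ballI)
      fix p q assume "p \<in> B' - B" "q \<in> B - B'"
      then have "p \<in> A - B" "q \<in> B - A" using U' KB unfolding K_def by blast+
      then show "\<not> E p q" by (rule ne)
    qed simp
    have "linked (B' \<union> B) E (A' \<inter> B')" unfolding linked_def
    proof (intro allI impI)
      fix Q assume Q: "pairing (A' \<inter> B') Q"
      show "linkable (B' \<union> B) E (A' \<inter> B') Q"
        by (rule linkable_replace_clique[OF sB]) (use r(5) linkedD[OF lB' Q] in \<open>simp_all add: BA E'_def K_def\<close>)
    qed
    moreover have "split V E A' (B' \<union> B)" unfolding split_def
    proof (intro conjI ballI)
      show "A' \<union> (B' \<union> B) = V" using U U' by blast
      fix p q assume p: "p \<in> A' - (B' \<union> B)" and q: "q \<in> B' \<union> B - A'"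
      show "\<not> E p q"
      proof (cases "q \<in> B'")
        case True
        then show ?thesis using ne''[of p q] p q by blast
      next
        case False
        then have "q \<in> B - A" using q KB U' unfolding K_def by blast
        moreover have "p \<in> A - B" using p U' by blast
        ultimately show ?thesis using ne by blast
      qed
    qed
    moreover have "B' \<union> B - A' \<noteq> {}" using r(4) U' by blast
    ultimately have "card A \<le> card A'" using min[of A' "B' \<union> B"] v(2,3) unfolding eqs by blast
    moreover have "card A' < card A" by (rule psubset_card_mono[OF finA]) (use U' \<open>\<not> K \<subseteq> A'\<close> KA in blast)
    ultimately show False by simp
  qed
qed

lemma no_linked_core:
  assumes "split V E C D" "X \<subseteq> C" "card X \<le> card D" "\<And>Y. Y \<subseteq> C \<inter> D \<Longrightarrow> card Y \<le> card X \<Longrightarrow> linked D E Y"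
  shows False
  using linked_or_linked_split[OF fin E assms] not_linked no_linked_split by blast

text \<open>By \<open>full\<close>, a non-neighbour of \<open>u\<close> in \<open>X\<close> must be
  paired with \<open>u\<close>.\<close>

lemma partner_unique:
  assumes "u \<in> X"
  shows "card {w \<in> X. w \<noteq> u \<and> \<not> E u w} \<le> 1"
proof -
  have "w = w'" if w: "w \<in> X" "w \<noteq> u" "\<not> E u w" "w' \<in> X" "w' \<noteq> u" "\<not> E u w'" for w w'
  proof (rule ccontr)
    assume n: "w \<noteq> w'"
    obtain p where p: "p \<in> Pr" "p = (u, w) \<or> p = (w, u)" using full[OF assms w(1)] w by blast
    obtain q where q: "q \<in> Pr" "q = (u, w') \<or> q = (w', u)" using full[OF assms w(4)] w by blast
    have "p \<noteq> q" using p q n w by auto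
    from pairingD(4)[OF pr p(1) q(1) this] p q show False by auto
  qed
  moreover have "finite {w \<in> X. w \<noteq> u \<and> \<not> E u w}" using fin XV finite_subset[of X V] by simp
  ultimately show ?thesis unfolding One_nat_def by (subst card_le_Suc0_iff_eq) simp_all
qed

text \<open>Edges from \<open>v\<close> to \<open>W\<close> reappear at \<open>u\<close>. Lost are
  the edge \<open>uv\<close>, one edge for each common neighbour, and, if \<open>u\<close> is in
  \<open>X\<close>, possibly the edge from \<open>v\<close> to the partner of \<open>u\<close>,
  since its image lies inside \<open>X\<close> and is not counted.\<close>

lemma rho_contract:
  assumes u: "u \<in> V" and v: "v \<in> V" "v \<notin> X" and uv: "E u v"
  defines "E1 \<equiv> \<lambda>a b. a \<noteq> b \<and> (E a b \<or> a = u \<and> E v b \<or> b = u \<and> E v a)"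
  shows "rho V E (V - X) \<le> rho (V - {v}) E1 (V - {v} - X) + 2 * (card {w \<in> V. E u w \<and> E v w} + 2)"
proof -
  define N where "N = nb E V v"
  define W where "W = {w \<in> N. w \<noteq> u \<and> \<not> E u w \<and> \<not> (u \<in> X \<and> w \<in> X)}"
  define Q where "Q = {(p, q). p \<in> V \<and> q \<in> V \<and> E p q \<and> (p \<notin> X \<or> q \<notin> X) \<and> p \<noteq> v \<and> q \<noteq> v}"
  have finN: "finite N" "finite W" unfolding N_def W_def using fin by auto
  have finQ: "finite Q" by (rule finite_subset[of _ "V \<times> V"]) (use fin in \<open>auto simp: Q_def\<close>)
  have "arcs V E (V - X) \<subseteq> Q \<union> ({v} \<times> N \<union> N \<times> {v})" unfolding arcs_def Q_def N_def using Es by auto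
  then have "rho V E (V - X) \<le> card (Q \<union> ({v} \<times> N \<union> N \<times> {v}))" unfolding rho_def
    by (rule card_mono[rotated]) (use finQ finN in auto)
  also have "\<dots> \<le> card Q + (card ({v} \<times> N) + card (N \<times> {v}))"
    using card_Un_le[of Q "{v} \<times> N \<union> N \<times> {v}"] card_Un_le[of "{v} \<times> N" "N \<times> {v}"] by linarith
  finally have 1: "rho V E (V - X) \<le> card Q + 2 * card N" by (simp add: card_cartesian_product)
  have un: "u \<noteq> v" using uv Ei by blast
  have "Q \<union> ({u} \<times> W \<union> W \<times> {u}) \<subseteq> arcs (V - {v}) E1 (V - {v} - X)"
    unfolding arcs_def Q_def W_def N_def E1_def using Ei un u by auto
  then have "card (Q \<union> ({u} \<times> W \<union> W \<times> {u})) \<le> rho (V - {v}) E1 (V - {v} - X)" unfolding rho_def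
    by (rule card_mono[rotated]) (use fin in \<open>intro finite_arcs; simp\<close>)
  moreover have "card (Q \<union> ({u} \<times> W \<union> W \<times> {u})) = card Q + card ({u} \<times> W \<union> W \<times> {u})"
  proof (rule card_Un_disjoint)
    show "Q \<inter> ({u} \<times> W \<union> W \<times> {u}) = {}" unfolding Q_def W_def using Es by auto
  qed (use finQ finN in auto)
  moreover have "card ({u} \<times> W \<union> W \<times> {u}) = card ({u} \<times> W) + card (W \<times> {u})"
    by (rule card_Un_disjoint) (use finN in \<open>auto simp: W_def\<close>)
  ultimately have 2: "card Q + 2 * card W \<le> rho (V - {v}) E1 (V - {v} - X)" by (simp add: card_cartesian_product)
  let ?C = "{w \<in> V. E u w \<and> E v w}"
  let ?P = "if u \<in> X then {w \<in> X. w \<noteq> u \<and> \<not> E u w} else {}"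
  have cP: "card ?P \<le> 1" using partner_unique by auto
  have "finite X" using XV fin finite_subset by blast
  then have finP: "finite ?P" by simp
  have "N \<subseteq> W \<union> ?C \<union> {u} \<union> ?P" unfolding W_def N_def by auto
  then have "card N \<le> card (W \<union> ?C \<union> {u} \<union> ?P)" by (rule card_mono[rotated]) (use finN fin finP in simp)
  also have "\<dots> \<le> card W + card ?C + card {u} + card ?P"
    using card_Un_le[of "W \<union> ?C \<union> {u}" ?P] card_Un_le[of "W \<union> ?C" "{u}"] card_Un_le[of W ?C] by linarith
  finally have "card N \<le> card W + card ?C + 2" using cP by simp
  then show ?thesis using 1 2 unfolding distrib_left by linarith
qed

text \<open>With too few triangles at the edge, its contraction keeps the density but is not linked,
  so it violates the separation condition. The place of \<open>u\<close> in a minimal violation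
  decides: on the near side the violation lifts to the original graph; on the far side a linked
  split of small order arises; in the separator, \<open>v\<close> joins \<open>u\<close> there and
  the order becomes exactly \<open>card X\<close>.\<close>

lemma common_neighbours:
  assumes u: "u \<in> V" and v: "v \<in> V" "v \<notin> X" and uv: "E u v"
  shows "lam \<le> card {w \<in> V. E u w \<and> E v w} + 1"
proof (rule ccontr)
  assume "\<not> ?thesis"
  then have few: "card {w \<in> V. E u w \<and> E v w} + 2 \<le> lam" by simp
  define E1 where "E1 = (\<lambda>a b. a \<noteq> b \<and> (E a b \<or> a = u \<and> E v b \<or> b = u \<and> E v a))"
  define V1 where "V1 = V - {v}"
  have E1s: "sym_irrefl E1" unfolding sym_irrefl_def E1_def using Es by blast
  have E1: "E1 a b" if "E a b" for a b using that Ei unfolding E1_def by blast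
  have E1u: "E1 u b" if "E v b" "b \<noteq> u" for b using that unfolding E1_def by blast
  have un: "u \<noteq> v" using uv Ei by blast
  have fin1: "finite V1" and V1V: "V1 \<subseteq> V" and vV1: "v \<notin> V1" and iV1: "insert v V1 = V" and XV1: "X \<subseteq> V1" and uV1: "u \<in> V1"
    using fin v u un XV unfolding V1_def by auto
  have c1: "card V1 < card V" by (rule psubset_card_mono[OF fin]) (use v V1V vV1 in blast)
  have "rho V E (V - X) \<le> rho V1 E1 (V1 - X) + 2 * (card {w \<in> V. E u w \<and> E v w} + 2)"
    using rho_contract[OF u v uv] unfolding E1_def V1_def .
  moreover have "card (V - X) = Suc (card (V1 - X))"
  proof -
    have "V - X = insert v (V1 - X)" using v iV1 by blast
    then show ?thesis using fin1 vV1 by simp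
  qed
  ultimately have M1': "2 * lam * card (V1 - X) < rho V1 E1 (V1 - X)" using M1 few unfolding distrib_left by simp
  have "\<not> linked V1 E1 X"
  proof
    assume "linked V1 E1 X"
    then have "linkable V1 E1 X Pr" using pr by (rule linkedD)
    then have "linkable (insert v V1) E X Pr" unfolding E1_def by (rule linkable_uncontract[OF _ v(2) vV1 uv E])
    then show False using nl iV1 by simp
  qed
  then have "\<not> massed lam m V1 E1 X" using smaller c1 by blast
  then obtain A0 B0 where v0: "split V1 E1 A0 B0" "X \<subseteq> A0" "card (A0 \<inter> B0) < card X" "2 * lam * card (B0 - A0) < rho V1 E1 (B0 - A0)"
    unfolding massed_def using fin1 E1s XV1 cX M1' not_le by blast
  obtain A B where s: "split V1 E1 A B" "X \<subseteq> A" "card (A \<inter> B) < card X" "2 * lam * card (B - A) < rho V1 E1 (B - A)"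
      "massed lam m B E1 (A \<inter> B)"
    by (rule minimal_violation[OF fin1 E1s cX v0]) (rule that)
  have U: "A \<union> B = V1" and ne1: "\<And>a b. a \<in> A - B \<Longrightarrow> b \<in> B - A \<Longrightarrow> \<not> E1 a b" using s(1) unfolding split_def by blast+
  have ne: "\<not> E a b" if "a \<in> A - B" "b \<in> B - A" for a b using ne1[OF that] E1 by blast
  have vAB: "v \<notin> A" "v \<notin> B" using U vV1 by auto
  have lB: "linked B E1 (A \<inter> B)"
  proof (rule smaller[OF s(5)])
    have "card B \<le> card V1" using U fin1 by (intro card_mono) auto
    then show "card B < card V" using c1 by simp
  qed
  \<comment> \<open>An arc at \<open>u\<close> that the contraction creates is the image of an arc
    at \<open>v\<close>.\<close>
  have rho_img: "rho V1 E1 (B - A) \<le> rho V E (B - A)" if "u \<notin> B - A"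
  proof -
    let ?g = "\<lambda>(p, q). (if p = v then u else p, if q = v then u else q)"
    have "arcs V1 E1 (B - A) \<subseteq> ?g ` arcs V E (B - A)"
    proof
      fix e assume "e \<in> arcs V1 E1 (B - A)"
      then obtain p q where e: "e = (p, q)" "p \<in> V1" "q \<in> V1" "E1 p q" "p \<in> B - A \<or> q \<in> B - A" unfolding arcs_def by blast
      have pq: "p \<noteq> v" "q \<noteq> v" "p \<in> V" "q \<in> V" using e vV1 V1V by auto
      consider "E p q" | "p = u" "E v q" | "q = u" "E v p" using e(4) unfolding E1_def by blast
      then show "e \<in> ?g ` arcs V E (B - A)"
      proof cases
        case 1
        then have "(p, q) \<in> arcs V E (B - A)" using e pq unfolding arcs_def by blast
        then show ?thesis by (rule rev_image_eqI) (use e pq in simp)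
      next
        case 2
        then have "(v, q) \<in> arcs V E (B - A)" using e pq v that unfolding arcs_def by blast
        then show ?thesis by (rule rev_image_eqI) (use e pq 2 in simp)
      next
        case 3
        then have "(p, v) \<in> arcs V E (B - A)" using e pq v that Es unfolding arcs_def by blast
        then show ?thesis by (rule rev_image_eqI) (use e pq 3 in simp)
      qed
    qed
    then show ?thesis unfolding rho_def by (rule surj_card_le[OF finite_arcs[OF fin]])
  qed
  consider "u \<in> A - B" | "u \<in> B - A" | "u \<in> A \<inter> B" using uV1 U by blast
  then show False
  proof cases
    case 1
    have eqs: "insert v A \<inter> B = A \<inter> B" "B - insert v A = B - A" using vAB by auto
    have "split V E (insert v A) B" unfolding split_def
    proof (intro conjI ballI)
      show "insert v A \<union> B = V" using U iV1 by blast
      fix p q assume p: "p \<in> insert v A - B" and q: "q \<in> B - insert v A"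
      show "\<not> E p q"
      proof (cases "p = v")
        case True
        have "q \<noteq> u" using 1 q by blast
        then show ?thesis using E1u[of q] ne1[OF 1, of q] q True by blast
      next
        case False
        then show ?thesis using ne[of p q] p q by blast
      qed
    qed
    then have "rho V E (B - A) \<le> 2 * lam * card (B - A)" using M2[of "insert v A" B] s(2,3) unfolding eqs by blast
    then show False using rho_img 1 s(4) by force
  next
    case 2
    have eqs: "A \<inter> insert v B = A \<inter> B" using vAB by auto
    have "split V E A (insert v B)" unfolding split_def
    proof (intro conjI ballI)
      show "A \<union> insert v B = V" using U iV1 by blast
      fix p q assume p: "p \<in> A - insert v B" and q: "q \<in> insert v B - A"
      show "\<not> E p q"
      proof (cases "q = v")
        case True
        show ?thesis
        proof
          assume "E p q"
          then have "E v p" using True Es by blast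
          moreover have "p \<noteq> u" using 2 p by blast
          ultimately have "E1 p u" using E1u E1s unfolding sym_irrefl_def by blast
          then show False using ne1[of p u] 2 p by blast
        qed
      next
        case False
        then show ?thesis using ne[of p q] p q by blast
      qed
    qed
    moreover have "linked (insert v B) E (A \<inter> B)" unfolding linked_def
    proof (intro allI impI)
      fix Q assume "pairing (A \<inter> B) Q"
      then have "linkable B E1 (A \<inter> B) Q" using lB by (intro linkedD)
      then show "linkable (insert v B) E (A \<inter> B) Q" unfolding E1_def
        by (rule linkable_uncontract) (use vAB uv E in auto)
    qed
    moreover have "insert v B - A \<noteq> {}" using vAB by blast
    ultimately show False using no_linked_split[of A "insert v B"] s(2,3) unfolding eqs by blast
  next
    case 3
    let ?A = "insert v A" and ?B = "insert v B"
    have eqs: "?A \<inter> ?B = insert v (A \<inter> B)" "?B - ?A = B - A" using vAB by auto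
    have sp: "split V E ?A ?B" unfolding split_def
    proof (intro conjI ballI)
      show "?A \<union> ?B = V" using U iV1 by blast
      fix p q assume "p \<in> ?A - ?B" "q \<in> ?B - ?A"
      then show "\<not> E p q" using ne[of p q] by blast
    qed
    have rh: "2 * lam * card (?B - ?A) < rho V E (?B - ?A)" using rho_img 3 s(4) unfolding eqs by force
    have XA: "X \<subseteq> ?A" using s(2) by blast
    have finAB: "finite (A \<inter> B)" "finite A" "finite B" using fin1 U finite_subset by auto
    have cAB: "card (?A \<inter> ?B) = Suc (card (A \<inter> B))" unfolding eqs using finAB vAB by simp
    \<comment> \<open>With \<open>v\<close> in the separator the split still violates the density
      condition, so its order cannot be below \<open>card X\<close>.\<close>
    then have cAX: "card (?A \<inter> ?B) = card X" using M2[OF sp XA] rh s(3) by (cases "card (?A \<inter> ?B) < card X") auto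
    have "massed lam m ?B E (?A \<inter> ?B)"
      by (rule massed_split[OF fin E sp XA _ rh]) (use cAX cX M2 in auto)
    moreover have "card ?B < card V"
    proof (rule psubset_card_mono[OF fin])
      have "\<not> A \<subseteq> B"
      proof
        assume "A \<subseteq> B"
        then have "A \<inter> B = A" by blast
        then show False using card_mono[OF finAB(2) s(2)] s(3) by simp
      qed
      then obtain a where a: "a \<in> A" "a \<notin> B" by blast
      have "a \<noteq> v" using a vAB by blast
      then have "a \<in> V" "a \<notin> ?B" using a U V1V by auto
      moreover have "?B \<subseteq> V" using U iV1 by blast
      ultimately show "?B \<subset> V" by blast
    qed
    ultimately have "linked ?B E (?A \<inter> ?B)" by (rule smaller)
    then have "linked ?B E Y" if "Y \<subseteq> ?A \<inter> ?B" for Y using that by (rule linked_subset)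
    moreover have "card X \<le> card ?B" unfolding cAX[symmetric] using finAB by (intro card_mono) auto
    ultimately show False using no_linked_core[OF sp XA] by blast
  qed
qed

lemma edge_exists: "\<exists>u v. u \<in> V \<and> v \<in> V - X \<and> E u v"
proof -
  have "arcs V E (V - X) \<noteq> {}" using M1 unfolding rho_def by auto
  then show ?thesis unfolding arcs_def using Es by blast
qed

text \<open>Otherwise some edge \<open>uv\<close> can be deleted: a split that exists only after the
  deletion has all common neighbours of \<open>u\<close> and \<open>v\<close> in its separator,
  which are too many for an order below \<open>card X\<close>.\<close>

lemma rho_tight: "rho V E (V - X) \<le> 2 * lam * card (V - X) + 2"
proof (rule ccontr)
  assume n: "\<not> ?thesis"
  obtain u v where uv: "u \<in> V" "v \<in> V" "v \<notin> X" "E u v" using edge_exists by blast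
  define E' where "E' = (\<lambda>a b. E a b \<and> \<not> (a = u \<and> b = v \<or> a = v \<and> b = u))"
  have E's: "sym_irrefl E'" unfolding sym_irrefl_def E'_def using Es Ei by blast
  have sub: "arcs V E' S \<subseteq> arcs V E S" for S unfolding arcs_def E'_def by blast
  have le: "rho V E' S \<le> rho V E S" for S unfolding rho_def by (rule card_mono[OF finite_arcs[OF fin] sub])
  have "arcs V E (V - X) \<subseteq> arcs V E' (V - X) \<union> {(u, v), (v, u)}" unfolding arcs_def E'_def by auto
  then have "rho V E (V - X) \<le> card (arcs V E' (V - X) \<union> {(u, v), (v, u)})" unfolding rho_def
    by (rule card_mono[rotated]) (use finite_arcs fin in blast)
  also have "\<dots> \<le> rho V E' (V - X) + card {(u, v), (v, u)}" unfolding rho_def by (rule card_Un_le)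
  finally have "rho V E (V - X) \<le> rho V E' (V - X) + card {(u, v), (v, u)}" .
  moreover have "card {(u, v), (v, u)} \<le> 2" using card_insert_le_m1[of 2 "{(v, u)}" "(u, v)"] by simp
  ultimately have M1': "2 * lam * card (V - X) < rho V E' (V - X)" using n by linarith
  have "(u, v) \<in> arcs V E (V - X) - arcs V E' (V - X)" using uv unfolding arcs_def E'_def by blast
  then have less: "rho V E' (V - X) < rho V E (V - X)" unfolding rho_def
    by (intro psubset_card_mono finite_arcs[OF fin]) (use sub in blast)
  have "massed lam m V E' X" unfolding massed_def
  proof (intro conjI allI impI fin E's XV cX M1')
    fix A B assume s: "split V E' A B" "X \<subseteq> A" "card (A \<inter> B) < card X"
    have U: "A \<union> B = V" and ne: "\<And>a b. a \<in> A - B \<Longrightarrow> b \<in> B - A \<Longrightarrow> \<not> E' a b" using s(1) unfolding split_def by blast+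
    have cross: False if c: "a \<in> A - B" "b \<in> B - A" "a = u \<and> b = v \<or> a = v \<and> b = u" for a b
    proof -
      have "{w \<in> V. E u w \<and> E v w} \<subseteq> A \<inter> B"
      proof
        fix w assume w: "w \<in> {w \<in> V. E u w \<and> E v w}"
        then have "E' a w" "E' w b" using c(3) Es Ei unfolding E'_def by auto
        then show "w \<in> A \<inter> B" using ne[of a w] ne[of w b] c w U by blast
      qed
      moreover have "finite (A \<inter> B)" using fin U by auto
      ultimately have "card {w \<in> V. E u w \<and> E v w} \<le> card (A \<inter> B)" by (intro card_mono)
      then show False using common_neighbours[OF uv] s(3) cX lam6 m1 by linarith
    qed
    have "split V E A B" unfolding split_def
    proof (intro conjI ballI U)
      fix a b assume "a \<in> A - B" "b \<in> B - A"
      then show "\<not> E a b" using ne[of a b] cross[of a b] unfolding E'_def by blast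
    qed
    then show "rho V E' (B - A) \<le> 2 * lam * card (B - A)" using M2[OF _ s(2,3)] le[of "B - A"] by force
  qed
  then have "linked V E' X" using less by (rule sparser)
  then have "linkable V E' X Pr" using pr by (rule linkedD)
  then have "linkable V E X Pr" by (rule linkable_mono) (auto simp: E'_def)
  then show False using nl by blast
qed

text \<open>Deleting an isolated vertex would not decrease the density.\<close>

lemma no_isolated:
  assumes v: "v \<in> V" "v \<notin> X"
  shows "nb E V v \<noteq> {}"
proof
  assume n: "nb E V v = {}"
  define V1 where "V1 = V - {v}"
  have V1: "V1 \<subseteq> V" "v \<notin> V1" "insert v V1 = V" "finite V1" "X \<subseteq> V1" unfolding V1_def using v fin XV by auto
  have nv: "\<not> E v b" "\<not> E b v" if "b \<in> V" for b using n that Es[of b v] by blast+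
  have "massed lam m V1 E X" unfolding massed_def
  proof (intro conjI allI impI V1 E cX)
    have "rho V E (V - X) \<le> rho V1 E (V1 - X)" by (rule rho_le[OF V1(4)]) (use nv V1 in blast)
    moreover have "card (V1 - X) \<le> card (V - X)" using V1 fin by (intro card_mono) auto
    then have "2 * lam * card (V1 - X) \<le> 2 * lam * card (V - X)" by simp
    ultimately show "2 * lam * card (V1 - X) < rho V1 E (V1 - X)" using M1 by linarith
    fix A B assume s: "split V1 E A B" "X \<subseteq> A" "card (A \<inter> B) < card X"
    have U: "A \<union> B = V1" and ne: "\<And>a b. a \<in> A - B \<Longrightarrow> b \<in> B - A \<Longrightarrow> \<not> E a b" using s(1) unfolding split_def by blast+
    have eqs: "insert v A \<inter> B = A \<inter> B" "B - insert v A = B - A" using U V1(2) by auto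
    have "split V E (insert v A) B" unfolding split_def
    proof (intro conjI ballI)
      show "insert v A \<union> B = V" using U V1 by blast
      fix p q assume p: "p \<in> insert v A - B" and q: "q \<in> B - insert v A"
      then show "\<not> E p q" using ne[of p q] nv(1)[of q] U V1 by blast
    qed
    then have "rho V E (B - A) \<le> 2 * lam * card (B - A)" using M2[of "insert v A" B] s(2,3) unfolding eqs by blast
    moreover have "rho V1 E (B - A) \<le> rho V E (B - A)" by (rule rho_le[OF fin]) (use V1 in blast)
    ultimately show "rho V1 E (B - A) \<le> 2 * lam * card (B - A)" by linarith
  qed
  moreover have "card V1 < card V" by (rule psubset_card_mono[OF fin]) (use V1 in blast)
  ultimately have "linked V1 E X" by (rule smaller)
  then have "linkable V1 E X Pr" using pr by (rule linkedD)
  then have "linkable V E X Pr" by (rule linkable_mono) (use V1 in auto)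
  then show False using nl by blast
qed

text \<open>If all degrees off \<open>X\<close> were at least \<open>2 * lam + 1\<close>, then
  \<open>rho_tight\<close> would leave at most two vertices off \<open>X\<close>, too few to
  accommodate such degrees.\<close>

lemma low_degree: "\<exists>v\<in>V - X. card (nb E V v) \<le> 2 * lam"
proof (rule ccontr)
  assume "\<not> ?thesis"
  then have big: "2 * lam + 1 \<le> card (nb E V v)" if "v \<in> V - X" for v
    using that by (metis not_less_eq_eq Suc_eq_plus1)
  obtain v where v: "v \<in> V - X" using edge_exists by blast
  have "insert v (nb E V v) \<subseteq> V" using v by blast
  then have "card (insert v (nb E V v)) \<le> card V" by (rule card_mono[OF fin])
  then have 1: "2 * lam + 2 \<le> card V" using big[OF v] fin Ei by simp
  have finX: "finite X" using XV fin finite_subset by blast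
  have 2: "card V = card (V - X) + card X" using card_Diff_subset[OF finX XV] card_mono[OF fin XV] by simp
  have "Sigma (V - X) (nb E V) \<subseteq> arcs V E (V - X)" unfolding arcs_def by auto
  then have "card (Sigma (V - X) (nb E V)) \<le> rho V E (V - X)" unfolding rho_def by (rule card_mono[OF finite_arcs[OF fin]])
  moreover have "card (Sigma (V - X) (nb E V)) = (\<Sum>v\<in>V - X. card (nb E V v))" using fin by (intro card_SigmaI) auto
  moreover have "(\<Sum>v\<in>V - X. 2 * lam + 1) \<le> (\<Sum>v\<in>V - X. card (nb E V v))" by (rule sum_mono) (use big in blast)
  ultimately have "card (V - X) * (2 * lam + 1) \<le> 2 * lam * card (V - X) + 2"
    using rho_tight by (simp add: mult.commute)
  moreover have "card (V - X) * (2 * lam + 1) = 2 * lam * card (V - X) + card (V - X)" by (simp add: algebra_simps)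
  ultimately have "card (V - X) \<le> 2" by linarith
  then show False using 1 2 cX lam6 m1 by linarith
qed

text \<open>In the neighbourhood of a vertex of low degree every vertex has at least
  \<open>lam - 1\<close> neighbours. So it contains an \<open>mlinked\<close> set \<open>L\<close>,
  and the trivial split \<open>(V, L)\<close> has a linked far side.\<close>

lemma contradiction: False
proof -
  obtain v where v: "v \<in> V - X" "card (nb E V v) \<le> 2 * lam" using low_degree by blast
  let ?H = "nb E V v"
  have "\<exists>L\<subseteq>?H. 2 * m \<le> card L \<and> mlinked m L E"
  proof (rule dense_contains_mlinked[of _ _ "lam - 1"])
    show "finite ?H" "sym_irrefl E" "?H \<noteq> {}" using fin E no_isolated v by auto
    show "lam - 1 \<le> card (nb E ?H p)" if p: "p \<in> ?H" for p
    proof -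
      have "nb E ?H p = {w \<in> V. E p w \<and> E v w}" by blast
      moreover have "lam \<le> card {w \<in> V. E p w \<and> E v w} + 1" by (rule common_neighbours) (use p v Es in auto)
      ultimately show ?thesis by simp
    qed
  qed (use v lam6 lam99 m1 in linarith)+
  then obtain L where L: "L \<subseteq> ?H" "2 * m \<le> card L" "mlinked m L E" by blast
  have LV: "L \<subseteq> V" using L(1) by blast
  then have finL: "finite L" using fin finite_subset by blast
  show False
  proof (rule no_linked_core[of V L])
    show "split V E V L" unfolding split_def using LV by blast
    show "X \<subseteq> V" by (rule XV)
    show "card X \<le> card L" using cX L(2) by simp
    fix Y assume "Y \<subseteq> V \<inter> L" "card Y \<le> card X"
    then show "linked L E Y" using mlinked_imp_linked[OF L(3) finL L(2)] cX by simp
  qed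
qed

end

text \<open>Induction on the number of vertices, then on the number of edges not inside
  \<open>X\<close>. For a pairing that fails, all edges inside \<open>X\<close> between vertices
  that are not paired are added: \<open>rho\<close> does not count them off \<open>X\<close>, and no
  linkage set contains both ends of one.\<close>

theorem massed_imp_linked:
  assumes "massed lam m V E X" and "1 \<le> m" "6 * m \<le> lam + 3" "99 * m \<le> 16 * lam + 68"
  shows "linked V E X"
  using assms(1)
proof (induction "card V" arbitrary: V E X rule: less_induct)
  case less
  note smaller = less.hyps
  show ?case using less.prems smaller
  proof (induction "rho V E (V - X)" arbitrary: E rule: less_induct)
    case (less E)
    show ?case
    proof (rule ccontr)
      assume "\<not> linked V E X"
      then obtain Pr where Pr: "pairing X Pr" "\<not> linkable V E X Pr" unfolding linked_def by blast
      define E' where "E' = (\<lambda>a b. E a b \<or> a \<in> X \<and> b \<in> X \<and> a \<noteq> b \<and> (a, b) \<notin> Pr \<and> (b, a) \<notin> Pr)"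
      have ms: "finite V" "sym_irrefl E" "X \<subseteq> V" using less.prems(1) unfolding massed_def by auto
      have r: "rho V E' S = rho V E S" if "S \<inter> X = {}" for S
      proof -
        have "arcs V E' S = arcs V E S" unfolding arcs_def E'_def using that by blast
        then show ?thesis unfolding rho_def by simp
      qed
      have rX: "rho V E' (V - X) = rho V E (V - X)" by (rule r) blast
      have sp: "split V E A B" if "split V E' A B" for A B using that unfolding split_def E'_def by blast
      have m': "massed lam m V E' X" unfolding massed_def
      proof (intro conjI allI impI ms)
        show "sym_irrefl E'" using ms(2) unfolding sym_irrefl_def E'_def by blast
        show "card X \<le> 2 * m" using less.prems(1) unfolding massed_def by blast
        show "2 * lam * card (V - X) < rho V E' (V - X)" using less.prems(1) rX unfolding massed_def by simp
        fix A B assume a: "split V E' A B" "X \<subseteq> A" "card (A \<inter> B) < card X"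
        have "rho V E' (B - A) = rho V E (B - A)" by (rule r) (use a(2) in blast)
        then show "rho V E' (B - A) \<le> 2 * lam * card (B - A)"
          using less.prems(1) a(2,3) sp[OF a(1)] unfolding massed_def by simp
      qed
      have nl': "\<not> linkable V E' X Pr"
      proof
        assume l: "linkable V E' X Pr"
        obtain S where S: "\<And>p. p \<in> Pr \<Longrightarrow> S p \<subseteq> V" "\<And>p. p \<in> Pr \<Longrightarrow> S p \<inter> X = {fst p, snd p}"
          "\<And>p. p \<in> Pr \<Longrightarrow> reach E' (S p) (fst p) (snd p)" "\<And>p q. p \<in> Pr \<Longrightarrow> q \<in> Pr \<Longrightarrow> p \<noteq> q \<Longrightarrow> S p \<inter> S q = {}"
          by (rule linkableE[OF l]) (rule that)
        have "linkable V E X Pr"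
        proof (rule linkableI[of Pr S])
          fix p assume p: "p \<in> Pr"
          have "reach E (S p) (fst p) (snd p)"
          proof (rule reach_mono[OF S(3)[OF p] subset_refl])
            fix a b assume ab: "E' a b" "a \<in> S p" "b \<in> S p"
            show "E a b"
            proof (rule ccontr)
              assume "\<not> E a b"
              then have c: "a \<in> X" "b \<in> X" "a \<noteq> b" "(a, b) \<notin> Pr" "(b, a) \<notin> Pr" using ab(1) unfolding E'_def by auto
              then have "a \<in> {fst p, snd p}" "b \<in> {fst p, snd p}" using S(2)[OF p] ab by blast+
              then have "p = (a, b) \<or> p = (b, a)" using c(3) by (cases p) auto
              then show False using c p by blast
            qed
          qed
          then show "S p \<subseteq> V \<and> S p \<inter> X = {fst p, snd p} \<and> reach E (S p) (fst p) (snd p)" using S(1,2)[OF p] by blast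
        qed (rule S(4))
        then show False using Pr(2) by blast
      qed
      have "massed_counterexample V E' X lam m Pr"
      proof
        show "(a, b) \<in> Pr \<or> (b, a) \<in> Pr" if "a \<in> X" "b \<in> X" "a \<noteq> b" "\<not> E' a b" for a b
          using that unfolding E'_def by blast
        show "linked V'' E'' X''" if "massed lam m V'' E'' X''" "card V'' < card V" for V'' :: "'a set" and E'' X''
          using less.prems(2) that by blast
        show "linked V E'' X" if "massed lam m V E'' X" "rho V E'' (V - X) < rho V E' (V - X)" for E''
        proof (rule less.hyps)
          show "rho V E'' (V - X) < rho V E (V - X)" using that(2) rX by simp
        qed (use that less.prems(2) in blast)+
      qed (use m' Pr(1) nl' assms in blast)+
      then show False by (rule massed_counterexample.contradiction)
    qed
  qed
qed

section \<open>A highly linked bipartite subgraph\<close>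

definition crossing :: "('a \<Rightarrow> 'a \<Rightarrow> bool) \<Rightarrow> ('a \<Rightarrow> bool) \<Rightarrow> 'a \<Rightarrow> 'a \<Rightarrow> bool" where
  "crossing E c a b \<longleftrightarrow> E a b \<and> c a \<noteq> c b"

lemma crossing_sym_irrefl: "sym_irrefl E \<Longrightarrow> sym_irrefl (crossing E c)"
  unfolding sym_irrefl_def crossing_def by blast

lemma rho_remove_vertex:
  assumes fin: "finite V" and E: "sym_irrefl E" and v: "v \<in> V"
  shows "rho V E V = rho (V - {v}) E (V - {v}) + 2 * card (nb E V v)"
proof -
  let ?N = "nb E V v"
  have "arcs V E V = arcs (V - {v}) E (V - {v}) \<union> ({v} \<times> ?N \<union> ?N \<times> {v})"
    unfolding arcs_def using v sym_irreflD(1)[OF E] by auto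
  moreover have "card (arcs (V - {v}) E (V - {v}) \<union> ({v} \<times> ?N \<union> ?N \<times> {v}))
     = card (arcs (V - {v}) E (V - {v})) + card ({v} \<times> ?N \<union> ?N \<times> {v})"
  proof (rule card_Un_disjoint)
    show "finite (arcs (V - {v}) E (V - {v}))" using fin by (intro finite_arcs) simp
    show "arcs (V - {v}) E (V - {v}) \<inter> ({v} \<times> ?N \<union> ?N \<times> {v}) = {}" unfolding arcs_def by auto
  qed (use fin in simp)
  moreover have "card ({v} \<times> ?N \<union> ?N \<times> {v}) = card ({v} \<times> ?N) + card (?N \<times> {v})"
    by (rule card_Un_disjoint) (use fin sym_irreflD(2)[OF E] in auto)
  ultimately show ?thesis unfolding rho_def by (simp add: card_cartesian_product)
qed

text \<open>In a cut with the most crossing edges, moving \<open>v\<close> to the other side does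
  not help, so at least half of the edges at \<open>v\<close> cross.\<close>

lemma max_cut:
  assumes fin: "finite V" and E: "sym_irrefl E"
  shows "\<exists>c. \<forall>v\<in>V. card (nb E V v) \<le> 2 * card (nb (crossing E c) V v)"
proof -
  have "rho V (crossing E c) V \<le> card (V \<times> V)" for c
    unfolding rho_def by (rule card_mono) (use fin in \<open>auto simp: arcs_def\<close>)
  then have "\<exists>c. True \<and> (\<forall>c'. True \<longrightarrow> rho V (crossing E c') V \<le> rho V (crossing E c) V)"
    by (intro ex_has_greatest_nat[where b = "Suc (card (V \<times> V))"]) (simp_all add: le_imp_less_Suc del: card_cartesian_product)
  then obtain c where c: "\<And>c'. rho V (crossing E c') V \<le> rho V (crossing E c) V" by blast
  have "card (nb E V v) \<le> 2 * card (nb (crossing E c) V v)" if v: "v \<in> V" for v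
  proof -
    define c' where "c' = c(v := \<not> c v)"
    have "arcs (V - {v}) (crossing E c') (V - {v}) = arcs (V - {v}) (crossing E c) (V - {v})"
      unfolding arcs_def crossing_def c'_def by auto
    then have "rho (V - {v}) (crossing E c') (V - {v}) = rho (V - {v}) (crossing E c) (V - {v})" unfolding rho_def by simp
    then have le: "card (nb (crossing E c') V v) \<le> card (nb (crossing E c) V v)"
      using c[of c'] rho_remove_vertex[OF fin crossing_sym_irrefl[OF E] v, of c] rho_remove_vertex[OF fin crossing_sym_irrefl[OF E] v, of c'] by simp
    have "nb E V v \<subseteq> nb (crossing E c') V v \<union> nb (crossing E c) V v" unfolding crossing_def c'_def using sym_irreflD(2)[OF E] by auto
    then have "card (nb E V v) \<le> card (nb (crossing E c') V v \<union> nb (crossing E c) V v)" by (rule card_mono[rotated]) (use fin in simp)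
    also have "\<dots> \<le> card (nb (crossing E c') V v) + card (nb (crossing E c) V v)" by (rule card_Un_le)
    finally show ?thesis using le by simp
  qed
  then show ?thesis by blast
qed

lemma rho_bipartite_le:
  assumes "finite S"
  shows "2 * rho S (crossing E c) S \<le> card S * card S"
proof -
  let ?S1 = "{v \<in> S. c v}" and ?S2 = "{v \<in> S. \<not> c v}"
  have "arcs S (crossing E c) S \<subseteq> ?S1 \<times> ?S2 \<union> ?S2 \<times> ?S1" unfolding arcs_def crossing_def by auto
  then have "rho S (crossing E c) S \<le> card (?S1 \<times> ?S2 \<union> ?S2 \<times> ?S1)" unfolding rho_def
    by (rule card_mono[rotated]) (use assms in simp)
  also have "\<dots> \<le> card ?S1 * card ?S2 + card ?S2 * card ?S1"
    using card_Un_le[of "?S1 \<times> ?S2" "?S2 \<times> ?S1"] by (simp add: card_cartesian_product)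
  also have "\<dots> = 2 * (card ?S1 * card ?S2)" by (simp add: mult.commute)
  finally have 1: "rho S (crossing E c) S \<le> 2 * (card ?S1 * card ?S2)" .
  have "S = ?S1 \<union> ?S2" by blast
  then have "card S = card (?S1 \<union> ?S2)" by simp
  also have "\<dots> = card ?S1 + card ?S2" by (rule card_Un_disjoint) (use assms in auto)
  finally have 2: "card S = card ?S1 + card ?S2" .
  have sq: "4 * (a * b) \<le> (a + b) * (a + b)" for a b :: nat
  proof -
    have "0 \<le> (int a - int b) * (int a - int b)" by simp
    then have "4 * (int a * int b) \<le> (int a + int b) * (int a + int b)" by (simp add: algebra_simps)
    then show ?thesis by (metis of_nat_add of_nat_le_iff of_nat_mult of_nat_numeral)
  qed
  show ?thesis using 1 sq[of "card ?S1" "card ?S2"] unfolding 2 by linarith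
qed

lemma min_degree_sum:
  assumes fin: "finite V" and d: "\<And>v. v \<in> S \<Longrightarrow> d \<le> card (nb E V v)" and SV: "S \<subseteq> V"
  shows "d * card S \<le> rho V E S"
proof -
  have finS: "finite S" using fin SV finite_subset by blast
  have "Sigma S (nb E V) \<subseteq> arcs V E S" unfolding arcs_def using SV by auto
  then have "card (Sigma S (nb E V)) \<le> rho V E S" unfolding rho_def by (rule card_mono[OF finite_arcs[OF fin]])
  moreover have "card (Sigma S (nb E V)) = (\<Sum>v\<in>S. card (nb E V v))" using finS fin by (intro card_SigmaI) auto
  moreover have "(\<Sum>v\<in>S. d) \<le> (\<Sum>v\<in>S. card (nb E V v))" by (rule sum_mono) (rule d)
  ultimately show ?thesis by (simp add: mult.commute)
qed

text \<open>\<open>62/5 * k\<close> lies between \<open>99/8 * k\<close>, which the linkage theorem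
  requires for \<open>m = 2 * k\<close>, and the available density \<open>25/2 * k\<close>. The
  error from rounding down is absorbed by the constant \<open>68\<close>.\<close>

lemma lam_bounds:
  fixes k :: nat
  assumes "1 \<le> k"
  defines "lam \<equiv> (62 * k) div 5"
  shows "5 * lam \<le> 62 * k" "6 * (2 * k) \<le> lam + 3" "99 * (2 * k) \<le> 16 * lam + 68"
proof -
  have 1: "5 * lam \<le> 62 * k" unfolding lam_def by simp
  have "62 * k = 62 * k div 5 * 5 + 62 * k mod 5" by simp
  moreover have "62 * k mod 5 < 5" by simp
  ultimately have 2: "62 * k < 5 * lam + 5" unfolding lam_def by linarith
  show "5 * lam \<le> 62 * k" "6 * (2 * k) \<le> lam + 3" "99 * (2 * k) \<le> 16 * lam + 68" using 1 2 by linarith+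
qed

text \<open>A subgraph that is minimal subject to having at least \<open>25k/2 (h - 4k)\<close> edges on \<open>h \<ge> 8k\<close>
  vertices has no separation of order below \<open>4k\<close>.\<close>

lemma linked_bipartite_subgraph:
  assumes fin: "finite V" and E: "sym_irrefl E" and k: "1 \<le> k" and cV: "8 * k \<le> card V"
    and deg: "\<And>v. v \<in> V \<Longrightarrow> 50 * k \<le> card (nb E V v)"
  shows "\<exists>H c. H \<subseteq> V \<and> 44 * k < card H \<and> (\<forall>X\<subseteq>H. card X \<le> 4 * k \<longrightarrow> linked H (crossing E c) X)"
proof -
  obtain c where c: "\<And>v. v \<in> V \<Longrightarrow> card (nb E V v) \<le> 2 * card (nb (crossing E c) V v)" using max_cut[OF fin E] by blast
  define F where "F = crossing E c"
  have F: "sym_irrefl F" unfolding F_def by (rule crossing_sym_irrefl[OF E])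
  note Fs = sym_irreflD(1)[OF F]
  have degF: "25 * k \<le> card (nb F V v)" if "v \<in> V" for v using c[OF that] deg[OF that] unfolding F_def by linarith
  define good where "good H \<longleftrightarrow> H \<subseteq> V \<and> 8 * k \<le> card H \<and> 25 * k * (card H - 4 * k) \<le> rho H F H" for H
  have "25 * k * card V \<le> rho V F V" by (rule min_degree_sum[OF fin degF]) auto
  then have "25 * k * (card V - 4 * k) \<le> rho V F V" by (rule le_trans[rotated]) simp
  then have "good V" unfolding good_def using cV by blast
  then obtain H where H: "good H" "\<And>H'. good H' \<Longrightarrow> card H \<le> card H'"
    using ex_has_least_nat[of good V card] by blast
  have HV: "H \<subseteq> V" and h8: "8 * k \<le> card H" and rH: "25 * k * (card H - 4 * k) \<le> rho H F H" using H(1) unfolding good_def by auto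
  have finH: "finite H" using HV fin finite_subset by blast
  have small: "rho S F S < 25 * k * (card S - 4 * k)" if "S \<subset> H" "8 * k \<le> card S" for S
  proof (rule ccontr)
    assume "\<not> ?thesis"
    then have "good S" unfolding good_def using that HV by auto
    then show False using H(2) psubset_card_mono[OF finH that(1)] by fastforce
  qed
  \<comment> \<open>A bipartite graph on \<open>h\<close> vertices has \<open>rho\<close> at most
    \<open>h^2 / 2\<close>. With \<open>h = 8k + a\<close> and \<open>a \<le> 36k\<close> this gives
    \<open>136k^2 + 34ka \<le> a^2 \<le> 36ka \<le> 34ka + 72k^2\<close>, which is absurd.\<close>
  have h44: "44 * k < card H"
  proof (rule ccontr)
    assume n: "\<not> ?thesis"
    obtain a where a: "card H = 8 * k + a" using h8 le_Suc_ex by blast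
    have ak: "a \<le> 36 * k" using n a by linarith
    have "2 * (25 * k * (4 * k + a)) \<le> (8 * k + a) * (8 * k + a)"
    proof -
      have "2 * (25 * k * (card H - 4 * k)) \<le> 2 * rho H F H" using rH by simp
      also have "\<dots> \<le> card H * card H" unfolding F_def by (rule rho_bipartite_le[OF finH])
      finally show ?thesis unfolding a by simp
    qed
    then have 1: "136 * (k * k) + 34 * (k * a) \<le> a * a" by (simp add: algebra_simps)
    have "a * a \<le> 36 * (k * a)" using ak by (metis mult.assoc mult_le_mono1)
    moreover have "k * a \<le> 36 * (k * k)" using ak by (metis mult_le_mono2 mult.left_commute)
    ultimately have "136 * (k * k) \<le> 72 * (k * k)" using 1 by linarith
    then show False using k by simp
  qed
  \<comment> \<open>Deleting a vertex of degree below \<open>8k\<close> lowers \<open>rho\<close> by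
    less than \<open>16k\<close>, whereas the required bound falls by \<open>25k\<close>, against
    minimality.\<close>
  have degH: "8 * k \<le> card (nb F H v)" if v: "v \<in> H" for v
  proof (rule ccontr)
    assume n: "\<not> ?thesis"
    have cH: "card (H - {v}) = card H - 1" using v by simp
    have "rho (H - {v}) F (H - {v}) < 25 * k * (card (H - {v}) - 4 * k)"
      by (rule small) (use v h44 cH k in auto)
    moreover have "rho H F H = rho (H - {v}) F (H - {v}) + 2 * card (nb F H v)" by (rule rho_remove_vertex[OF finH F v])
    moreover obtain b where b: "card H = Suc (4 * k + b)" using h44 less_imp_Suc_add[of "4 * k" "card H"] by auto
    ultimately have "25 * k * (b + 1) < 25 * k * b + 2 * (8 * k)" using rH n cH by auto
    then show False using k by (simp add: algebra_simps)
  qed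
  define lam where "lam = (62 * k) div 5"
  note lb = lam_bounds[OF k, folded lam_def]
  have full: "linked H F X" if X: "X \<subseteq> H" "card X = 4 * k" for X
  proof (rule massed_imp_linked)
    have finX: "finite X" using X(1) finH finite_subset by blast
    show "massed lam (2 * k) H F X" unfolding massed_def
    proof (intro conjI allI impI finH F X(1))
      show "card X \<le> 2 * (2 * k)" using X(2) by simp
      have "arcs H F H \<subseteq> arcs H F (H - X) \<union> arcs X F X" unfolding arcs_def by auto
      then have "rho H F H \<le> card (arcs H F (H - X) \<union> arcs X F X)" unfolding rho_def
        by (rule card_mono[rotated]) (use finite_arcs finH finX in blast)
      also have "\<dots> \<le> rho H F (H - X) + rho X F X" unfolding rho_def by (rule card_Un_le)
      finally have 1: "25 * k * (card H - 4 * k) \<le> rho H F (H - X) + rho X F X" using rH by simp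
      have "2 * rho X F X \<le> card X * card X" unfolding F_def by (rule rho_bipartite_le[OF finX])
      then have 2: "rho X F X \<le> 8 * (k * k)" unfolding X(2) by simp
      obtain b where b: "card H = 44 * k + Suc b" using h44 less_imp_Suc_add[of "44 * k" "card H"] by auto
      have 3: "card (H - X) = 40 * k + Suc b" using card_Diff_subset[OF finX X(1)] X(2) b by simp
      \<comment> \<open>The gap between \<open>25k\<close> and \<open>2 * lam \<le> 24.8k\<close>,
        taken over more than \<open>40k\<close> vertices, exceeds the at most \<open>8k^2\<close>
        counted inside \<open>X\<close>; this is what \<open>44k < card H\<close> is for.\<close>
      have "5 * (2 * lam * (40 * k + Suc b)) \<le> 124 * k * (40 * k + Suc b)"
        using mult_le_mono1[OF lb(1), of "2 * (40 * k + Suc b)"] by (simp add: algebra_simps)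
      moreover have "5 * (25 * k * (40 * k + Suc b)) = 125 * k * (40 * k + Suc b)" by simp
      moreover have "124 * k * (40 * k + Suc b) + 40 * (k * k) + k * Suc b = 125 * k * (40 * k + Suc b)" by (simp add: algebra_simps)
      moreover have "0 < k * Suc b" using k by simp
      moreover have "25 * k * (40 * k + Suc b) \<le> rho H F (H - X) + rho X F X" using 1 unfolding b by simp
      ultimately show "2 * lam * card (H - X) < rho H F (H - X)" using 2 unfolding 3 by linarith
      fix A B assume s: "split H F A B" "X \<subseteq> A" "card (A \<inter> B) < card X"
      have U: "A \<union> B = H" and ne: "\<And>a b. a \<in> A - B \<Longrightarrow> b \<in> B - A \<Longrightarrow> \<not> F a b" using s(1) unfolding split_def by blast+
      have finAB: "finite A" "finite B" using finH U by auto
      \<comment> \<open>Otherwise both sides are proper and, by \<open>degH\<close>, have at least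
        \<open>8k\<close> vertices. By minimality they are sparse, and as
        \<open>card A + card B < card H + 4k\<close>, their counts cannot add up to that of
        \<open>H\<close>.\<close>
      have "B - A = {}"
      proof (rule ccontr)
        assume BA: "B - A \<noteq> {}"
        then obtain b where bB: "b \<in> B" "b \<notin> A" by blast
        have "\<not> X \<subseteq> A \<inter> B" using card_mono[of "A \<inter> B" X] finAB s(3) by auto
        then obtain a where aA: "a \<in> A" "a \<notin> B" using s(2) by blast
        have "nb F H a \<subseteq> A" using ne[of a] aA U by blast
        then have cA: "8 * k \<le> card A" using degH[of a] aA U card_mono[OF finAB(1)] by (meson UnI1 le_trans)
        have "nb F H b \<subseteq> B" using ne[of _ b] bB U Fs by blast
        then have cB: "8 * k \<le> card B" using degH[of b] bB U card_mono[OF finAB(2)] by (meson UnI2 le_trans)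
        have rA: "rho A F A < 25 * k * (card A - 4 * k)" by (rule small[OF _ cA]) (use U bB in blast)
        have rB: "rho B F B < 25 * k * (card B - 4 * k)" by (rule small[OF _ cB]) (use U aA in blast)
        have "arcs H F H \<subseteq> arcs A F A \<union> arcs B F B" unfolding arcs_def using ne Fs U by auto
        then have "rho H F H \<le> card (arcs A F A \<union> arcs B F B)" unfolding rho_def
          by (rule card_mono[rotated]) (use finite_arcs finAB in blast)
        also have "\<dots> \<le> rho A F A + rho B F B" unfolding rho_def by (rule card_Un_le)
        finally have "25 * k * (card H - 4 * k) < 25 * k * (card A - 4 * k) + 25 * k * (card B - 4 * k)" using rA rB rH by linarith
        also have "\<dots> = 25 * k * ((card A - 4 * k) + (card B - 4 * k))" by (simp add: distrib_left)
        finally have "card H - 4 * k < (card A - 4 * k) + (card B - 4 * k)" by (metis mult_less_cancel1)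
        moreover have "card A + card B = card H + card (A \<inter> B)" using card_Un_Int[OF finAB] U by simp
        ultimately show False using cA cB s(3) X(2) h8 by linarith
      qed
      moreover have "arcs H F {} = {}" unfolding arcs_def by simp
      ultimately show "rho H F (B - A) \<le> 2 * lam * card (B - A)" unfolding rho_def by (simp only: card.empty)
    qed
  qed (use lb k in auto)
  have "linked H F X" if X: "X \<subseteq> H" "card X \<le> 4 * k" for X
  proof -
    have finX: "finite X" using X(1) finH finite_subset by blast
    have "4 * k - card X \<le> card (H - X)" using card_Diff_subset[OF finX X(1)] h8 by simp
    then obtain Z where Z: "Z \<subseteq> H - X" "card Z = 4 * k - card X" "finite Z" by (rule obtain_subset_with_card_n)
    have "card (X \<union> Z) = card X + card Z" by (rule card_Un_disjoint) (use Z finX in auto)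
    then have "linked H F (X \<union> Z)" using Z X by (intro full) auto
    then show ?thesis by (rule linked_subset) blast
  qed
  then show ?thesis using HV h44 unfolding F_def by blast
qed

text \<open>The minimum degree exceeds \<open>2 * lam\<close>, and by \<open>conn\<close> a
  separation of small order cuts off nothing from \<open>X\<close>, so \<open>V\<close> is
  massed.\<close>

lemma linked_of_min_degree:
  assumes fin: "finite V" and E: "sym_irrefl E" and k: "1 \<le> k" and ne: "V \<noteq> {}"
    and deg: "\<And>v. v \<in> V \<Longrightarrow> 25 * k \<le> card (nb E V v)"
    and conn: "\<And>A B. split V E A B \<Longrightarrow> card (A \<inter> B) < 4 * k \<Longrightarrow> A \<subseteq> B \<or> B \<subseteq> A"
    and X: "X \<subseteq> V" "card X \<le> 4 * k"
  shows "linked V E X"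
proof (rule massed_imp_linked)
  define lam where "lam = (62 * k) div 5"
  note lb = lam_bounds[OF k, folded lam_def]
  have finX: "finite X" using X(1) fin finite_subset by blast
  show "massed lam (2 * k) V E X" unfolding massed_def
  proof (intro conjI allI impI fin E X(1))
    show "card X \<le> 2 * (2 * k)" using X(2) by simp
    obtain v where v: "v \<in> V" using ne by blast
    have "card (nb E V v) \<le> card V" using fin by (intro card_mono) auto
    then have "card X < card V" using deg[OF v] X(2) k by linarith
    then have pos: "0 < card (V - X)" using card_Diff_subset[OF finX X(1)] by simp
    have "2 * lam < 25 * k" using lb(1) k by linarith
    then have "2 * lam * card (V - X) < 25 * k * card (V - X)" using pos by simp
    also have "\<dots> \<le> rho V E (V - X)" by (rule min_degree_sum[OF fin]) (use deg in auto)
    finally show "2 * lam * card (V - X) < rho V E (V - X)" .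
    fix A B assume s: "split V E A B" "X \<subseteq> A" "card (A \<inter> B) < card X"
    have finAB: "finite (A \<inter> B)" using fin s(1) unfolding split_def by auto
    have "\<not> A \<subseteq> B" using card_mono[OF finAB, of X] s(2,3) by (meson Int_greatest le_trans not_le order_refl subset_trans)
    then have "B \<subseteq> A" using conn[OF s(1)] s(3) X(2) by linarith
    then have "B - A = {}" by blast
    moreover have "arcs V E {} = {}" unfolding arcs_def by simp
    ultimately show "rho V E (B - A) \<le> 2 * lam * card (B - A)" unfolding rho_def by (simp only: card.empty)
  qed
  show "1 \<le> 2 * k" "6 * (2 * k) \<le> lam + 3" "99 * (2 * k) \<le> 16 * lam + 68" using lb k by auto
qed

section \<open>The Tutte--Berge formula\<close>

definition matching :: "'b set \<Rightarrow> ('b \<Rightarrow> 'b \<Rightarrow> bool) \<Rightarrow> 'b set set \<Rightarrow> bool" where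
  "matching V E M \<longleftrightarrow> (\<forall>e\<in>M. \<exists>a\<in>V. \<exists>b\<in>V. a \<noteq> b \<and> E a b \<and> E b a \<and> e = {a, b})
     \<and> (\<forall>e\<in>M. \<forall>f\<in>M. e \<noteq> f \<longrightarrow> e \<inter> f = {})"

definition max_matching :: "'b set \<Rightarrow> ('b \<Rightarrow> 'b \<Rightarrow> bool) \<Rightarrow> 'b set set \<Rightarrow> bool" where
  "max_matching V E M \<longleftrightarrow> matching V E M \<and> (\<forall>M'. matching V E M' \<longrightarrow> card M' \<le> card M)"

text \<open>The classes are unions of components and need not be connected; only the number of odd
  classes matters.\<close>

definition edge_partition :: "'b set \<Rightarrow> ('b \<Rightarrow> 'b \<Rightarrow> bool) \<Rightarrow> 'b set set \<Rightarrow> bool" where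
  "edge_partition V E C \<longleftrightarrow> \<Union>C = V \<and> (\<forall>K\<in>C. \<forall>L\<in>C. K \<noteq> L \<longrightarrow> K \<inter> L = {})
     \<and> (\<forall>K\<in>C. \<forall>L\<in>C. K \<noteq> L \<longrightarrow> (\<forall>a\<in>K. \<forall>b\<in>L. \<not> E a b))"

lemma matching_sub: "matching V E M \<Longrightarrow> e \<in> M \<Longrightarrow> e \<subseteq> V"
  unfolding matching_def by fastforce

lemma matching_Union: "matching V E M \<Longrightarrow> \<Union>M \<subseteq> V"
  by (intro Union_least matching_sub)

lemma matching_finite:
  assumes "finite V" "matching V E M"
  shows "finite M"
  by (rule finite_subset[of _ "Pow V"]) (use assms matching_sub in blast)+

lemma matching_card:
  assumes "finite V" "matching V E M"
  shows "card (\<Union>M) = 2 * card M"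
proof -
  have c: "card e = 2" if "e \<in> M" for e using assms(2) that unfolding matching_def by fastforce
  have "card (\<Union>M) = sum card M"
  proof (rule card_Union_disjoint)
    show "pairwise disjnt M" using assms(2) unfolding matching_def pairwise_def disjnt_def by simp
    show "finite e" if "e \<in> M" for e using c[OF that] by (metis card.infinite zero_neq_numeral)
  qed
  then show ?thesis using c by simp
qed

lemma matching_edge:
  assumes "matching V E M" "e \<in> M"
  obtains a b where "a \<in> V" "b \<in> V" "a \<noteq> b" "E a b" "E b a" "e = {a, b}"
  using assms unfolding matching_def by auto

lemma matching_disjoint: "matching V E M \<Longrightarrow> e \<in> M \<Longrightarrow> f \<in> M \<Longrightarrow> e \<noteq> f \<Longrightarrow> e \<inter> f = {}"
  unfolding matching_def by simp

lemma matchingI: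
  assumes "\<And>e. e \<in> M \<Longrightarrow> \<exists>a\<in>V. \<exists>b\<in>V. a \<noteq> b \<and> E a b \<and> E b a \<and> e = {a, b}"
    and "\<And>e f. e \<in> M \<Longrightarrow> f \<in> M \<Longrightarrow> e \<noteq> f \<Longrightarrow> e \<inter> f = {}"
  shows "matching V E M"
  using assms unfolding matching_def by simp

lemma matching_mono:
  assumes "matching V E M" "V \<subseteq> V'"
  shows "matching V' E M"
proof (rule matchingI)
  fix e assume "e \<in> M"
  then obtain a b where "a \<in> V" "b \<in> V" "a \<noteq> b" "E a b" "E b a" "e = {a, b}" by (rule matching_edge[OF assms(1)])
  then show "\<exists>a\<in>V'. \<exists>b\<in>V'. a \<noteq> b \<and> E a b \<and> E b a \<and> e = {a, b}"
    using subsetD[OF assms(2)] by (intro bexI[of _ a] bexI[of _ b]) auto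
qed (rule matching_disjoint[OF assms(1)])

lemma matching_subset:
  assumes "matching V E M" "N \<subseteq> M"
  shows "matching V E N"
  using assms unfolding matching_def by (meson subsetD)

lemma matching_insert:
  assumes "matching V E M" "a \<in> V" "b \<in> V" "a \<noteq> b" "E a b" "E b a" "a \<notin> \<Union>M" "b \<notin> \<Union>M"
  shows "matching V E (insert {a, b} M)"
proof (rule matchingI)
  fix e assume "e \<in> insert {a, b} M"
  then consider "e = {a, b}" | "e \<in> M" by blast
  then show "\<exists>x\<in>V. \<exists>y\<in>V. x \<noteq> y \<and> E x y \<and> E y x \<and> e = {x, y}"
  proof cases
    case 1
    have "a \<noteq> b \<and> E a b \<and> E b a \<and> e = {a, b}" using assms(4-6) 1 by simp
    then show ?thesis using assms(2,3) by (intro bexI)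
  next
    case 2
    then show ?thesis using assms(1) unfolding matching_def by simp
  qed
next
  fix e f assume ef: "e \<in> insert {a, b} M" "f \<in> insert {a, b} M" "e \<noteq> f"
  have "{a, b} \<inter> h = {}" if "h \<in> M" for h using assms(7,8) that by blast
  then show "e \<inter> f = {}" using ef matching_disjoint[OF assms(1), of e f] by blast
qed

lemma max_matching_exists:
  assumes "finite V"
  shows "\<exists>M. max_matching V E M"
proof -
  have "matching V E {}" unfolding matching_def by simp
  moreover have "card M < Suc (card (Pow V))" if "matching V E M" for M
    using card_mono[of "Pow V" M] assms matching_sub[OF that] by (simp add: le_imp_less_Suc subsetI)
  ultimately show ?thesis unfolding max_matching_def
    using ex_has_greatest_nat[of "matching V E" "{}" card "Suc (card (Pow V))"] by blast
qed

text \<open>Gallai's argument. Among the maximum matchings that miss \<open>v\<close>, let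
  \<open>N\<close> share the most edges with \<open>M\<close>. It covers \<open>u\<close> and
  \<open>w\<close>, so \<open>M\<close> covers some \<open>x \<noteq> v\<close> that
  \<open>N\<close> misses. Trading an edge of \<open>N\<close> for the edge of \<open>M\<close> at
  \<open>x\<close> keeps \<open>v\<close> missed and brings \<open>N\<close> closer to
  \<open>M\<close>.\<close>

lemma gallai_transitive:
  assumes fin: "finite V" and M: "max_matching V E M" "u \<notin> \<Union>M" "w \<notin> \<Union>M" "u \<in> V" "w \<in> V" "u \<noteq> w"
    and v: "max_matching V E N0" "v \<notin> \<Union>N0"
    and uv: "\<And>N. max_matching V E N \<Longrightarrow> v \<notin> \<Union>N \<Longrightarrow> u \<in> \<Union>N" and vw: "\<And>N. max_matching V E N \<Longrightarrow> v \<notin> \<Union>N \<Longrightarrow> w \<in> \<Union>N"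
  shows False
proof -
  have finM: "finite M" using M(1) fin matching_finite unfolding max_matching_def by blast
  define good where "good N \<longleftrightarrow> max_matching V E N \<and> v \<notin> \<Union>N" for N
  have "good N0" unfolding good_def using v by blast
  moreover have "card (M \<inter> N) < Suc (card M)" for N using card_mono[OF finM, of "M \<inter> N"] by (simp add: le_imp_less_Suc)
  ultimately obtain N where N: "good N" "\<And>N'. good N' \<Longrightarrow> card (M \<inter> N') \<le> card (M \<inter> N)"
    using ex_has_greatest_nat[of good N0 "\<lambda>N. card (M \<inter> N)" "Suc (card M)"] by blast
  have mN: "max_matching V E N" "v \<notin> \<Union>N" using N(1) unfolding good_def by auto
  have m: "matching V E M" "matching V E N" using M(1) mN(1) unfolding max_matching_def by auto
  have finN: "finite N" using matching_finite[OF fin m(2)] .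
  have "card M = card N" using M(1) mN(1) unfolding max_matching_def by (simp add: le_antisym)
  then have c: "card (\<Union>M) = card (\<Union>N)" using matching_card[OF fin] m by simp
  have fU: "finite (\<Union>M)" "finite (\<Union>N)" using finite_subset[OF matching_Union[OF m(1)] fin] finite_subset[OF matching_Union[OF m(2)] fin] by simp_all
  have "{u, w} \<subseteq> \<Union>N - \<Union>M" using uv[OF mN] vw[OF mN] M(2,3) by blast
  then have "card {u, w} \<le> card (\<Union>N - \<Union>M)" using fU by (intro card_mono) auto
  then have "2 \<le> card (\<Union>N - \<Union>M)" using M(6) by simp
  moreover have "card (\<Union>N - \<Union>M) + card (\<Union>N \<inter> \<Union>M) = card (\<Union>N)" "card (\<Union>M - \<Union>N) + card (\<Union>N \<inter> \<Union>M) = card (\<Union>M)"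
    using card_Diff_subset_Int[of "\<Union>N" "\<Union>M"] card_Diff_subset_Int[of "\<Union>M" "\<Union>N"] fU
      card_mono[OF fU(2), of "\<Union>N \<inter> \<Union>M"] card_mono[OF fU(1), of "\<Union>M \<inter> \<Union>N"] by (simp_all add: Int_commute)
  ultimately have "\<not> card (\<Union>M - \<Union>N) \<le> 1" using c by linarith
  then have "\<not> \<Union>M - \<Union>N \<subseteq> {v}" using card_mono[of "{v}" "\<Union>M - \<Union>N"] by auto
  then obtain x where x: "x \<in> \<Union>M" "x \<notin> \<Union>N" "x \<noteq> v" by blast
  obtain e where e: "e \<in> M" "x \<in> e" using x(1) by blast
  obtain a b where ab: "a \<in> V" "b \<in> V" "a \<noteq> b" "E a b" "E b a" "e = {a, b}" by (rule matching_edge[OF m(1) e(1)])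
  obtain y where y: "e = {x, y}" "x \<noteq> y" "x \<in> V" "y \<in> V" "E x y" "E y x"
    using that[of b] that[of a] ab e(2) by (cases "x = a") (auto simp: insert_commute)
  have yN: "y \<in> \<Union>N"
  proof (rule ccontr)
    assume "y \<notin> \<Union>N"
    then have "matching V E (insert {x, y} N)" using x y by (intro matching_insert[OF m(2)])
    then have "card (insert {x, y} N) \<le> card N" using mN(1) unfolding max_matching_def by blast
    moreover have "{x, y} \<notin> N" using x(2) by blast
    ultimately show False using finN by simp
  qed
  then obtain f where f: "f \<in> N" "y \<in> f" by blast
  let ?N = "insert {x, y} (N - {f})"
  have "y \<notin> \<Union>(N - {f})" using matching_disjoint[OF m(2)] f by blast
  then have mat: "matching V E ?N" using x y by (intro matching_insert[OF matching_subset[OF m(2)]]) auto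
  have "{x, y} \<notin> N" using x(2) by blast
  then have "card ?N = card N" using finN f(1) by (metis card_Suc_Diff1 card_insert_disjoint finite_Diff insert_Diff insert_iff)
  then have "max_matching V E ?N" using mN(1) mat unfolding max_matching_def by simp
  moreover have "v \<notin> \<Union>?N" using mN(2) x(3) yN by blast
  ultimately have "card (M \<inter> ?N) \<le> card (M \<inter> N)" using N(2) unfolding good_def by blast
  moreover have "f \<notin> M"
  proof
    assume "f \<in> M"
    moreover have "e \<noteq> f" using y(1) f x(2) by blast
    ultimately have "e \<inter> f = {}" using matching_disjoint[OF m(1) e(1)] by blast
    then show False using y(1) f(2) by blast
  qed
  then have "insert e (M \<inter> N) \<subseteq> M \<inter> ?N" using e(1) y(1) by blast
  then have "card (insert e (M \<inter> N)) \<le> card (M \<inter> ?N)" using finM by (intro card_mono) auto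
  moreover have "e \<notin> N" using e x(2) by blast
  ultimately show False using finM by simp
qed

text \<open>A vertex that every maximum matching covers goes into \<open>U\<close>, and its deletion
  lowers the matching number. If there is no such vertex, "no maximum matching misses both" is an
  equivalence relation by Gallai's argument and contains all edges. A vertex missed by
  \<open>M\<close> is the only one in its class, and the others are matched among themselves, so the
  class is odd.\<close>

theorem tutte_berge:
  assumes "finite V" "\<And>a b. E a b \<Longrightarrow> E b a"
  shows "\<exists>U C M. U \<subseteq> V \<and> edge_partition (V - U) E C \<and> matching V E M
    \<and> card U + card V \<le> card {K \<in> C. odd (card K)} + 2 * card M"
  using assms(1)
proof (induction "card V" arbitrary: V rule: less_induct)
  case less
  note fin = less.prems
  obtain M where M: "max_matching V E M" using max_matching_exists[OF fin] by blast
  have mM: "matching V E M" using M unfolding max_matching_def by blast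
  show ?case
  proof (cases "\<exists>v\<in>V. \<forall>N. max_matching V E N \<longrightarrow> v \<in> \<Union>N")
    case True
    then obtain v where v: "v \<in> V" "\<And>N. max_matching V E N \<Longrightarrow> v \<in> \<Union>N" by blast
    let ?V = "V - {v}"
    have "card ?V < card V" using fin v(1) by (simp add: card_Diff1_less del: card_Diff_insert)
    then obtain U C N where IH: "U \<subseteq> ?V" "edge_partition (?V - U) E C" "matching ?V E N"
      "card U + card ?V \<le> card {K \<in> C. odd (card K)} + 2 * card N" using less.hyps[of ?V] fin by auto
    have mN: "matching V E N" using IH(3) by (rule matching_mono) blast
    have "v \<notin> \<Union>N" using matching_Union[OF IH(3)] by blast
    then have "\<not> max_matching V E N" using v(2) by blast
    then have "card N < card M" using M mN unfolding max_matching_def by (meson le_less_trans not_le le_trans)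
    moreover have "card (insert v U) = Suc (card U)"
      using IH(1) fin finite_subset[of U ?V] by (intro card_insert_disjoint) auto
    moreover have "card V = Suc (card ?V)" using v(1) fin by (metis card_Suc_Diff1)
    ultimately have "card (insert v U) + card V \<le> card {K \<in> C. odd (card K)} + 2 * card M" using IH(4) by linarith
    moreover have "V - insert v U = ?V - U" by blast
    then have "edge_partition (V - insert v U) E C" using IH(2) by simp
    moreover have "insert v U \<subseteq> V" using IH(1) v(1) by blast
    ultimately show ?thesis using mM by (intro exI[of _ "insert v U"] exI[of _ C] exI[of _ M] conjI)
  next
    case False
    then have ness: "\<exists>N. max_matching V E N \<and> v \<notin> \<Union>N" if "v \<in> V" for v using that by blast
    define r where "r u v \<longleftrightarrow> u = v \<or> (\<forall>N. max_matching V E N \<longrightarrow> u \<in> \<Union>N \<or> v \<in> \<Union>N)" for u v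
    have rs: "r u v \<Longrightarrow> r v u" for u v unfolding r_def by blast
    have rt: "r u w" if uvw: "u \<in> V" "v \<in> V" "w \<in> V" "r u v" "r v w" for u v w
    proof (rule ccontr)
      assume n: "\<not> r u w"
      then obtain N where N: "max_matching V E N" "u \<notin> \<Union>N" "w \<notin> \<Union>N" "u \<noteq> w" unfolding r_def by blast
      have ne: "u \<noteq> v" "v \<noteq> w" using n uvw by auto
      obtain N0 where N0: "max_matching V E N0" "v \<notin> \<Union>N0" using ness[OF uvw(2)] by blast
      show False
        by (rule gallai_transitive[OF fin N(1-3) uvw(1,3) N(4) N0]) (use uvw(4,5) ne in \<open>unfold r_def, blast+\<close>)
    qed
    define cl where "cl v = {w \<in> V. r v w}" for v
    have clv: "v \<in> cl v" if "v \<in> V" for v using that unfolding cl_def r_def by simp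
    have cleq: "cl u = cl v" if "u \<in> V" "v \<in> V" "r u v" for u v
      unfolding cl_def using rt[OF that(1,2)] rt[OF that(2,1)] that rs by blast
    have adj: "r a b" if ab: "a \<in> V" "b \<in> V" "E a b" for a b
    proof (rule ccontr)
      assume "\<not> r a b"
      then obtain N where N: "max_matching V E N" "a \<notin> \<Union>N" "b \<notin> \<Union>N" "a \<noteq> b" unfolding r_def by blast
      have mN: "matching V E N" using N(1) unfolding max_matching_def by blast
      have "matching V E (insert {a, b} N)" using matching_insert[OF mN ab(1,2) N(4) ab(3) assms(2)[OF ab(3)] N(2,3)] .
      then have "card (insert {a, b} N) \<le> card N" using N(1) unfolding max_matching_def by blast
      moreover have "{a, b} \<notin> N" using N(2) by blast
      ultimately show False using matching_finite[OF fin mN] by simp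
    qed
    let ?C = "cl ` V"
    have part: "edge_partition (V - {}) E ?C" unfolding edge_partition_def
    proof (intro conjI ballI impI)
      show "\<Union>?C = V - {}" using clv unfolding cl_def by blast
      fix K L assume KL: "K \<in> ?C" "L \<in> ?C" "K \<noteq> L"
      then obtain p q where pq: "p \<in> V" "K = cl p" "q \<in> V" "L = cl q" by blast
      have nr: "\<not> r a b" if "a \<in> K" "b \<in> L" for a b
      proof
        assume "r a b"
        have a: "a \<in> V" "r p a" and b: "b \<in> V" "r q b" using that pq unfolding cl_def by auto
        have "cl p = cl a" "cl q = cl b" "cl a = cl b" using cleq[of p a] cleq[of q b] cleq[of a b] a b pq \<open>r a b\<close> by blast+
        then show False using KL(3) pq by simp
      qed
      then show "K \<inter> L = {}" unfolding r_def by blast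
      fix a b assume ab: "a \<in> K" "b \<in> L"
      then have "a \<in> V" "b \<in> V" using pq unfolding cl_def by auto
      then show "\<not> E a b" using adj nr[OF ab] by blast
    qed
    have oddcl: "odd (card (cl v))" if v: "v \<in> V" "v \<notin> \<Union>M" for v
    proof -
      have miss: "w = v" if "w \<in> cl v" "w \<notin> \<Union>M" for w using that M v(2) unfolding cl_def r_def by blast
      let ?M = "{e \<in> M. e \<subseteq> cl v}"
      have "cl v - {v} = \<Union>?M"
      proof (intro equalityI subsetI)
        fix w assume w: "w \<in> cl v - {v}"
        then obtain e where e: "e \<in> M" "w \<in> e" using miss by blast
        obtain a b where ab: "a \<in> V" "b \<in> V" "a \<noteq> b" "E a b" "E b a" "e = {a, b}" by (rule matching_edge[OF mM e(1)])
        have wV: "w \<in> V" "r v w" using w unfolding cl_def by auto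
        have "r w a" "r w b" using e(2) ab adj[of a b] adj[of b a] unfolding r_def by auto
        then have "r v a" "r v b" using rt[OF v(1) wV(1) _ wV(2)] ab by blast+
        then have "e \<subseteq> cl v" using ab unfolding cl_def by blast
        then show "w \<in> \<Union>?M" using e by blast
      next
        fix w assume "w \<in> \<Union>?M"
        then show "w \<in> cl v - {v}" using v(2) by blast
      qed
      moreover have "card (\<Union>?M) = 2 * card ?M" by (rule matching_card[OF fin matching_subset[OF mM]]) blast
      moreover have "card (cl v) = Suc (card (cl v - {v}))"
        using clv[OF v(1)] fin unfolding cl_def by (metis (no_types, lifting) card_Suc_Diff1 finite_subset mem_Collect_eq subsetI)
      ultimately show ?thesis by simp
    qed
    have inj: "inj_on cl (V - \<Union>M)"
    proof (rule inj_onI)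
      fix u v assume uv: "u \<in> V - \<Union>M" "v \<in> V - \<Union>M" "cl u = cl v"
      then have "r u v" using clv[of v] unfolding cl_def by blast
      then show "u = v" using M uv unfolding r_def by blast
    qed
    have "card (V - \<Union>M) = card (cl ` (V - \<Union>M))" using card_image[OF inj] by simp
    also have "\<dots> \<le> card {K \<in> ?C. odd (card K)}" by (rule card_mono) (use fin oddcl in auto)
    finally have "card (V - \<Union>M) \<le> card {K \<in> ?C. odd (card K)}" .
    moreover have "card (V - \<Union>M) + card (\<Union>M) = card V"
    proof -
      have "\<Union>M \<subseteq> V" by (rule matching_Union[OF mM])
      then show ?thesis using fin by (metis card_Diff_subset card_mono finite_subset le_add_diff_inverse2)
    qed
    ultimately have "card {} + card V \<le> card {K \<in> ?C. odd (card K)} + 2 * card M"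
      using matching_card[OF fin mM] by simp
    then show ?thesis using part mM by (intro exI[of _ "{}"] exI[of _ ?C] exI[of _ M]) auto
  qed
qed

section \<open>Packing broken paths\<close>

text \<open>Whether the number of edges with both ends of the same colour is odd.\<close>

definition brk :: "('a \<Rightarrow> bool) \<Rightarrow> 'a list \<Rightarrow> bool" where
  "brk c P \<longleftrightarrow> (odd (length P - 1) \<longleftrightarrow> c (hd P) = c (last P))"

lemma brk_glue:
  assumes "P \<noteq> []" "Q \<noteq> []" "last P = hd Q"
  shows "brk c (P @ tl Q) \<longleftrightarrow> brk c P \<noteq> brk c Q"
proof -
  have l: "length (P @ tl Q) - 1 = (length P - 1) + (length Q - 1)" using assms(1) by (cases P) auto
  have "last (P @ tl Q) = last Q" using assms by (cases Q) (auto simp: last_append)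
  moreover have "hd (P @ tl Q) = hd P" using assms(1) by simp
  ultimately show ?thesis unfolding brk_def l using assms(3) by auto
qed

lemma brk_rev: "brk c (rev P) \<longleftrightarrow> brk c P"
  unfolding brk_def by (cases "P = []") (auto simp: hd_rev last_rev)

lemma brk_pair: "brk c [x, y] \<longleftrightarrow> c x = c y"
  unfolding brk_def by simp

lemma brk_single: "\<not> brk c [x]"
  unfolding brk_def by simp

lemma brk_crossing:
  assumes "successively (crossing E c) P" "P \<noteq> []"
  shows "\<not> brk c P"
  using assms
proof (induction P rule: induct_list012)
  case (3 x y zs)
  have "brk c ([x, y] @ tl (y # zs)) \<longleftrightarrow> brk c [x, y] \<noteq> brk c (y # zs)" by (rule brk_glue) auto
  then show ?case using 3 unfolding crossing_def by (auto simp: brk_pair)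
qed (auto simp: brk_single)

locale broken_paths =
  fixes D :: "'a set" and E :: "'a \<Rightarrow> 'a \<Rightarrow> bool" and c :: "'a \<Rightarrow> bool" and S :: "'a set"
  assumes fin: "finite D" and E: "sym_irrefl E" and SD: "S \<subseteq> D"
begin

lemma Es: "E a b \<Longrightarrow> E b a" and Ei: "\<not> E a a"
  using E unfolding sym_irrefl_def by blast+

definition bpath :: "'a list \<Rightarrow> bool" where
  "bpath P \<longleftrightarrow> is_path D E P \<and> hd P \<noteq> last P \<and> set P \<inter> S = {hd P, last P} \<and> brk c P"

text \<open>Each vertex of \<open>W = D - S\<close> has two copies, which are joined by an edge, and an edge of the graph
  joins copies on the same side iff its ends have the same colour. From a matching with \<open>card W + N\<close>
  edges, seen as a family of segments, the vertices of \<open>W\<close> are eliminated one by one: joining the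
  segments that end in the two copies of a vertex costs one segment, and the \<open>N\<close> segments that remain
  in the end are broken paths.\<close>

definition copies :: "'a set \<Rightarrow> ('a \<times> bool) set" where
  "copies W = S \<times> {False} \<union> W \<times> UNIV"

text \<open>The flags name the copies in which the segment starts and ends; they agree iff the path
  is broken. A list of one vertex stands for the edge between its two copies.\<close>

definition seg :: "'a set \<Rightarrow> 'a list \<times> bool \<times> bool \<Rightarrow> bool" where
  "seg W q \<longleftrightarrow> (case q of (P, i, j) \<Rightarrow> P \<noteq> [] \<and> distinct P \<and> successively E P \<and> set P \<subseteq> D
     \<and> (hd P, i) \<in> copies W \<and> (last P, j) \<in> copies W \<and> set P \<inter> (S \<union> W) = {hd P, last P}
     \<and> (if hd P = last P then i \<noteq> j else brk c P \<longleftrightarrow> i = j))"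

definition ends :: "'a list \<times> bool \<times> bool \<Rightarrow> ('a \<times> bool) set" where
  "ends q = (case q of (P, i, j) \<Rightarrow> {(hd P, i), (last P, j)})"

definition segs :: "'a set \<Rightarrow> ('a list \<times> bool \<times> bool) set \<Rightarrow> bool" where
  "segs W Q \<longleftrightarrow> (\<forall>q\<in>Q. seg W q) \<and> (\<forall>q\<in>Q. \<forall>q'\<in>Q. q \<noteq> q' \<longrightarrow> ends q \<inter> ends q' = {} \<and> set (fst q) \<inter> set (fst q') \<subseteq> S \<union> W)"

lemma segI:
  assumes "P \<noteq> []" "distinct P" "successively E P" "set P \<subseteq> D" "(hd P, i) \<in> copies W" "(last P, j) \<in> copies W"
    "set P \<inter> (S \<union> W) = {hd P, last P}" "if hd P = last P then i \<noteq> j else brk c P \<longleftrightarrow> i = j"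
  shows "seg W (P, i, j)"
  using assms unfolding seg_def by simp

lemma segD:
  assumes "seg W (P, i, j)"
  shows "P \<noteq> []" "distinct P" "successively E P" "set P \<subseteq> D" "(hd P, i) \<in> copies W" "(last P, j) \<in> copies W"
    "set P \<inter> (S \<union> W) = {hd P, last P}" "if hd P = last P then i \<noteq> j else brk c P \<longleftrightarrow> i = j"
  using assms unfolding seg_def by simp_all

lemma seg_rev:
  assumes "seg W (P, i, j)"
  shows "seg W (rev P, j, i)"
  using segD[OF assms] by (intro segI) (auto simp: hd_rev last_rev brk_rev successively_rev_sym[OF E] insert_commute simp del: successively_rev)

lemma seg_oriented:
  assumes "seg W q" "(w, b) \<in> ends q"
  obtains P i where "seg W (P, i, b)" "last P = w" "ends (P, i, b) = ends q" "set P = set (fst q)"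
proof -
  obtain P i j where q: "q = (P, i, j)" by (cases q)
  have P: "P \<noteq> []" using segD(1) assms(1) q by blast
  from assms(2) have "w = last P \<and> b = j \<or> w = hd P \<and> b = i" unfolding q ends_def by auto
  then show thesis
  proof
    assume "w = last P \<and> b = j"
    then show thesis using that[of P i] assms(1) q by simp
  next
    assume "w = hd P \<and> b = i"
    then show thesis using that[of "rev P" j] seg_rev[of W P i j] assms(1) q P
      by (simp add: ends_def hd_rev last_rev insert_commute)
  qed
qed

lemma seg_shrink:
  assumes s: "seg (insert w W) q" and w: "w \<notin> S" "w \<notin> W" and n: "\<And>b. (w, b) \<notin> ends q"
  shows "seg W q \<and> w \<notin> set (fst q)"
proof -
  obtain P i j where q: "q = (P, i, j)" by (cases q)
  note d = segD[OF s[unfolded q]]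
  have nw: "w \<noteq> hd P" "w \<noteq> last P" using n[of i] n[of j] unfolding q ends_def by auto
  have wP: "w \<notin> set P" using d(7) nw by blast
  have "set P \<inter> (S \<union> W) = {hd P, last P}" using d(7) wP by blast
  moreover have "(hd P, i) \<in> copies W" "(last P, j) \<in> copies W" using d(5,6) nw unfolding copies_def by auto
  ultimately show ?thesis using d wP unfolding q by (auto intro!: segI)
qed

text \<open>Two different segments that end in the two copies of \<open>w\<close> are joined. If
  there are no such two, at most one segment ends at \<open>w\<close>, and it is dropped.\<close>

lemma segs_merge:
  assumes s: "segs (insert w W) Q" and w: "w \<notin> S" "w \<notin> W" "w \<in> D" and fQ: "finite Q"
  shows "\<exists>Q'. finite Q' \<and> segs W Q' \<and> card Q \<le> Suc (card Q')"
proof -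
  have sg: "seg (insert w W) q" if "q \<in> Q" for q using s that unfolding segs_def by simp
  have sd: "ends q \<inter> ends q' = {}" "set (fst q) \<inter> set (fst q') \<subseteq> S \<union> insert w W" if "q \<in> Q" "q' \<in> Q" "q \<noteq> q'" for q q'
    using s that unfolding segs_def by blast+
  let ?T = "{q \<in> Q. \<exists>b. (w, b) \<in> ends q}"
  have sub: "segs W Q'" if Q': "Q' \<subseteq> Q - ?T" for Q'
    unfolding segs_def
  proof (intro conjI ballI impI)
    have *: "seg W q \<and> w \<notin> set (fst q)" if "q \<in> Q'" for q by (rule seg_shrink[OF sg]) (use that Q' w in auto)
    show "seg W q" if "q \<in> Q'" for q using *[OF that] by blast
    fix q q' assume a: "q \<in> Q'" "q' \<in> Q'" "q \<noteq> q'"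
    then have b: "q \<in> Q" "q' \<in> Q" using Q' by auto
    show "ends q \<inter> ends q' = {}" by (rule sd(1)[OF b a(3)])
    show "set (fst q) \<inter> set (fst q') \<subseteq> S \<union> W" using sd(2)[OF b a(3)] *[OF a(1)] by blast
  qed
  show ?thesis
  proof (cases "\<exists>q q'. q \<in> Q \<and> q' \<in> Q \<and> q \<noteq> q' \<and> (w, False) \<in> ends q \<and> (w, True) \<in> ends q'")
    case False
    have uniq: "q = q'" if "q \<in> ?T" "q' \<in> ?T" for q q'
    proof (rule ccontr)
      assume n: "q \<noteq> q'"
      from that obtain b b' where b: "q \<in> Q" "(w, b) \<in> ends q" "q' \<in> Q" "(w, b') \<in> ends q'"
        by (elim CollectE conjE exE)
      have "b \<noteq> b'" using sd(1)[OF b(1,3) n] b by blast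
      have no: "\<not> (r \<in> Q \<and> r' \<in> Q \<and> r \<noteq> r' \<and> (w, False) \<in> ends r \<and> (w, True) \<in> ends r')" for r r'
        by (rule False[unfolded not_ex, THEN spec, THEN spec])
      show False using no[of q q'] no[of q' q] b n \<open>b \<noteq> b'\<close> by (cases b; cases b') simp_all
    qed
    have fT: "finite ?T" using fQ by simp
    have "card ?T \<le> Suc 0" using uniq card_le_Suc0_iff_eq[OF fT] by blast
    then have "card Q \<le> Suc (card (Q - ?T))" using card_Diff_subset[OF fT, of Q] by auto
    then show ?thesis using sub[of "Q - ?T"] fQ by (intro exI[of _ "Q - ?T"]) simp
  next
    case True
    then obtain q q' where q: "q \<in> Q" "q' \<in> Q" "q \<noteq> q'" "(w, False) \<in> ends q" "(w, True) \<in> ends q'" by blast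
    obtain P i where P: "seg (insert w W) (P, i, False)" "last P = w" "ends (P, i, False) = ends q" "set P = set (fst q)"
      by (rule seg_oriented[OF sg[OF q(1)] q(4)])
    obtain R0 j where R0: "seg (insert w W) (R0, j, True)" "last R0 = w" "ends (R0, j, True) = ends q'" "set R0 = set (fst q')"
      by (rule seg_oriented[OF sg[OF q(2)] q(5)])
    define R where "R = rev R0"
    have R: "seg (insert w W) (R, True, j)" "hd R = w" "set R = set (fst q')" "ends q' = {(w, True), (last R, j)}"
      using seg_rev[OF R0(1)] R0 segD(1)[OF R0(1)] unfolding R_def by (auto simp: hd_rev last_rev ends_def)
    have eq: "ends q = {(hd P, i), (w, False)}" using P(2,3) unfolding ends_def by simp
    have ed: "ends q \<inter> ends q' = {}" by (rule sd(1)[OF q(1-3)])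
    note dP = segD[OF P(1)] and dR = segD[OF R(1)]
    have xw: "hd P \<noteq> w"
    proof
      assume "hd P = w"
      then have "i \<noteq> False" using dP(8) P(2) by simp
      then have "(w, True) \<in> ends q" using eq \<open>hd P = w\<close> by simp
      then show False using ed q(5) by blast
    qed
    have yw: "last R \<noteq> w"
    proof
      assume "last R = w"
      then have "True \<noteq> j" using dR(8) R(2) by simp
      then have "(w, False) \<in> ends q'" using R(4) \<open>last R = w\<close> by simp
      then show False using ed q(4) by blast
    qed
    have int: "set P \<inter> set R \<subseteq> {hd P, w} \<inter> {w, last R}"
    proof
      fix z assume z: "z \<in> set P \<inter> set R"
      then have "z \<in> S \<union> insert w W" using sd(2)[OF q(1-3)] P(4) R(3) by blast
      then have "z \<in> set P \<inter> (S \<union> insert w W)" "z \<in> set R \<inter> (S \<union> insert w W)" using z by auto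
      then show "z \<in> {hd P, w} \<inter> {w, last R}" unfolding dP(7) dR(7) using P(2) R(2) by simp
    qed
    \<comment> \<open>If the joined segment closes up to a cycle, it shrinks to the segment of a
      single vertex; its ends are different copies because different segments have disjoint
      ends.\<close>
    define new where "new = (if hd P = last R then ([hd P], i, j) else (P @ tl R, i, j))"
    have cop: "(hd P, i) \<in> copies W" "(last R, j) \<in> copies W" using dP(5) dR(6) xw yw unfolding copies_def by auto
    then have SW: "hd P \<in> S \<union> W" "last R \<in> S \<union> W" unfolding copies_def by auto
    have en: "ends new = {(hd P, i), (last R, j)}"
    proof (cases "hd P = last R")
      case False
      have "tl R \<noteq> []" using R(2) yw dR(1) by (cases R) auto
      then show ?thesis using False dP(1) unfolding new_def ends_def by (simp add: last_tl)
    qed (simp add: new_def ends_def)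
    have sn': "set (fst new) \<subseteq> set P \<union> set R" unfolding new_def using hd_in_set[OF dP(1)] by (cases R) auto
    have segn: "seg W new"
    proof (cases "hd P = last R")
      case True
      have "(hd P, i) \<noteq> (last R, j)" using ed eq R(4) by blast
      moreover have "hd P \<in> D" using hd_in_set[OF dP(1)] dP(4) by blast
      ultimately show ?thesis using True cop SW unfolding new_def by (auto intro!: segI)
    next
      case False
      have tR: "tl R \<noteq> []" using R(2) yw dR(1) by (cases R) auto
      have R': "R = w # tl R" using R(2) dR(1) by (cases R) auto
      have wtR: "w \<notin> set (tl R)" using dR(2) R' by (metis distinct.simps(2))
      have dis: "set P \<inter> set (tl R) = {}"
      proof (rule ccontr)
        assume "set P \<inter> set (tl R) \<noteq> {}"
        then obtain z where z: "z \<in> set P" "z \<in> set (tl R)" by blast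
        then have "z \<in> set R" by (cases R) auto
        then have "z \<in> {hd P, w} \<inter> {w, last R}" using z(1) int by blast
        moreover have "z \<noteq> w" using z(2) wtR by blast
        ultimately show False using False by simp
      qed
      have l: "last (P @ tl R) = last R" using tR by (simp add: last_tl)
      have sw: "successively E (P @ tl R)"
      proof (rule successively_appendI[OF dP(3)])
        show "successively E (tl R)" using dR(3) R' by (metis successively_Cons tR list.collapse)
        show "E (last P) (hd (tl R))" using dR(3) R' P(2) tR by (metis successively_Cons)
      qed
      \<comment> \<open>The flags at \<open>w\<close> are \<open>False\<close> and
        \<open>True\<close>; hence the exclusive or of the two parities is again equality of the
        outer flags.\<close>
      have b: "brk c (P @ tl R) \<longleftrightarrow> i = j"
        using brk_glue[OF dP(1) dR(1), of c] dP(8) dR(8) P(2) R(2) xw yw by auto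
      have "set (P @ tl R) \<inter> (S \<union> W) = {hd P, last R}"
      proof (intro equalityI subsetI)
        fix z assume z: "z \<in> set (P @ tl R) \<inter> (S \<union> W)"
        have zw: "z \<noteq> w" using z w by blast
        have "z \<in> set P \<or> z \<in> set R" using z by (cases R) auto
        then have "z \<in> set P \<inter> (S \<union> insert w W) \<or> z \<in> set R \<inter> (S \<union> insert w W)" using z by blast
        then show "z \<in> {hd P, last R}" unfolding dP(7) dR(7) using zw P(2) R(2) by simp
      next
        fix z assume "z \<in> {hd P, last R}"
        then show "z \<in> set (P @ tl R) \<inter> (S \<union> W)" using SW dP(1) tR last_tl[of R] last_in_set[of "tl R"] by auto
      qed
      moreover have "distinct (P @ tl R)" using dP(2) dR(2) dis by (simp add: distinct_tl)
      moreover have "set (P @ tl R) \<subseteq> D" using dP(4) dR(4) R' by (cases R) auto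
      moreover have "hd (P @ tl R) = hd P" using dP(1) by simp
      ultimately show ?thesis using False cop l sw b dP(1) unfolding new_def by (auto intro!: segI)
    qed
    let ?Rest = "Q - {q, q'}"
    let ?Q = "insert new ?Rest"
    have Tq: "?T \<subseteq> {q, q'}"
    proof
      fix r assume r: "r \<in> ?T"
      then obtain b where b: "r \<in> Q" "(w, b) \<in> ends r" by (elim CollectE conjE exE)
      show "r \<in> {q, q'}"
      proof (cases b)
        case True
        then have "ends r \<inter> ends q' \<noteq> {}" using b(2) q(5) by auto
        then show ?thesis using sd(1)[OF b(1) q(2)] by auto
      next
        case False
        then have "ends r \<inter> ends q \<noteq> {}" using b(2) q(4) by auto
        then show ?thesis using sd(1)[OF b(1) q(1)] by auto
      qed
    qed
    then have s0: "segs W ?Rest" by (intro sub Diff_mono subset_refl)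
    have rw: "w \<notin> set (fst r)" if "r \<in> ?Rest" for r
    proof -
      have rQ: "r \<in> Q" "r \<notin> ?T" using that Tq by auto
      have "(w, b) \<notin> ends r" for b using rQ by simp
      then show ?thesis using seg_shrink[OF sg[OF rQ(1)] w(1,2)] by blast
    qed
    have x: "ends new \<inter> ends r = {} \<and> set (fst new) \<inter> set (fst r) \<subseteq> S \<union> W" if r: "r \<in> ?Rest" for r
    proof -
      have rQ: "r \<in> Q" "q \<noteq> r" "q' \<noteq> r" using r by auto
      note e1 = sd[OF q(1) rQ(1,2)] and e2 = sd[OF q(2) rQ(1,3)]
      have "ends new \<subseteq> ends q \<union> ends q'" using en eq R(4) by blast
      then have "ends new \<inter> ends r = {}" using e1(1) e2(1) by blast
      moreover have "set (fst new) \<inter> set (fst r) \<subseteq> S \<union> W"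
        using sn' e1(2) e2(2) P(4) R(3) rw[OF r] by blast
      ultimately show ?thesis by blast
    qed
    have "segs W ?Q" unfolding segs_def
    proof (intro conjI ballI impI)
      show "seg W r" if "r \<in> ?Q" for r using that segn s0 unfolding segs_def by blast
      fix r r' assume rr: "r \<in> ?Q" "r' \<in> ?Q" "r \<noteq> r'"
      have *: "ends r \<inter> ends r' = {} \<and> set (fst r) \<inter> set (fst r') \<subseteq> S \<union> W"
      proof (cases "r = new")
        case True
        then show ?thesis using x[of r'] rr by blast
      next
        case F: False
        show ?thesis
        proof (cases "r' = new")
          case True
          then show ?thesis using x[of r] rr F by blast
        next
          case False
          then show ?thesis using F rr s0 unfolding segs_def by blast
        qed
      qed
      then show "ends r \<inter> ends r' = {}" "set (fst r) \<inter> set (fst r') \<subseteq> S \<union> W" by blast+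
    qed
    moreover have "new \<notin> ?Rest" using x[of new] en by blast
    then have "card ?Q = Suc (card ?Rest)" using fQ by simp
    moreover have "?Rest \<union> {q, q'} = Q" using q(1,2) by auto
    then have "card Q \<le> card ?Rest + card {q, q'}" using card_Un_le[of ?Rest "{q, q'}"] by simp
    moreover have "card {q, q'} = 2" using q(3) by simp
    ultimately show ?thesis using fQ by (intro exI[of _ ?Q]) simp
  qed
qed

lemma segs_paths:
  assumes "finite W" "W \<subseteq> D - S" "finite Q" "segs W Q" "card W + N \<le> card Q"
  shows "\<exists>Ps. finite Ps \<and> N \<le> card Ps \<and> (\<forall>P\<in>Ps. bpath P) \<and> (\<forall>P\<in>Ps. \<forall>P'\<in>Ps. P \<noteq> P' \<longrightarrow> set P \<inter> set P' = {})"
  using assms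
proof (induction W arbitrary: Q rule: finite_induct)
  case empty
  have sg: "seg {} q" if "q \<in> Q" for q using empty that unfolding segs_def by simp
  have sd: "ends q \<inter> ends q' = {}" "set (fst q) \<inter> set (fst q') \<subseteq> S" if "q \<in> Q" "q' \<in> Q" "q \<noteq> q'" for q q'
    using empty that unfolding segs_def by auto
  have q: "bpath (fst q) \<and> ends q = {(hd (fst q), False), (last (fst q), False)}" if q: "q \<in> Q" for q
  proof -
    obtain P i j where P: "q = (P, i, j)" by (cases q)
    note d = segD[OF sg[OF q, unfolded P]]
    \<comment> \<open>Vertices of \<open>S\<close> have the \<open>False\<close> copy only, so both
      flags agree and the segment is a broken path.\<close>
    have ij: "i = False" "j = False" using d(5,6) unfolding copies_def by auto
    then have "hd P \<noteq> last P" "brk c P" using d(8) by (auto split: if_splits)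
    then show ?thesis using d ij unfolding P bpath_def is_path_iff ends_def by simp
  qed
  have disj: "set (fst q) \<inter> set (fst q') = {}" if a: "q \<in> Q" "q' \<in> Q" "q \<noteq> q'" for q q'
  proof (rule ccontr)
    assume "set (fst q) \<inter> set (fst q') \<noteq> {}"
    then obtain z where z: "z \<in> set (fst q)" "z \<in> set (fst q')" by blast
    then have "z \<in> S" using sd(2)[OF a] by blast
    then have "(z, False) \<in> ends q" "(z, False) \<in> ends q'" using z q[OF a(1)] q[OF a(2)] unfolding bpath_def by auto
    then show False using sd(1)[OF a] by blast
  qed
  have "inj_on fst Q"
  proof (rule inj_onI, rule ccontr)
    fix q q' assume a: "q \<in> Q" "q' \<in> Q" "fst q = fst q'" "q \<noteq> q'"
    have "fst q \<noteq> []" using q[OF a(1)] unfolding bpath_def is_path_iff by blast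
    then show False using disj[OF a(1,2,4)] a(3) by simp
  qed
  then have "card (fst ` Q) = card Q" by (rule card_image)
  moreover have "bpath P" if "P \<in> fst ` Q" for P using that q by (elim imageE) simp
  moreover have "set P \<inter> set P' = {}" if "P \<in> fst ` Q" "P' \<in> fst ` Q" "P \<noteq> P'" for P P'
    using that by (elim imageE) (metis disj)
  ultimately show ?case using empty by (intro exI[of _ "fst ` Q"]) simp
next
  case (insert w W)
  obtain Q' where Q': "finite Q'" "segs W Q'" "card Q \<le> Suc (card Q')"
    using segs_merge[OF insert.prems(3)] insert by auto
  then show ?case using insert by (intro insert.IH[of Q']) auto
qed

definition gamma :: "'a \<times> bool \<Rightarrow> 'a \<times> bool \<Rightarrow> bool" where
  "gamma p q \<longleftrightarrow> fst p = fst q \<and> snd p \<noteq> snd q \<or> E (fst p) (fst q) \<and> (snd p = snd q \<longleftrightarrow> c (fst p) = c (fst q))"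

lemma gamma_sym: "gamma p q \<Longrightarrow> gamma q p"
  unfolding gamma_def using Es by auto

lemma gamma_edge: "E a b \<Longrightarrow> gamma (a, i) (b, i = (c a = c b))"
  unfolding gamma_def by auto

lemma gamma_twin: "gamma (a, i) (a, \<not> i)"
  unfolding gamma_def by auto

abbreviation W :: "'a set" where "W \<equiv> D - S"

lemma copies_finite: "finite (copies W)" "card (copies W) = card S + 2 * card W"
proof -
  have f: "finite S" "finite W" using fin SD finite_subset by auto
  then show "finite (copies W)" unfolding copies_def by simp
  have "card (copies W) = card (S \<times> {False}) + card (W \<times> (UNIV :: bool set))"
    unfolding copies_def by (rule card_Un_disjoint) (use f in auto)
  then show "card (copies W) = card S + 2 * card W" by (simp add: card_cartesian_product)
qed

lemma matching_segs:
  assumes M: "matching (copies W) gamma M"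
  shows "\<exists>Q. finite Q \<and> segs W Q \<and> card Q = card M"
proof -
  have U: "S \<union> W = D" using SD by blast
  have "\<exists>q. seg W q \<and> ends q = e \<and> set (fst q) \<subseteq> D" if eM: "e \<in> M" for e
  proof -
    obtain p q where pq: "p \<in> copies W" "q \<in> copies W" "p \<noteq> q" "gamma p q" "gamma q p" "e = {p, q}"
      by (rule matching_edge[OF M eM])
    obtain a i b j where ab: "p = (a, i)" "q = (b, j)" by (cases p; cases q)
    have D: "a \<in> D" "b \<in> D" using pq(1,2) SD unfolding ab copies_def by auto
    show ?thesis
    proof (cases "a = b")
      case True
      then have "seg W ([a], i, j)" using pq D U unfolding ab by (intro segI) auto
      then show ?thesis using True D pq(6) unfolding ab by (intro exI[of _ "([a], i, j)"]) (auto simp: ends_def)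
    next
      case False
      then have e: "E a b" "i = j \<longleftrightarrow> c a = c b" using pq(4) unfolding ab gamma_def by auto
      then have "seg W ([a, b], i, j)" using pq D U False unfolding ab by (intro segI) (auto simp: brk_pair)
      then show ?thesis using D pq(6) unfolding ab by (intro exI[of _ "([a, b], i, j)"]) (auto simp: ends_def)
    qed
  qed
  then obtain f where f: "\<And>e. e \<in> M \<Longrightarrow> seg W (f e) \<and> ends (f e) = e \<and> set (fst (f e)) \<subseteq> D" by metis
  have inj: "inj_on f M" by (rule inj_onI) (metis f)
  have finM: "finite M" by (rule matching_finite[OF copies_finite(1) M])
  have "segs W (f ` M)" unfolding segs_def
  proof (intro conjI ballI impI)
    show "seg W q" if "q \<in> f ` M" for q using that f by (elim imageE) simp
    fix q q' assume q: "q \<in> f ` M" "q' \<in> f ` M" "q \<noteq> q'"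
    obtain e where e: "e \<in> M" "q = f e" using q(1) by (elim imageE)
    obtain e' where e': "e' \<in> M" "q' = f e'" using q(2) by (elim imageE)
    have "e \<noteq> e'" using q(3) e e' by auto
    then show "ends q \<inter> ends q' = {}" using matching_disjoint[OF M e(1) e'(1)] f[OF e(1)] f[OF e'(1)] e e' by simp
    show "set (fst q) \<inter> set (fst q') \<subseteq> S \<union> W" using f[OF e(1)] e U by auto
  qed
  then show ?thesis using card_image[OF inj] finM by (intro exI[of _ "f ` M"]) simp
qed

definition exposed :: "('a \<times> bool) set \<Rightarrow> 'a set" where
  "exposed K = {x. \<exists>i. (x, i) \<in> K \<and> (x, \<not> i) \<notin> K}"

text \<open>Vertices with both copies in \<open>K\<close> contribute an even number.\<close>

lemma odd_exposed:
  assumes "finite K"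
  shows "odd (card K) \<longleftrightarrow> odd (card (exposed K))"
proof -
  let ?F = "{x. (x, True) \<in> K \<and> (x, False) \<in> K}"
  let ?X = "{p \<in> K. fst p \<in> exposed K}"
  have expI: "x \<in> exposed K" if "(x, i) \<in> K" "(x, \<not> i) \<notin> K" for x i
    unfolding exposed_def using that by blast
  have expD: "\<not> ((x, True) \<in> K \<and> (x, False) \<in> K)" if "x \<in> exposed K" for x
  proof -
    from that obtain i where "(x, i) \<in> K" "(x, \<not> i) \<notin> K" unfolding exposed_def by blast
    then show ?thesis by (cases i) simp_all
  qed
  have K: "K = ?F \<times> UNIV \<union> ?X"
  proof (intro equalityI subsetI)
    fix p assume p: "p \<in> K"
    obtain x i where xi: "p = (x, i)" by (cases p)
    show "p \<in> ?F \<times> UNIV \<union> ?X"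
    proof (cases "(x, \<not> i) \<in> K")
      case True
      then have "(x, True) \<in> K \<and> (x, False) \<in> K" using p xi by (cases i) simp_all
      then show ?thesis using xi by simp
    next
      case False
      then show ?thesis using expI p xi by simp
    qed
  next
    fix p assume p: "p \<in> ?F \<times> UNIV \<union> ?X"
    obtain x i where xi: "p = (x, i)" by (cases p)
    show "p \<in> K"
    proof (cases "x \<in> ?F")
      case True
      then show ?thesis using xi by (cases i) simp_all
    next
      case False
      then show ?thesis using p xi by auto
    qed
  qed
  have fF: "finite ?F"
  proof (rule finite_subset)
    show "?F \<subseteq> fst ` K" by (auto intro: rev_image_eqI)
  qed (use assms in simp)
  have dj: "?F \<times> UNIV \<inter> ?X = {}"
  proof (rule ccontr)
    assume "?F \<times> UNIV \<inter> ?X \<noteq> {}"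
    then obtain p where p: "p \<in> ?F \<times> UNIV" "p \<in> ?X" by (meson disjoint_iff)
    have "fst p \<in> ?F" using p(1) by (simp add: mem_Times_iff)
    moreover have "fst p \<in> exposed K" using p(2) by simp
    ultimately show False using expD[of "fst p"] by simp
  qed
  have 1: "card (?F \<times> UNIV \<union> ?X) = card (?F \<times> (UNIV :: bool set)) + card ?X"
    by (rule card_Un_disjoint[OF _ _ dj]) (use fF assms in auto)
  have 2: "card ?X = card (exposed K)"
  proof -
    have "inj_on fst ?X"
    proof (rule inj_onI, rule ccontr)
      fix p q assume pq: "p \<in> ?X" "q \<in> ?X" "fst p = fst q" "p \<noteq> q"
      obtain x i j where "p = (x, i)" "q = (x, j)" using pq(3) by (cases p; cases q) simp
      then show False using pq expD[of x] by (cases i; cases j) simp_all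
    qed
    moreover have "fst ` ?X = exposed K"
    proof (intro equalityI subsetI)
      fix x assume x: "x \<in> exposed K"
      then obtain i where "(x, i) \<in> K" unfolding exposed_def by blast
      then show "x \<in> fst ` ?X" using x by (intro image_eqI[of _ _ "(x, i)"]) auto
    qed auto
    ultimately show ?thesis using card_image[of fst ?X] by simp
  qed
  have "card K = 2 * card ?F + card (exposed K)"
    using 1 2 unfolding K[symmetric] by (simp add: card_cartesian_product)
  then show ?thesis by simp
qed

lemma snoc_step:
  assumes "Suc n < length P"
  shows "brk c (take (Suc (Suc n)) P) \<longleftrightarrow> brk c (take (Suc n) P) \<noteq> (c (P ! n) = c (P ! Suc n))"
proof -
  have t: "take (Suc (Suc n)) P = take (Suc n) P @ tl [P ! n, P ! Suc n]" using assms by (simp add: take_Suc_conv_app_nth)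
  have l: "last (take (Suc n) P) = P ! n" using assms by (simp add: take_Suc_conv_app_nth)
  have "take (Suc n) P \<noteq> []" using assms by (cases P) auto
  then have "brk c (take (Suc n) P @ tl [P ! n, P ! Suc n]) \<longleftrightarrow> brk c (take (Suc n) P) \<noteq> brk c [P ! n, P ! Suc n]"
    by (rule brk_glue) (use l in simp_all)
  then show ?thesis by (simp only: t brk_pair)
qed

text \<open>Follow a broken path that avoids \<open>Z\<close> through the double cover. Off
  \<open>Z\<close>, an exposed vertex is the representative of its class, and it follows that the
  class of the current copy always has its representative among the vertices already passed. The
  last vertex has one copy only, so it would itself be that representative, although a path does not
  repeat vertices.\<close>

lemma classes_hit:
  assumes U: "U \<subseteq> copies W" and part: "edge_partition (copies W - U) gamma C"
    and rep: "\<And>K. K \<in> C \<Longrightarrow> exposed K \<noteq> {} \<Longrightarrow> rep K \<in> exposed K"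
    and P: "bpath P"
    and Z: "Z = {x \<in> D. \<forall>i. (x, i) \<in> copies W \<longrightarrow> (x, i) \<in> U} \<union> (\<Union>K\<in>C. exposed K - {rep K})"
  shows "set P \<inter> Z \<noteq> {}"
proof
  assume nZ: "set P \<inter> Z = {}"
  have UC: "\<Union>C = copies W - U" by (rule part[unfolded edge_partition_def, THEN conjunct1])
  note noedge = part[unfolded edge_partition_def, THEN conjunct2, THEN conjunct2, rule_format]
  have cov: "\<exists>K\<in>C. p \<in> K" if "p \<in> copies W" "p \<notin> U" for p
  proof -
    have "p \<in> \<Union>C" unfolding UC using that by simp
    then show ?thesis by (elim UnionE) (rule bexI)
  qed
  have inC: "p \<in> copies W \<and> p \<notin> U" if "K \<in> C" "p \<in> K" for p K
  proof -
    have "p \<in> \<Union>C" using that by (rule UnionI)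
    then show ?thesis unfolding UC by simp
  qed
  have same: "q \<in> K" if a: "K \<in> C" "p \<in> K" "gamma p q" "q \<in> copies W" "q \<notin> U" for p q K
  proof -
    obtain L where L: "L \<in> C" "q \<in> L" using cov[OF a(4,5)] by (elim bexE)
    have "K = L" using noedge[OF a(1) L(1) _ a(2) L(2)] a(3) by (cases "K = L") simp_all
    then show ?thesis using L by simp
  qed
  have Pp: "P \<noteq> []" "distinct P" "set P \<subseteq> D" "successively E P" "hd P \<noteq> last P" "set P \<inter> S = {hd P, last P}" "brk c P"
    using P unfolding bpath_def is_path_iff by auto
  have nX: "\<exists>i. (x, i) \<in> copies W \<and> (x, i) \<notin> U" if "x \<in> set P" for x
    using that nZ Pp(3) unfolding Z by blast
  have isrep: "x = rep K" if "x \<in> set P" "K \<in> C" "x \<in> exposed K" for x K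
    using that nZ unfolding Z by blast
  let ?b = "\<lambda>n. brk c (take (Suc n) P)"
  have len: "2 \<le> length P" using Pp(1,5) by (cases P rule: list.exhaust; cases "tl P") auto
  have inS: "(x, i) \<in> copies W \<longleftrightarrow> i = False" if "x \<in> S" for x i using that unfolding copies_def by auto
  have single: "(x, False) \<in> copies W \<and> (x, False) \<notin> U" if xP: "x \<in> set P" "x \<in> S" for x
  proof -
    obtain i where i: "(x, i) \<in> copies W" "(x, i) \<notin> U" using nX[OF xP(1)] by (elim exE conjE)
    then show ?thesis using inS[OF xP(2), of i] by simp
  qed
  have exposedI: "x \<in> exposed K" if "(x, i) \<in> K" "(x, \<not> i) \<notin> K" for x i K
    unfolding exposed_def using that by (intro CollectI exI[of _ i] conjI)
  \<comment> \<open>\<open>?b n\<close>, whether the initial part of the path is broken, is the side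
    on which the path leaves \<open>P ! n\<close>; it has entered on the other side.\<close>
  have I: "\<exists>K\<in>C. (P ! n, ?b n) \<in> K \<and> (\<exists>m\<le>n. rep K = P ! m)" if "Suc n < length P" for n
    using that
  proof (induction n)
    case 0
    have h: "P ! 0 = hd P" "hd P \<in> S" "hd P \<in> set P" using Pp(1,6) by (auto simp: hd_conv_nth)
    have b0: "?b 0 = False" using Pp(1) by (cases P) (auto simp: brk_single)
    have cl: "(hd P, False) \<in> copies W" "(hd P, False) \<notin> U" using single[OF h(3,2)] by simp_all
    obtain K where K: "K \<in> C" "(hd P, False) \<in> K" using cov[OF cl] by (elim bexE)
    have "(hd P, True) \<notin> K" using inC[OF K(1), of "(hd P, True)"] inS[OF h(2), of True] by blast
    then have "hd P \<in> exposed K" using exposedI[OF K(2)] by simp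
    then have "hd P = rep K" by (rule isrep[OF h(3) K(1)])
    then show ?case using K h(1) b0 by (intro bexI[of _ K]) auto
  next
    case (Suc n)
    then obtain K m where K: "K \<in> C" "(P ! n, ?b n) \<in> K" "m \<le> n" "rep K = P ! m" by auto
    let ?v = "P ! Suc n"
    have vP: "?v \<in> set P" using Suc.prems by simp
    have "?v \<noteq> hd P" "?v \<noteq> last P"
      using Suc.prems Pp(1) nth_eq_iff_index_eq[OF Pp(2), of "Suc n" 0] nth_eq_iff_index_eq[OF Pp(2), of "Suc n" "length P - 1"]
      by (auto simp: hd_conv_nth last_conv_nth)
    then have vW: "?v \<in> W" using vP Pp(3,6) by blast
    have cv: "(?v, i) \<in> copies W" for i using vW unfolding copies_def by blast
    have "E (P ! n) ?v" using Pp(4) Suc.prems by (simp add: successively_conv_nth)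
    then have "gamma (P ! n, ?b n) (?v, ?b n = (c (P ! n) = c ?v))" by (rule gamma_edge)
    moreover have "(?b n = (c (P ! n) = c ?v)) = (\<not> ?b (Suc n))" using snoc_step[of n P] Suc.prems by auto
    ultimately have adj: "gamma (P ! n, ?b n) (?v, \<not> ?b (Suc n))" by simp
    have nrep: "?v \<noteq> rep K" using K(3,4) nth_eq_iff_index_eq[OF Pp(2), of "Suc n" m] Suc.prems by auto
    show ?case
    proof (cases "(?v, \<not> ?b (Suc n)) \<in> U")
      case False
      then have vK: "(?v, \<not> ?b (Suc n)) \<in> K" using same[OF K(1,2) adj cv] by blast
      have "(?v, ?b (Suc n)) \<in> K"
      proof (rule ccontr)
        assume "(?v, ?b (Suc n)) \<notin> K"
        then have "?v \<in> exposed K" using exposedI[OF vK] by simp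
        then show False using isrep[OF vP K(1)] nrep by simp
      qed
      moreover have "m \<le> Suc n" using K(3) by simp
      ultimately show ?thesis using K(1,4) by blast
    next
      case True
      obtain i where "(?v, i) \<notin> U" using nX[OF vP] by (elim exE conjE)
      then have nU: "(?v, ?b (Suc n)) \<notin> U" using True by (cases "i = ?b (Suc n)") simp_all
      obtain L where L: "L \<in> C" "(?v, ?b (Suc n)) \<in> L" using cov[OF cv nU] by (elim bexE)
      have "(?v, \<not> ?b (Suc n)) \<notin> L" using inC[OF L(1), of "(?v, \<not> ?b (Suc n))"] True by blast
      then have "?v \<in> exposed L" by (rule exposedI[OF L(2)])
      then have "?v = rep L" by (rule isrep[OF vP L(1)])
      then show ?thesis using L by (intro bexI[of _ L]) auto
    qed
  qed
  define r where "r = length P - 2"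
  have r: "Suc (Suc r) = length P" using len unfolding r_def by simp
  then obtain K m where K: "K \<in> C" "(P ! r, ?b r) \<in> K" "m \<le> r" "rep K = P ! m" using I[of r] by auto
  have l: "P ! Suc r = last P" "last P \<in> S" "last P \<in> set P" using r Pp(1,6) by (auto simp: last_conv_nth r[symmetric])
  have "E (P ! r) (last P)" using Pp(4) r l(1) by (simp add: successively_conv_nth flip: l(1))
  then have "gamma (P ! r, ?b r) (last P, ?b r = (c (P ! r) = c (last P)))" by (rule gamma_edge)
  moreover have "brk c P \<longleftrightarrow> ?b r \<noteq> (c (P ! r) = c (last P))" using snoc_step[of r P] r l(1) by simp
  \<comment> \<open>As \<open>P\<close> is broken, it arrives at the \<open>False\<close> copy of
    its last vertex, the only one that exists.\<close>
  then have "(?b r = (c (P ! r) = c (last P))) = False" using Pp(7) by blast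
  ultimately have adj: "gamma (P ! r, ?b r) (last P, False)" by (simp only:)
  have cl: "(last P, False) \<in> copies W" "(last P, False) \<notin> U" using single[OF l(3,2)] by simp_all
  have lK: "(last P, False) \<in> K" by (rule same[OF K(1,2) adj cl])
  have "(last P, True) \<notin> K" using inC[OF K(1), of "(last P, True)"] inS[OF l(2), of True] by blast
  then have "last P \<in> exposed K" using exposedI[OF lK] by simp
  then have "last P = rep K" by (rule isrep[OF l(3) K(1)])
  then have "P ! Suc r = P ! m" using l(1) K(4) by simp
  then show False using nth_eq_iff_index_eq[OF Pp(2), of "Suc r" m] r K(3) by simp
qed

text \<open>\<open>Z\<close> consists of the vertices with all copies in the barrier and, for each
  class, of all exposed vertices but one. A class is odd iff its number of exposed vertices is, so
  the omitted vertices pay for the odd classes in the Tutte--Berge formula.\<close>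

theorem packing_or_hitting:
  assumes N: "1 \<le> N"
  shows "(\<exists>Ps. finite Ps \<and> N \<le> card Ps \<and> (\<forall>P\<in>Ps. bpath P) \<and> (\<forall>P\<in>Ps. \<forall>P'\<in>Ps. P \<noteq> P' \<longrightarrow> set P \<inter> set P' = {}))
    \<or> (\<exists>Z\<subseteq>D. card Z \<le> 2 * N - 2 \<and> (\<forall>P. bpath P \<longrightarrow> set P \<inter> Z \<noteq> {}))"
proof -
  obtain U C M where T: "U \<subseteq> copies W" "edge_partition (copies W - U) gamma C" "matching (copies W) gamma M"
    "card U + card (copies W) \<le> card {K \<in> C. odd (card K)} + 2 * card M"
    using tutte_berge[OF copies_finite(1), of gamma] gamma_sym by blast
  have finW: "finite W" "finite S" using fin SD finite_subset by auto
  show ?thesis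
  proof (cases "card W + N \<le> card M")
    case True
    obtain Q where "finite Q" "segs W Q" "card Q = card M" using matching_segs[OF T(3)] by blast
    then show ?thesis using segs_paths[OF finW(1), of Q N] True by auto
  next
    case False
    \<comment> \<open>A matching too small for \<open>N\<close> broken paths has at most
      \<open>card W + N - 1\<close> edges.\<close>
    have few: "card U + card S \<le> card {K \<in> C. odd (card K)} + (2 * N - 2)"
      using T(4) False N unfolding copies_finite(2) by linarith
    have UC: "\<Union>C = copies W - U" by (rule T(2)[unfolded edge_partition_def, THEN conjunct1])
    note ndj = T(2)[unfolded edge_partition_def, THEN conjunct2, THEN conjunct1, rule_format]
      and noedge = T(2)[unfolded edge_partition_def, THEN conjunct2, THEN conjunct2, rule_format]
    have finUC: "finite (\<Union>C)" unfolding UC using copies_finite(1) by simp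
    have finC: "finite C" by (rule finite_UnionD[OF finUC])
    have finK: "finite K" if "K \<in> C" for K by (rule finite_subset[OF Union_upper[OF that] finUC])
    have finE: "finite (exposed K)" if "K \<in> C" for K
    proof (rule finite_subset)
      show "exposed K \<subseteq> fst ` K"
      proof
        fix x assume "x \<in> exposed K"
        then obtain i where "(x, i) \<in> K" unfolding exposed_def by blast
        then show "x \<in> fst ` K" by (rule rev_image_eqI) simp
      qed
    qed (use finK[OF that] in simp)
    define rep where "rep K = (SOME x. x \<in> exposed K)" for K
    have rep: "rep K \<in> exposed K" if "K \<in> C" "exposed K \<noteq> {}" for K unfolding rep_def using that some_in_eq by blast
    define X where "X = {x \<in> D. \<forall>i. (x, i) \<in> copies W \<longrightarrow> (x, i) \<in> U}"
    define Z where "Z = X \<union> (\<Union>K\<in>C. exposed K - {rep K})"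
    have hit: "set P \<inter> Z \<noteq> {}" if "bpath P" for P
      by (rule classes_hit[OF T(1,2) rep that Z_def[unfolded X_def]])
    have cK: "p \<in> copies W \<and> p \<notin> U" if "K \<in> C" "p \<in> K" for p K
    proof -
      have "p \<in> \<Union>C" using that by (rule UnionI)
      then show ?thesis unfolding UC by simp
    qed
    have same: "K = L" if a: "K \<in> C" "L \<in> C" "p \<in> K" "q \<in> L" "p = q \<or> gamma p q" for p q K L
    proof (rule ccontr)
      assume n: "K \<noteq> L"
      have "K \<inter> L = {}" by (rule ndj[OF a(1,2) n])
      then have "p \<noteq> q" using a(3,4) by (metis IntI empty_iff)
      then show False using noedge[OF a(1,2) n a(3,4)] a(5) by simp
    qed
    have disj: "exposed K \<inter> exposed L = {}" if KL: "K \<in> C" "L \<in> C" "K \<noteq> L" for K L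
    proof (rule ccontr)
      assume "exposed K \<inter> exposed L \<noteq> {}"
      then obtain x i j where x: "(x, i) \<in> K" "(x, j) \<in> L" unfolding exposed_def by blast
      have "(x, i) = (x, j) \<or> gamma (x, i) (x, j)" unfolding gamma_def by auto
      then show False using same[OF KL(1,2) x] KL(3) by blast
    qed
    define B where "B = (\<Union>K\<in>C. exposed K)"
    have cB: "card B = (\<Sum>K\<in>C. card (exposed K))" unfolding B_def
      by (rule card_UN_disjoint[OF finC]) (use finE disj in auto)
    have BD: "B \<subseteq> D"
    proof
      fix x assume "x \<in> B"
      then obtain K i where "K \<in> C" "(x, i) \<in> K" unfolding B_def exposed_def by blast
      then show "x \<in> D" using cK SD unfolding copies_def by blast
    qed
    have XD: "X \<subseteq> D" unfolding X_def by blast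
    have finXB: "finite X" "finite B" using XD BD fin finite_subset by blast+
    have XB: "X \<inter> B = {}"
    proof (rule ccontr)
      assume "X \<inter> B \<noteq> {}"
      then obtain x K i where "x \<in> X" "K \<in> C" "(x, i) \<in> K" unfolding B_def exposed_def by blast
      then show False using cK unfolding X_def by blast
    qed
    \<comment> \<open>The two copies of a vertex are adjacent, so a copy that is missing from the
      class of the other one can only be in the barrier.\<close>
    have BW: "\<exists>i. (w, i) \<in> U" if "w \<in> B \<inter> W" for w
    proof -
      from that obtain K i where K: "K \<in> C" "(w, i) \<in> K" "(w, \<not> i) \<notin> K" unfolding B_def exposed_def by blast
      have "(w, \<not> i) \<in> copies W" using that unfolding copies_def by blast
      moreover have "gamma (w, i) (w, \<not> i)" by (rule gamma_twin)
      moreover have "\<not> (\<exists>L\<in>C. (w, \<not> i) \<in> L)" using same[OF K(1) _ K(2)] K(3) calculation(2) by blast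
      ultimately have "(w, \<not> i) \<in> U" using UC by blast
      then show ?thesis by blast
    qed
    have Uge: "card X + card (X \<inter> W) + card (B \<inter> W) \<le> card U"
    proof -
      define g where "g w = (w, SOME i. (w, i) \<in> U)" for w :: 'a
      have g: "g w \<in> U" if "w \<in> B \<inter> W" for w using BW[OF that] someI_ex[of "\<lambda>i. (w, i) \<in> U"] unfolding g_def by blast
      let ?A1 = "X \<times> {False}" and ?A2 = "(X \<inter> W) \<times> {True}" and ?A3 = "g ` (B \<inter> W)"
      have finU: "finite U" using T(1) copies_finite(1) finite_subset by blast
      have "?A1 \<subseteq> U"
      proof
        fix p assume "p \<in> ?A1"
        then obtain x where x: "x \<in> X" "p = (x, False)" by blast
        then have "(x, False) \<in> copies W" using XD unfolding copies_def by blast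
        then show "p \<in> U" using x unfolding X_def by blast
      qed
      moreover have "?A2 \<subseteq> U"
      proof
        fix p assume "p \<in> ?A2"
        then obtain x where x: "x \<in> X" "x \<in> W" "p = (x, True)" by blast
        then have "(x, True) \<in> copies W" unfolding copies_def by blast
        then show "p \<in> U" using x unfolding X_def by blast
      qed
      moreover have "?A3 \<subseteq> U" using g by blast
      ultimately have "card (?A1 \<union> ?A2 \<union> ?A3) \<le> card U" using finU by (intro card_mono) auto
      moreover have "card (?A1 \<union> ?A2 \<union> ?A3) = card (?A1 \<union> ?A2) + card ?A3"
        by (rule card_Un_disjoint) (use finXB XB in \<open>auto simp: g_def\<close>)
      moreover have "card (?A1 \<union> ?A2) = card ?A1 + card ?A2"
        by (rule card_Un_disjoint) (use finXB in auto)
      moreover have "card ?A3 = card (B \<inter> W)" by (rule card_image) (auto simp: inj_on_def g_def)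
      ultimately show ?thesis by (simp add: card_cartesian_product)
    qed
    have Sge: "card (X \<inter> S) + card (B \<inter> S) \<le> card S"
    proof -
      have "card (X \<inter> S \<union> B \<inter> S) \<le> card S" by (rule card_mono[OF finW(2)]) blast
      moreover have "card (X \<inter> S \<union> B \<inter> S) = card (X \<inter> S) + card (B \<inter> S)"
        by (rule card_Un_disjoint) (use finW XB in auto)
      ultimately show ?thesis by simp
    qed
    have splitc: "card A = card (A \<inter> S) + card (A \<inter> W)" if "A \<subseteq> D" for A
    proof -
      have "A = A \<inter> S \<union> A \<inter> W" using that by blast
      moreover have "card (A \<inter> S \<union> A \<inter> W) = card (A \<inter> S) + card (A \<inter> W)"
        by (rule card_Un_disjoint) (use finW in auto)
      ultimately show ?thesis by simp
    qed
    have main: "2 * card X + card B \<le> card {K \<in> C. odd (card K)} + (2 * N - 2)"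
      using Uge Sge splitc[OF XD] splitc[OF BD] few by linarith
    have "card {K \<in> C. odd (card K)} = (\<Sum>K\<in>C. if odd (card K) then 1 else 0)"
      by (simp only: card_eq_sum sum.inter_filter[OF finC])
    also have "\<dots> = (\<Sum>K\<in>C. if odd (card (exposed K)) then 1 else 0)"
      by (rule sum.cong) (use odd_exposed[OF finK] in auto)
    finally have odds: "card {K \<in> C. odd (card K)} = (\<Sum>K\<in>C. if odd (card (exposed K)) then 1 else 0)" .
    have "(\<Sum>K\<in>C. card (exposed K) - 1) + (\<Sum>K\<in>C. if odd (card (exposed K)) then 1 else 0) \<le> (\<Sum>K\<in>C. card (exposed K))"
      unfolding sum.distrib[symmetric] by (rule sum_mono) (auto simp: Suc_leI odd_pos)
    then have "card X + (\<Sum>K\<in>C. card (exposed K) - 1) \<le> 2 * N - 2" using main odds cB by linarith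
    moreover have "card Z \<le> card X + card (\<Union>K\<in>C. exposed K - {rep K})" unfolding Z_def by (rule card_Un_le)
    moreover have "card (\<Union>K\<in>C. exposed K - {rep K}) \<le> (\<Sum>K\<in>C. card (exposed K - {rep K}))"
      by (rule card_UN_le[OF finC])
    moreover have "(\<Sum>K\<in>C. card (exposed K - {rep K})) \<le> (\<Sum>K\<in>C. card (exposed K) - 1)"
    proof (rule sum_mono)
      fix K assume K: "K \<in> C"
      show "card (exposed K - {rep K}) \<le> card (exposed K) - 1"
      proof (cases "exposed K = {}")
        case False
        then show ?thesis using rep[OF K False] finE[OF K] by simp
      qed simp
    qed
    ultimately have "card Z \<le> 2 * N - 2" by linarith
    moreover have "Z \<subseteq> D" using XD BD unfolding Z_def B_def by blast
    ultimately show ?thesis using hit by blast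
  qed
qed

end

section \<open>Parity linkages from broken paths\<close>

definition upath :: "('a \<Rightarrow> 'a \<Rightarrow> bool) \<Rightarrow> 'a list \<Rightarrow> bool" where
  "upath E p \<longleftrightarrow> p \<noteq> [] \<and> distinct p \<and> successively E p"

lemma is_path_upath: "is_path V E p \<longleftrightarrow> upath E p \<and> set p \<subseteq> V"
  unfolding is_path_iff upath_def by blast

lemma upath_rev: "sym_irrefl E \<Longrightarrow> upath E (rev p) \<longleftrightarrow> upath E p"
  unfolding upath_def using successively_rev_sym by auto

lemma upath_glue:
  assumes p: "upath E p" and q: "upath E q" and l: "last p = hd q" and d: "set p \<inter> set q \<subseteq> {hd q}"
  shows "upath E (p @ tl q)" "hd (p @ tl q) = hd p" "last (p @ tl q) = last q" "set (p @ tl q) = set p \<union> set q"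
    "brk c (p @ tl q) \<longleftrightarrow> brk c p \<noteq> brk c q"
proof -
  have ne: "p \<noteq> []" "q \<noteq> []" using p q unfolding upath_def by auto
  have hq: "q = hd q # tl q" using ne by simp
  have hp: "hd q \<in> set p" using l ne last_in_set[of p] by simp
  have sq: "set q = insert (hd q) (set (tl q))" using ne by (cases q) auto
  then show "set (p @ tl q) = set p \<union> set q" using hp by auto
  show "hd (p @ tl q) = hd p" using ne by simp
  show "last (p @ tl q) = last q" using l ne by (cases q) (auto simp: last_append)
  have "hd q \<notin> set (tl q)" using q hq unfolding upath_def by (metis distinct.simps(2))
  then have "set p \<inter> set (tl q) = {}" using d sq by blast
  moreover have "successively E (p @ tl q)"
    using p q l ne unfolding upath_def by (cases q) (auto simp: successively_append_iff successively_Cons)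
  ultimately show "upath E (p @ tl q)" using p q ne unfolding upath_def by (auto simp: distinct_tl)
  show "brk c (p @ tl q) \<longleftrightarrow> brk c p \<noteq> brk c q" by (rule brk_glue[OF ne l])
qed

text \<open>Greedy choice: each set has more elements than have been used before.\<close>

lemma distinct_representatives:
  fixes N :: "nat \<Rightarrow> 'a set"
  assumes "\<And>i. i < n \<Longrightarrow> n \<le> card (N i)"
  shows "\<exists>r. (\<forall>i<n. r i \<in> N i) \<and> inj_on r {..<n}"
proof -
  have "\<exists>r. (\<forall>i<j. r i \<in> N i) \<and> inj_on r {..<j}" if "j \<le> n" for j
    using that
  proof (induction j)
    case (Suc j)
    then obtain r where r: "\<forall>i<j. r i \<in> N i" "inj_on r {..<j}" by auto
    have "card (r ` {..<j}) \<le> j" using card_image_le[of "{..<j}" r] by simp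
    then have "\<not> N j \<subseteq> r ` {..<j}" using card_mono[of "r ` {..<j}" "N j"] assms[of j] Suc.prems by fastforce
    then obtain x where x: "x \<in> N j" "x \<notin> r ` {..<j}" by blast
    have "\<forall>i<Suc j. (r(j := x)) i \<in> N i" using r(1) x(1) by (auto simp: less_Suc_eq)
    moreover have "inj_on (r(j := x)) {..<Suc j}"
      unfolding lessThan_Suc using r(2) x(2) by (auto simp: inj_on_def)
    ultimately show ?case by blast
  qed simp
  then show ?thesis by blast
qed

text \<open>\<open>M i\<close> is the correction, with \<open>[]\<close> for none. The path runs
  along \<open>A i\<close>, a link, \<open>M i\<close>, a second link and \<open>C i\<close>
  backwards, or with a single link if there is no correction. The links are unbroken, and their
  ends, at most four for each \<open>i\<close>, are all linked at once, so that no link meets an end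
  that belongs to another one.\<close>

lemma linked_composition:
  fixes A C M :: "nat \<Rightarrow> 'a list"
  assumes E: "sym_irrefl E"
    and lk: "\<And>X. X \<subseteq> H \<Longrightarrow> card X \<le> 4 * k \<Longrightarrow> linked H (crossing E c) X"
    and A: "\<And>i. i < k \<Longrightarrow> upath E (A i) \<and> set (A i) \<inter> H = {last (A i)}"
    and C: "\<And>i. i < k \<Longrightarrow> upath E (C i) \<and> set (C i) \<inter> H = {last (C i)}"
    and M: "\<And>i. i < k \<Longrightarrow> M i \<noteq> [] \<Longrightarrow> upath E (M i) \<and> hd (M i) \<noteq> last (M i) \<and> set (M i) \<inter> H = {hd (M i), last (M i)}"
    and AC: "\<And>i j. i < k \<Longrightarrow> j < k \<Longrightarrow> set (A i) \<inter> set (C j) = {}"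
    and AM: "\<And>i j. i < k \<Longrightarrow> j < k \<Longrightarrow> set (A i) \<inter> set (M j) = {}"
    and CM: "\<And>i j. i < k \<Longrightarrow> j < k \<Longrightarrow> set (C i) \<inter> set (M j) = {}"
    and AA: "\<And>i j. i < k \<Longrightarrow> j < k \<Longrightarrow> i \<noteq> j \<Longrightarrow> set (A i) \<inter> set (A j) = {}"
    and CC: "\<And>i j. i < k \<Longrightarrow> j < k \<Longrightarrow> i \<noteq> j \<Longrightarrow> set (C i) \<inter> set (C j) = {}"
    and MM: "\<And>i j. i < k \<Longrightarrow> j < k \<Longrightarrow> i \<noteq> j \<Longrightarrow> set (M i) \<inter> set (M j) = {}"
  shows "\<exists>P. (\<forall>i<k. upath E (P i) \<and> set (P i) \<subseteq> H \<union> set (A i) \<union> set (C i) \<union> set (M i)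
        \<and> hd (P i) = hd (A i) \<and> last (P i) = hd (C i)
        \<and> (brk c (P i) \<longleftrightarrow> (brk c (A i) \<noteq> brk c (C i)) \<noteq> (M i \<noteq> [] \<and> brk c (M i))))
     \<and> (\<forall>i<k. \<forall>j<k. i \<noteq> j \<longrightarrow> set (P i) \<inter> set (P j) = {})"
proof -
  define a where "a i = last (A i)" for i
  define b where "b i = last (C i)" for i
  define U where "U i = set (A i) \<union> set (C i) \<union> set (M i)" for i
  define R where "R i = {a i, b i} \<union> (if M i = [] then {} else {hd (M i), last (M i)})" for i
  define X where "X = (\<Union>i<k. R i)"
  have UR: "U i \<inter> H = R i" if "i < k" for i
    using A[OF that] C[OF that] M[OF that] unfolding U_def R_def a_def b_def by (cases "M i = []") auto
  have UU: "U i \<inter> U j = {}" if "i < k" "j < k" "i \<noteq> j" for i j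
    using AC[OF that(1,2)] AC[OF that(2,1)] AM[OF that(1,2)] AM[OF that(2,1)] CM[OF that(1,2)] CM[OF that(2,1)]
      AA[OF that] CC[OF that] MM[OF that] unfolding U_def by (simp add: Int_Un_distrib Int_Un_distrib2 Int_commute)
  have RU: "R i \<subseteq> U i" "R i \<subseteq> H" if "i < k" for i using UR[OF that] by blast+
  have RR: "R i \<inter> R j = {}" if "i < k" "j < k" "i \<noteq> j" for i j using UU[OF that] RU[OF that(1)] RU[OF that(2)] by blast
  have mem: "a i \<in> set (A i)" "b i \<in> set (C i)" "M i \<noteq> [] \<Longrightarrow> hd (M i) \<in> set (M i) \<and> last (M i) \<in> set (M i)" if "i < k" for i
    using A[OF that] C[OF that] unfolding upath_def a_def b_def by auto
  have ne: "a i \<noteq> b i" "M i \<noteq> [] \<Longrightarrow> a i \<noteq> hd (M i)" "M i \<noteq> [] \<Longrightarrow> a i \<noteq> last (M i)" "M i \<noteq> [] \<Longrightarrow> b i \<noteq> hd (M i)"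
    "M i \<noteq> [] \<Longrightarrow> b i \<noteq> last (M i)" "M i \<noteq> [] \<Longrightarrow> hd (M i) \<noteq> last (M i)" if "i < k" for i
    using mem[OF that] AC[OF that that] AM[OF that that] CM[OF that that] M[OF that] by (auto simp: disjoint_iff)
  have cR: "card (R i) \<le> 4" for i
  proof -
    have "R i \<subseteq> {a i, b i, hd (M i), last (M i)}" unfolding R_def by auto
    then have "card (R i) \<le> card {a i, b i, hd (M i), last (M i)}" by (rule card_mono[rotated]) simp
    also have "\<dots> \<le> 4" using card_length[of "[a i, b i, hd (M i), last (M i)]"] by simp
    finally show ?thesis .
  qed
  have XH: "X \<subseteq> H" unfolding X_def using RU(2) by blast
  have "card X \<le> (\<Sum>i<k. card (R i))" unfolding X_def by (rule card_UN_le) simp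
  also have "\<dots> \<le> (\<Sum>i<k. 4)" by (rule sum_mono) (rule cR)
  finally have cX: "card X \<le> 4 * k" by simp
  define f where "f i = (a i, if M i = [] then b i else hd (M i))" for i
  define g where "g i = (last (M i), b i)" for i
  define Pr where "Pr = f ` {..<k} \<union> g ` {i. i < k \<and> M i \<noteq> []}"
  have fR: "fst (f i) \<in> R i" "snd (f i) \<in> R i" for i unfolding f_def R_def by auto
  have gR: "fst (g i) \<in> R i" "snd (g i) \<in> R i" if "M i \<noteq> []" for i using that unfolding g_def R_def by auto
  have fg: "fst (f i) \<noteq> snd (f i)" "M i \<noteq> [] \<Longrightarrow> fst (g i) \<noteq> snd (g i)" "M i \<noteq> [] \<Longrightarrow> fst (f i) \<noteq> fst (g i)"
    "M i \<noteq> [] \<Longrightarrow> fst (f i) \<noteq> snd (g i)" "M i \<noteq> [] \<Longrightarrow> snd (f i) \<noteq> fst (g i)" "M i \<noteq> [] \<Longrightarrow> snd (f i) \<noteq> snd (g i)" if "i < k" for i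
    using ne[OF that] unfolding f_def g_def by auto
  have PrD: "\<exists>i<k. fst p \<in> R i \<and> snd p \<in> R i \<and> (p = f i \<or> M i \<noteq> [] \<and> p = g i)" if "p \<in> Pr" for p
    using that fR gR unfolding Pr_def by blast
  have pr: "pairing X Pr"
  proof (rule pairingI)
    fix p assume "p \<in> Pr"
    then obtain i where i: "i < k" "fst p \<in> R i" "snd p \<in> R i" "p = f i \<or> M i \<noteq> [] \<and> p = g i" using PrD by blast
    then show "fst p \<in> X \<and> snd p \<in> X \<and> fst p \<noteq> snd p" using fg(1,2)[OF i(1)] unfolding X_def by auto
  next
    fix p q assume pq: "p \<in> Pr" "q \<in> Pr" "p \<noteq> q"
    obtain i where i: "i < k" "fst p \<in> R i" "snd p \<in> R i" "p = f i \<or> M i \<noteq> [] \<and> p = g i" using PrD[OF pq(1)] by blast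
    obtain j where j: "j < k" "fst q \<in> R j" "snd q \<in> R j" "q = f j \<or> M j \<noteq> [] \<and> q = g j" using PrD[OF pq(2)] by blast
    show "fst p \<noteq> fst q \<and> fst p \<noteq> snd q \<and> snd p \<noteq> fst q \<and> snd p \<noteq> snd q"
    proof (cases "i = j")
      case False
      then show ?thesis using RR[OF i(1) j(1)] i(2,3) j(2,3) by (metis disjoint_iff)
    next
      case True
      then have "M i \<noteq> [] \<and> (p = f i \<and> q = g i \<or> p = g i \<and> q = f i)" using i(4) j(4) pq(3) by auto
      then show ?thesis using fg(3-6)[OF i(1)] by metis
    qed
  qed
  obtain S where S: "\<And>p. p \<in> Pr \<Longrightarrow> S p \<subseteq> H" "\<And>p. p \<in> Pr \<Longrightarrow> S p \<inter> X = {fst p, snd p}"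
    "\<And>p. p \<in> Pr \<Longrightarrow> reach (crossing E c) (S p) (fst p) (snd p)" "\<And>p q. p \<in> Pr \<Longrightarrow> q \<in> Pr \<Longrightarrow> p \<noteq> q \<Longrightarrow> S p \<inter> S q = {}"
    by (rule linkableE[OF linkedD[OF lk[OF XH cX] pr]]) (rule that)
  have "\<exists>w. upath E w \<and> set w \<subseteq> S p \<and> hd w = fst p \<and> last w = snd p \<and> \<not> brk c w" if p: "p \<in> Pr" for p
  proof -
    obtain w where w: "is_path (S p) (crossing E c) w" "hd w = fst p" "last w = snd p" using reach_path[OF S(3)[OF p]] by blast
    have "\<not> brk c w" using w(1) brk_crossing unfolding is_path_iff by blast
    moreover have "successively E w" using w(1) unfolding is_path_iff crossing_def
      by (auto intro: successively_mono)
    ultimately show ?thesis using w unfolding is_path_iff upath_def by blast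
  qed
  then obtain w where w: "\<And>p. p \<in> Pr \<Longrightarrow> upath E (w p) \<and> set (w p) \<subseteq> S p \<and> hd (w p) = fst p \<and> last (w p) = snd p \<and> \<not> brk c (w p)"
    by metis
  have wH: "set (w p) \<subseteq> H" "set (w p) \<inter> X \<subseteq> {fst p, snd p}" if "p \<in> Pr" for p using w[OF that] S(1,2)[OF that] by blast+
  have wd: "set (w p) \<inter> set (w q) = {}" if "p \<in> Pr" "q \<in> Pr" "p \<noteq> q" for p q
    using w[OF that(1)] w[OF that(2)] S(4)[OF that] by blast
  have fP: "f i \<in> Pr" if "i < k" for i using that unfolding Pr_def by blast
  have gP: "g i \<in> Pr" if "i < k" "M i \<noteq> []" for i using that unfolding Pr_def by blast
  have RX: "R i \<subseteq> X" if "i < k" for i using that unfolding X_def by blast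
  have "\<exists>P. upath E P \<and> set P \<subseteq> U i \<union> set (w (f i)) \<union> (if M i = [] then {} else set (w (g i)))
        \<and> hd P = hd (A i) \<and> last P = hd (C i)
        \<and> (brk c P \<longleftrightarrow> (brk c (A i) \<noteq> brk c (C i)) \<noteq> (M i \<noteq> [] \<and> brk c (M i)))" if i: "i < k" for i
  proof -
    note wf = w[OF fP[OF i]]
    have A': "upath E (A i)" "last (A i) = fst (f i)" using A[OF i] unfolding a_def f_def by auto
    have C': "upath E (rev (C i))" "last (rev (C i)) = hd (C i)" "hd (rev (C i)) = b i"
      using C[OF i] upath_rev[OF E, of "C i"] unfolding b_def upath_def by (auto simp: hd_rev last_rev)
    have mA: "set (A i) \<subseteq> U i" "set (C i) \<subseteq> U i" "set (M i) \<subseteq> U i" unfolding U_def by auto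
    have "set (A i) \<inter> set (w (f i)) \<subseteq> {hd (w (f i))}"
    proof
      fix z assume z: "z \<in> set (A i) \<inter> set (w (f i))"
      then have "z \<in> H" using wH(1)[OF fP[OF i]] by blast
      then have "z = a i" using A[OF i] z unfolding a_def by blast
      then show "z \<in> {hd (w (f i))}" using wf unfolding f_def by simp
    qed
    note g1 = upath_glue[OF A'(1) conjunct1[OF wf] _ this]
    let ?p1 = "A i @ tl (w (f i))"
    have p1: "upath E ?p1" "hd ?p1 = hd (A i)" "last ?p1 = snd (f i)" "set ?p1 = set (A i) \<union> set (w (f i))" "brk c ?p1 \<longleftrightarrow> brk c (A i)"
      using g1 A'(2) wf by auto
    have Cz: "z = b i" if "z \<in> set (C i)" "z \<in> H" for z using C[OF i] that unfolding b_def by blast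
    show ?thesis
    proof (cases "M i = []")
      case True
      have "set ?p1 \<inter> set (rev (C i)) \<subseteq> {hd (rev (C i))}"
        using p1(4) AC[OF i i] Cz wH(1)[OF fP[OF i]] C'(3) by auto
      note g2 = upath_glue[OF p1(1) C'(1) _ this]
      have l: "last ?p1 = hd (rev (C i))" using p1(3) C'(3) True unfolding f_def by simp
      have "set (?p1 @ tl (rev (C i))) \<subseteq> U i \<union> set (w (f i))" using g2(4)[OF l] p1(4) mA by auto
      then show ?thesis using g2[OF l] p1 C'(2) True brk_rev[of c "C i"] by (intro exI[of _ "?p1 @ tl (rev (C i))"]) auto
    next
      case False
      note M' = M[OF i False]
      note wg = w[OF gP[OF i False]]
      have Mz: "z = hd (M i) \<or> z = last (M i)" if "z \<in> set (M i)" "z \<in> H" for z using M' that by blast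
      have fX: "z \<in> {a i, hd (M i)}" if "z \<in> set (w (f i))" "z \<in> R i" for z
        using wH(2)[OF fP[OF i]] that RX[OF i] False unfolding f_def by auto
      have gX: "z \<in> {last (M i), b i}" if "z \<in> set (w (g i))" "z \<in> R i" for z
        using wH(2)[OF gP[OF i False]] that RX[OF i] False unfolding g_def by auto
      have inR: "a i \<in> R i" "b i \<in> R i" "hd (M i) \<in> R i" "last (M i) \<in> R i" using False unfolding R_def by auto
      have 1: "set ?p1 \<inter> set (M i) \<subseteq> {hd (M i)}"
      proof
        fix z assume z: "z \<in> set ?p1 \<inter> set (M i)"
        then have zw: "z \<in> set (w (f i))" using p1(4) AM[OF i i] by blast
        then have "z = hd (M i) \<or> z = last (M i)" using Mz z wH(1)[OF fP[OF i]] by blast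
        then show "z \<in> {hd (M i)}" using fX[OF zw] inR ne(3,6)[OF i False] by auto
      qed
      note g2 = upath_glue[OF p1(1) conjunct1[OF M'] _ 1]
      let ?p2 = "?p1 @ tl (M i)"
      have l2: "last ?p1 = hd (M i)" using p1(3) False unfolding f_def by simp
      have p2: "upath E ?p2" "hd ?p2 = hd (A i)" "last ?p2 = last (M i)" "set ?p2 = set (A i) \<union> set (w (f i)) \<union> set (M i)"
         "brk c ?p2 \<longleftrightarrow> brk c (A i) \<noteq> brk c (M i)"
        using g2[OF l2] p1 by auto
      have fng: "f i \<noteq> g i" using fg(3)[OF i False] by auto
      have 2: "set ?p2 \<inter> set (w (g i)) \<subseteq> {hd (w (g i))}"
      proof
        fix z assume z: "z \<in> set ?p2 \<inter> set (w (g i))"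
        then have zg: "z \<in> set (w (g i))" "z \<in> H" using wH(1)[OF gP[OF i False]] by auto
        have nf: "z \<notin> set (w (f i))" using wd[OF fP[OF i] gP[OF i False] fng] zg by blast
        then have "z \<in> set (A i) \<or> z \<in> set (M i)" using z p2(4) by blast
        then have "z = a i \<or> z = hd (M i) \<or> z = last (M i)" using A[OF i] Mz zg(2) unfolding a_def by blast
        then have "z \<in> R i" using inR by blast
        then have "z = last (M i) \<or> z = b i" using gX zg(1) by blast
        then have "z = last (M i)" using \<open>z = a i \<or> z = hd (M i) \<or> z = last (M i)\<close> ne(1,4,5)[OF i] False by metis
        then show "z \<in> {hd (w (g i))}" using wg unfolding g_def by simp
      qed
      note g3 = upath_glue[OF p2(1) conjunct1[OF wg] _ 2]
      let ?p3 = "?p2 @ tl (w (g i))"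
      have l3: "last ?p2 = hd (w (g i))" using p2(3) wg unfolding g_def by simp
      have p3: "upath E ?p3" "hd ?p3 = hd (A i)" "last ?p3 = b i" "set ?p3 = set (A i) \<union> set (w (f i)) \<union> set (M i) \<union> set (w (g i))"
         "brk c ?p3 \<longleftrightarrow> brk c (A i) \<noteq> brk c (M i)"
        using g3[OF l3] p2 wg unfolding g_def by auto
      have 3: "set ?p3 \<inter> set (rev (C i)) \<subseteq> {hd (rev (C i))}"
      proof
        fix z assume z: "z \<in> set ?p3 \<inter> set (rev (C i))"
        then have zC: "z \<in> set (C i)" by simp
        have "z \<in> set (w (f i)) \<or> z \<in> set (w (g i))" using z p3(4) AC[OF i i] CM[OF i i] by auto
        then have "z \<in> H" using wH(1)[OF fP[OF i]] wH(1)[OF gP[OF i False]] by blast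
        then show "z \<in> {hd (rev (C i))}" using Cz[OF zC] C'(3) by simp
      qed
      note g4 = upath_glue[OF p3(1) C'(1) _ 3]
      have l4: "last ?p3 = hd (rev (C i))" using p3(3) C'(3) by simp
      let ?p4 = "?p3 @ tl (rev (C i))"
      have "set ?p4 \<subseteq> U i \<union> set (w (f i)) \<union> set (w (g i))" using g4(4)[OF l4] p3(4) mA by auto
      moreover have "brk c ?p4 \<longleftrightarrow> (brk c (A i) \<noteq> brk c (M i)) \<noteq> brk c (C i)" using g4(5)[OF l4] p3(5) brk_rev[of c "C i"] by simp
      ultimately show ?thesis using g4(1-3)[OF l4] p3(2) C'(2) False by (intro exI[of _ ?p4]) auto
    qed
  qed
  then obtain P where P: "\<And>i. i < k \<Longrightarrow> upath E (P i) \<and> set (P i) \<subseteq> U i \<union> set (w (f i)) \<union> (if M i = [] then {} else set (w (g i)))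
        \<and> hd (P i) = hd (A i) \<and> last (P i) = hd (C i)
        \<and> (brk c (P i) \<longleftrightarrow> (brk c (A i) \<noteq> brk c (C i)) \<noteq> (M i \<noteq> [] \<and> brk c (M i)))" by metis
  define Q where "Q i = set (w (f i)) \<union> (if M i = [] then {} else set (w (g i)))" for i
  have QH: "Q i \<subseteq> H" if "i < k" for i
    using wH(1)[OF fP[OF that]] wH(1)[OF gP[OF that]] unfolding Q_def by auto
  have QX: "Q i \<inter> X \<subseteq> R i" if "i < k" for i
    using wH(2)[OF fP[OF that]] wH(2)[OF gP[OF that]] fR[of i] gR[of i] unfolding Q_def by auto
  have QQ: "Q i \<inter> Q j = {}" if "i < k" "j < k" "i \<noteq> j" for i j
  proof -
    have n: "p \<noteq> q" if "fst p \<in> R i" "fst q \<in> R j" for p q :: "'a \<times> 'a" using RR[OF \<open>i < k\<close> \<open>j < k\<close> \<open>i \<noteq> j\<close>] that by auto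
    have "set (w p) \<inter> set (w q) = {}" if "p \<in> Pr" "q \<in> Pr" "fst p \<in> R i" "fst q \<in> R j" for p q
      using wd[OF that(1,2) n[OF that(3,4)]] .
    then show ?thesis using fP[OF \<open>i < k\<close>] fP[OF \<open>j < k\<close>] gP[OF \<open>i < k\<close>] gP[OF \<open>j < k\<close>] fR(1) gR(1)
      unfolding Q_def by (auto simp: Int_Un_distrib Int_Un_distrib2 split: if_splits)
  qed
  have UQ: "U i \<inter> Q j = {}" if "i < k" "j < k" "i \<noteq> j" for i j
  proof -
    have "U i \<inter> Q j \<subseteq> R i" using UR[OF that(1)] QH[OF that(2)] by blast
    moreover have "R i \<inter> Q j \<subseteq> R j" using RX[OF that(1)] QX[OF that(2)] by blast
    ultimately show ?thesis using RR[OF that] by blast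
  qed
  have PUQ: "set (P i) \<subseteq> U i \<union> Q i" if "i < k" for i using P[OF that] unfolding Q_def by auto
  have "set (P i) \<inter> set (P j) = {}" if "i < k" "j < k" "i \<noteq> j" for i j
    using PUQ[OF that(1)] PUQ[OF that(2)] UU[OF that] UQ[OF that] UQ[OF that(2,1)] QQ[OF that] that(3) by blast
  moreover have "set (P i) \<subseteq> H \<union> set (A i) \<union> set (C i) \<union> set (M i)" if "i < k" for i
    using PUQ[OF that] QH[OF that] unfolding U_def by blast
  ultimately show ?thesis using P by (intro exI[of _ P] conjI allI impI) simp_all
qed

lemma k_connected_split:
  assumes kc: "k_connected K V E" and D: "D \<subseteq> V" and c: "card D + card (A \<inter> B) < K"
    and sp: "split (V - D) E A B"
  shows "A \<subseteq> B \<or> B \<subseteq> A"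
proof (rule ccontr)
  assume "\<not> ?thesis"
  then obtain a b where ab: "a \<in> A" "a \<notin> B" "b \<in> B" "b \<notin> A" by blast
  have U: "A \<union> B = V - D" and ne: "\<And>a b. a \<in> A - B \<Longrightarrow> b \<in> B - A \<Longrightarrow> \<not> E a b" using sp unfolding split_def by blast+
  let ?X = "D \<union> A \<inter> B"
  have "card ?X < K" using card_Un_le[of D "A \<inter> B"] c by linarith
  moreover have "?X \<subseteq> V" using D U by blast
  ultimately have "connected_graph (V - ?X) E" using kc unfolding k_connected_def by blast
  moreover have "a \<in> V - ?X" "b \<in> V - ?X" using ab U by auto
  ultimately obtain p where p: "is_path (V - ?X) E p" "hd p = a" "last p = b" unfolding connected_graph_def by blast
  then have "reach E (V - ?X) a b" unfolding reach_iff_path by blast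
  then have "(\<lambda>x y. E x y \<and> x \<in> V - ?X \<and> y \<in> V - ?X)\<^sup>*\<^sup>* a b" unfolding reach_def by blast
  then have "b \<in> A - B"
  proof (induction rule: rtranclp_induct)
    case base
    show ?case using ab by blast
  next
    case (step y z)
    then have "z \<in> A - B \<or> z \<in> B - A" using U by blast
    then show ?case using ne[of y z] step by blast
  qed
  then show False using ab by blast
qed

lemma k_connected_degree:
  assumes fin: "finite V" and kc: "k_connected K V E" and v: "v \<in> V"
  shows "K \<le> card (nb E V v)"
proof (rule ccontr)
  assume n: "\<not> ?thesis"
  let ?N = "nb E V v"
  have fN: "finite ?N" using fin by simp
  have cV: "K < card V" using kc unfolding k_connected_def by blast
  have "card (insert v ?N) \<le> Suc (card ?N)" by (rule card_insert_le_m1) simp_all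
  then have "\<not> V \<subseteq> insert v ?N" using card_mono[of "insert v ?N" V] fN n cV by auto
  then obtain z where z: "z \<in> V" "z \<noteq> v" "z \<notin> ?N" by blast
  have "card (?N - {v}) < K" using card_mono[OF fN, of "?N - {v}"] n by auto
  moreover have "?N - {v} \<subseteq> V" by blast
  ultimately have "connected_graph (V - (?N - {v})) E" using kc unfolding k_connected_def by simp
  moreover have "v \<in> V - (?N - {v})" "z \<in> V - (?N - {v})" using v z by auto
  ultimately obtain p where p: "is_path (V - (?N - {v})) E p" "hd p = v" "last p = z" unfolding connected_graph_def by blast
  have ne: "p \<noteq> []" using p(1) unfolding is_path_iff by blast
  have "tl p \<noteq> []" using p(2,3) z(2) ne by (cases p) auto
  then obtain y ys where y: "p = v # y # ys" using p(2) ne by (cases p; cases "tl p") auto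
  then have "E v y" "y \<in> V - (?N - {v})" "y \<noteq> v" using p(1) unfolding is_path_iff by auto
  then show False by blast
qed

fun step_count :: "('a \<Rightarrow> 'a \<Rightarrow> bool) \<Rightarrow> 'a list \<Rightarrow> nat" where
  "step_count R (x # y # zs) = (if R x y then 0 else 1) + step_count R (y # zs)"
| "step_count R _ = 0"

lemma step_count_append: "step_count R (xs @ z # ys) = step_count R (xs @ [z]) + step_count R (z # ys)"
proof (induction xs)
  case (Cons x xs)
  then show ?case by (cases xs) auto
qed (cases ys; simp)

lemma step_count_zero: "successively R w \<Longrightarrow> step_count R w = 0"
  by (induction R w rule: step_count.induct) auto

lemma step_count_zero_iff: "step_count R w = 0 \<longleftrightarrow> successively R w"
  by (induction R w rule: step_count.induct) auto

locale terminals =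
  fixes V :: "'a set" and E :: "'a \<Rightarrow> 'a \<Rightarrow> bool" and k :: nat and s t :: "nat \<Rightarrow> 'a" and par :: "nat \<Rightarrow> bool"
  assumes fin: "finite V" and E: "sym_irrefl E" and k1: "1 \<le> k" and kc: "k_connected (50 * k) V E"
    and sV: "i < k \<Longrightarrow> s i \<in> V" and tV: "i < k \<Longrightarrow> t i \<in> V"
    and ss: "i < k \<Longrightarrow> j < k \<Longrightarrow> i \<noteq> j \<Longrightarrow> s i \<noteq> s j" and tt: "i < k \<Longrightarrow> j < k \<Longrightarrow> i \<noteq> j \<Longrightarrow> t i \<noteq> t j"
    and st: "i < k \<Longrightarrow> j < k \<Longrightarrow> s i \<noteq> t j"
begin

lemma Es: "E a b \<Longrightarrow> E b a" and Ei: "\<not> E a a"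
  using E unfolding sym_irrefl_def by blast+

definition T :: "'a set" where "T = s ` {..<k} \<union> t ` {..<k}"

definition parity_linkage :: bool where
  "parity_linkage \<longleftrightarrow> (\<exists>P :: nat \<Rightarrow> 'a list.
     (\<forall>i<k. is_path V E (P i) \<and> hd (P i) = s i \<and> last (P i) = t i \<and> (odd (path_length (P i)) \<longleftrightarrow> par i))
     \<and> (\<forall>i<k. \<forall>j<k. i \<noteq> j \<longrightarrow> set (P i) \<inter> set (P j) = {}))"

lemma T_facts: "T \<subseteq> V" "finite T" "card T \<le> 2 * k" "i < k \<Longrightarrow> s i \<in> T" "i < k \<Longrightarrow> t i \<in> T"
proof -
  show "T \<subseteq> V" unfolding T_def using sV tV by auto
  show "finite T" unfolding T_def by simp
  show "card T \<le> 2 * k"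
    using card_Un_le[of "s ` {..<k}" "t ` {..<k}"] card_image_le[of "{..<k}" s] card_image_le[of "{..<k}" t]
    unfolding T_def by simp
qed (auto simp: T_def)

text \<open>By the definition of \<open>brk\<close>, a path from \<open>s i\<close> to
  \<open>t i\<close> has the parity \<open>par i\<close> iff it is broken exactly when
  \<open>par i \<longleftrightarrow> c (s i) = c (t i)\<close>.\<close>

lemma parity_linkageI:
  assumes H: "H \<subseteq> V" and lk: "\<And>X. X \<subseteq> H \<Longrightarrow> card X \<le> 4 * k \<Longrightarrow> linked H (crossing E c) X"
    and A: "\<And>i. i < k \<Longrightarrow> upath E (A i) \<and> set (A i) \<subseteq> V \<and> set (A i) \<inter> H = {last (A i)} \<and> hd (A i) = s i"
    and C: "\<And>i. i < k \<Longrightarrow> upath E (C i) \<and> set (C i) \<subseteq> V \<and> set (C i) \<inter> H = {last (C i)} \<and> hd (C i) = t i"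
    and M: "\<And>i. i < k \<Longrightarrow> M i \<noteq> [] \<Longrightarrow> upath E (M i) \<and> set (M i) \<subseteq> V \<and> hd (M i) \<noteq> last (M i) \<and> set (M i) \<inter> H = {hd (M i), last (M i)}"
    and AC: "\<And>i j. i < k \<Longrightarrow> j < k \<Longrightarrow> set (A i) \<inter> set (C j) = {}"
    and AM: "\<And>i j. i < k \<Longrightarrow> j < k \<Longrightarrow> set (A i) \<inter> set (M j) = {}"
    and CM: "\<And>i j. i < k \<Longrightarrow> j < k \<Longrightarrow> set (C i) \<inter> set (M j) = {}"
    and AA: "\<And>i j. i < k \<Longrightarrow> j < k \<Longrightarrow> i \<noteq> j \<Longrightarrow> set (A i) \<inter> set (A j) = {}"
    and CC: "\<And>i j. i < k \<Longrightarrow> j < k \<Longrightarrow> i \<noteq> j \<Longrightarrow> set (C i) \<inter> set (C j) = {}"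
    and MM: "\<And>i j. i < k \<Longrightarrow> j < k \<Longrightarrow> i \<noteq> j \<Longrightarrow> set (M i) \<inter> set (M j) = {}"
    and b: "\<And>i. i < k \<Longrightarrow> ((brk c (A i) \<noteq> brk c (C i)) \<noteq> (M i \<noteq> [] \<and> brk c (M i))) \<longleftrightarrow> (par i \<longleftrightarrow> c (s i) = c (t i))"
  shows parity_linkage
proof -
  have "\<exists>P. (\<forall>i<k. upath E (P i) \<and> set (P i) \<subseteq> H \<union> set (A i) \<union> set (C i) \<union> set (M i)
        \<and> hd (P i) = hd (A i) \<and> last (P i) = hd (C i)
        \<and> (brk c (P i) \<longleftrightarrow> (brk c (A i) \<noteq> brk c (C i)) \<noteq> (M i \<noteq> [] \<and> brk c (M i))))
     \<and> (\<forall>i<k. \<forall>j<k. i \<noteq> j \<longrightarrow> set (P i) \<inter> set (P j) = {})"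
    by (rule linked_composition[OF E]) (use lk A C M AC AM CM AA CC MM in simp_all)
  then obtain P where P: "\<forall>i<k. upath E (P i) \<and> set (P i) \<subseteq> H \<union> set (A i) \<union> set (C i) \<union> set (M i)
        \<and> hd (P i) = hd (A i) \<and> last (P i) = hd (C i)
        \<and> (brk c (P i) \<longleftrightarrow> (brk c (A i) \<noteq> brk c (C i)) \<noteq> (M i \<noteq> [] \<and> brk c (M i)))"
     "\<forall>i<k. \<forall>j<k. i \<noteq> j \<longrightarrow> set (P i) \<inter> set (P j) = {}" by (elim exE conjE)
  have "is_path V E (P i) \<and> hd (P i) = s i \<and> last (P i) = t i \<and> (odd (path_length (P i)) \<longleftrightarrow> par i)" if i: "i < k" for i
  proof -
    have Pi: "upath E (P i)" "set (P i) \<subseteq> H \<union> set (A i) \<union> set (C i) \<union> set (M i)" "hd (P i) = s i" "last (P i) = t i"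
       "brk c (P i) \<longleftrightarrow> (par i \<longleftrightarrow> c (s i) = c (t i))" using P(1) i A[OF i] C[OF i] b[OF i] by auto
    have "set (M i) \<subseteq> V" using M[OF i] by (cases "M i = []") auto
    then have "set (P i) \<subseteq> V" using Pi(2) H A[OF i] C[OF i] by blast
    then have "is_path V E (P i)" using Pi(1) unfolding is_path_upath by blast
    moreover have "odd (path_length (P i)) \<longleftrightarrow> par i" using Pi(3-5) unfolding brk_def path_length_def by auto
    ultimately show ?thesis using Pi(3,4) by blast
  qed
  then show ?thesis using P(2) unfolding parity_linkage_def by blast
qed

text \<open>Menger's theorem in \<open>V - T \<inter> H\<close>: the terminals in \<open>H\<close>
  need no path and must not lie on the paths of the others.\<close>

lemma paths_to_set:
  assumes H: "H \<subseteq> V" and cH: "6 * k \<le> card H"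
  shows "\<exists>Q. \<forall>x\<in>T - H. is_path V E (Q x) \<and> hd (Q x) = x \<and> set (Q x) \<inter> T = {x} \<and> set (Q x) \<inter> (H - T) = {last (Q x)}
    \<and> (\<forall>y\<in>T - H. x \<noteq> y \<longrightarrow> set (Q x) \<inter> set (Q y) = {})"
proof -
  let ?V = "V - T \<inter> H" and ?X = "T - H" and ?S = "H - T"
  have finX: "finite ?X" using T_facts(2) by simp
  have cX: "card ?X + card (T \<inter> H) \<le> 2 * k"
  proof -
    have "card (T - H) + card (T \<inter> H) = card (T - H \<union> T \<inter> H)" by (rule card_Un_disjoint[symmetric]) (use T_facts(2) in auto)
    also have "T - H \<union> T \<inter> H = T" by blast
    finally show ?thesis using T_facts(3) by simp
  qed
  have "\<exists>P :: nat \<Rightarrow> 'a list. (\<forall>i<card ?X. is_path ?V E (P i) \<and> set (P i) \<inter> ?X = {hd (P i)} \<and> set (P i) \<inter> ?S = {last (P i)})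
     \<and> (\<forall>i<card ?X. \<forall>j<card ?X. i \<noteq> j \<longrightarrow> set (P i) \<inter> set (P j) = {})"
  proof (rule menger)
    show "finite ?V" "?X \<subseteq> ?V" "?S \<subseteq> ?V" using fin T_facts(1) H by auto
    fix Z assume Z: "Z \<subseteq> ?V" "\<forall>p. is_path ?V E p \<and> hd p \<in> ?X \<and> last p \<in> ?S \<longrightarrow> set p \<inter> Z \<noteq> {}"
    have finZ: "finite Z" using Z(1) fin finite_subset by blast
    show "card ?X \<le> card Z"
    proof (rule ccontr)
      assume n: "\<not> ?thesis"
      then have "\<not> ?X \<subseteq> Z" using card_mono[OF finZ] by blast
      then obtain x where x: "x \<in> ?X" "x \<notin> Z" by blast
      have "card ?S \<ge> card H - card T" using diff_card_le_card_Diff[OF T_facts(2)] by blast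
      then have "\<not> ?S \<subseteq> Z" using card_mono[OF finZ, of ?S] n cX cH T_facts(3) k1 by linarith
      then obtain y where y: "y \<in> ?S" "y \<notin> Z" by blast
      let ?D = "T \<inter> H \<union> Z"
      have "card ?D < 50 * k" using card_Un_le[of "T \<inter> H" Z] n cX k1 by linarith
      moreover have "?D \<subseteq> V" using T_facts(1) Z(1) by blast
      ultimately have "connected_graph (V - ?D) E" using kc unfolding k_connected_def by blast
      moreover have "x \<in> V - ?D" "y \<in> V - ?D" using x y T_facts(1) H by auto
      ultimately obtain p where p: "is_path (V - ?D) E p" "hd p = x" "last p = y" unfolding connected_graph_def by blast
      have "is_path ?V E p" using p(1) unfolding is_path_iff by blast
      then have "set p \<inter> Z \<noteq> {}" using Z(2) p(2,3) x(1) y(1) by blast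
      then show False using p(1) unfolding is_path_iff by blast
    qed
  qed
  then obtain P :: "nat \<Rightarrow> 'a list" where P0:
      "\<forall>i<card ?X. is_path ?V E (P i) \<and> set (P i) \<inter> ?X = {hd (P i)} \<and> set (P i) \<inter> ?S = {last (P i)}"
      "\<forall>i<card ?X. \<forall>j<card ?X. i \<noteq> j \<longrightarrow> set (P i) \<inter> set (P j) = {}" by (elim exE conjE)
  have hP: "hd (P i) \<in> set (P i)" if "i < card ?X" for i using P0(1) that by blast
  have "inj_on (\<lambda>i. hd (P i)) {..<card ?X}"
  proof (rule inj_onI, rule ccontr)
    fix i j assume ij: "i \<in> {..<card ?X}" "j \<in> {..<card ?X}" "hd (P i) = hd (P j)" "i \<noteq> j"
    then have "set (P i) \<inter> set (P j) = {}" using P0(2) by blast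
    then show False using hP[of i] hP[of j] ij by auto
  qed
  then have img: "(\<lambda>i. hd (P i)) ` {..<card ?X} = ?X"
    by (intro card_subset_eq[OF finX]) (use P0(1) in \<open>auto simp: card_image\<close>)
  have "\<exists>i<card ?X. hd (P i) = x" if "x \<in> ?X" for x
  proof -
    have "x \<in> (\<lambda>i. hd (P i)) ` {..<card ?X}" unfolding img by (rule that)
    then show ?thesis by (elim imageE) auto
  qed
  then obtain ix where ix: "\<And>x. x \<in> ?X \<Longrightarrow> ix x < card ?X \<and> hd (P (ix x)) = x" by metis
  have "is_path V E (P (ix x)) \<and> hd (P (ix x)) = x \<and> set (P (ix x)) \<inter> T = {x} \<and> set (P (ix x)) \<inter> ?S = {last (P (ix x))}" if x: "x \<in> ?X" for x
  proof -
    have P: "is_path ?V E (P (ix x))" "set (P (ix x)) \<inter> ?X = {x}" "set (P (ix x)) \<inter> ?S = {last (P (ix x))}"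
      using P0(1) ix[OF x] by auto
    have "set (P (ix x)) \<subseteq> ?V" using P(1) unfolding is_path_iff by blast
    then have "set (P (ix x)) \<inter> T = {x}" using P(2) by blast
    moreover have "is_path V E (P (ix x))" using P(1) unfolding is_path_iff by blast
    ultimately show ?thesis using P(3) ix[OF x] by blast
  qed
  moreover have "set (P (ix x)) \<inter> set (P (ix y)) = {}" if "x \<in> ?X" "y \<in> ?X" "x \<noteq> y" for x y
    using P0(2) ix[OF that(1)] ix[OF that(2)] that(3) by metis
  ultimately show ?thesis by (intro exI[of _ "\<lambda>x. P (ix x)"]) simp
qed

text \<open>With \<open>3k\<close> disjoint broken paths at hand, paths from the terminals to \<open>H\<close> that leave the broken
  paths as rarely as possible end on every broken path they meet, so they avoid \<open>k\<close> of them.\<close>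

lemma linkage_of_broken_paths:
  assumes H: "H \<subseteq> V" and cH: "6 * k \<le> card H"
    and lk: "\<And>X. X \<subseteq> H \<Longrightarrow> card X \<le> 4 * k \<Longrightarrow> linked H (crossing E c) X"
    and Ps: "finite Ps" "3 * k \<le> card Ps" "\<And>P. P \<in> Ps \<Longrightarrow> broken_paths.bpath (V - T) E c (H - T) P"
      "\<And>P P'. P \<in> Ps \<Longrightarrow> P' \<in> Ps \<Longrightarrow> P \<noteq> P' \<Longrightarrow> set P \<inter> set P' = {}"
  shows parity_linkage
proof -
  interpret B: broken_paths "V - T" E c "H - T" by unfold_locales (use fin E H in auto)
  let ?X = "T - H" and ?S = "H - T"
  have bp: "upath E P" "set P \<subseteq> V - T" "hd P \<noteq> last P" "set P \<inter> ?S = {hd P, last P}" "brk c P" if "P \<in> Ps" for P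
    using Ps(3)[OF that] unfolding B.bpath_def is_path_upath by auto
  define R where "R a b \<longleftrightarrow> (\<exists>P\<in>Ps. \<exists>xs ys. P = xs @ a # b # ys \<or> P = xs @ b # a # ys)" for a b
  define good where "good Q \<longleftrightarrow> (\<forall>x\<in>?X. is_path V E (Q x) \<and> hd (Q x) = x \<and> set (Q x) \<inter> T = {x} \<and> set (Q x) \<inter> ?S = {last (Q x)}
    \<and> (\<forall>y\<in>?X. x \<noteq> y \<longrightarrow> set (Q x) \<inter> set (Q y) = {}))" for Q
  obtain Q0 where "good Q0" using paths_to_set[OF H cH] unfolding good_def by blast
  then obtain Q where Q: "good Q" "\<And>Q'. good Q' \<Longrightarrow> (\<Sum>x\<in>?X. step_count R (Q x)) \<le> (\<Sum>x\<in>?X. step_count R (Q' x))"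
    using ex_has_least_nat[of good Q0 "\<lambda>Q. \<Sum>x\<in>?X. step_count R (Q x)"] by blast
  have Qx: "upath E (Q x)" "set (Q x) \<subseteq> V" "hd (Q x) = x" "set (Q x) \<inter> T = {x}" "set (Q x) \<inter> ?S = {last (Q x)}" if "x \<in> ?X" for x
    using Q(1) that unfolding good_def is_path_upath by auto
  have Qd: "set (Q x) \<inter> set (Q y) = {}" if "x \<in> ?X" "y \<in> ?X" "x \<noteq> y" for x y
    using Q(1) that unfolding good_def by blast
  have finX: "finite ?X" using T_facts(2) by simp
  let ?Ends = "(\<lambda>x. last (Q x)) ` ?X"
  \<comment> \<open>Otherwise let \<open>z\<close> be the first vertex of \<open>P\<close>, seen
    from \<open>hd P\<close>, that lies on some \<open>Q x\<close>. Rerouting \<open>Q x\<close>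
    from \<open>z\<close> back along \<open>P\<close> to \<open>hd P\<close> meets no other path and
    costs no step off the broken paths.\<close>
  have hit: "hd P \<in> ?Ends \<or> last P \<in> ?Ends" if P: "P \<in> Ps" and x0: "x0 \<in> ?X" "set (Q x0) \<inter> set P \<noteq> {}" for P x0
  proof (rule ccontr)
    assume n: "\<not> ?thesis"
    let ?U = "\<Union>x\<in>?X. set (Q x)"
    have "\<exists>z\<in>set P. z \<in> ?U" using x0 by blast
    then obtain xs z ys where z: "P = xs @ z # ys" "z \<in> ?U" "\<forall>v\<in>set xs. v \<notin> ?U"
      using split_list_first_prop[of P "\<lambda>v. v \<in> ?U"] by blast
    obtain x where x: "x \<in> ?X" "z \<in> set (Q x)" using z(2) by blast
    obtain us vs where Qs: "Q x = us @ z # vs" using split_list[OF x(2)] by blast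
    have zP: "z \<in> set P" using z(1) by simp
    have eQ: "z' \<notin> set P" if "z' = last (Q x)" for z'
    proof
      assume "z' \<in> set P"
      moreover have "z' \<in> ?S" using Qx(5)[OF x(1)] that by blast
      ultimately have "z' = hd P \<or> z' = last P" using bp(4)[OF P] by blast
      then show False using n that x(1) by blast
    qed
    have zS: "z \<notin> ?S"
    proof
      assume "z \<in> ?S"
      then have "z = last (Q x)" using Qx(5)[OF x(1)] x(2) by blast
      then show False using eQ zP by blast
    qed
    have Pne: "P \<noteq> []" "distinct P" "successively E P" using bp(1)[OF P] unfolding upath_def by auto
    have "hd P \<in> ?S" using bp(4)[OF P] by blast
    then have xs: "xs \<noteq> []" using z(1) zS by (cases xs) auto
    have hxs: "hd xs = hd P" using xs z(1) by simp
    have Rin: "b \<in> set P" if "R a b" "a \<in> set P" for a b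
    proof -
      obtain P' xs' ys' where P': "P' \<in> Ps" "P' = xs' @ a # b # ys' \<or> P' = xs' @ b # a # ys'" using \<open>R a b\<close> unfolding R_def by blast
      then have ab: "a \<in> set P'" "b \<in> set P'" by auto
      then have "P' = P" using Ps(4)[OF P P'(1)] \<open>a \<in> set P\<close> by blast
      then show ?thesis using ab by blast
    qed
    \<comment> \<open>If the rest of \<open>Q x\<close> never left the broken paths, it would stay
      on \<open>P\<close> and end in an end of \<open>P\<close>.\<close>
    have pos: "step_count R (z # vs) \<noteq> 0"
    proof
      assume "step_count R (z # vs) = 0"
      then have "successively R (z # vs)" using step_count_zero_iff by blast
      then have "set (z # vs) \<subseteq> set P" using zP
      proof (induction vs arbitrary: z)
        case (Cons v vs)
        then show ?case using Rin[of z v] by auto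
      qed simp
      moreover have "last (Q x) \<in> set (z # vs)" unfolding Qs by (simp add: last_in_set)
      ultimately show False using eQ by blast
    qed
    let ?w = "us @ z # rev xs"
    have cw: "step_count R (z # rev xs) = 0"
    proof (rule step_count_zero)
      have "successively R (xs @ [z])"
        unfolding successively_conv_nth
      proof (intro allI impI)
        fix i assume i: "Suc i < length (xs @ [z])"
        let ?p = "xs @ [z]"
        have "?p = take i ?p @ ?p ! i # ?p ! Suc i # drop (Suc (Suc i)) ?p"
          using i by (metis Cons_nth_drop_Suc Suc_lessD append_take_drop_id)
        then have "P = take i ?p @ ?p ! i # ?p ! Suc i # (drop (Suc (Suc i)) ?p @ ys)" using z(1) by (metis append.assoc append_Cons append_Nil)
        then show "R (?p ! i) (?p ! Suc i)" using P unfolding R_def by blast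
      qed
      moreover have "R a b \<longleftrightarrow> R b a" for a b unfolding R_def by blast
      then have "(\<lambda>x y. R y x) = R" by (simp add: fun_eq_iff)
      ultimately have "successively (\<lambda>x y. R y x) (xs @ [z])" by (simp only:)
      then show "successively R (z # rev xs)" using successively_rev[of R "xs @ [z]"] by simp
    qed
    have hw: "hd ?w = x" using Qx(3)[OF x(1)] unfolding Qs by (cases us) auto
    have lw: "last ?w = hd P" using xs hxs by (simp add: last_rev)
    have xsP: "set xs \<subseteq> set P" using z(1) by auto
    have xsQ: "set xs \<inter> set (Q y) = {}" if "y \<in> ?X" for y using z(3) that by blast
    have dw: "distinct ?w" using Qx(1)[OF x(1)] Pne(2) xsQ[OF x(1)] unfolding Qs upath_def z(1) by auto
    have sw: "successively E ?w"
    proof -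
      have "successively E (us @ [z])" using Qx(1)[OF x(1)] unfolding Qs upath_def by (auto simp: successively_append_iff successively_Cons)
      moreover have "successively E (xs @ [z])" using Pne(3) unfolding z(1) by (auto simp: successively_append_iff successively_Cons)
      then have "successively E (rev (xs @ [z]))" using successively_rev_sym[OF E] by blast
      then have "successively E (z # rev xs)" by simp
      ultimately show ?thesis by (auto simp: successively_append_iff successively_Cons)
    qed
    have usV: "set us \<subseteq> set (Q x)" "set us \<subseteq> V" "z \<in> V" using Qx(2)[OF x(1)] unfolding Qs by auto
    have xsV: "set xs \<subseteq> V - T" using xsP bp(2)[OF P] by blast
    have wT: "set ?w \<inter> T = {x}"
    proof -
      have "x \<in> set ?w" using hw by (metis hd_in_set Nil_is_append_conv list.distinct(1))
      moreover have "x \<in> T" using x(1) by blast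
      moreover have "set ?w \<subseteq> set (Q x) \<union> set xs" unfolding Qs by auto
      ultimately show ?thesis using Qx(4)[OF x(1)] xsV by blast
    qed
    have wS: "set ?w \<inter> ?S = {hd P}"
    proof -
      have "last (Q x) \<in> set (z # vs)" unfolding Qs by (simp add: last_in_set)
      then have "last (Q x) \<notin> set us" using Qx(1)[OF x(1)] unfolding Qs upath_def by auto
      have usS: "set us \<inter> ?S = {}"
      proof (rule ccontr)
        assume "set us \<inter> ?S \<noteq> {}"
        then obtain v where v: "v \<in> set us" "v \<in> ?S" by blast
        then have "v \<in> set (Q x) \<inter> ?S" using usV(1) by blast
        then have "v = last (Q x)" unfolding Qx(5)[OF x(1)] by simp
        then show False using v(1) \<open>last (Q x) \<notin> set us\<close> by simp
      qed
      have "last P \<in> set (z # ys)" unfolding z(1) by (simp add: last_in_set)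
      then have "last P \<notin> set xs" using Pne(2) unfolding z(1) by auto
      have "set xs \<inter> ?S = {hd P}"
      proof (intro equalityI subsetI)
        fix v assume v: "v \<in> set xs \<inter> ?S"
        then have "v \<in> set P \<inter> ?S" using xsP by blast
        then have "v = hd P \<or> v = last P" unfolding bp(4)[OF P] by simp
        then show "v \<in> {hd P}" using v \<open>last P \<notin> set xs\<close> by auto
      next
        fix v assume "v \<in> {hd P}"
        then show "v \<in> set xs \<inter> ?S" using hxs hd_in_set[OF xs] \<open>hd P \<in> ?S\<close> by simp
      qed
      then show ?thesis using zS usS by auto
    qed
    have "good (Q(x := ?w))" unfolding good_def
    proof (intro ballI)
      fix y assume y: "y \<in> ?X"
      have dy: "set ?w \<inter> set (Q v) = {}" if "v \<in> ?X" "v \<noteq> x" for v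
      proof -
        have "set ?w \<subseteq> set (Q x) \<union> set xs" unfolding Qs by auto
        then show ?thesis using Qd[OF x(1) that(1)] xsQ[OF that(1)] that(2) by blast
      qed
      show "is_path V E ((Q(x := ?w)) y) \<and> hd ((Q(x := ?w)) y) = y \<and> set ((Q(x := ?w)) y) \<inter> T = {y}
        \<and> set ((Q(x := ?w)) y) \<inter> ?S = {last ((Q(x := ?w)) y)} \<and> (\<forall>v\<in>?X. y \<noteq> v \<longrightarrow> set ((Q(x := ?w)) y) \<inter> set ((Q(x := ?w)) v) = {})"
      proof (cases "y = x")
        case True
        have "is_path V E ?w" unfolding is_path_iff using dw sw usV xsV by auto
        then show ?thesis using True hw wT wS lw dy by simp
      next
        case False
        then show ?thesis using Q(1) y dy[OF y False] unfolding good_def by (auto simp: Int_commute)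
      qed
    qed
    then have "(\<Sum>y\<in>?X. step_count R (Q y)) \<le> (\<Sum>y\<in>?X. step_count R ((Q(x := ?w)) y))" by (rule Q(2))
    moreover have "(\<Sum>y\<in>?X. step_count R ((Q(x := ?w)) y)) < (\<Sum>y\<in>?X. step_count R (Q y))"
    proof (rule sum_strict_mono_ex1[OF finX])
      have "step_count R ?w < step_count R (Q x)"
        unfolding Qs step_count_append[of R us z "rev xs"] step_count_append[of R us z vs] using cw pos by simp
      then show "\<forall>y\<in>?X. step_count R ((Q(x := ?w)) y) \<le> step_count R (Q y)"
        "\<exists>y\<in>?X. step_count R ((Q(x := ?w)) y) < step_count R (Q y)" using x(1) by auto
    qed
    ultimately show False by simp
  qed
  let ?Hit = "{P \<in> Ps. \<exists>x\<in>?X. set (Q x) \<inter> set P \<noteq> {}}"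
  define e where "e P = (if hd P \<in> ?Ends then hd P else last P)" for P :: "'a list"
  have eE: "e P \<in> ?Ends \<and> e P \<in> set P" if P: "P \<in> ?Hit" for P
  proof -
    have "P \<in> Ps" "P \<noteq> []" using P bp(1) unfolding upath_def by auto
    then show ?thesis using hit[of P] P unfolding e_def by auto
  qed
  have "inj_on e ?Hit"
  proof (rule inj_onI, rule ccontr)
    fix P P' assume "P \<in> ?Hit" "P' \<in> ?Hit" "e P = e P'" "P \<noteq> P'"
    then show False using Ps(4)[of P P'] eE[of P] eE[of P'] by auto
  qed
  then have "card ?Hit \<le> card ?Ends" by (rule card_inj_on_le) (use eE finX in auto)
  also have "\<dots> \<le> card ?X" by (rule card_image_le[OF finX])
  also have "\<dots> \<le> 2 * k" using card_mono[OF T_facts(2), of ?X] T_facts(3) by auto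
  finally have "card ?Hit \<le> 2 * k" .
  moreover have "card (Ps - ?Hit) = card Ps - card ?Hit" by (rule card_Diff_subset) (use Ps(1) in auto)
  ultimately have "k \<le> card (Ps - ?Hit)" using Ps(2) by linarith
  then obtain F where F: "F \<subseteq> Ps - ?Hit" "card F = k" "finite F" by (rule obtain_subset_with_card_n)
  obtain h where h: "bij_betw h {..<k} F" using ex_bij_betw_nat_finite[OF F(3)] F(2) unfolding atLeast0LessThan by auto
  have hF: "h i \<in> F" if "i < k" for i using h that unfolding bij_betw_def by blast
  have hi: "h i \<noteq> h j" if "i < k" "j < k" "i \<noteq> j" for i j using h that unfolding bij_betw_def inj_on_def by blast
  have hP: "h i \<in> Ps" "\<And>x. x \<in> ?X \<Longrightarrow> set (Q x) \<inter> set (h i) = {}" if "i < k" for i using hF[OF that] F(1) by blast+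
  define A where "A x = (if x \<in> H then [x] else Q x)" for x
  have A: "upath E (A x) \<and> set (A x) \<subseteq> V \<and> set (A x) \<inter> H = {last (A x)} \<and> hd (A x) = x \<and> set (A x) \<inter> T = {x}" if x: "x \<in> T" for x
  proof (cases "x \<in> H")
    case True
    then show ?thesis using x T_facts(1) unfolding A_def upath_def by auto
  next
    case False
    then have xX: "x \<in> ?X" using x by blast
    have "set (Q x) \<inter> H = set (Q x) \<inter> ?S \<union> set (Q x) \<inter> T \<inter> H" by blast
    then have "set (Q x) \<inter> H = {last (Q x)}" unfolding Qx(4,5)[OF xX] using False by simp
    then show ?thesis using Qx[OF xX] False unfolding A_def by auto
  qed
  have Ad: "set (A x) \<inter> set (A y) = {}" if xy: "x \<in> T" "y \<in> T" "x \<noteq> y" for x y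
  proof (cases "x \<in> H \<or> y \<in> H")
    case True
    then show ?thesis using A[OF xy(1)] A[OF xy(2)] xy unfolding A_def by (auto split: if_splits)
  next
    case False
    then show ?thesis using Qd[of x y] xy unfolding A_def by auto
  qed
  have Ah: "set (A x) \<inter> set (h i) = {}" if "x \<in> T" "i < k" for x i
  proof (cases "x \<in> H")
    case True
    then show ?thesis using bp(2)[OF hP(1)[OF that(2)]] that(1) unfolding A_def by auto
  next
    case False
    then show ?thesis using hP(2)[OF that(2)] that(1) unfolding A_def by auto
  qed
  define M where "M i = (if (brk c (A (s i)) \<noteq> brk c (A (t i))) \<longleftrightarrow> (par i \<longleftrightarrow> c (s i) = c (t i)) then [] else h i)" for i
  note sT = T_facts(4) and tT = T_facts(5)
  have hh: "upath E (h i)" "set (h i) \<subseteq> V" "hd (h i) \<noteq> last (h i)" "set (h i) \<inter> H = {hd (h i), last (h i)}" "brk c (h i)" if "i < k" for i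
    using bp[OF hP(1)[OF that]] by auto
  show ?thesis
  proof (rule parity_linkageI[OF H lk, of "\<lambda>i. A (s i)" "\<lambda>i. A (t i)" M])
    show "upath E (M i) \<and> set (M i) \<subseteq> V \<and> hd (M i) \<noteq> last (M i) \<and> set (M i) \<inter> H = {hd (M i), last (M i)}" if "i < k" "M i \<noteq> []" for i
      using hh[OF that(1)] that(2) unfolding M_def by (auto split: if_splits)
    show "set (A (s i)) \<inter> set (M j) = {}" if "i < k" "j < k" for i j using Ah[OF sT[OF that(1)] that(2)] unfolding M_def by auto
    show "set (A (t i)) \<inter> set (M j) = {}" if "i < k" "j < k" for i j using Ah[OF tT[OF that(1)] that(2)] unfolding M_def by auto
    show "set (M i) \<inter> set (M j) = {}" if "i < k" "j < k" "i \<noteq> j" for i j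
      using Ps(4)[OF hP(1)[OF that(1)] hP(1)[OF that(2)] hi[OF that]] unfolding M_def by auto
    show "((brk c (A (s i)) \<noteq> brk c (A (t i))) \<noteq> (M i \<noteq> [] \<and> brk c (M i))) \<longleftrightarrow> (par i \<longleftrightarrow> c (s i) = c (t i))" if i: "i < k" for i
    proof -
      have "h i \<noteq> []" using hh(1)[OF i] unfolding upath_def by blast
      then show ?thesis using hh(5)[OF i] unfolding M_def by auto
    qed
  qed (use A sT tT Ad ss tt st in simp_all)
qed

end

section \<open>Parity linkages when a few vertices hit all broken paths\<close>

text \<open>A closed walk given by its cyclic list of vertices, so that \<open>length w\<close> is
  its number of edges.\<close>

definition odd_closed :: "('a \<Rightarrow> 'a \<Rightarrow> bool) \<Rightarrow> 'a set \<Rightarrow> 'a list \<Rightarrow> bool" where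
  "odd_closed E B w \<longleftrightarrow> successively E w \<and> E (last w) (hd w) \<and> set w \<subseteq> B \<and> odd (length w)"

text \<open>At a repeated vertex a closed walk falls into two closed walks, one of which is
  odd.\<close>

lemma odd_closed_distinct:
  assumes "odd_closed E B w"
  shows "\<exists>w'. odd_closed E B w' \<and> distinct w'"
  using assms
proof (induction "length w" arbitrary: w rule: less_induct)
  case less
  show ?case
  proof (cases "distinct w")
    case False
    then obtain xs ys zs y where w: "w = xs @ [y] @ ys @ [y] @ zs" using not_distinct_decomp by blast
    let ?u = "y # ys" and ?v = "xs @ [y] @ zs"
    have o: "successively E w" "E (last w) (hd w)" "set w \<subseteq> B" "odd (length w)" using less.prems unfolding odd_closed_def by auto
    have su: "successively E ?u" "E (last ?u) (hd ?u)" "set ?u \<subseteq> B"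
    proof -
      have "successively E ((y # ys) @ y # zs)" using o(1) unfolding w by (simp add: successively_append_iff)
      then show "successively E ?u" "E (last ?u) (hd ?u)" unfolding successively_append_iff by auto
      show "set ?u \<subseteq> B" using o(3) unfolding w by auto
    qed
    have hl: "hd ?v = hd w" "last ?v = last w" unfolding w by (auto simp: hd_append)
    have sv: "successively E ?v" "set ?v \<subseteq> B"
      using o(1,3) unfolding w by (auto simp: successively_append_iff successively_Cons split: if_splits)
    have len: "length ?u + length ?v = length w" unfolding w by simp
    have "odd (length ?u) \<or> odd (length ?v)" using o(4) len by (metis even_add)
    then show ?thesis
    proof
      assume "odd (length ?u)"
      then have "odd_closed E B ?u" using su unfolding odd_closed_def by blast
      then show ?thesis using less.hyps[of ?u] unfolding w by simp
    next
      assume "odd (length ?v)"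
      then have "odd_closed E B ?v" using sv hl o(2) unfolding odd_closed_def by simp
      then show ?thesis using less.hyps[of ?v] unfolding w by simp
    qed
  qed (use less.prems in blast)
qed

text \<open>Colour a vertex by whether some walk from \<open>x\<close> to it has an odd number of
  vertices. As this is not a proper colouring, some edge joins two vertices that are reached by
  walks of the same parity, and it closes them to an odd walk.\<close>

lemma odd_closed_exists:
  assumes E: "sym_irrefl E" and con: "connected_graph B E" and x: "x \<in> B" and nb: "\<not> bipartite B E"
  shows "\<exists>w. odd_closed E B w"
proof -
  define walk where "walk v w \<longleftrightarrow> w \<noteq> [] \<and> successively E w \<and> set w \<subseteq> B \<and> hd w = x \<and> last w = v" for v w
  define col where "col v \<longleftrightarrow> (\<exists>w. walk v w \<and> odd (length w))" for v
  obtain u v where uv: "u \<in> B" "v \<in> B" "E u v" "col u = col v" using nb unfolding bipartite_def by blast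
  have ex: "\<exists>w. walk z w" if "z \<in> B" for z
    using con x that unfolding connected_graph_def walk_def is_path_iff by blast
  obtain w1 w2 where w: "walk u w1" "walk v w2" "odd (length w1) = odd (length w2)"
  proof (cases "col u")
    case True
    then obtain w1 w2 where "walk u w1" "odd (length w1)" "walk v w2" "odd (length w2)" using uv(4) unfolding col_def by blast
    then show ?thesis using that[of w1 w2] by blast
  next
    case False
    obtain w1 w2 where "walk u w1" "walk v w2" using ex[OF uv(1)] ex[OF uv(2)] by blast
    moreover have "even (length w1)" "even (length w2)" using False uv(4) calculation unfolding col_def by blast+
    ultimately show ?thesis using that[of w1 w2] by blast
  qed
  have w1: "w1 \<noteq> []" "successively E w1" "set w1 \<subseteq> B" "hd w1 = x" "last w1 = u" using w(1) unfolding walk_def by auto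
  have w2: "w2 \<noteq> []" "successively E w2" "set w2 \<subseteq> B" "hd w2 = x" "last w2 = v" using w(2) unfolding walk_def by auto
  \<comment> \<open>The second walk is appended without its start \<open>x\<close>, which the cyclic
    list already contains; if it consists of \<open>x\<close> only, the edge itself closes the first
    walk.\<close>
  show ?thesis
  proof (cases "tl w2")
    case Nil
    then have "length w2 = 1" "v = x" using w2 by (cases w2; auto)+
    then have "odd_closed E B w1" using w1 w(3) uv(3) unfolding odd_closed_def by simp
    then show ?thesis by blast
  next
    case (Cons y ys)
    then have w2': "w2 = x # y # ys" using w2 by (cases w2) auto
    let ?w = "w1 @ rev (y # ys)"
    have sr: "successively E (rev (y # ys))" using successively_rev_sym[OF E] w2(2) unfolding w2' by (metis successively_Cons list.distinct(1))
    have "hd (rev (y # ys)) = v" using w2(5) unfolding w2' by (simp add: hd_rev del: rev.simps)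
    then have "successively E ?w" using w1 uv(3) sr by (intro successively_appendI) auto
    moreover have "last ?w = y" by simp
    moreover have "E y x" using w2(2) sym_irreflD(1)[OF E] unfolding w2' by auto
    moreover have "hd ?w = x" using w1 by simp
    moreover have "set ?w \<subseteq> B" using w1(3) w2(3) unfolding w2' by auto
    moreover have "odd (length ?w)" using w(3) unfolding w2' by auto
    ultimately have "odd_closed E B ?w" unfolding odd_closed_def by simp
    then show ?thesis by blast
  qed
qed

text \<open>An inner vertex in \<open>S\<close> divides the path into two parts, exactly one of
  which is broken.\<close>

lemma broken_subpath:
  assumes "upath E P" "set P \<subseteq> B" "hd P \<in> S" "last P \<in> S" "hd P \<noteq> last P" "brk c P"
  shows "\<exists>Q. upath E Q \<and> set Q \<subseteq> B \<and> hd Q \<noteq> last Q \<and> set Q \<inter> S = {hd Q, last Q} \<and> brk c Q"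
  using assms
proof (induction "length P" arbitrary: P rule: less_induct)
  case less
  note p = less.prems
  have ne: "P \<noteq> []" "distinct P" "successively E P" using p(1) unfolding upath_def by auto
  show ?case
  proof (cases "\<exists>z\<in>set P. z \<in> S \<and> z \<noteq> hd P \<and> z \<noteq> last P")
    case False
    then have "set P \<inter> S = {hd P, last P}" using p(3,4) ne(1) by auto
    then show ?thesis using p by blast
  next
    case True
    then obtain z xs ys where z: "P = xs @ z # ys" "z \<in> S" "z \<noteq> hd P" "z \<noteq> last P" by (metis split_list)
    have xs: "xs \<noteq> []" and ys: "ys \<noteq> []" using z by auto
    let ?a = "xs @ [z]" and ?b = "z # ys"
    have "brk c (?a @ tl ?b) \<longleftrightarrow> brk c ?a \<noteq> brk c ?b" by (rule brk_glue) auto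
    then have b: "brk c ?a \<or> brk c ?b" using p(6) z(1) by auto
    have ha: "hd ?a = hd P" "last ?b = last P" using xs ys unfolding z(1) by auto
    have ua: "upath E ?a" "upath E ?b" using ne(2,3) unfolding upath_def z(1) by (auto simp: successively_append_iff successively_Cons)
    have sa: "set ?a \<subseteq> B" "set ?b \<subseteq> B" using p(2) unfolding z(1) by auto
    from b show ?thesis
    proof
      assume "brk c ?a"
      then show ?thesis using less.hyps[of ?a] ua(1) sa(1) p(3) z(2,3) ha(1) ys unfolding z(1) by auto
    next
      assume "brk c ?b"
      then show ?thesis using less.hyps[of ?b] ua(2) sa(2) p(4) z(2,4) ha(2) xs unfolding z(1) by auto
    qed
  qed
qed

text \<open>If there is an odd cycle, Menger's theorem gives two disjoint paths from
  \<open>S\<close> to it. The two arcs of the cycle between their ends have different parities, so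
  going round one way or the other yields a broken path between vertices of
  \<open>S\<close>.\<close>

lemma bipartite_of_no_broken_path:
  assumes fin: "finite B" and E: "sym_irrefl E" and S: "S \<subseteq> B" "2 \<le> card S"
    and con: "\<And>Z. Z \<subseteq> B \<Longrightarrow> card Z \<le> 1 \<Longrightarrow> connected_graph (B - Z) E"
    and nobrk: "\<And>Q. upath E Q \<Longrightarrow> set Q \<subseteq> B \<Longrightarrow> hd Q \<noteq> last Q \<Longrightarrow> set Q \<inter> S = {hd Q, last Q} \<Longrightarrow> \<not> brk c Q"
  shows "bipartite B E"
proof (rule ccontr)
  assume nb: "\<not> bipartite B E"
  have "S \<noteq> {}" using S(2) by auto
  then obtain x where x: "x \<in> B" using S(1) by blast
  have "connected_graph B E" using con[of "{}"] by simp
  from odd_closed_exists[OF E this x nb] obtain w0 where "odd_closed E B w0" by blast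
  from odd_closed_distinct[OF this] obtain w where w: "odd_closed E B w" "distinct w" by blast
  have wo: "successively E w" "E (last w) (hd w)" "set w \<subseteq> B" "odd (length w)" using w(1) unfolding odd_closed_def by auto
  have "length w \<noteq> 1"
  proof
    assume "length w = 1"
    then obtain y where "w = [y]" by (metis One_nat_def length_0_conv length_Suc_conv)
    then show False using wo(2) sym_irreflD(2)[OF E] by simp
  qed
  then have lw: "2 \<le> card (set w)" using wo(4) distinct_card[OF w(2)] by (cases "length w"; cases "length w - 1") auto
  have no: "\<not> brk c P" if "upath E P" "set P \<subseteq> B" "hd P \<in> S" "last P \<in> S" "hd P \<noteq> last P" for P
    using broken_subpath[OF that, of c] nobrk by blast
  have "\<exists>P :: nat \<Rightarrow> 'a list. (\<forall>i<2. is_path B E (P i) \<and> set (P i) \<inter> S = {hd (P i)} \<and> set (P i) \<inter> set w = {last (P i)})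
     \<and> (\<forall>i<2. \<forall>j<2. i \<noteq> j \<longrightarrow> set (P i) \<inter> set (P j) = {})"
  proof (rule menger[OF fin S(1) wo(3)])
    fix Z assume Z: "Z \<subseteq> B" "\<forall>p. is_path B E p \<and> hd p \<in> S \<and> last p \<in> set w \<longrightarrow> set p \<inter> Z \<noteq> {}"
    show "2 \<le> card Z"
    proof (rule ccontr)
      assume n: "\<not> ?thesis"
      have finZ: "finite Z" using Z(1) fin finite_subset by blast
      have "\<not> S \<subseteq> Z" "\<not> set w \<subseteq> Z" using card_mono[OF finZ] n S(2) lw by (meson le_trans)+
      then obtain a b where ab: "a \<in> S" "a \<notin> Z" "b \<in> set w" "b \<notin> Z" by blast
      have "connected_graph (B - Z) E" using con[OF Z(1)] n by simp
      moreover have "a \<in> B - Z" "b \<in> B - Z" using ab S(1) wo(3) by auto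
      ultimately obtain p where p: "is_path (B - Z) E p" "hd p = a" "last p = b" unfolding connected_graph_def by blast
      have "is_path B E p" using p(1) unfolding is_path_iff by blast
      then have "set p \<inter> Z \<noteq> {}" using Z(2) p(2,3) ab by blast
      then show False using p(1) unfolding is_path_iff by blast
    qed
  qed
  then obtain P :: "nat \<Rightarrow> 'a list" where P:
    "\<forall>i<2. is_path B E (P i) \<and> set (P i) \<inter> S = {hd (P i)} \<and> set (P i) \<inter> set w = {last (P i)}"
    "\<forall>i<2. \<forall>j<2. i \<noteq> j \<longrightarrow> set (P i) \<inter> set (P j) = {}" by (elim exE conjE)
  have Pi: "upath E (P i)" "set (P i) \<subseteq> B" "set (P i) \<inter> S = {hd (P i)}" "set (P i) \<inter> set w = {last (P i)}" if "i < 2" for i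
    using P(1) that unfolding is_path_upath by auto
  have Pd: "set (P 0) \<inter> set (P 1) = {}" using P(2) by simp
  \<comment> \<open>Stated for arbitrary \<open>p\<close> and \<open>q\<close>, since the two ends
    may appear in either order on the list of the cycle.\<close>
  have final: False
    if pq: "upath E p" "set p \<subseteq> B" "set p \<inter> S = {hd p}" "set p \<inter> set w = {last p}"
      "upath E q" "set q \<subseteq> B" "set q \<inter> S = {hd q}" "set q \<inter> set w = {last q}" "set p \<inter> set q = {}"
      and ws: "w = xs @ last p # ys @ last q # zs" for p q xs ys zs
  proof -
    let ?a = "last p" and ?b = "last q"
    let ?A = "?a # ys @ [?b]" and ?C = "?b # zs @ xs @ [?a]"
    have uA: "upath E ?A"
    proof -
      have "w = xs @ ?A @ zs" unfolding ws by simp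
      then have "successively E ?A" using wo(1) by (simp only: successively_append_iff)
      then show ?thesis using w(2) unfolding upath_def ws by auto
    qed
    have s1: "successively E (?b # zs)" "successively E (xs @ [?a])"
      using wo(1) unfolding ws by (auto simp: successively_append_iff successively_Cons)
    have "last (?b # zs) = last w" "hd (xs @ [?a]) = hd w" unfolding ws by (auto simp: hd_append)
    then have "E (last (?b # zs)) (hd (xs @ [?a]))" using wo(2) by (simp only:)
    then have "successively E ((?b # zs) @ xs @ [?a])" by (rule successively_appendI[OF s1])
    then have "upath E ?C" using w(2) unfolding upath_def ws by auto
    then have uC: "upath E (rev ?C)" using upath_rev[OF E] by blast
    have hl: "hd ?A = ?a" "last ?A = ?b" "hd (rev ?C) = ?a" "last (rev ?C) = ?b" by (auto simp: hd_rev)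
    have len: "odd (length ?A - 1) \<noteq> odd (length (rev ?C) - 1)" using wo(4) unfolding ws by auto
    have bb: "brk c ?A \<noteq> brk c (rev ?C)" using len hl unfolding brk_def by auto
    have hne: "hd p \<noteq> hd q"
    proof -
      have "hd p \<in> set p" "hd q \<in> set q" using pq(3,7) by blast+
      then show ?thesis using pq(9) by auto
    qed
    have uq: "upath E (rev q)" "hd (rev q) = ?b" "last (rev q) = hd q" using pq(5) upath_rev[OF E] unfolding upath_def by (auto simp: hd_rev last_rev)
    have main: "\<not> (brk c p \<noteq> brk c X) \<noteq> brk c q" if X: "upath E X" "hd X = ?a" "last X = ?b" "set X \<subseteq> set w" for X
    proof -
      have i1: "set p \<inter> set X \<subseteq> {hd X}" unfolding X(2) pq(4)[symmetric] using X(4) by blast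
      note g1 = upath_glue[OF pq(1) X(1) _ i1]
      have l1: "last p = hd X" using X(2) by simp
      have "set (p @ tl X) \<inter> set (rev q) \<subseteq> {hd (rev q)}"
        unfolding g1(4)[OF l1] uq(2) using pq(8,9) X(4) by auto
      note g2 = upath_glue[OF g1(1)[OF l1] uq(1) _ this]
      have l2: "last (p @ tl X) = hd (rev q)" using g1(3)[OF l1] X(3) uq(2) by simp
      let ?R = "(p @ tl X) @ tl (rev q)"
      have "set ?R \<subseteq> B" unfolding g2(4)[OF l2] g1(4)[OF l1] using pq(2,6) X(4) wo(3) by auto
      moreover have "hd ?R = hd p" using g2(2)[OF l2] g1(2)[OF l1] by simp
      moreover have "last ?R = hd q" using g2(3)[OF l2] uq(3) by simp
      moreover have "hd p \<in> S" "hd q \<in> S" using pq(3,7) by blast+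
      ultimately have "\<not> brk c ?R" using no[OF g2(1)[OF l2]] hne by simp
      then show ?thesis using g2(5)[OF l2, of c] g1(5)[OF l1, of c] brk_rev[of c q] by simp
    qed
    have "set ?A \<subseteq> set w" "set (rev ?C) \<subseteq> set w" unfolding ws by auto
    then show False using main[OF uA hl(1,2)] main[OF uC hl(3,4)] bb by blast
  qed
  have l01: "last (P 0) \<in> set w" "last (P 1) \<in> set w" "last (P 0) \<noteq> last (P 1)"
  proof -
    show a: "last (P 0) \<in> set w" "last (P 1) \<in> set w" using Pi(4)[of 0] Pi(4)[of 1] by auto
    have "last (P 0) \<in> set (P 0)" "last (P 1) \<in> set (P 1)" using Pi(4)[of 0] Pi(4)[of 1] by auto
    then show "last (P 0) \<noteq> last (P 1)" using Pd by auto
  qed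
  obtain us vs where us: "w = us @ last (P 0) # vs" using split_list[OF l01(1)] by blast
  have "last (P 1) \<in> set us \<or> last (P 1) \<in> set vs" using l01 us by auto
  then show False
  proof
    assume "last (P 1) \<in> set vs"
    then obtain ys zs where "vs = ys @ last (P 1) # zs" using split_list by metis
    then show False using final[of "P 0" "P 1" us ys zs] Pi[of 0] Pi[of 1] Pd us by simp
  next
    assume "last (P 1) \<in> set us"
    then obtain xs ys where "us = xs @ last (P 1) # ys" using split_list by metis
    then show False using final[of "P 1" "P 0" xs ys vs] Pi[of 0] Pi[of 1] Pd us by (simp add: Int_commute)
  qed
qed

lemma upath_snoc: "upath E p \<Longrightarrow> E (last p) x \<Longrightarrow> x \<notin> set p \<Longrightarrow> upath E (p @ [x])"
  unfolding upath_def by (auto simp: successively_append_iff)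

lemma upath_Cons: "upath E p \<Longrightarrow> E x (hd p) \<Longrightarrow> x \<notin> set p \<Longrightarrow> upath E (x # p)"
  unfolding upath_def by (auto simp: successively_Cons)

lemma brk_snoc:
  assumes "p \<noteq> []"
  shows "brk c (p @ [x]) \<longleftrightarrow> brk c p \<noteq> (c (last p) = c x)"
  using brk_glue[of p "[last p, x]" c] assms by (simp add: brk_pair)

lemma brk_Cons:
  assumes "p \<noteq> []"
  shows "brk c (x # p) \<longleftrightarrow> (c x = c (hd p)) \<noteq> brk c p"
  using brk_glue[of "[x, hd p]" p c] assms by (cases p) (auto simp: brk_pair)

section \<open>Gadgets that adjust the parity of a pair\<close>

locale coloured_terminals = terminals +
  fixes Z :: "'a set" and cB :: "'a \<Rightarrow> bool"
  assumes Z: "Z \<subseteq> V - T" and cZ: "card Z + 2 \<le> 6 * k"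
    and indep: "a \<in> T \<Longrightarrow> b \<in> T \<Longrightarrow> \<not> E a b"
    and bip: "a \<in> V - T - Z \<Longrightarrow> b \<in> V - T - Z \<Longrightarrow> E a b \<Longrightarrow> cB a \<noteq> cB b"
begin

definition B :: "'a set" where "B = V - T - Z"

text \<open>Vertices that can be left through either colour and thus change a parity on their own.
  As every vertex has at least \<open>42k\<close> neighbours in \<open>B\<close>, one colour is
  plentiful anyway, and \<open>8k\<close> is above the \<open>5k\<close> that the gadgets
  require.\<close>

definition both :: "'a set" where
  "both = {y \<in> T \<union> Z. \<forall>j. 8 * k \<le> card {b \<in> B. E y b \<and> cB b = j}}"

text \<open>Off \<open>B\<close> and \<open>both\<close>, a vertex gets the colour that few of its
  neighbours in \<open>B\<close> have. Vertices of \<open>both\<close> get \<open>False\<close>, an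
  arbitrary choice.\<close>

definition c :: "'a \<Rightarrow> bool" where
  "c v = (if v \<in> B then cB v else card {b \<in> B. E v b \<and> cB b} < 8 * k)"

definition nbc :: "'a \<Rightarrow> bool \<Rightarrow> 'a set" where
  "nbc v j = {b \<in> B. E v b \<and> c b = j}"

lemma cTZ: "card (T \<union> Z) + 2 \<le> 8 * k"
  using card_Un_le[of T Z] T_facts(3) cZ by linarith

lemma finB: "finite B" "B \<subseteq> V" "B \<inter> T = {}"
  unfolding B_def using fin by auto

lemma nbc_eq: "nbc v j = {b \<in> B. E v b \<and> cB b = j}"
  unfolding nbc_def c_def by auto

lemma deg_B:
  assumes "v \<in> V"
  shows "42 * k \<le> card (nbc v True) + card (nbc v False)"
proof -
  have "nb E V v \<subseteq> nbc v True \<union> nbc v False \<union> (T \<union> Z)" unfolding nbc_def B_def by auto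
  then have "card (nb E V v) \<le> card (nbc v True \<union> nbc v False \<union> (T \<union> Z))"
    by (rule card_mono[rotated]) (use finB T_facts(2) Z fin in \<open>auto simp: nbc_def intro: finite_subset\<close>)
  also have "\<dots> \<le> card (nbc v True) + card (nbc v False) + card (T \<union> Z)"
    using card_Un_le[of "nbc v True \<union> nbc v False" "T \<union> Z"] card_Un_le[of "nbc v True" "nbc v False"] by linarith
  finally show ?thesis using k_connected_degree[OF fin kc assms] cTZ by linarith
qed

lemma other_colour:
  assumes "v \<in> V" "v \<notin> both"
  shows "12 * k \<le> card (nbc v (\<not> c v))"
proof (cases "v \<in> B")
  case True
  have "nbc v (c v) = {}" unfolding nbc_eq c_def using True bip unfolding B_def by auto
  then have "card (nbc v (c v)) = 0" by simp
  then show ?thesis using deg_B[OF assms(1)] k1 by (cases "c v") auto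
next
  case False
  then have "v \<in> T \<union> Z" using assms(1) unfolding B_def by blast
  then obtain j where j: "card (nbc v j) < 8 * k" using assms(2) unfolding both_def nbc_eq by (auto simp: not_le)
  have c: "c v = (card (nbc v True) < 8 * k)" using False unfolding c_def nbc_eq by simp
  then have "card (nbc v (c v)) < 8 * k" using j by (cases j; cases "c v") auto
  then show ?thesis using deg_B[OF assms(1)] by (cases "c v") auto
qed

lemma both_colours: "v \<in> both \<Longrightarrow> 8 * k \<le> card (nbc v j)"
  unfolding both_def nbc_eq by blast

text \<open>\<open>A\<close> and \<open>C\<close> start at the terminals, and \<open>M\<close> is an
  optional correction; \<open>ja\<close>, \<open>jc\<close>, \<open>jd\<close>, \<open>je\<close>
  are the colours of the vertices by which their ends will be attached to the linked part of
  \<open>B\<close>. Of \<open>5k\<close> candidates at least \<open>4k\<close> survive when the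
  gadgets use up \<open>k\<close> vertices of \<open>B\<close>, enough for \<open>4k\<close>
  distinct attachments. The last condition is the parity balance after attachment.\<close>

definition gadget_parts :: "nat \<Rightarrow> 'a set \<Rightarrow> 'a list \<Rightarrow> 'a list \<Rightarrow> 'a list \<Rightarrow> bool \<Rightarrow> bool \<Rightarrow> bool \<Rightarrow> bool \<Rightarrow> bool" where
  "gadget_parts i G A C M ja jc jd je \<longleftrightarrow> upath E A \<and> hd A = s i \<and> upath E C \<and> hd C = t i \<and> (M \<noteq> [] \<longrightarrow> upath E M)
     \<and> set A \<union> set C \<union> set M \<subseteq> G \<and> set A \<inter> set C = {} \<and> set A \<inter> set M = {} \<and> set C \<inter> set M = {}
     \<and> 5 * k \<le> card (nbc (last A) ja) \<and> 5 * k \<le> card (nbc (last C) jc)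
     \<and> (M \<noteq> [] \<longrightarrow> 5 * k \<le> card (nbc (hd M) jd) \<and> 5 * k \<le> card (nbc (last M) je))
     \<and> (((brk c A \<noteq> (c (last A) = ja)) \<noteq> (brk c C \<noteq> (c (last C) = jc)))
         \<noteq> (M \<noteq> [] \<and> ((jd = c (hd M)) \<noteq> (brk c M \<noteq> (c (last M) = je)))) \<longleftrightarrow> (par i \<longleftrightarrow> c (s i) = c (t i)))"

definition gadget :: "nat \<Rightarrow> 'a set \<Rightarrow> bool" where
  "gadget i G \<longleftrightarrow> (\<exists>A C M ja jc jd je. gadget_parts i G A C M ja jc jd je)"

text \<open>What the gadgets leave of \<open>B\<close> is \<open>H\<close>, obtained from
  \<open>V\<close> by deleting at most \<open>9k\<close> vertices. So it has minimum degree at least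
  \<open>41k\<close>, no separation of order below \<open>4k\<close>, and only crossing edges, and
  \<open>linked_of_min_degree\<close> applies.\<close>

lemma gadgets_link:
  assumes gad: "\<And>i. i < k \<Longrightarrow> gadget i (G i)" and GV: "\<And>i. i < k \<Longrightarrow> G i \<subseteq> V"
    and GG: "\<And>i j. i < k \<Longrightarrow> j < k \<Longrightarrow> i \<noteq> j \<Longrightarrow> G i \<inter> G j = {}" and GB: "\<And>i. i < k \<Longrightarrow> card (B \<inter> G i) \<le> 1"
  shows parity_linkage
proof -
  from gad obtain A C M ja jc jd je where g0: "\<And>i. i < k \<Longrightarrow> gadget_parts i (G i) (A i) (C i) (M i) (ja i) (jc i) (jd i) (je i)"
    unfolding gadget_def by metis
  have g: "upath E (A i) \<and> hd (A i) = s i \<and> upath E (C i) \<and> hd (C i) = t i \<and> (M i \<noteq> [] \<longrightarrow> upath E (M i))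
     \<and> set (A i) \<union> set (C i) \<union> set (M i) \<subseteq> G i \<and> set (A i) \<inter> set (C i) = {} \<and> set (A i) \<inter> set (M i) = {} \<and> set (C i) \<inter> set (M i) = {}
     \<and> 5 * k \<le> card (nbc (last (A i)) (ja i)) \<and> 5 * k \<le> card (nbc (last (C i)) (jc i))
     \<and> (M i \<noteq> [] \<longrightarrow> 5 * k \<le> card (nbc (hd (M i)) (jd i)) \<and> 5 * k \<le> card (nbc (last (M i)) (je i)))
     \<and> (((brk c (A i) \<noteq> (c (last (A i)) = ja i)) \<noteq> (brk c (C i) \<noteq> (c (last (C i)) = jc i)))
         \<noteq> (M i \<noteq> [] \<and> ((jd i = c (hd (M i))) \<noteq> (brk c (M i) \<noteq> (c (last (M i)) = je i)))) \<longleftrightarrow> (par i \<longleftrightarrow> c (s i) = c (t i)))"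
    if "i < k" for i using g0[OF that] unfolding gadget_parts_def .
  define D where "D = (\<Union>i<k. G i)"
  define H where "H = B - D"
  have cBD: "card (B \<inter> D) \<le> k"
  proof -
    have "B \<inter> D = (\<Union>i<k. B \<inter> G i)" unfolding D_def by blast
    then have "card (B \<inter> D) \<le> (\<Sum>i<k. card (B \<inter> G i))" using card_UN_le[of "{..<k}" "\<lambda>i. B \<inter> G i"] by simp
    also have "\<dots> \<le> (\<Sum>i<k. 1)" by (rule sum_mono) (use GB in auto)
    finally show ?thesis by simp
  qed
  let ?R = "T \<union> Z \<union> B \<inter> D"
  have cR: "card ?R \<le> 9 * k" using card_Un_le[of "T \<union> Z" "B \<inter> D"] cTZ cBD by linarith
  have RV: "?R \<subseteq> V" using T_facts(1) Z finB(2) by blast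
  have HR: "H = V - ?R" unfolding H_def B_def by blast
  have finH: "finite H" "H \<subseteq> V" using fin HR by auto
  have cross: "crossing E c a b \<longleftrightarrow> E a b" if "a \<in> H" "b \<in> H" for a b
    using that bip[of a b] unfolding crossing_def c_def H_def B_def by auto
  have cH: "41 * k \<le> card H"
  proof -
    have "card H = card V - card ?R" unfolding HR by (rule card_Diff_subset) (use RV fin finite_subset in auto)
    moreover have "50 * k < card V" using kc unfolding k_connected_def by blast
    ultimately show ?thesis using cR by linarith
  qed
  have lk: "linked H (crossing E c) X" if X: "X \<subseteq> H" "card X \<le> 4 * k" for X
  proof (rule linked_of_min_degree[OF finH(1) crossing_sym_irrefl[OF E] k1 _ _ _ X])
    show "H \<noteq> {}" using cH k1 by auto
    show "25 * k \<le> card (nb (crossing E c) H v)" if v: "v \<in> H" for v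
    proof -
      have "nb E V v \<subseteq> nb (crossing E c) H v \<union> ?R" using cross[OF v] unfolding HR by auto
      then have "card (nb E V v) \<le> card (nb (crossing E c) H v \<union> ?R)"
        by (rule card_mono[rotated]) (use finH RV fin finite_subset in auto)
      also have "\<dots> \<le> card (nb (crossing E c) H v) + card ?R" by (rule card_Un_le)
      finally show ?thesis using k_connected_degree[OF fin kc, of v] v finH(2) cR by fastforce
    qed
    fix A' B' assume sp: "split H (crossing E c) A' B'" "card (A' \<inter> B') < 4 * k"
    have "split (V - ?R) E A' B'" using sp(1) cross unfolding split_def HR[symmetric] by blast
    then show "A' \<subseteq> B' \<or> B' \<subseteq> A'" using k_connected_split[OF kc RV, of A' B'] sp(2) cR k1 by simp
  qed
  \<comment> \<open>Candidates for the four attachments of pair \<open>i\<close>, numbered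
    \<open>4 * i\<close> to \<open>4 * i + 3\<close>; without a correction, the last two are dummies
    from \<open>H\<close>.\<close>
  define N where "N q = (let i = q div 4 in
      if q mod 4 = 0 then nbc (last (A i)) (ja i) - D else if q mod 4 = 1 then nbc (last (C i)) (jc i) - D
      else if M i = [] then H else if q mod 4 = 2 then nbc (hd (M i)) (jd i) - D else nbc (last (M i)) (je i) - D)" for q
  have big: "4 * k \<le> card (nbc v j - D)" if "5 * k \<le> card (nbc v j)" for v j
  proof -
    have "nbc v j - D = nbc v j - B \<inter> D" unfolding nbc_def by blast
    moreover have "card (nbc v j) - card (B \<inter> D) \<le> card (nbc v j - B \<inter> D)"
      by (rule diff_card_le_card_Diff) (use finB in simp)
    ultimately have "card (nbc v j) - card (B \<inter> D) \<le> card (nbc v j - D)" by simp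
    then show ?thesis using that cBD by linarith
  qed
  have "4 * k \<le> card (N q)" if q: "q < 4 * k" for q
  proof -
    have i: "q div 4 < k" using q by (simp add: less_mult_imp_div_less mult.commute)
    show ?thesis using g[OF i] big cH k1 unfolding N_def Let_def by auto
  qed
  then obtain r where r: "\<And>q. q < 4 * k \<Longrightarrow> r q \<in> N q" "inj_on r {..<4 * k}" using distinct_representatives[of "4 * k" N] by blast
  have rr: "r q = r q' \<longleftrightarrow> q = q'" if "q < 4 * k" "q' < 4 * k" for q q' using r(2) that unfolding inj_on_def by auto
  have i4: "4 * i < 4 * k" "4 * i + 1 < 4 * k" "4 * i + 2 < 4 * k" "4 * i + 3 < 4 * k" if "i < k" for i using that by auto
  have md: "(4 * i + 1) div 4 = i" "(4 * i + 2) div 4 = i" "(4 * i + 3) div 4 = i" "(4 * i + 1) mod 4 = 1" "(4 * i + 2) mod 4 = 2"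
    "(4 * i + 3) mod 4 = 3" for i :: nat by presburger+
  have rA: "r (4 * i) \<in> nbc (last (A i)) (ja i) - D" if "i < k" for i using r(1)[OF i4(1)[OF that]] unfolding N_def Let_def by simp
  have rC: "r (4 * i + 1) \<in> nbc (last (C i)) (jc i) - D" if "i < k" for i using r(1)[OF i4(2)[OF that]] unfolding N_def Let_def md by simp
  have rM: "r (4 * i + 2) \<in> nbc (hd (M i)) (jd i) - D" "r (4 * i + 3) \<in> nbc (last (M i)) (je i) - D" if "i < k" "M i \<noteq> []" for i
    using r(1)[OF i4(3)[OF that(1)]] r(1)[OF i4(4)[OF that(1)]] that(2) unfolding N_def Let_def md by simp_all
  have nH: "v \<in> H" if "v \<in> nbc u j - D" for u v j using that unfolding nbc_def H_def by blast
  have GD: "G i \<subseteq> D" "G i \<inter> H = {}" if "i < k" for i using that unfolding D_def H_def by auto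
  define A' where "A' i = A i @ [r (4 * i)]" for i
  define C' where "C' i = C i @ [r (4 * i + 1)]" for i
  define M' where "M' i = (if M i = [] then [] else r (4 * i + 2) # M i @ [r (4 * i + 3)])" for i
  have AG: "set (A i) \<subseteq> G i" "set (C i) \<subseteq> G i" "set (M i) \<subseteq> G i" if "i < k" for i using g[OF that] by auto
  have rH: "r (4 * i) \<in> H" "r (4 * i + 1) \<in> H" "M i \<noteq> [] \<Longrightarrow> r (4 * i + 2) \<in> H" "M i \<noteq> [] \<Longrightarrow> r (4 * i + 3) \<in> H" if "i < k" for i
    using nH[OF rA[OF that]] nH[OF rC[OF that]] nH[OF rM(1)[OF that]] nH[OF rM(2)[OF that]] by blast+
  have sA: "set (A' i) = insert (r (4 * i)) (set (A i))" and sC: "set (C' i) = insert (r (4 * i + 1)) (set (C i))"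
    and sM: "set (M' i) = (if M i = [] then {} else insert (r (4 * i + 2)) (insert (r (4 * i + 3)) (set (M i))))" for i
    unfolding A'_def C'_def M'_def by auto
  have outer: "set (A i) \<inter> H = {}" "set (C i) \<inter> H = {}" "set (M i) \<inter> H = {}" if "i < k" for i
    using AG[OF that] GD(2)[OF that] by blast+
  have nmem: "r q \<notin> set (A i)" "r q \<notin> set (C i)" "r q \<notin> set (M i)" if "r q \<in> H" "i < k" for q i
    using outer[OF that(2)] that(1) by blast+
  have dis: "set (A i) \<inter> set (A j) = {}" "set (C i) \<inter> set (C j) = {}" "set (M i) \<inter> set (M j) = {}"
     "set (A i) \<inter> set (C j) = {}" "set (A i) \<inter> set (M j) = {}" "set (C i) \<inter> set (M j) = {}" if "i < k" "j < k" "i \<noteq> j" for i j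
    using AG[OF that(1)] AG[OF that(2)] GG[OF that] by blast+
  have dis': "set (A i) \<inter> set (C j) = {}" "set (A i) \<inter> set (M j) = {}" "set (C i) \<inter> set (M j) = {}" if "i < k" "j < k" for i j
    using dis[OF that] g[OF that(1)] by (cases "i = j"; simp)+
  have ix: "4 * i \<noteq> 4 * j + 1" "4 * i \<noteq> 4 * j + 2" "4 * i \<noteq> 4 * j + 3" "4 * i + 1 \<noteq> 4 * j + 2" "4 * i + 1 \<noteq> 4 * j + 3" "4 * i + 2 \<noteq> 4 * j + 3" for i j :: nat
    by presburger+
  show ?thesis
  proof (rule parity_linkageI[OF finH(2) lk, of A' C' M'])
    fix i assume i: "i < k"
    note gi = g[OF i]
    have A: "upath E (A i)" "A i \<noteq> []" and C: "upath E (C i)" "C i \<noteq> []" using gi unfolding upath_def by auto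
    have eA: "E (last (A i)) (r (4 * i))" "c (r (4 * i)) = ja i" and eC: "E (last (C i)) (r (4 * i + 1))" "c (r (4 * i + 1)) = jc i"
      using rA[OF i] rC[OF i] unfolding nbc_def by auto
    have hA: "hd (A i) = s i" by (rule gi[THEN conjunct2, THEN conjunct1])
    have hC: "hd (C i) = t i" by (rule gi[THEN conjunct2, THEN conjunct2, THEN conjunct2, THEN conjunct1])
    have tail: "upath E (p @ [x]) \<and> set (p @ [x]) \<subseteq> V \<and> set (p @ [x]) \<inter> H = {last (p @ [x])} \<and> hd (p @ [x]) = hd p"
      if "upath E p" "E (last p) x" "x \<in> H" "set p \<inter> H = {}" "set p \<subseteq> G i" for p x
    proof (intro conjI)
      show "upath E (p @ [x])" by (rule upath_snoc[OF that(1,2)]) (use that(3,4) in blast)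
      show "set (p @ [x]) \<subseteq> V" using that(3,5) GV[OF i] finH(2) by auto
      show "set (p @ [x]) \<inter> H = {last (p @ [x])}" using that(3,4) by simp
      show "hd (p @ [x]) = hd p" using that(1) unfolding upath_def by simp
    qed
    show "upath E (A' i) \<and> set (A' i) \<subseteq> V \<and> set (A' i) \<inter> H = {last (A' i)} \<and> hd (A' i) = s i"
      unfolding A'_def using tail[OF A(1) eA(1) rH(1)[OF i] outer(1)[OF i] AG(1)[OF i]] unfolding hA .
    show "upath E (C' i) \<and> set (C' i) \<subseteq> V \<and> set (C' i) \<inter> H = {last (C' i)} \<and> hd (C' i) = t i"
      unfolding C'_def using tail[OF C(1) eC(1) rH(2)[OF i] outer(2)[OF i] AG(2)[OF i]] unfolding hC .
    have Mi: "upath E (M' i) \<and> (brk c (M' i) \<longleftrightarrow> (jd i = c (hd (M i))) \<noteq> (brk c (M i) \<noteq> (c (last (M i)) = je i)))" if m: "M i \<noteq> []"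
    proof -
      have e: "E (hd (M i)) (r (4 * i + 2))" "c (r (4 * i + 2)) = jd i" "E (last (M i)) (r (4 * i + 3))" "c (r (4 * i + 3)) = je i"
        using rM[OF i m] unfolding nbc_def by auto
      have um: "upath E (M i)" using gi m by blast
      have "r (4 * i + 2) \<noteq> r (4 * i + 3)" using rr[OF i4(3)[OF i] i4(4)[OF i]] by simp
      then have "upath E (M' i)" using upath_Cons[OF upath_snoc[OF um e(3) nmem(3)[OF rH(4)[OF i m] i]], of "r (4 * i + 2)"]
         Es[OF e(1)] nmem(3)[OF rH(3)[OF i m] i] m unfolding M'_def by simp
      moreover have "brk c (M' i) \<longleftrightarrow> (c (r (4 * i + 2)) = c (hd (M i))) \<noteq> (brk c (M i) \<noteq> (c (last (M i)) = c (r (4 * i + 3))))"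
        using m brk_Cons[of "M i @ [r (4 * i + 3)]" c "r (4 * i + 2)"] brk_snoc[OF m, of c] unfolding M'_def by simp
      ultimately show ?thesis unfolding e(2,4) by blast
    qed
    show "upath E (M' i) \<and> set (M' i) \<subseteq> V \<and> hd (M' i) \<noteq> last (M' i) \<and> set (M' i) \<inter> H = {hd (M' i), last (M' i)}" if "M' i \<noteq> []"
    proof -
      have m: "M i \<noteq> []" using that unfolding M'_def by auto
      have hl: "hd (M' i) = r (4 * i + 2)" "last (M' i) = r (4 * i + 3)" using m unfolding M'_def by auto
      have "set (M' i) \<inter> H = {r (4 * i + 2), r (4 * i + 3)}" using m rH(3,4)[OF i m] outer(3)[OF i] unfolding sM by auto
      moreover have "set (M' i) \<subseteq> V" using m rH(3,4)[OF i m] finH(2) AG(3)[OF i] GV[OF i] unfolding sM by auto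
      moreover have "r (4 * i + 2) \<noteq> r (4 * i + 3)" using rr[OF i4(3)[OF i] i4(4)[OF i]] by simp
      ultimately show ?thesis using Mi[OF m] unfolding hl by blast
    qed
    show "((brk c (A' i) \<noteq> brk c (C' i)) \<noteq> (M' i \<noteq> [] \<and> brk c (M' i))) \<longleftrightarrow> (par i \<longleftrightarrow> c (s i) = c (t i))"
    proof -
      have 1: "brk c (A' i) \<longleftrightarrow> brk c (A i) \<noteq> (c (last (A i)) = ja i)" "brk c (C' i) \<longleftrightarrow> brk c (C i) \<noteq> (c (last (C i)) = jc i)"
        unfolding A'_def C'_def brk_snoc[OF A(2)] brk_snoc[OF C(2)] eA(2) eC(2) by (rule refl)+
      have 2: "(M' i \<noteq> [] \<and> brk c (M' i)) \<longleftrightarrow> (M i \<noteq> [] \<and> ((jd i = c (hd (M i))) \<noteq> (brk c (M i) \<noteq> (c (last (M i)) = je i))))"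
        using Mi unfolding M'_def by (cases "M i = []") auto
      show ?thesis unfolding 1 2 by (rule gi[THEN conjunct2, THEN conjunct2, THEN conjunct2, THEN conjunct2, THEN conjunct2, THEN conjunct2, THEN conjunct2, THEN conjunct2, THEN conjunct2, THEN conjunct2, THEN conjunct2, THEN conjunct2])
    qed
  next
    fix i j assume ij: "i < k" "j < k"
    show "set (A' i) \<inter> set (C' j) = {}" unfolding sA sC
      using rr[OF i4(1)[OF ij(1)] i4(2)[OF ij(2)]] ix(1)[of i j] nmem[OF rH(1)[OF ij(1)] ij(2)] nmem[OF rH(2)[OF ij(2)] ij(1)] dis'[OF ij] by simp
    show "set (A' i) \<inter> set (M' j) = {}" unfolding sA sM
      using rr[OF i4(1)[OF ij(1)] i4(3)[OF ij(2)]] rr[OF i4(1)[OF ij(1)] i4(4)[OF ij(2)]] ix(2,3)[of i j]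
        nmem[OF rH(1)[OF ij(1)] ij(2)] nmem[OF rH(3)[OF ij(2)] ij(1)] nmem[OF rH(4)[OF ij(2)] ij(1)] dis'[OF ij] by simp
    show "set (C' i) \<inter> set (M' j) = {}" unfolding sC sM
      using rr[OF i4(2)[OF ij(1)] i4(3)[OF ij(2)]] rr[OF i4(2)[OF ij(1)] i4(4)[OF ij(2)]] ix(4,5)[of i j]
        nmem[OF rH(2)[OF ij(1)] ij(2)] nmem[OF rH(3)[OF ij(2)] ij(1)] nmem[OF rH(4)[OF ij(2)] ij(1)] dis'[OF ij] by simp
    assume n: "i \<noteq> j"
    show "set (A' i) \<inter> set (A' j) = {}" unfolding sA
      using rr[OF i4(1)[OF ij(1)] i4(1)[OF ij(2)]] n nmem[OF rH(1)[OF ij(1)] ij(2)] nmem[OF rH(1)[OF ij(2)] ij(1)] dis[OF ij n] by simp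
    show "set (C' i) \<inter> set (C' j) = {}" unfolding sC
      using rr[OF i4(2)[OF ij(1)] i4(2)[OF ij(2)]] n nmem[OF rH(2)[OF ij(1)] ij(2)] nmem[OF rH(2)[OF ij(2)] ij(1)] dis[OF ij n] by simp
    show "set (M' i) \<inter> set (M' j) = {}"
    proof (cases "M i = [] \<or> M j = []")
      case True
      then show ?thesis unfolding sM by auto
    next
      case False
      then have m: "M i \<noteq> []" "M j \<noteq> []" by auto
      have "r (4 * i + 2) \<noteq> r (4 * j + 2)" "r (4 * i + 2) \<noteq> r (4 * j + 3)" "r (4 * i + 3) \<noteq> r (4 * j + 2)" "r (4 * i + 3) \<noteq> r (4 * j + 3)"
        using rr[OF i4(3)[OF ij(1)] i4(3)[OF ij(2)]] rr[OF i4(3)[OF ij(1)] i4(4)[OF ij(2)]] rr[OF i4(4)[OF ij(1)] i4(3)[OF ij(2)]]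
          rr[OF i4(4)[OF ij(1)] i4(4)[OF ij(2)]] n ix(6)[of i j] ix(6)[of j i] by auto
      then show ?thesis unfolding sM using m nmem[OF rH(3)[OF ij(1) m(1)] ij(2)] nmem[OF rH(4)[OF ij(1) m(1)] ij(2)]
          nmem[OF rH(3)[OF ij(2) m(2)] ij(1)] nmem[OF rH(4)[OF ij(2) m(2)] ij(1)] dis[OF ij n] by simp
    qed
  qed
qed

end

section \<open>Corrections as a matching, and the dual cover\<close>

context coloured_terminals
begin

abbreviation mono :: "'a \<Rightarrow> 'a \<Rightarrow> bool" where "mono a b \<equiv> E a b \<and> c a = c b"

text \<open>Pairs that need no further correction, as one of their terminals can be attached through
  either colour.\<close>

definition Ib :: "nat set" where "Ib = {i. i < k \<and> (s i \<in> both \<or> t i \<in> both)}"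

text \<open>Three kinds of corrections: a detour over a monochromatic edge at a terminal, which
  serves pair \<open>i\<close> only, and a vertex of \<open>both\<close> or a monochromatic edge
  elsewhere, which serve any pair.\<close>

definition usable :: "nat \<Rightarrow> 'a set \<Rightarrow> bool" where
  "usable i W \<longleftrightarrow> W \<subseteq> V - T \<and> ((\<exists>y. W = {y} \<and> y \<notin> both \<and> (mono (s i) y \<or> mono (t i) y)) \<or> (\<exists>z\<in>both. W = {z})
     \<or> (\<exists>x y. W = {x, y} \<and> x \<notin> both \<and> y \<notin> both \<and> mono x y))"

lemma opposite: "v \<in> V \<Longrightarrow> 5 * k \<le> card (nbc v (\<not> c v))"
  using other_colour[of v] both_colours[of v "\<not> c v"] by (cases "v \<in> both") auto

lemma either: "v \<in> both \<Longrightarrow> 5 * k \<le> card (nbc v j)"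
  using both_colours[of v j] by simp

lemma upath1: "upath E [x]" and upath2: "E x y \<Longrightarrow> upath E [x, y]"
  using Ei unfolding upath_def by auto

lemma gadget_plain:
  assumes i: "i < k" and G: "s i \<in> G" "t i \<in> G" and d: "\<not> (par i \<longleftrightarrow> c (s i) = c (t i))"
  shows "gadget i G"
  unfolding gadget_def
proof (intro exI)
  show "gadget_parts i G [s i] [t i] [] (\<not> c (s i)) (\<not> c (t i)) True True"
    unfolding gadget_parts_def using G d opposite[OF sV[OF i]] opposite[OF tV[OF i]] st[OF i i] by (simp add: upath1 brk_single)
qed

lemma gadget_both:
  assumes i: "i \<in> Ib" and G: "s i \<in> G" "t i \<in> G"
  shows "gadget i G"
proof (cases "par i \<longleftrightarrow> c (s i) = c (t i)")
  case d: True
  have ik: "i < k" using i unfolding Ib_def by blast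
  show ?thesis
  proof (cases "s i \<in> both")
    case True
    have "gadget_parts i G [s i] [t i] [] (c (s i)) (\<not> c (t i)) True True"
      unfolding gadget_parts_def using G d either[OF True] opposite[OF tV[OF ik]] st[OF ik ik] by (simp add: upath1 brk_single)
    then show ?thesis unfolding gadget_def by blast
  next
    case False
    then have tb: "t i \<in> both" using i unfolding Ib_def by blast
    have "gadget_parts i G [s i] [t i] [] (\<not> c (s i)) (c (t i)) True True"
      unfolding gadget_parts_def using G d either[OF tb] opposite[OF sV[OF ik]] st[OF ik ik] by (simp add: upath1 brk_single)
    then show ?thesis unfolding gadget_def by blast
  qed
next
  case False
  have "i < k" using i unfolding Ib_def by blast
  then show ?thesis using gadget_plain G False by blast
qed

lemma gadget_usable:
  assumes i: "i < k" and u: "usable i W"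
  shows "gadget i ({s i, t i} \<union> W)"
proof (cases "par i \<longleftrightarrow> c (s i) = c (t i)")
  case d: True
  let ?G = "{s i, t i} \<union> W"
  note o = opposite[OF sV[OF i]] opposite[OF tV[OF i]]
  have WT: "W \<subseteq> V - T" using u unfolding usable_def by blast
  have sT: "s i \<in> T" "t i \<in> T" using T_facts(4,5) i by auto
  note n = st[OF i i]
  from u[unfolded usable_def, THEN conjunct2] show ?thesis
  proof (elim disjE exE conjE bexE)
    fix y assume 1: "W = {y}" "y \<notin> both" "E (s i) y" "c (s i) = c y"
    have y: "y \<in> V" "y \<noteq> t i" using WT 1(1) sT by auto
    have "gadget_parts i ?G [s i, y] [t i] [] (\<not> c y) (\<not> c (t i)) True True"
      unfolding gadget_parts_def using 1 d opposite[OF y(1)] o n y(2) upath2[of "s i" y]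
      by (simp add: upath1 brk_single brk_pair)
    then show ?thesis unfolding gadget_def by blast
  next
    fix y assume 2: "W = {y}" "y \<notin> both" "E (t i) y" "c (t i) = c y"
    have y: "y \<in> V" "y \<noteq> s i" using WT 2(1) sT by auto
    have "gadget_parts i ?G [s i] [t i, y] [] (\<not> c (s i)) (\<not> c y) True True"
      unfolding gadget_parts_def using 2 d opposite[OF y(1)] o n y(2) upath2[of "t i" y]
      by (simp add: upath1 brk_single brk_pair)
    then show ?thesis unfolding gadget_def by blast
  next
    fix z assume 3: "z \<in> both" "W = {z}"
    have z: "z \<in> V" "z \<noteq> s i" "z \<noteq> t i" using WT 3(2) sT by auto
    have "gadget_parts i ?G [s i] [t i] [z] (\<not> c (s i)) (\<not> c (t i)) (c z) (\<not> c z)"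
      unfolding gadget_parts_def using 3 d either[OF 3(1)] o n z by (simp add: upath1 brk_single)
    then show ?thesis unfolding gadget_def by blast
  next
    fix x y assume 4: "W = {x, y}" "x \<notin> both" "y \<notin> both" "E x y" "c x = c y"
    have xy: "x \<in> V" "y \<in> V" "x \<noteq> s i" "x \<noteq> t i" "y \<noteq> s i" "y \<noteq> t i" using WT 4(1) sT by auto
    have "gadget_parts i ?G [s i] [t i] [x, y] (\<not> c (s i)) (\<not> c (t i)) (\<not> c x) (\<not> c y)"
      unfolding gadget_parts_def using 4 d opposite[OF xy(1)] opposite[OF xy(2)] o n xy upath2[of x y]
      by (simp add: upath1 brk_single brk_pair)
    then show ?thesis unfolding gadget_def by blast
  qed
next
  case False
  then show ?thesis using gadget_plain[OF i] by simp
qed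

lemma mono_not_B: "mono x y \<Longrightarrow> \<not> (x \<in> B \<and> y \<in> B)"
  using bip[of x y] finB(3) T_facts(1) unfolding c_def B_def by (auto split: if_splits)

lemma usable_B:
  assumes "usable i W"
  shows "card (B \<inter> W) \<le> 1"
proof -
  have single: ?thesis if "W = {y}" for y
    unfolding that using card_mono[of "{y}" "B \<inter> {y}"] by simp
  have pair: ?thesis if "W = {x, y}" "E x y" "c x = c y" for x y
  proof -
    have "B \<inter> W \<subseteq> {x} \<or> B \<inter> W \<subseteq> {y}" using mono_not_B[of x y] that by auto
    then show ?thesis using card_mono[of "{x}" "B \<inter> W"] card_mono[of "{y}" "B \<inter> W"] by auto
  qed
  from assms[unfolded usable_def, THEN conjunct2] show ?thesis
    by (elim disjE exE conjE bexE) (erule single, erule single, erule single, rule pair)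
qed

lemma usable_link:
  assumes u: "\<And>i. i < k \<Longrightarrow> i \<notin> Ib \<Longrightarrow> usable i (W i)"
    and d: "\<And>i j. i < k \<Longrightarrow> i \<notin> Ib \<Longrightarrow> j < k \<Longrightarrow> j \<notin> Ib \<Longrightarrow> i \<noteq> j \<Longrightarrow> W i \<inter> W j = {}"
  shows parity_linkage
proof (rule gadgets_link[of "\<lambda>i. {s i, t i} \<union> (if i \<in> Ib then {} else W i)"])
  have WV: "W i \<subseteq> V - T" if "i < k" "i \<notin> Ib" for i using u[OF that] unfolding usable_def by blast
  fix i assume i: "i < k"
  show "gadget i ({s i, t i} \<union> (if i \<in> Ib then {} else W i))"
    using gadget_both[of i] gadget_usable[OF i u[OF i]] by (cases "i \<in> Ib") simp_all
  show "{s i, t i} \<union> (if i \<in> Ib then {} else W i) \<subseteq> V" using sV[OF i] tV[OF i] WV[OF i] by auto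
  have "B \<inter> {s i, t i} = {}" using finB(3) T_facts(4,5)[OF i] by blast
  then have "B \<inter> ({s i, t i} \<union> (if i \<in> Ib then {} else W i)) = (if i \<in> Ib then {} else B \<inter> W i)" by auto
  then show "card (B \<inter> ({s i, t i} \<union> (if i \<in> Ib then {} else W i))) \<le> 1" using usable_B[OF u[OF i]] by simp
  fix j assume j: "j < k" "i \<noteq> j"
  have st0: "{s i, t i} \<inter> {s j, t j} = {}" using ss[OF i j] tt[OF i j] st[OF i j(1)] st[OF j(1) i] by auto
  have w1: "(if l \<in> Ib then {} else W l) \<inter> {s m, t m} = {}" if "l < k" "m < k" for l m
    using WV[OF that(1)] T_facts(4,5)[OF that(2)] by auto
  have w2: "(if i \<in> Ib then {} else W i) \<inter> (if j \<in> Ib then {} else W j) = {}" using d[OF i _ j(1) _ j(2)] by auto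
  show "({s i, t i} \<union> (if i \<in> Ib then {} else W i)) \<inter> ({s j, t j} \<union> (if j \<in> Ib then {} else W j)) = {}"
    using st0 w1[OF i j(1)] w1[OF j(1) i] w2 by (simp only: Int_Un_distrib Int_Un_distrib2 Int_commute Un_empty)
qed

text \<open>A monochromatic edge at \<open>s i\<close> and one at \<open>t i\<close> correct the
  same pair, so only one of them is of use; identifying the two terminals expresses this by a
  matching.\<close>

definition proj :: "'a \<Rightarrow> 'a" where
  "proj v = (if v \<in> t ` {..<k} then s (inv_into {..<k} t v) else v)"

lemma proj_t: "i < k \<Longrightarrow> proj (t i) = s i"
proof -
  assume i: "i < k"
  have "inj_on t {..<k}" using tt unfolding inj_on_def by (metis lessThan_iff)
  then show ?thesis using i unfolding proj_def by simp
qed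

lemma proj_other: "v \<notin> t ` {..<k} \<Longrightarrow> proj v = v"
  unfolding proj_def by simp

lemma proj_cases: "proj x = x \<or> (\<exists>i<k. x = t i \<and> proj x = s i)"
proof (cases "x \<in> t ` {..<k}")
  case True
  then obtain i where "i < k" "x = t i" by auto
  then show ?thesis using proj_t by blast
qed (simp add: proj_other)

text \<open>Vertices of \<open>both\<close> and the pairs in \<open>Ib\<close> are corrections
  without any edge and are counted separately; every other \<open>t i\<close> is represented by
  \<open>s i\<close>.\<close>

definition V' :: "'a set" where
  "V' = {v \<in> V. v \<notin> both \<and> v \<notin> t ` {..<k} \<and> v \<notin> s ` Ib}"

definition F' :: "'a \<Rightarrow> 'a \<Rightarrow> bool" where
  "F' a b \<longleftrightarrow> a \<noteq> b \<and> (\<exists>x y. x \<notin> both \<and> y \<notin> both \<and> proj x = a \<and> proj y = b \<and> mono x y)"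

lemma F'_sym: "F' a b \<Longrightarrow> F' b a"
  unfolding F'_def using Es by metis

lemma V'_T: "v \<in> V' \<Longrightarrow> v \<in> T \<Longrightarrow> \<exists>i<k. i \<notin> Ib \<and> v = s i"
  unfolding V'_def T_def by auto

lemma proj_T: "proj x = s i \<Longrightarrow> i < k \<Longrightarrow> x = s i \<or> x = t i"
  using proj_cases[of x] ss by metis

lemma proj_notT: "proj x \<notin> T \<Longrightarrow> x = proj x"
  using proj_cases[of x] T_facts(4) by metis

text \<open>Terminals are independent, so a monochromatic edge at a terminal leads out of
  \<open>T\<close>.\<close>

lemma F'_terminal:
  assumes "F' (s i) b" "i < k"
  shows "b \<notin> T \<and> b \<notin> both \<and> (mono (s i) b \<or> mono (t i) b)"
proof -
  obtain x y where xy: "x \<notin> both" "y \<notin> both" "proj x = s i" "proj y = b" "mono x y" using assms(1) unfolding F'_def by blast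
  have x: "x = s i \<or> x = t i" using proj_T[OF xy(3) assms(2)] .
  then have "x \<in> T" using T_facts(4,5)[OF assms(2)] by blast
  then have yT: "y \<notin> T" using indep[of x y] xy(5) by blast
  have "y = b"
  proof (rule ccontr)
    assume "y \<noteq> b"
    then obtain j where "j < k" "y = t j" using proj_cases[of y] xy(4) by metis
    then show False using yT T_facts(5) by blast
  qed
  then show ?thesis using yT xy x by blast
qed

lemma F'_plain:
  assumes "F' a b" "a \<notin> T" "b \<notin> T"
  shows "a \<notin> both \<and> b \<notin> both \<and> mono a b"
proof -
  obtain x y where xy: "x \<notin> both" "y \<notin> both" "proj x = a" "proj y = b" "mono x y" using assms(1) unfolding F'_def by blast
  have "x = a" "y = b" using proj_notT[of x] proj_notT[of y] assms(2,3) xy(3,4) by auto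
  then show ?thesis using xy by blast
qed

lemma V'_facts: "finite V'" "V' \<subseteq> V"
  unfolding V'_def using fin by auto

lemma Ib_facts: "finite Ib" "Ib \<subseteq> {..<k}"
  unfolding Ib_def by auto

text \<open>A matching edge at \<open>s i\<close> corrects pair \<open>i\<close>; these pairs form
  \<open>I1\<close>. The remaining pairs outside \<open>Ib\<close> take distinct corrections from
  \<open>G\<close>, the other matching edges and the vertices of \<open>both - T\<close>, of which
  there are enough by the count \<open>c\<close>.\<close>

lemma matching_link:
  assumes M: "matching V' F' M" and c: "k \<le> card Ib + card (both - T) + card M"
  shows parity_linkage
proof -
  have finM: "finite M" by (rule matching_finite[OF V'_facts(1) M])
  have MV: "\<Union>M \<subseteq> V'" by (rule matching_Union[OF M])
  define I1 where "I1 = {i. i < k \<and> i \<notin> Ib \<and> s i \<in> \<Union>M}"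
  define E1 where "E1 = {e \<in> M. e \<inter> T \<noteq> {}}"
  have finI: "finite I1" unfolding I1_def by simp
  have "\<exists>e. i \<in> I1 \<longrightarrow> e \<in> M \<and> s i \<in> e" for i unfolding I1_def by blast
  then obtain ed where ed: "\<And>i. i \<in> I1 \<Longrightarrow> ed i \<in> M \<and> s i \<in> ed i" by metis
  have ed_eq: "e = ed i" if "i \<in> I1" "e \<in> M" "s i \<in> e" for i e
    using matching_disjoint[OF M that(2), of "ed i"] ed[OF that(1)] that(3) by blast
  have edge: "\<exists>y. ed i = {s i, y} \<and> F' (s i) y \<and> y \<in> V'" if i: "i \<in> I1" for i
  proof -
    have e: "ed i \<in> M" "s i \<in> ed i" using ed[OF i] by auto
    obtain a b where ab: "a \<in> V'" "b \<in> V'" "a \<noteq> b" "F' a b" "F' b a" "ed i = {a, b}" by (rule matching_edge[OF M e(1)])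
    then have "s i = a \<or> s i = b" using e(2) by blast
    then show ?thesis using ab by (elim disjE) (intro exI[of _ b], simp, intro exI[of _ a], simp add: insert_commute)
  qed
  then obtain y where y: "\<And>i. i \<in> I1 \<Longrightarrow> ed i = {s i, y i} \<and> F' (s i) (y i) \<and> y i \<in> V'" by metis
  have yT: "y i \<notin> T" "y i \<notin> both" "mono (s i) (y i) \<or> mono (t i) (y i)" "y i \<in> V" if "i \<in> I1" for i
    using F'_terminal[of i "y i"] y[OF that] that V'_facts(2) unfolding I1_def by auto
  have "E1 \<subseteq> ed ` I1"
  proof
    fix e assume e: "e \<in> E1"
    then obtain v where v: "e \<in> M" "v \<in> e" "v \<in> T" unfolding E1_def by blast
    then have "v \<in> V'" using MV by blast
    then obtain i where i: "i < k" "i \<notin> Ib" "v = s i" using V'_T v(3) by blast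
    then have "i \<in> I1" using v unfolding I1_def by blast
    then show "e \<in> ed ` I1" using ed_eq[of i e] v i by blast
  qed
  then have c1: "card E1 \<le> card I1" by (rule surj_card_le[OF finI])
  have E1M: "E1 \<subseteq> M" unfolding E1_def by blast
  have finE1: "finite E1" by (rule finite_subset[OF E1M finM])
  define G where "G = (\<lambda>z. {z}) ` (both - T) \<union> (M - E1)"
  have bothV: "both \<subseteq> V" unfolding both_def using T_facts(1) Z by blast
  have finb: "finite (both - T)" using bothV fin finite_subset by blast
  have nbM: "v \<notin> both" if "v \<in> e" "e \<in> M" for v e using that MV unfolding V'_def by blast
  have cG: "card G = card (both - T) + (card M - card E1)"
  proof -
    have "card G = card ((\<lambda>z. {z}) ` (both - T)) + card (M - E1)" unfolding G_def
    proof (rule card_Un_disjoint)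
      show "(\<lambda>z. {z}) ` (both - T) \<inter> (M - E1) = {}" using nbM by blast
    qed (use finb finM in auto)
    moreover have "card ((\<lambda>z. {z}) ` (both - T)) = card (both - T)" by (rule card_image) simp
    moreover have "card (M - E1) = card M - card E1" by (rule card_Diff_subset[OF finE1 E1M])
    ultimately show ?thesis by simp
  qed
  define I2 where "I2 = {..<k} - (Ib \<union> I1)"
  have "card I2 = k - (card Ib + card I1)"
  proof -
    have "card (Ib \<union> I1) = card Ib + card I1" by (rule card_Un_disjoint) (use Ib_facts finI in \<open>auto simp: I1_def\<close>)
    moreover have "Ib \<union> I1 \<subseteq> {..<k}" using Ib_facts unfolding I1_def by auto
    ultimately show ?thesis unfolding I2_def using card_Diff_subset[of "Ib \<union> I1" "{..<k}"] Ib_facts(1) finI by simp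
  qed
  moreover have "card E1 \<le> card M" by (rule card_mono[OF finM E1M])
  ultimately have "card I2 \<le> card G" using c c1 unfolding cG by linarith
  moreover have "finite I2" "finite G" unfolding I2_def G_def using finb finM by auto
  ultimately obtain h where h: "h ` I2 \<subseteq> G" "inj_on h I2" using card_le_inj by blast
  have Gd: "g \<inter> g' = {}" if gg: "g \<in> G" "g' \<in> G" "g \<noteq> g'" for g g'
  proof -
    consider "g \<in> M" "g' \<in> M" | z where "g = {z}" "z \<in> both" "g' \<in> M" | z where "g' = {z}" "z \<in> both" "g \<in> M"
      | z z' where "g = {z}" "g' = {z'}" using gg(1,2) unfolding G_def by blast
    then show ?thesis
    proof cases
      case 1 then show ?thesis using matching_disjoint[OF M 1] gg(3) by blast
    next
      case 2 then show ?thesis using nbM[of z g'] by blast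
    next
      case 3 then show ?thesis using nbM[of z g] by blast
    next
      case 4 then show ?thesis using gg(3) by blast
    qed
  qed
  define W where "W i = (if i \<in> I1 then {y i} else h i)" for i
  have cases: "i \<in> I1 \<or> i \<notin> I1 \<and> i \<in> I2" if "i < k" "i \<notin> Ib" for i using that unfolding I2_def by blast
  show ?thesis
  proof (rule usable_link[of W])
    fix i assume i: "i < k" "i \<notin> Ib"
    show "usable i (W i)"
    proof (cases "i \<in> I1")
      case True
      then show ?thesis using yT[OF True] unfolding usable_def W_def by auto
    next
      case False
      then have "h i \<in> G" using cases[OF i] h(1) by blast
      then consider z where "z \<in> both - T" "h i = {z}" | "h i \<in> M" "h i \<notin> E1" unfolding G_def by blast
      then show ?thesis
      proof cases
        case 1
        then show ?thesis using False bothV unfolding usable_def W_def by auto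
      next
        case 2
        obtain a b where ab: "a \<in> V'" "b \<in> V'" "a \<noteq> b" "F' a b" "F' b a" "h i = {a, b}" by (rule matching_edge[OF M 2(1)])
        have "a \<notin> T" "b \<notin> T" using 2 ab(6) unfolding E1_def by auto
        then show ?thesis using F'_plain[OF ab(4)] ab(1,2,6) False V'_facts(2) unfolding usable_def W_def by auto
      qed
    qed
    fix j assume j: "j < k" "j \<notin> Ib" "i \<noteq> j"
    have edd: "ed l \<inter> e = {}" if "l \<in> I1" "e \<in> M" "s l \<notin> e" for l e
      using matching_disjoint[OF M conjunct1[OF ed[OF that(1)]] that(2)] ed[OF that(1)] that(3) by blast
    have mixed: "y l \<notin> h m" if "l \<in> I1" "m \<in> I2" for l m
    proof
      assume yh: "y l \<in> h m"
      have "h m \<in> G" using h(1) that(2) by blast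
      then consider z where "z \<in> both" "h m = {z}" | "h m \<in> M" "h m \<notin> E1" unfolding G_def by blast
      then show False
      proof cases
        case 1 then show ?thesis using yT(2)[OF that(1)] yh by auto
      next
        case 2
        have "s l \<notin> h m" using 2 T_facts(4)[of l] that(1) unfolding E1_def I1_def by blast
        then show ?thesis using edd[OF that(1) 2(1)] y[OF that(1)] yh by auto
      qed
    qed
    show "W i \<inter> W j = {}"
    proof (cases "i \<in> I1"; cases "j \<in> I1")
      assume ij: "i \<in> I1" "j \<in> I1"
      have "s i \<notin> ed j" using y[OF ij(2)] yT(1)[OF ij(2)] T_facts(4)[OF i(1)] ss[OF i(1) j(1,3)] by auto
      then have "ed i \<inter> ed j = {}" using edd[OF ij(1)] ed[OF ij(2)] by blast
      then show ?thesis using y[OF ij(1)] y[OF ij(2)] ij unfolding W_def by auto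
    next
      assume ij: "i \<in> I1" "j \<notin> I1"
      then show ?thesis using mixed[OF ij(1), of j] cases[OF j(1,2)] unfolding W_def by auto
    next
      assume ij: "i \<notin> I1" "j \<in> I1"
      then show ?thesis using mixed[OF ij(2), of i] cases[OF i] unfolding W_def by auto
    next
      assume ij: "i \<notin> I1" "j \<notin> I1"
      then have I: "i \<in> I2" "j \<in> I2" using cases[OF i] cases[OF j(1,2)] by auto
      then have "h i \<noteq> h j" using h(2) j(3) unfolding inj_on_def by blast
      moreover have "h i \<in> G" "h j \<in> G" using h(1) I by blast+
      ultimately show ?thesis using Gd ij unfolding W_def by simp
    qed
  qed
qed

text \<open>A Tutte--Berge barrier of the graph of monochromatic edges, with \<open>s i\<close> and \<open>t i\<close> identified,
  yields a vertex cover: take both vertices over each identified vertex of the barrier, and in each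
  class all vertices but one, where the terminals themselves are dispensable because they are independent.\<close>

lemma cover_bipartite:
  assumes U: "U \<subseteq> V'" and part: "edge_partition (V' - U) F' C"
    and tb: "card U + card V' \<le> card {K \<in> C. odd (card K)} + 2 * n" and n: "n + card Ib + card (both - T) < k"
  shows "\<exists>X\<subseteq>V. card X \<le> 2 * k - 2 \<and> bipartite (V - X) E"
proof -
  have UC: "\<Union>C = V' - U" by (rule part[unfolded edge_partition_def, THEN conjunct1])
  note ndj = part[unfolded edge_partition_def, THEN conjunct2, THEN conjunct1, rule_format]
    and noedge = part[unfolded edge_partition_def, THEN conjunct2, THEN conjunct2, rule_format]
  have finUC: "finite (\<Union>C)" unfolding UC using V'_facts(1) by simp
  have finC: "finite C" by (rule finite_UnionD[OF finUC])
  have finK: "finite K" if "K \<in> C" for K by (rule finite_subset[OF Union_upper[OF that] finUC])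
  have finU: "finite U" using U V'_facts(1) finite_subset by blast
  define rest where "rest K = (if K \<inter> T = {} then K - {SOME x. x \<in> K} else K - T)" for K
  have crest: "card (rest K) \<le> card K - 1" if K: "K \<in> C" for K
  proof (cases "K \<inter> T = {}")
    case True
    show ?thesis
    proof (cases "K = {}")
      case False
      then have "(SOME x. x \<in> K) \<in> K" by (simp add: some_in_eq)
      then show ?thesis using True finK[OF K] unfolding rest_def by simp
    qed (simp add: rest_def)
  next
    case False
    have "card (K - T) < card K" by (rule psubset_card_mono[OF finK[OF K]]) (use False in blast)
    then show ?thesis using False unfolding rest_def by simp
  qed
  define X1 where "X1 = U \<union> t ` {i. i < k \<and> s i \<in> U}"
  define X2 where "X2 = (\<Union>K\<in>C. rest K)"
  define X3 where "X3 = (both - T) \<union> (s ` Ib \<union> t ` Ib)"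
  let ?X = "X1 \<union> X2 \<union> X3"
  have cX1: "card X1 \<le> 2 * card U"
  proof -
    have "card (t ` {i. i < k \<and> s i \<in> U}) \<le> card {i. i < k \<and> s i \<in> U}" by (rule card_image_le) simp
    also have "\<dots> \<le> card U"
    proof (rule card_inj_on_le)
      show "inj_on s {i. i < k \<and> s i \<in> U}" by (rule inj_onI, rule ccontr) (use ss in blast)
    qed (use finU in auto)
    finally show ?thesis unfolding X1_def using card_Un_le[of U "t ` {i. i < k \<and> s i \<in> U}"] by linarith
  qed
  have cX2: "card X2 \<le> (\<Sum>K\<in>C. card K - 1)"
  proof -
    have "card X2 \<le> (\<Sum>K\<in>C. card (rest K))" unfolding X2_def by (rule card_UN_le[OF finC])
    also have "\<dots> \<le> (\<Sum>K\<in>C. card K - 1)" by (rule sum_mono) (rule crest)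
    finally show ?thesis .
  qed
  have cX3: "card X3 \<le> card (both - T) + 2 * card Ib"
    unfolding X3_def using card_Un_le[of "both - T" "s ` Ib \<union> t ` Ib"] card_Un_le[of "s ` Ib" "t ` Ib"]
      card_image_le[OF Ib_facts(1), of s] card_image_le[OF Ib_facts(1), of t] by linarith
  have "card V' = card U + card (V' - U)" using card_Diff_subset[OF finU U] card_mono[OF V'_facts(1) U] by simp
  moreover have "card (V' - U) = (\<Sum>K\<in>C. card K)"
    unfolding UC[symmetric] by (rule card_Union_disjoint) (use ndj finK in \<open>auto simp: pairwise_def disjnt_def\<close>)
  moreover have "card {K \<in> C. odd (card K)} = (\<Sum>K\<in>C. if odd (card K) then 1 else 0)"
    by (simp only: card_eq_sum sum.inter_filter[OF finC])
  moreover have "(\<Sum>K\<in>C. card K - 1) + (\<Sum>K\<in>C. if odd (card K) then 1 else 0) \<le> (\<Sum>K\<in>C. card K)"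
    unfolding sum.distrib[symmetric] by (rule sum_mono) (auto simp: Suc_leI odd_pos)
  \<comment> \<open>The formula counts a barrier vertex twice, which pays for both terminals over
    it, and each class with all vertices but one.\<close>
  ultimately have "2 * card U + (\<Sum>K\<in>C. card K - 1) \<le> 2 * n" using tb by linarith
  moreover have "card ?X \<le> card X1 + card X2 + card X3"
    using card_Un_le[of "X1 \<union> X2" X3] card_Un_le[of X1 X2] by linarith
  ultimately have "card ?X \<le> 2 * n + (card (both - T) + 2 * card Ib)" using cX1 cX2 cX3 by linarith
  then have cX: "card ?X \<le> 2 * k - 2" using n by linarith
  have bothV: "both \<subseteq> V" unfolding both_def using T_facts(1) Z by blast
  have "X1 \<subseteq> V" unfolding X1_def using U V'_facts(2) tV by auto
  moreover have "X2 \<subseteq> V"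
  proof -
    have "rest K \<subseteq> \<Union>C" if "K \<in> C" for K unfolding rest_def using that by auto
    then show ?thesis unfolding X2_def UC using V'_facts(2) by blast
  qed
  moreover have "X3 \<subseteq> V" unfolding X3_def using bothV sV tV Ib_facts(2) by auto
  ultimately have XV: "?X \<subseteq> V" by blast
  have inV': "proj a \<in> V' - U \<and> a \<notin> both" if a: "a \<in> V - ?X" for a
  proof -
    have nb: "a \<notin> both"
    proof
      assume ab: "a \<in> both"
      show False
      proof (cases "a \<in> T")
        case True
        then obtain i where i: "i < k" "a = s i \<or> a = t i" unfolding T_def by auto
        then have "i \<in> Ib" using ab unfolding Ib_def by auto
        then show False using i(2) a unfolding X3_def by blast
      next
        case False
        then show False using ab a unfolding X3_def by blast
      qed
    qed
    show ?thesis
    proof (cases "a \<in> t ` {..<k}")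
      case True
      then obtain i where i: "i < k" "a = t i" by auto
      have "i \<notin> Ib" using i(2) a unfolding X3_def by blast
      then have sb: "s i \<notin> both" using i(1) unfolding Ib_def by blast
      have "s i \<notin> s ` Ib"
      proof
        assume "s i \<in> s ` Ib"
        then obtain j where "j \<in> Ib" "s i = s j" by blast
        then show False using ss[OF i(1), of j] Ib_facts(2) \<open>i \<notin> Ib\<close> by blast
      qed
      moreover have "s i \<notin> t ` {..<k}" using st[OF i(1)] by auto
      ultimately have "s i \<in> V'" using sb sV[OF i(1)] unfolding V'_def by blast
      moreover have "s i \<notin> U" using i a unfolding X1_def by blast
      ultimately show ?thesis using nb proj_t[OF i(1)] i(2) by simp
    next
      case False
      have "a \<notin> s ` Ib" using a unfolding X3_def by blast
      then have "a \<in> V'" using False nb a unfolding V'_def by blast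
      moreover have "a \<notin> U" using a unfolding X1_def by blast
      ultimately show ?thesis using nb proj_other[OF False] by simp
    qed
  qed
  have projT: "proj a = a" if "a \<notin> T" for a using that proj_other[of a] unfolding T_def by blast
  have "bipartite (V - ?X) E" unfolding bipartite_def
  proof (intro exI[of _ c] ballI impI)
    fix a b assume ab: "a \<in> V - ?X" "b \<in> V - ?X" "E a b"
    show "c a \<noteq> c b"
    proof
      assume cab: "c a = c b"
      have pa: "proj a \<in> \<Union>C" "a \<notin> both" and pb: "proj b \<in> \<Union>C" "b \<notin> both" using inV'[OF ab(1)] inV'[OF ab(2)] unfolding UC by auto
      have T1: "\<not> (a \<in> T \<and> b \<in> T)" using indep ab(3) by blast
      have ne: "proj a \<noteq> proj b"
      proof
        assume eq: "proj a = proj b"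
        have "a \<in> T \<or> proj a = a" "b \<in> T \<or> proj b = b" using projT by blast+
        moreover have "proj x \<in> T" if "x \<in> T" for x using proj_cases[of x] that T_facts(4) by metis
        ultimately have "a = b" using eq T1 by metis
        then show False using ab(3) Ei by blast
      qed
      \<comment> \<open>A monochromatic edge outside the cover is an edge of \<open>F'\<close> and
        hence stays within one class, of which the cover leaves only one vertex or only
        terminals.\<close>
      have f: "F' (proj a) (proj b)" unfolding F'_def using ne pa(2) pb(2) ab(3) cab by blast
      obtain K where K: "K \<in> C" "proj a \<in> K" using pa(1) by blast
      obtain L where L: "L \<in> C" "proj b \<in> L" using pb(1) by blast
      have "K = L" using noedge[OF K(1) L(1) _ K(2) L(2)] f by blast
      then have bK: "proj b \<in> K" using L(2) by blast
      have nrest: "x \<notin> rest K" if "x \<in> V - ?X" for x using that K(1) unfolding X2_def by blast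
      show False
      proof (cases "K \<inter> T = {}")
        case True
        have "a \<notin> T" "b \<notin> T"
          using True K(2) bK proj_cases[of a] proj_cases[of b] T_facts(4) by (metis disjoint_iff)+
        then have "a \<in> K" "b \<in> K" using projT K(2) bK by auto
        then have "a = (SOME x. x \<in> K)" "b = (SOME x. x \<in> K)" using nrest[OF ab(1)] nrest[OF ab(2)] True unfolding rest_def by auto
        then have "a = b" by (simp only:)
        then show False using ab(3) Ei by blast
      next
        case False
        have *: "False" if "x \<notin> T" "proj x \<in> K" "x \<in> V - ?X" for x
          using nrest[OF that(3)] projT[OF that(1)] that False unfolding rest_def by simp
        show False using T1 *[of a] *[of b] K(2) bK ab by blast
      qed
    qed
  qed
  then show ?thesis using XV cX by blast
qed

theorem linkage_or_cover: "parity_linkage \<or> (\<exists>X\<subseteq>V. card X \<le> 2 * k - 2 \<and> bipartite (V - X) E)"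
proof -
  obtain U C M where T: "U \<subseteq> V'" "edge_partition (V' - U) F' C" "matching V' F' M"
    "card U + card V' \<le> card {K \<in> C. odd (card K)} + 2 * card M"
    using tutte_berge[OF V'_facts(1), of F'] F'_sym by blast
  show ?thesis
  proof (cases "k \<le> card Ib + card (both - T) + card M")
    case True
    then show ?thesis using matching_link[OF T(3)] by blast
  next
    case False
    then show ?thesis using cover_bipartite[OF T(1,2,4)] by simp
  qed
qed

end

section \<open>The two cases combined\<close>

lemma (in terminals) linkage_or_bipartite:
  assumes indep: "\<And>a b. a \<in> T \<Longrightarrow> b \<in> T \<Longrightarrow> \<not> E a b"
  shows "parity_linkage \<or> (\<exists>X\<subseteq>V. card X \<le> 2 * k - 2 \<and> bipartite (V - X) E)"
proof -
  have cV: "50 * k < card V" using kc unfolding k_connected_def by blast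
  have cV8: "8 * k \<le> card V" using cV by simp
  obtain H c where H: "H \<subseteq> V" "44 * k < card H" "\<And>X. X \<subseteq> H \<Longrightarrow> card X \<le> 4 * k \<Longrightarrow> linked H (crossing E c) X"
    using linked_bipartite_subgraph[OF fin E k1 cV8 k_connected_degree[OF fin kc]] by blast
  interpret P: broken_paths "V - T" E c "H - T" by unfold_locales (use fin E H(1) in auto)
  have N: "1 \<le> 3 * k" using k1 by simp
  from P.packing_or_hitting[OF N] show ?thesis
  proof (elim disjE exE conjE)
    fix Ps assume Ps: "finite Ps" "3 * k \<le> card Ps" "\<forall>P\<in>Ps. P.bpath P" "\<forall>P\<in>Ps. \<forall>P'\<in>Ps. P \<noteq> P' \<longrightarrow> set P \<inter> set P' = {}"
    have "6 * k \<le> card H" using H(2) by simp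
    from linkage_of_broken_paths[OF H(1) this H(3) Ps(1,2) bspec[OF Ps(3)] Ps(4)[rule_format]]
    show ?thesis by blast
  next
    fix Z assume Z: "Z \<subseteq> V - T" "card Z \<le> 2 * (3 * k) - 2" "\<forall>P. P.bpath P \<longrightarrow> set P \<inter> Z \<noteq> {}"
    have fins: "finite T" "finite Z" "finite H" using T_facts(2) finite_subset[OF Z(1)] finite_subset[OF H(1)] fin by auto
    have cZ: "card Z + 2 \<le> 6 * k" using Z(2) k1 by linarith
    have "bipartite (V - T - Z) E"
    proof (rule bipartite_of_no_broken_path[where S = "H - T - Z" and c = c])
      show "finite (V - T - Z)" using fin by simp
      show "H - T - Z \<subseteq> V - T - Z" using H(1) by blast
      have "card H - card T \<le> card (H - T)" "card (H - T) - card Z \<le> card (H - T - Z)"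
        by (rule diff_card_le_card_Diff, rule fins)+
      \<comment> \<open>Of more than \<open>44k\<close> vertices of \<open>H\<close>, at most
        \<open>8k - 2\<close> are lost to \<open>T\<close> and \<open>Z\<close>.\<close>
      then show "2 \<le> card (H - T - Z)" using H(2) T_facts(3) cZ k1 by linarith
      fix Z' assume Z': "Z' \<subseteq> V - T - Z" "card Z' \<le> 1"
      have "card (T \<union> Z \<union> Z') < 50 * k"
        using card_Un_le[of "T \<union> Z" Z'] card_Un_le[of T Z] T_facts(3) cZ Z'(2) k1 by linarith
      moreover have "T \<union> Z \<union> Z' \<subseteq> V" using T_facts(1) Z(1) Z'(1) by blast
      ultimately have "connected_graph (V - (T \<union> Z \<union> Z')) E" using kc unfolding k_connected_def by blast
      moreover have "V - (T \<union> Z \<union> Z') = V - T - Z - Z'" by blast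
      ultimately show "connected_graph (V - T - Z - Z') E" by simp
    next
      fix Q assume Q: "upath E Q" "set Q \<subseteq> V - T - Z" "hd Q \<noteq> last Q" "set Q \<inter> (H - T - Z) = {hd Q, last Q}"
      have "set Q \<inter> (H - T) = {hd Q, last Q}" "set Q \<inter> Z = {}" "set Q \<subseteq> V - T" using Q(2,4) by blast+
      then show "\<not> brk c Q" using Z(3) Q(1,3) unfolding P.bpath_def is_path_upath by blast
    qed (rule E)
    then obtain cB :: "'a \<Rightarrow> bool" where "\<forall>a\<in>V - T - Z. \<forall>b\<in>V - T - Z. E a b \<longrightarrow> cB a \<noteq> cB b"
      unfolding bipartite_def by blast
    then have cB: "\<And>a b. a \<in> V - T - Z \<Longrightarrow> b \<in> V - T - Z \<Longrightarrow> E a b \<Longrightarrow> cB a \<noteq> cB b" by blast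
    interpret C: coloured_terminals V E k s t par Z cB
      by unfold_locales (fact Z(1) cZ indep cB)+
    show ?thesis by (rule C.linkage_or_cover)
  qed
qed

theorem theorem7:
  fixes V :: "'a set" and E :: "'a \<Rightarrow> 'a \<Rightarrow> bool" and k :: nat
  assumes "graph V E"
    and "k \<ge> 1"
    and "k_connected (50 * k) V E"
  shows "parity_linked_indep k V E
         \<or> (\<exists>X. X \<subseteq> V \<and> card X \<le> 2 * k - 2 \<and> bipartite (V - X) E)"
proof (rule disjCI)
  assume no: "\<not> (\<exists>X. X \<subseteq> V \<and> card X \<le> 2 * k - 2 \<and> bipartite (V - X) E)"
  have fin: "finite V" and E: "sym_irrefl E" using assms(1) unfolding graph_def sym_irrefl_def by auto
  show "parity_linked_indep k V E" unfolding parity_linked_indep_def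
  proof (intro allI impI, elim conjE)
    fix s t :: "nat \<Rightarrow> 'a" and p :: "nat \<Rightarrow> bool"
    assume a: "\<forall>i<k. s i \<in> V \<and> t i \<in> V" "\<forall>i<k. \<forall>j<k. i \<noteq> j \<longrightarrow> s i \<noteq> s j \<and> t i \<noteq> t j"
      "\<forall>i<k. \<forall>j<k. s i \<noteq> t j" "independent_set E (s ` {..<k} \<union> t ` {..<k})"
    interpret terminals V E k s t p
      by unfold_locales (use fin E assms(2,3) a(1-3) in auto)
    have "\<not> E a b" if "a \<in> T" "b \<in> T" for a b
      using a(4) that unfolding independent_set_def T_def by blast
    then have "parity_linkage" using linkage_or_bipartite no by blast
    then show "\<exists>P. (\<forall>i<k. is_path V E (P i) \<and> hd (P i) = s i \<and> last (P i) = t i \<and> (odd (path_length (P i)) \<longleftrightarrow> p i))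
        \<and> (\<forall>i<k. \<forall>j<k. i \<noteq> j \<longrightarrow> set (P i) \<inter> set (P j) = {})"
      unfolding parity_linkage_def .
  qed
qed

end
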